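(* Let $R$ be a $d$-dimensional Cohen--Macaulay local ring possessing a canonical module $\omega_R$. Let $M$ be a finite $R$-module such that $M^*\ne0$ and $\operatorname{pd}_R(M^* )^{\dagger}<\infty$. Then: (1) If $d\le1$, then $M^{**}$ is free. (2) If $\operatorname{Ext}_R^j(M,R)=0$ for all $j=1,\ldots,d$ when $d\ge1$, or for all $j>0$ when $d=0$, then $M$ is free. In either case, $R$ is Gorenstein.
   Context: Rings are commutative Noetherian; finite means finitely generated. $X^*=\operatorname{Hom}_R(X,R)$ (so $M^{**}=(M^* )^*$) and $X^{\dagger}=\operatorname{Hom}_R(X,\omega_R)$. $\operatorname{pd}$ is projective dimension. *)

theory Defs
  imports "HOL-Algebra.Algebra" "HOL-Library.Extended_Nat"
begin

text \<open>A module record inherits from \<open>ring\<close> the fields \<open>mult\<close> and \<open>one\<close>, which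
  the locale \<open>module\<close> ignores; they are left undefined below.\<close>

definition self_module :: "('a, 'r) ring_scheme \<Rightarrow> ('a, 'a) module" where
  "self_module R = \<lparr>carrier = carrier R, monoid.mult = undefined, one = undefined,
     ring.zero = ring.zero R, ring.add = ring.add R, module.smult = monoid.mult R\<rparr>"

definition zero_module :: "('a, 'b, 'm) module_scheme \<Rightarrow> bool" where
  "zero_module M \<longleftrightarrow> carrier M = {\<zero>\<^bsub>M\<^esub>}"

definition mod_hom ::
  "('a, 'r) ring_scheme \<Rightarrow> ('a, 'b, 'm) module_scheme \<Rightarrow> ('a, 'c, 'n) module_scheme \<Rightarrow> ('b \<Rightarrow> 'c) set"
  where
  "mod_hom R M N = {f \<in> carrier M \<rightarrow> carrier N.
     (\<forall>x\<in>carrier M. \<forall>y\<in>carrier M. f (x \<oplus>\<^bsub>M\<^esub> y) = f x \<oplus>\<^bsub>N\<^esub> f y) \<and>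
     (\<forall>a\<in>carrier R. \<forall>x\<in>carrier M. f (a \<odot>\<^bsub>M\<^esub> x) = a \<odot>\<^bsub>N\<^esub> f x)}"

definition mod_iso ::
  "('a, 'r) ring_scheme \<Rightarrow> ('a, 'b, 'm) module_scheme \<Rightarrow> ('a, 'c, 'n) module_scheme \<Rightarrow> bool" where
  "mod_iso R M N \<longleftrightarrow> (\<exists>f\<in>mod_hom R M N. bij_betw f (carrier M) (carrier N))"

definition mod_ker ::
  "('a, 'b, 'm) module_scheme \<Rightarrow> ('a, 'c, 'n) module_scheme \<Rightarrow> ('b \<Rightarrow> 'c) \<Rightarrow> 'b set" where
  "mod_ker M N f = {x \<in> carrier M. f x = \<zero>\<^bsub>N\<^esub>}"

text \<open>Elements of \<open>Hom(M, N)\<close> are made extensional on the carrier of \<open>M\<close>, so that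
  equality of HOL functions is equality of homomorphisms.\<close>

definition Hom_module ::
  "('a, 'r) ring_scheme \<Rightarrow> ('a, 'b, 'm) module_scheme \<Rightarrow> ('a, 'c, 'n) module_scheme
    \<Rightarrow> ('a, 'b \<Rightarrow> 'c) module" where
  "Hom_module R M N = \<lparr>carrier = mod_hom R M N \<inter> extensional (carrier M),
     monoid.mult = undefined, one = undefined,
     ring.zero = (\<lambda>x\<in>carrier M. \<zero>\<^bsub>N\<^esub>),
     ring.add = (\<lambda>f g. \<lambda>x\<in>carrier M. f x \<oplus>\<^bsub>N\<^esub> g x),
     module.smult = (\<lambda>a f. \<lambda>x\<in>carrier M. a \<odot>\<^bsub>N\<^esub> f x)\<rparr>"

definition dual_module ::
  "('a, 'r) ring_scheme \<Rightarrow> ('a, 'b, 'm) module_scheme \<Rightarrow> ('a, 'b \<Rightarrow> 'a) module" where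
  "dual_module R M = Hom_module R M (self_module R)"

definition quot_module ::
  "('a, 'b, 'm) module_scheme \<Rightarrow> 'b set \<Rightarrow> ('a, 'b set) module" where
  "quot_module M N = \<lparr>carrier = a_rcosets\<^bsub>M\<^esub> N, monoid.mult = undefined, one = undefined,
     ring.zero = N, ring.add = set_add M,
     module.smult = (\<lambda>a C. \<Union>x\<in>C. N +>\<^bsub>M\<^esub> (a \<odot>\<^bsub>M\<^esub> x))\<rparr>"

definition fg_module :: "('a, 'r) ring_scheme \<Rightarrow> ('a, 'b, 'm) module_scheme \<Rightarrow> bool" where
  "fg_module R M \<longleftrightarrow> module R M \<and> (\<exists>A \<subseteq> carrier M. finite A \<and>
     (\<forall>x\<in>carrier M. \<exists>c \<in> A \<rightarrow> carrier R. x = (\<Oplus>\<^bsub>M\<^esub>a\<in>A. c a \<odot>\<^bsub>M\<^esub> a)))"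

definition is_basis ::
  "('a, 'r) ring_scheme \<Rightarrow> ('a, 'b, 'm) module_scheme \<Rightarrow> 'b set \<Rightarrow> bool" where
  "is_basis R M B \<longleftrightarrow> B \<subseteq> carrier M \<and>
     (\<forall>x\<in>carrier M. \<exists>A \<subseteq> B. finite A \<and> (\<exists>c \<in> A \<rightarrow> carrier R. x = (\<Oplus>\<^bsub>M\<^esub>a\<in>A. c a \<odot>\<^bsub>M\<^esub> a))) \<and>
     (\<forall>A \<subseteq> B. finite A \<longrightarrow> (\<forall>c \<in> A \<rightarrow> carrier R.
        (\<Oplus>\<^bsub>M\<^esub>a\<in>A. c a \<odot>\<^bsub>M\<^esub> a) = \<zero>\<^bsub>M\<^esub> \<longrightarrow> (\<forall>a\<in>A. c a = \<zero>\<^bsub>R\<^esub>)))"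

definition free_module :: "('a, 'r) ring_scheme \<Rightarrow> ('a, 'b, 'm) module_scheme \<Rightarrow> bool" where
  "free_module R M \<longleftrightarrow> module R M \<and> (\<exists>B. is_basis R M B)"

locale noetherian_local_ring = noetherian_ring R + cring R for R (structure) +
  assumes ex1_maximalideal: "\<exists>!I. maximalideal I R"

definition max_ideal :: "('a, 'r) ring_scheme \<Rightarrow> 'a set" where
  "max_ideal R = (THE I. maximalideal I R)"

definition residue_module :: "('a, 'r) ring_scheme \<Rightarrow> ('a, 'a set) module" where
  "residue_module R = quot_module (self_module R) (max_ideal R)"

definition krull_dim :: "('a, 'r) ring_scheme \<Rightarrow> enat" where
  "krull_dim R = Sup {enat n | n. \<exists>p :: nat \<Rightarrow> 'a set.
     (\<forall>i\<le>n. primeideal (p i) R) \<and> (\<forall>i<n. p i \<subset> p (Suc i))}"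

definition annihilator :: "('a, 'r) ring_scheme \<Rightarrow> ('a, 'b, 'm) module_scheme \<Rightarrow> 'a set" where
  "annihilator R M = {a \<in> carrier R. \<forall>x\<in>carrier M. a \<odot>\<^bsub>M\<^esub> x = \<zero>\<^bsub>M\<^esub>}"

definition module_dim :: "('a, 'r) ring_scheme \<Rightarrow> ('a, 'b, 'm) module_scheme \<Rightarrow> enat" where
  "module_dim R M = krull_dim (R Quot annihilator R M)"

text \<open>The submodule \<open>S M\<close> generated by all products; for \<open>S = {x\<^sub>1, \<dots>, x\<^sub>n}\<close> it is
  \<open>(x\<^sub>1, \<dots>, x\<^sub>n) M\<close>.\<close>

definition set_smult ::
  "('a, 'r) ring_scheme \<Rightarrow> ('a, 'b, 'm) module_scheme \<Rightarrow> 'a set \<Rightarrow> 'b set" where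
  "set_smult R M S =
     \<Inter> {N. submodule N R M \<and> (\<forall>a\<in>S. \<forall>x\<in>carrier M. a \<odot>\<^bsub>M\<^esub> x \<in> N)}"

definition regular_on :: "('a, 'b, 'm) module_scheme \<Rightarrow> 'a \<Rightarrow> bool" where
  "regular_on M a \<longleftrightarrow> (\<forall>x\<in>carrier M. a \<odot>\<^bsub>M\<^esub> x = \<zero>\<^bsub>M\<^esub> \<longrightarrow> x = \<zero>\<^bsub>M\<^esub>)"

definition regular_sequence ::
  "('a, 'r) ring_scheme \<Rightarrow> ('a, 'b, 'm) module_scheme \<Rightarrow> 'a list \<Rightarrow> bool" where
  "regular_sequence R M xs \<longleftrightarrow> set xs \<subseteq> carrier R \<and>
     (\<forall>i<length xs. regular_on (quot_module M (set_smult R M (set (take i xs)))) (xs ! i)) \<and>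
     \<not> zero_module (quot_module M (set_smult R M (set xs)))"

definition depth :: "('a, 'r) ring_scheme \<Rightarrow> ('a, 'b, 'm) module_scheme \<Rightarrow> enat" where
  "depth R M = Sup {enat (length xs) | xs. set xs \<subseteq> max_ideal R \<and> regular_sequence R M xs}"

definition cm_module :: "('a, 'r) ring_scheme \<Rightarrow> ('a, 'b, 'm) module_scheme \<Rightarrow> bool" where
  "cm_module R M \<longleftrightarrow> fg_module R M \<and> \<not> zero_module M \<and> depth R M = module_dim R M"

definition mcm_module :: "('a, 'r) ring_scheme \<Rightarrow> ('a, 'b, 'm) module_scheme \<Rightarrow> bool" where
  "mcm_module R M \<longleftrightarrow> cm_module R M \<and> module_dim R M = krull_dim R"

definition cm_local_ring :: "('a, 'r) ring_scheme \<Rightarrow> bool" where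
  "cm_local_ring R \<longleftrightarrow> noetherian_local_ring R \<and> cm_module R (self_module R)"

text \<open>\<open>\<dots> \<rightarrow> P 1 \<rightarrow> P 0 \<rightarrow> M \<rightarrow> 0\<close> is exact, where \<open>\<delta> i : P (i + 1) \<rightarrow> P i\<close> and \<open>\<epsilon> : P 0 \<rightarrow> M\<close>.\<close>

definition left_resolution ::
  "('a, 'r) ring_scheme \<Rightarrow> ('a, 'b, 'm) module_scheme \<Rightarrow>
   (nat \<Rightarrow> ('a, 'u) module) \<Rightarrow> (nat \<Rightarrow> 'u \<Rightarrow> 'u) \<Rightarrow> ('u \<Rightarrow> 'b) \<Rightarrow> bool" where
  "left_resolution R M P \<delta> \<epsilon> \<longleftrightarrow>
     (\<forall>i. module R (P i)) \<and> \<epsilon> \<in> mod_hom R (P 0) M \<and> (\<forall>i. \<delta> i \<in> mod_hom R (P (Suc i)) (P i)) \<and>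
     \<epsilon> ` carrier (P 0) = carrier M \<and>
     mod_ker (P 0) M \<epsilon> = \<delta> 0 ` carrier (P 1) \<and>
     (\<forall>i. mod_ker (P (Suc i)) (P i) (\<delta> i) = \<delta> (Suc i) ` carrier (P (Suc (Suc i))))"

text \<open>\<open>0 \<rightarrow> M \<rightarrow> E 0 \<rightarrow> E 1 \<rightarrow> \<dots>\<close> is exact, where \<open>\<eta> : M \<rightarrow> E 0\<close> and \<open>\<delta> i : E i \<rightarrow> E (i + 1)\<close>.\<close>

definition right_resolution ::
  "('a, 'r) ring_scheme \<Rightarrow> ('a, 'b, 'm) module_scheme \<Rightarrow>
   (nat \<Rightarrow> ('a, 'v) module) \<Rightarrow> (nat \<Rightarrow> 'v \<Rightarrow> 'v) \<Rightarrow> ('b \<Rightarrow> 'v) \<Rightarrow> bool" where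
  "right_resolution R M E \<delta> \<eta> \<longleftrightarrow>
     (\<forall>i. module R (E i)) \<and> \<eta> \<in> mod_hom R M (E 0) \<and> (\<forall>i. \<delta> i \<in> mod_hom R (E i) (E (Suc i))) \<and>
     mod_ker M (E 0) \<eta> = {\<zero>\<^bsub>M\<^esub>} \<and>
     mod_ker (E 0) (E 1) (\<delta> 0) = \<eta> ` carrier M \<and>
     (\<forall>i. mod_ker (E (Suc i)) (E (Suc (Suc i))) (\<delta> (Suc i)) = \<delta> i ` carrier (E i))"

text \<open>HOL cannot quantify over all modules, so lifting is tested against surjections from
  modules of type \<open>'c \<Rightarrow> 'a\<close> to modules of type \<open>'c\<close>. This includes the surjection onto \<open>P\<close> from
  the free module on the elements of \<open>P\<close> (finitely supported functions), which splits only if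
  \<open>P\<close> is projective; so the lifting property against arbitrary surjections follows.\<close>

definition projective_module :: "('a, 'r) ring_scheme \<Rightarrow> ('a, 'c, 'm) module_scheme \<Rightarrow> bool" where
  "projective_module R P \<longleftrightarrow> module R P \<and>
     (\<forall>(A :: ('a, 'c \<Rightarrow> 'a) module) (B :: ('a, 'c) module). module R A \<longrightarrow> module R B \<longrightarrow>
        (\<forall>g\<in>mod_hom R A B. \<forall>f\<in>mod_hom R P B. g ` carrier A = carrier B \<longrightarrow>
           (\<exists>h\<in>mod_hom R P A. \<forall>x\<in>carrier P. g (h x) = f x)))"

text \<open>Extension is tested on submodules of modules of type \<open>'a\<close>. Since these include the
  ideals of \<open>R\<close>, the extension property for arbitrary modules follows by Baer's criterion.\<close>

definition injective_module :: "('a, 'r) ring_scheme \<Rightarrow> ('a, 'c, 'm) module_scheme \<Rightarrow> bool" where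
  "injective_module R E \<longleftrightarrow> module R E \<and>
     (\<forall>(B :: ('a, 'a) module) A. module R B \<longrightarrow> submodule A R B \<longrightarrow>
        (\<forall>f\<in>mod_hom R (B\<lparr>carrier := A\<rparr>) E. \<exists>g\<in>mod_hom R B E. \<forall>x\<in>A. g x = f x))"

text \<open>The type argument is the type in which the modules of a resolution live. The infimum of
  the empty set is \<open>\<infinity>\<close>. For a large enough type the value is the usual one; for every type a
  finite value exhibits an honest finite resolution.\<close>

definition projective_dim ::
  "'u itself \<Rightarrow> ('a, 'r) ring_scheme \<Rightarrow> ('a, 'b, 'm) module_scheme \<Rightarrow> enat" where
  "projective_dim _ R M = Inf {enat n | n.
     \<exists>(P :: nat \<Rightarrow> ('a, 'u) module) \<delta> \<epsilon>. left_resolution R M P \<delta> \<epsilon> \<and>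
       (\<forall>i. projective_module R (P i)) \<and> (\<forall>i>n. zero_module (P i))}"

definition injective_dim ::
  "'v itself \<Rightarrow> ('a, 'r) ring_scheme \<Rightarrow> ('a, 'b, 'm) module_scheme \<Rightarrow> enat" where
  "injective_dim _ R M = Inf {enat n | n.
     \<exists>(E :: nat \<Rightarrow> ('a, 'v) module) \<delta> \<eta>. right_resolution R M E \<delta> \<eta> \<and>
       (\<forall>i. injective_module R (E i)) \<and> (\<forall>i>n. zero_module (E i))}"

definition cocycles ::
  "('a, 'r) ring_scheme \<Rightarrow> (nat \<Rightarrow> ('a, 'u) module) \<Rightarrow> (nat \<Rightarrow> 'u \<Rightarrow> 'u) \<Rightarrow>
   ('a, 'c, 'n) module_scheme \<Rightarrow> nat \<Rightarrow> ('u \<Rightarrow> 'c) set" where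
  "cocycles R P \<delta> N j =
     {f \<in> carrier (Hom_module R (P j) N). \<forall>x\<in>carrier (P (Suc j)). f (\<delta> j x) = \<zero>\<^bsub>N\<^esub>}"

fun coboundaries ::
  "('a, 'r) ring_scheme \<Rightarrow> (nat \<Rightarrow> ('a, 'u) module) \<Rightarrow> (nat \<Rightarrow> 'u \<Rightarrow> 'u) \<Rightarrow>
   ('a, 'c, 'n) module_scheme \<Rightarrow> nat \<Rightarrow> ('u \<Rightarrow> 'c) set" where
  "coboundaries R P \<delta> N 0 = {\<zero>\<^bsub>Hom_module R (P 0) N\<^esub>}"
| "coboundaries R P \<delta> N (Suc j) =
     (\<lambda>g. \<lambda>x\<in>carrier (P (Suc j)). g (\<delta> j x)) ` carrier (Hom_module R (P j) N)"

definition Hom_cohomology ::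
  "('a, 'r) ring_scheme \<Rightarrow> (nat \<Rightarrow> ('a, 'u) module) \<Rightarrow> (nat \<Rightarrow> 'u \<Rightarrow> 'u) \<Rightarrow>
   ('a, 'c, 'n) module_scheme \<Rightarrow> nat \<Rightarrow> ('a, ('u \<Rightarrow> 'c) set) module" where
  "Hom_cohomology R P \<delta> N j =
     quot_module (Hom_module R (P j) N \<lparr>carrier := cocycles R P \<delta> N j\<rparr>) (coboundaries R P \<delta> N j)"

text \<open>\<open>Ext\<^sup>j(M, N)\<close> for a finitely generated module \<open>M\<close> over a Noetherian ring. Such an \<open>M\<close> has a
  resolution by finitely generated free modules, and these can be taken to be \<open>R\<^sup>n\<close>, which lives
  in the type \<open>nat \<Rightarrow> 'a\<close>; up to isomorphism the result does not depend on the choice.\<close>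

definition Ext_module ::
  "('a, 'r) ring_scheme \<Rightarrow> nat \<Rightarrow> ('a, 'b, 'm) module_scheme \<Rightarrow> ('a, 'c, 'n) module_scheme
    \<Rightarrow> ('a, ((nat \<Rightarrow> 'a) \<Rightarrow> 'c) set) module" where
  "Ext_module R j M N =
     (let (P, \<delta>) = (SOME (P :: nat \<Rightarrow> ('a, nat \<Rightarrow> 'a) module, \<delta>).
        (\<exists>\<epsilon>. left_resolution R M P \<delta> \<epsilon>) \<and> (\<forall>i. free_module R (P i) \<and> fg_module R (P i)))
      in Hom_cohomology R P \<delta> N j)"

text \<open>Type 1 means that \<open>Ext\<^sup>t(k, M)\<close>, \<open>t = depth M\<close>, is one-dimensional over the residue field
  \<open>k\<close>. It is annihilated by the maximal ideal, so this is isomorphism with \<open>k\<close> over \<open>R\<close>.\<close>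

definition type_one :: "('a, 'r) ring_scheme \<Rightarrow> ('a, 'b, 'm) module_scheme \<Rightarrow> bool" where
  "type_one R M \<longleftrightarrow> (\<exists>t. depth R M = enat t \<and>
     mod_iso R (Ext_module R t (residue_module R) M) (residue_module R))"

definition canonical_module ::
  "'v itself \<Rightarrow> ('a, 'r) ring_scheme \<Rightarrow> ('a, 'w, 'm) module_scheme \<Rightarrow> bool" where
  "canonical_module V R \<omega> \<longleftrightarrow> mcm_module R \<omega> \<and> type_one R \<omega> \<and> injective_dim V R \<omega> < \<infinity>"

definition gorenstein_local_ring :: "'v itself \<Rightarrow> ('a, 'r) ring_scheme \<Rightarrow> bool" where
  "gorenstein_local_ring V R \<longleftrightarrow>
     noetherian_local_ring R \<and> injective_dim V R (self_module R) < \<infinity>"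

end

theory Submission
  imports Defs
begin

text \<open>
  Let \<open>N\<close> be the dual of \<open>M\<close> and \<open>Y = Hom(N, \<omega>)\<close>. The canonical module has no higher \<open>Ext\<close> into itself, and
  \<open>Ext\<close> from any finite module to \<open>\<omega>\<close> vanishes above degree \<open>d\<close>. Since \<open>N\<close> is a high enough syzygy, by the
  bound on \<open>d\<close> or by the vanishing of \<open>Ext\<close> from \<open>M\<close> to \<open>R\<close>, all higher \<open>Ext\<close> from \<open>N\<close> to \<open>\<omega>\<close> vanish, and then
  also those from \<open>Y\<close>. For \<open>Y\<close> of finite projective dimension this forces \<open>Y\<close> to be free, and it is nonzero.
  The maps in \<open>Y\<close> extend from \<open>N\<close> to the dual of a free module, and a basis element of \<open>Y\<close> can only be of this
  kind if \<open>\<omega>\<close> maps onto \<open>R\<close>. Type one makes such a map an isomorphism. Hence \<open>R\<close> is Gorenstein and \<open>Y\<close> is the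
  bidual of \<open>M\<close>; in the second case \<open>M\<close> is reflexive by extending functionals along the dual complex.
\<close>

section \<open>Homomorphisms and submodules\<close>

text \<open>Ext into \<omega> is computed from the injective resolution given with \<omega>, while
  \<open>Ext_module\<close> uses free resolutions. The two are not compared: vanishing for the
  injective one extends maps into \<omega>, and such extensions give the exactness of Hom(P,
  \<omega>) that is needed. The injective dimension of \<omega> is only known to be finite, so the
  bound d has to be derived by descent from an unknown length. Quotients are kept as pairs of a
  module and a submodule, so that inductions over ideals and syzygies stay inside one type. The
  constant in d \<le> 1: let F i be the dual of P i for a free resolution P of M. Then N is the
  kernel of F 0 \<rightarrow> F 1. Extending maps from N to F 0 takes the first Ext of F 0 / N,
  which is the second Ext of the cokernel of F 0 \<rightarrow> F 1 and vanishes for d \<le> 1. Every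
  exact spot of the dual complex raises this bound by one. Injectivity of the map from M to its
  bidual extends functionals from F 0 / N to F 1, one place further on, and so asks for d exact
  spots.\<close>

abbreviation msub :: "('a,'b,'m) module_scheme \<Rightarrow> 'b set \<Rightarrow> ('a,'b,'m) module_scheme" (infixl "\<restriction>" 90)
  where "M \<restriction> A \<equiv> M\<lparr>carrier := A\<rparr>"

lemma (in abelian_group) minus_eq_zero_iff:
  "x \<in> carrier G \<Longrightarrow> y \<in> carrier G \<Longrightarrow> x \<ominus> y = \<zero> \<longleftrightarrow> x = y"
  by (metis a_minus_def add.inv_closed l_neg local.minus_minus minus_equality r_neg)

lemma mod_homI:
  assumes "\<And>x. x \<in> carrier M \<Longrightarrow> f x \<in> carrier N"
    and "\<And>x y. x \<in> carrier M \<Longrightarrow> y \<in> carrier M \<Longrightarrow> f (x \<oplus>\<^bsub>M\<^esub> y) = f x \<oplus>\<^bsub>N\<^esub> f y"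
    and "\<And>a x. a \<in> carrier R \<Longrightarrow> x \<in> carrier M \<Longrightarrow> f (a \<odot>\<^bsub>M\<^esub> x) = a \<odot>\<^bsub>N\<^esub> f x"
  shows "f \<in> mod_hom R M N"
  using assms unfolding mod_hom_def by auto

lemma hom_closed: "f \<in> mod_hom R M N \<Longrightarrow> x \<in> carrier M \<Longrightarrow> f x \<in> carrier N"
  unfolding mod_hom_def by auto

lemma hom_add: "f \<in> mod_hom R M N \<Longrightarrow> x \<in> carrier M \<Longrightarrow> y \<in> carrier M \<Longrightarrow> f (x \<oplus>\<^bsub>M\<^esub> y) = f x \<oplus>\<^bsub>N\<^esub> f y"
  unfolding mod_hom_def by auto

lemma hom_smult: "f \<in> mod_hom R M N \<Longrightarrow> a \<in> carrier R \<Longrightarrow> x \<in> carrier M \<Longrightarrow> f (a \<odot>\<^bsub>M\<^esub> x) = a \<odot>\<^bsub>N\<^esub> f x"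
  unfolding mod_hom_def by auto

lemma hom_zero:
  assumes "module R M" "module R N" "f \<in> mod_hom R M N"
  shows "f \<zero>\<^bsub>M\<^esub> = \<zero>\<^bsub>N\<^esub>"
proof -
  interpret M: module R M by fact
  interpret N: module R N by fact
  have "f (\<zero>\<^bsub>R\<^esub> \<odot>\<^bsub>M\<^esub> \<zero>\<^bsub>M\<^esub>) = \<zero>\<^bsub>R\<^esub> \<odot>\<^bsub>N\<^esub> f \<zero>\<^bsub>M\<^esub>"
    by (rule hom_smult[OF assms(3)]) auto
  then show ?thesis using hom_closed[OF assms(3), of "\<zero>\<^bsub>M\<^esub>"] by simp
qed

lemma hom_neg:
  assumes "module R M" "module R N" "f \<in> mod_hom R M N" "x \<in> carrier M"
  shows "f (\<ominus>\<^bsub>M\<^esub> x) = \<ominus>\<^bsub>N\<^esub> f x"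
proof -
  interpret M: module R M by fact
  interpret N: module R N by fact
  have "f ((\<ominus>\<^bsub>R\<^esub> \<one>\<^bsub>R\<^esub>) \<odot>\<^bsub>M\<^esub> x) = (\<ominus>\<^bsub>R\<^esub> \<one>\<^bsub>R\<^esub>) \<odot>\<^bsub>N\<^esub> f x"
    using assms(3,4) by (simp add: hom_smult)
  then show ?thesis using assms hom_closed[OF assms(3,4)]
    by (simp add: M.smult_l_minus N.smult_l_minus)
qed

lemma hom_diff:
  assumes "module R M" "module R N" "f \<in> mod_hom R M N" "x \<in> carrier M" "y \<in> carrier M"
  shows "f (x \<ominus>\<^bsub>M\<^esub> y) = f x \<ominus>\<^bsub>N\<^esub> f y"
proof -
  interpret M: module R M by fact
  show ?thesis using assms by (simp add: a_minus_def hom_add hom_neg)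
qed

lemma hom_comp:
  assumes "f \<in> mod_hom R M N" "g \<in> mod_hom R N K"
  shows "(\<lambda>x. g (f x)) \<in> mod_hom R M K"
  using assms by (intro mod_homI) (auto simp: hom_closed hom_add hom_smult)

lemma hom_cong:
  assumes "module R M" "f \<in> mod_hom R M N" "\<And>x. x \<in> carrier M \<Longrightarrow> g x = f x"
  shows "g \<in> mod_hom R M N"
proof -
  interpret M: module R M by fact
  show ?thesis using assms(2,3) by (intro mod_homI) (auto simp: hom_closed hom_add hom_smult)
qed

lemma hom_restrict: "module R M \<Longrightarrow> f \<in> mod_hom R M N \<Longrightarrow> restrict f (carrier M) \<in> mod_hom R M N"
  by (erule hom_cong) auto

lemma hom_zero_map:
  assumes "module R N" shows "(\<lambda>x. \<zero>\<^bsub>N\<^esub>) \<in> mod_hom R M N"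
proof -
  interpret N: module R N by fact
  show ?thesis by (intro mod_homI) auto
qed

lemma hom_plus:
  assumes "module R N" "f \<in> mod_hom R M N" "g \<in> mod_hom R M N"
  shows "(\<lambda>x. f x \<oplus>\<^bsub>N\<^esub> g x) \<in> mod_hom R M N"
proof -
  interpret N: module R N by fact
  show ?thesis using assms
    by (intro mod_homI) (auto simp: hom_closed hom_add hom_smult N.a_ac N.smult_r_distr)
qed

lemma hom_scale:
  assumes "module R N" "f \<in> mod_hom R M N" "a \<in> carrier R"
  shows "(\<lambda>x. a \<odot>\<^bsub>N\<^esub> f x) \<in> mod_hom R M N"
proof -
  interpret N: module R N by fact
  show ?thesis using assms
    by (intro mod_homI) (auto simp: hom_closed hom_add hom_smult N.smult_r_distr N.R.m_ac
        simp flip: N.smult_assoc1)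
qed

lemma hom_uminus:
  assumes "module R N" "f \<in> mod_hom R M N"
  shows "(\<lambda>x. \<ominus>\<^bsub>N\<^esub> f x) \<in> mod_hom R M N"
proof -
  interpret N: module R N by fact
  show ?thesis using assms
    by (intro mod_homI) (auto simp: hom_closed hom_add hom_smult N.smult_r_minus N.minus_add N.a_ac)
qed

lemma hom_minus:
  assumes "module R N" "f \<in> mod_hom R M N" "g \<in> mod_hom R M N"
  shows "(\<lambda>x. f x \<ominus>\<^bsub>N\<^esub> g x) \<in> mod_hom R M N"
  unfolding a_minus_def by (intro hom_plus hom_uminus assms)

lemma hom_id: "(\<lambda>x. x) \<in> mod_hom R M M"
  by (intro mod_homI) auto

lemma hom_smult_id:
  assumes "module R M" "a \<in> carrier R" shows "(\<lambda>x. a \<odot>\<^bsub>M\<^esub> x) \<in> mod_hom R M M"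
  by (rule hom_scale[OF assms(1) hom_id assms(2)])

lemma hom_smult_elem:
  assumes "module R M" "x \<in> carrier M" shows "(\<lambda>r. r \<odot>\<^bsub>M\<^esub> x) \<in> mod_hom R (self_module R) M"
proof -
  interpret M: module R M by fact
  show ?thesis using assms(2)
    by (intro mod_homI) (auto simp: self_module_def M.smult_l_distr M.smult_assoc1)
qed

lemma hom_dom_sub: "f \<in> mod_hom R M N \<Longrightarrow> A \<subseteq> carrier M \<Longrightarrow> f \<in> mod_hom R (M \<restriction> A) N"
  by (intro mod_homI) (auto simp: hom_closed hom_add hom_smult subset_iff)

lemma hom_cod_sub: "f \<in> mod_hom R M N \<Longrightarrow> f ` carrier M \<subseteq> B \<Longrightarrow> f \<in> mod_hom R M (N \<restriction> B)"
  by (intro mod_homI) (auto simp: hom_closed hom_add hom_smult)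

lemma hom_cod_sup: "f \<in> mod_hom R M (N \<restriction> B) \<Longrightarrow> B \<subseteq> carrier N \<Longrightarrow> f \<in> mod_hom R M N"
  using hom_closed[of f R M "N \<restriction> B"] by (intro mod_homI) (auto simp: hom_add hom_smult)

lemma module_sub: "module R M \<Longrightarrow> submodule A R M \<Longrightarrow> module R (M \<restriction> A)"
  by (rule submodule.submodule_is_module)

lemma submodD:
  assumes "module R M" "submodule A R M"
  shows "A \<subseteq> carrier M" "\<zero>\<^bsub>M\<^esub> \<in> A" "\<And>x. x \<in> A \<Longrightarrow> x \<in> carrier M"
    "\<And>x. x \<in> A \<Longrightarrow> \<ominus>\<^bsub>M\<^esub> x \<in> A" "\<And>x y. x \<in> A \<Longrightarrow> y \<in> A \<Longrightarrow> x \<oplus>\<^bsub>M\<^esub> y \<in> A"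
    "\<And>x y. x \<in> A \<Longrightarrow> y \<in> A \<Longrightarrow> x \<ominus>\<^bsub>M\<^esub> y \<in> A"
    "\<And>a x. a \<in> carrier R \<Longrightarrow> x \<in> A \<Longrightarrow> a \<odot>\<^bsub>M\<^esub> x \<in> A"
proof -
  interpret M: module R M by fact
  note * = M.submoduleE[OF assms(2)]
  show 1: "A \<subseteq> carrier M" by (rule *(1))
  then show "x \<in> carrier M" if "x \<in> A" for x using that by blast
  obtain x where "x \<in> A" using *(2) by blast
  then show "\<zero>\<^bsub>M\<^esub> \<in> A" using *(3)[of x] *(5)[of x "\<ominus>\<^bsub>M\<^esub> x"] 1 by (auto simp: M.r_neg subset_iff)
  show "x \<ominus>\<^bsub>M\<^esub> y \<in> A" if "x \<in> A" "y \<in> A" for x y using that *(3,5) by (simp add: a_minus_def)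
  show "\<ominus>\<^bsub>M\<^esub> x \<in> A" if "x \<in> A" for x using that *(3) by blast
  show "x \<oplus>\<^bsub>M\<^esub> y \<in> A" if "x \<in> A" "y \<in> A" for x y using that *(5) by blast
  show "a \<odot>\<^bsub>M\<^esub> x \<in> A" if "a \<in> carrier R" "x \<in> A" for a x using that *(4) by blast
qed

lemma submodI:
  assumes "module R M" "A \<subseteq> carrier M" "\<zero>\<^bsub>M\<^esub> \<in> A"
    "\<And>x y. x \<in> A \<Longrightarrow> y \<in> A \<Longrightarrow> x \<oplus>\<^bsub>M\<^esub> y \<in> A"
    "\<And>a x. a \<in> carrier R \<Longrightarrow> x \<in> A \<Longrightarrow> a \<odot>\<^bsub>M\<^esub> x \<in> A"
  shows "submodule A R M"
proof -
  interpret M: module R M by fact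
  show ?thesis
  proof (rule M.submoduleI)
    show "\<ominus>\<^bsub>M\<^esub> a \<in> A" if "a \<in> A" for a
      using assms(5)[of "\<ominus>\<^bsub>R\<^esub> \<one>\<^bsub>R\<^esub>" a] that assms(2) by (auto simp: M.smult_l_minus subset_iff)
  qed (use assms in auto)
qed

lemma submod_carrier: "module R M \<Longrightarrow> submodule (carrier M) R M"
  by (rule module.carrier_is_submodule)

lemma submod_zero: assumes "module R M" shows "submodule {\<zero>\<^bsub>M\<^esub>} R M"
proof -
  interpret M: module R M by fact
  show ?thesis by (intro submodI assms) auto
qed

lemma submod_Int: "module R M \<Longrightarrow> submodule A R M \<Longrightarrow> submodule B R M \<Longrightarrow> submodule (A \<inter> B) R M"
  by (intro submodI) (auto dest: submodD)

lemma submod_vimage: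
  assumes "module R M" "module R N" "f \<in> mod_hom R M N" "submodule B R N"
  shows "submodule {x \<in> carrier M. f x \<in> B} R M"
proof -
  interpret M: module R M by fact
  show ?thesis using assms
    by (intro submodI) (auto simp: hom_zero hom_add hom_smult dest: submodD)
qed

lemma submod_image:
  assumes "module R M" "module R N" "f \<in> mod_hom R M N" "submodule A R M"
  shows "submodule (f ` A) R N"
proof (intro submodI assms)
  interpret M: module R M by fact
  note A = submodD[OF assms(1,4)]
  show "f ` A \<subseteq> carrier N" using A assms by (auto intro: hom_closed)
  show "\<zero>\<^bsub>N\<^esub> \<in> f ` A" using A(2) hom_zero[OF assms(1-3)] by force
  fix x y assume "x \<in> f ` A" "y \<in> f ` A"
  then obtain u v where "u \<in> A" "v \<in> A" "x = f u" "y = f v" by blast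
  then show "x \<oplus>\<^bsub>N\<^esub> y \<in> f ` A" using A hom_add[OF assms(3), of u v] by (auto intro!: image_eqI[of _ _ "u \<oplus>\<^bsub>M\<^esub> v"])
next
  interpret M: module R M by fact
  note A = submodD[OF assms(1,4)]
  fix a x assume a: "a \<in> carrier R" and "x \<in> f ` A"
  then obtain u where u: "u \<in> A" "x = f u" by blast
  then have "a \<odot>\<^bsub>N\<^esub> x = f (a \<odot>\<^bsub>M\<^esub> u)" using hom_smult[OF assms(3) a] A by simp
  then show "a \<odot>\<^bsub>N\<^esub> x \<in> f ` A" using A(7)[OF a u(1)] by simp
qed

lemma submod_ker:
  assumes "module R M" "module R N" "f \<in> mod_hom R M N"
  shows "submodule {x \<in> carrier M. f x = \<zero>\<^bsub>N\<^esub>} R M"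
  using submod_vimage[OF assms submod_zero[OF assms(2)]] by simp

lemma submod_sub: "module R M \<Longrightarrow> submodule A R M \<Longrightarrow> submodule B R M \<Longrightarrow> B \<subseteq> A \<Longrightarrow> submodule B R (M \<restriction> A)"
  by (rule submodI[OF module_sub]) (auto dest: submodD)

lemma submod_trans:
  assumes "module R M" "submodule A R M" "submodule B R (M \<restriction> A)" shows "submodule B R M"
proof -
  note * = submodD[OF module_sub[OF assms(1,2)] assms(3), simplified]
  show ?thesis using * submodD(1)[OF assms(1,2)] by (intro submodI assms) auto
qed

text \<open>The universal property of a cokernel, stated for a surjection \<open>p\<close> instead
  of a literal quotient, so that it applies to whatever module plays that role. Two preimages of a
  point differ by an element of the kernel of \<open>p\<close>, hence \<open>f\<close> after any
  choice of preimages is well defined and linear.\<close>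

lemma hom_factor:
  assumes "module R U" "module R Y" "module R W" "p \<in> mod_hom R U Y" "p ` carrier U = carrier Y"
    and "f \<in> mod_hom R U W" and "\<And>x. x \<in> carrier U \<Longrightarrow> p x = \<zero>\<^bsub>Y\<^esub> \<Longrightarrow> f x = \<zero>\<^bsub>W\<^esub>"
  shows "\<exists>g\<in>mod_hom R Y W. \<forall>x\<in>carrier U. g (p x) = f x"
proof -
  interpret U: module R U by fact
  interpret Y: module R Y by fact
  interpret W: module R W by fact
  define s where "s y = (SOME x. x \<in> carrier U \<and> p x = y)" for y
  have s: "s y \<in> carrier U" "p (s y) = y" if "y \<in> carrier Y" for y
  proof -
    have "\<exists>x. x \<in> carrier U \<and> p x = y" using that unfolding assms(5)[symmetric] by blast
    from someI_ex[OF this] show "s y \<in> carrier U" "p (s y) = y" unfolding s_def by auto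
  qed
  have eq: "f x = f y" if "x \<in> carrier U" "y \<in> carrier U" "p x = p y" for x y
  proof -
    have "p (x \<ominus>\<^bsub>U\<^esub> y) = \<zero>\<^bsub>Y\<^esub>"
      using that assms by (simp add: hom_diff hom_closed Y.minus_eq_zero_iff)
    then have "f (x \<ominus>\<^bsub>U\<^esub> y) = \<zero>\<^bsub>W\<^esub>" using that assms(7) by simp
    then show ?thesis using that assms by (simp add: hom_diff hom_closed W.minus_eq_zero_iff)
  qed
  have fs: "f (s (p x)) = f x" if "x \<in> carrier U" for x
    using eq[of "s (p x)" x] that s hom_closed[OF assms(4)] by auto
  have "(\<lambda>y. f (s y)) \<in> mod_hom R Y W"
  proof (rule mod_homI)
    fix x y assume xy: "x \<in> carrier Y" "y \<in> carrier Y"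
    then show "f (s x) \<in> carrier W" using s assms by (auto intro: hom_closed)
    have "f (s (x \<oplus>\<^bsub>Y\<^esub> y)) = f (s x \<oplus>\<^bsub>U\<^esub> s y)"
      by (rule eq) (use xy s assms in \<open>auto simp: hom_add\<close>)
    then show "f (s (x \<oplus>\<^bsub>Y\<^esub> y)) = f (s x) \<oplus>\<^bsub>W\<^esub> f (s y)" using xy s assms by (simp add: hom_add)
  next
    fix a x assume ax: "a \<in> carrier R" "x \<in> carrier Y"
    have "f (s (a \<odot>\<^bsub>Y\<^esub> x)) = f (a \<odot>\<^bsub>U\<^esub> s x)"
      by (rule eq) (use ax s assms in \<open>auto simp: hom_smult\<close>)
    then show "f (s (a \<odot>\<^bsub>Y\<^esub> x)) = a \<odot>\<^bsub>W\<^esub> f (s x)" using ax s assms by (simp add: hom_smult)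
  qed
  then show ?thesis by (rule bexI[rotated]) (simp add: fs)
qed

lemma hom_inj_iff:
  assumes "module R U" "module R Y" "f \<in> mod_hom R U Y"
  shows "inj_on f (carrier U) \<longleftrightarrow> (\<forall>x\<in>carrier U. f x = \<zero>\<^bsub>Y\<^esub> \<longrightarrow> x = \<zero>\<^bsub>U\<^esub>)"
proof
  interpret U: module R U by fact
  interpret Y: module R Y by fact
  assume "inj_on f (carrier U)"
  then show "\<forall>x\<in>carrier U. f x = \<zero>\<^bsub>Y\<^esub> \<longrightarrow> x = \<zero>\<^bsub>U\<^esub>"
    using hom_zero[OF assms] by (metis U.zero_closed inj_onD)
next
  interpret U: module R U by fact
  interpret Y: module R Y by fact
  assume *: "\<forall>x\<in>carrier U. f x = \<zero>\<^bsub>Y\<^esub> \<longrightarrow> x = \<zero>\<^bsub>U\<^esub>"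
  show "inj_on f (carrier U)"
  proof (rule inj_onI)
    fix x y assume xy: "x \<in> carrier U" "y \<in> carrier U" "f x = f y"
    then have "f (x \<ominus>\<^bsub>U\<^esub> y) = \<zero>\<^bsub>Y\<^esub>" using assms by (simp add: hom_diff hom_closed Y.minus_eq_zero_iff)
    then show "x = y" using * xy by (metis U.minus_closed U.minus_eq_zero_iff)
  qed
qed

lemma hom_inv:
  assumes "module R U" "module R Y" "f \<in> mod_hom R U Y" "bij_betw f (carrier U) (carrier Y)"
  shows "inv_into (carrier U) f \<in> mod_hom R Y U"
proof -
  interpret U: module R U by fact
  interpret Y: module R Y by fact
  let ?g = "inv_into (carrier U) f"
  have g: "?g y \<in> carrier U" "f (?g y) = y" if "y \<in> carrier Y" for y
    using that assms(4) by (auto simp: bij_betw_def inv_into_into f_inv_into_f)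
  have gi: "?g (f x) = x" if "x \<in> carrier U" for x
    using that assms(4) by (auto simp: bij_betw_def)
  show ?thesis
  proof (rule mod_homI)
    fix x y assume xy: "x \<in> carrier Y" "y \<in> carrier Y"
    then show "?g x \<in> carrier U" using g by blast
    show "?g (x \<oplus>\<^bsub>Y\<^esub> y) = ?g x \<oplus>\<^bsub>U\<^esub> ?g y"
      using gi[of "?g x \<oplus>\<^bsub>U\<^esub> ?g y"] xy g hom_add[OF assms(3), of "?g x" "?g y"] by simp
  next
    fix a x assume ax: "a \<in> carrier R" "x \<in> carrier Y"
    then show "?g (a \<odot>\<^bsub>Y\<^esub> x) = a \<odot>\<^bsub>U\<^esub> ?g x"
      using gi[of "a \<odot>\<^bsub>U\<^esub> ?g x"] g hom_smult[OF assms(3), of a "?g x"] by simp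
  qed
qed

lemma self_simps [simp]: "carrier (self_module R) = carrier R" "\<zero>\<^bsub>self_module R\<^esub> = \<zero>\<^bsub>R\<^esub>"
  "x \<oplus>\<^bsub>self_module R\<^esub> y = x \<oplus>\<^bsub>R\<^esub> y" "a \<odot>\<^bsub>self_module R\<^esub> x = a \<otimes>\<^bsub>R\<^esub> x"
  by (simp_all add: self_module_def)

lemma module_self: assumes "cring R" shows "module R (self_module R)"
proof -
  interpret cring R by fact
  show ?thesis
  proof (rule moduleI)
    show "abelian_group (self_module R)"
    proof (rule abelian_groupI)
      show "\<exists>y\<in>carrier (self_module R). y \<oplus>\<^bsub>self_module R\<^esub> x = \<zero>\<^bsub>self_module R\<^esub>" if "x \<in> carrier (self_module R)" for x
        using that l_neg by (intro bexI[of _ "\<ominus>\<^bsub>R\<^esub> x"]) auto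
    qed (auto simp: a_ac)
  qed (auto simp: is_cring l_distr r_distr m_assoc)
qed

lemma a_inv_self: "\<ominus>\<^bsub>self_module R\<^esub> x = \<ominus>\<^bsub>R\<^esub> x"
  by (simp add: a_inv_def m_inv_def self_module_def)

lemma hom_self_eq:
  assumes "cring R" "f \<in> mod_hom R (self_module R) M" "r \<in> carrier R"
  shows "f r = r \<odot>\<^bsub>M\<^esub> f \<one>\<^bsub>R\<^esub>"
proof -
  interpret cring R by fact
  show ?thesis using hom_smult[OF assms(2), of r "\<one>\<^bsub>R\<^esub>"] assms(3) by simp
qed

section \<open>Spans and finite generation\<close>

definition mspan :: "('a,'r) ring_scheme \<Rightarrow> ('a,'b,'m) module_scheme \<Rightarrow> 'b set \<Rightarrow> 'b set" where
  "mspan R M S = \<Inter>{N. submodule N R M \<and> S \<subseteq> N}"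

lemma mspan_submod: assumes "module R M" "S \<subseteq> carrier M" shows "submodule (mspan R M S) R M"
proof (rule submodI[OF assms(1)])
  note D = submodD[OF assms(1)]
  show "mspan R M S \<subseteq> carrier M" unfolding mspan_def using assms submod_carrier[OF assms(1)] by (intro Inter_lower) simp
qed (auto simp: mspan_def submodD[OF assms(1)])

lemma mspan_superset: "S \<subseteq> mspan R M S" unfolding mspan_def by blast

lemma mspan_least: "submodule N R M \<Longrightarrow> S \<subseteq> N \<Longrightarrow> mspan R M S \<subseteq> N" unfolding mspan_def by blast

lemma mspan_mono: "S \<subseteq> T \<Longrightarrow> mspan R M S \<subseteq> mspan R M T" unfolding mspan_def by blast

lemma mspan_eq: "submodule N R M \<Longrightarrow> mspan R M N = N"
  by (simp add: mspan_least mspan_superset subset_antisym)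

lemma submod_plus:
  assumes "module R M" "submodule A R M" "submodule B R M"
  shows "submodule {a \<oplus>\<^bsub>M\<^esub> b | a b. a \<in> A \<and> b \<in> B} R M" (is "submodule ?C R M")
proof -
  interpret M: module R M by fact
  note A = submodD[OF assms(1,2)] and B = submodD[OF assms(1,3)]
  show ?thesis
  proof (intro submodI assms)
    show "\<zero>\<^bsub>M\<^esub> \<in> ?C" using A(2) B(2) by (auto intro!: exI[of _ "\<zero>\<^bsub>M\<^esub>"])
    fix x y assume "x \<in> ?C" "y \<in> ?C"
    then obtain a b a' b' where *: "x = a \<oplus>\<^bsub>M\<^esub> b" "y = a' \<oplus>\<^bsub>M\<^esub> b'" "a \<in> A" "b \<in> B" "a' \<in> A" "b' \<in> B" by blast
    then have "x \<oplus>\<^bsub>M\<^esub> y = (a \<oplus>\<^bsub>M\<^esub> a') \<oplus>\<^bsub>M\<^esub> (b \<oplus>\<^bsub>M\<^esub> b')" using A(3) B(3) by (simp add: M.a_ac)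
    moreover have "a \<oplus>\<^bsub>M\<^esub> a' \<in> A" "b \<oplus>\<^bsub>M\<^esub> b' \<in> B" using * A(5) B(5) by auto
    ultimately show "x \<oplus>\<^bsub>M\<^esub> y \<in> ?C" by blast
  next
    fix r x assume "r \<in> carrier R" "x \<in> ?C"
    then obtain a b where *: "x = a \<oplus>\<^bsub>M\<^esub> b" "a \<in> A" "b \<in> B" "r \<in> carrier R" by blast
    then have "r \<odot>\<^bsub>M\<^esub> x = r \<odot>\<^bsub>M\<^esub> a \<oplus>\<^bsub>M\<^esub> r \<odot>\<^bsub>M\<^esub> b" using A(3) B(3) by (simp add: M.smult_r_distr)
    moreover have "r \<odot>\<^bsub>M\<^esub> a \<in> A" "r \<odot>\<^bsub>M\<^esub> b \<in> B" using * A(7) B(7) by auto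
    ultimately show "r \<odot>\<^bsub>M\<^esub> x \<in> ?C" by blast
  qed (use A B in auto)
qed

lemma submod_smult_ideal:
  assumes "module R M" "ideal I R" "x \<in> carrier M"
  shows "submodule {r \<odot>\<^bsub>M\<^esub> x | r. r \<in> I} R M" (is "submodule ?C R M")
proof -
  interpret M: module R M by fact
  interpret ideal I R by fact
  show ?thesis
  proof (intro submodI assms)
    show "\<zero>\<^bsub>M\<^esub> \<in> ?C" using assms(3) by (auto intro!: exI[of _ "\<zero>\<^bsub>R\<^esub>"])
    fix u v assume "u \<in> ?C" "v \<in> ?C"
    then obtain r s where *: "u = r \<odot>\<^bsub>M\<^esub> x" "v = s \<odot>\<^bsub>M\<^esub> x" "r \<in> I" "s \<in> I" by blast
    then have "u \<oplus>\<^bsub>M\<^esub> v = (r \<oplus>\<^bsub>R\<^esub> s) \<odot>\<^bsub>M\<^esub> x" using assms(3) by (simp add: M.smult_l_distr)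
    then show "u \<oplus>\<^bsub>M\<^esub> v \<in> ?C" using * by blast
  next
    fix a u assume "a \<in> carrier R" "u \<in> ?C"
    then obtain r where *: "u = r \<odot>\<^bsub>M\<^esub> x" "r \<in> I" "a \<in> carrier R" by blast
    then have "a \<odot>\<^bsub>M\<^esub> u = (a \<otimes>\<^bsub>R\<^esub> r) \<odot>\<^bsub>M\<^esub> x" using assms(3) by (simp add: M.smult_assoc1)
    then show "a \<odot>\<^bsub>M\<^esub> u \<in> ?C" using * I_l_closed by blast
  qed (use assms(3) in auto)
qed

lemma ideal_carrier: "cring R \<Longrightarrow> ideal (carrier R) R"
  by (simp add: cring.axioms(1) ring.oneideal)

lemma mspan_insert:
  assumes "module R M" "S \<subseteq> carrier M" "x \<in> carrier M"
  shows "mspan R M (insert x S) = {r \<odot>\<^bsub>M\<^esub> x \<oplus>\<^bsub>M\<^esub> s | r s. r \<in> carrier R \<and> s \<in> mspan R M S}" (is "_ = ?C")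
proof
  interpret M: module R M by fact
  note S = submodD[OF assms(1) mspan_submod[OF assms(1,2)]]
  have "?C = {a \<oplus>\<^bsub>M\<^esub> b | a b. a \<in> {r \<odot>\<^bsub>M\<^esub> x | r. r \<in> carrier R} \<and> b \<in> mspan R M S}" by blast
  then have "submodule ?C R M" using submod_plus[OF assms(1) submod_smult_ideal[OF assms(1) ideal_carrier assms(3)]
      mspan_submod[OF assms(1,2)]] M.R.is_cring by simp
  moreover have "x \<in> ?C" using assms(3) S(2)
    by (auto intro!: exI[of _ "\<one>\<^bsub>R\<^esub>"] exI[of _ "\<zero>\<^bsub>M\<^esub>"])
  moreover have "s \<in> ?C" if "s \<in> S" for s using assms(2,3) that mspan_superset[of S R M]
    by (auto intro!: exI[of _ "\<zero>\<^bsub>R\<^esub>"] exI[of _ s] simp: subset_iff)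
  ultimately show "mspan R M (insert x S) \<subseteq> ?C" by (intro mspan_least) blast+
next
  have sub: "submodule (mspan R M (insert x S)) R M" using assms by (intro mspan_submod) auto
  note T = submodD[OF assms(1) sub]
  have "x \<in> mspan R M (insert x S)" "mspan R M S \<subseteq> mspan R M (insert x S)"
    using mspan_superset[of "insert x S" R M] mspan_mono[OF subset_insertI, of R M S x] by auto
  then show "?C \<subseteq> mspan R M (insert x S)" using T by auto
qed

lemma mspan_empty: assumes "module R M" shows "mspan R M {} = {\<zero>\<^bsub>M\<^esub>}"
  using mspan_least[OF submod_zero[OF assms], of "{}"] submodD(2)[OF assms mspan_submod[OF assms, of "{}"]] by auto

text \<open>The points where \<open>f\<close> and \<open>g\<close> agree form a submodule, the
  preimage of zero under the difference of the two maps.\<close>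

lemma hom_eq_on_span:
  assumes "module R M" "module R N" "f \<in> mod_hom R M N" "g \<in> mod_hom R M N" "S \<subseteq> carrier M"
    "\<And>x. x \<in> S \<Longrightarrow> f x = g x" "x \<in> mspan R M S"
  shows "f x = g x"
proof -
  interpret M: module R M by fact
  interpret N: module R N by fact
  have "submodule {x \<in> carrier M. f x \<ominus>\<^bsub>N\<^esub> g x \<in> {\<zero>\<^bsub>N\<^esub>}} R M"
    by (rule submod_vimage[OF assms(1,2) hom_minus submod_zero]) (use assms in auto)
  moreover have "S \<subseteq> {x \<in> carrier M. f x \<ominus>\<^bsub>N\<^esub> g x \<in> {\<zero>\<^bsub>N\<^esub>}}"
    using assms(4-6) by (auto simp: hom_closed N.minus_eq_zero_iff)
  ultimately have "x \<in> {x \<in> carrier M. f x \<ominus>\<^bsub>N\<^esub> g x \<in> {\<zero>\<^bsub>N\<^esub>}}" using mspan_least assms(7) by blast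
  then show ?thesis using assms(3,4) by (auto simp: hom_closed N.minus_eq_zero_iff)
qed

text \<open>With spans as intersections of submodules, generation is checked by minimality and
  without linear combinations. The explicit coefficients of \<open>fg_module\<close> appear only
  where the statement or \<open>Ext_module\<close> asks for them.\<close>

definition fgm :: "('a,'r) ring_scheme \<Rightarrow> ('a,'b,'m) module_scheme \<Rightarrow> bool" where
  "fgm R M \<longleftrightarrow> module R M \<and> (\<exists>S \<subseteq> carrier M. finite S \<and> mspan R M S = carrier M)"

lemma submod_finsum:
  assumes "module R M" "submodule A R M" "finite S" "\<And>s. s \<in> S \<Longrightarrow> f s \<in> A"
  shows "finsum M f S \<in> A"
  using assms(3,4)
proof (induction S rule: finite_induct)
  interpret M: module R M by fact
  note A = submodD[OF assms(1,2)]
  case empty show ?case using A by simp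
next
  interpret M: module R M by fact
  note A = submodD[OF assms(1,2)]
  case (insert x F)
  then show ?case using A by (subst M.finsum_insert) (auto simp: Pi_def)
qed

lemma fg_module_imp_fgm: assumes "fg_module R M" shows "fgm R M"
proof -
  from assms obtain A where A: "module R M" "A \<subseteq> carrier M" "finite A" and
    *: "\<forall>x\<in>carrier M. \<exists>c \<in> A \<rightarrow> carrier R. x = (\<Oplus>\<^bsub>M\<^esub>a\<in>A. c a \<odot>\<^bsub>M\<^esub> a)"
    unfolding fg_module_def by blast
  interpret M: module R M by fact
  have sub: "submodule (mspan R M A) R M" by (rule mspan_submod[OF A(1,2)])
  have "x \<in> mspan R M A" if xM: "x \<in> carrier M" for x
  proof -
    obtain c where c: "c \<in> A \<rightarrow> carrier R" "x = (\<Oplus>\<^bsub>M\<^esub>a\<in>A. c a \<odot>\<^bsub>M\<^esub> a)" using *[rule_format, OF xM] by (elim bexE)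
    show ?thesis unfolding c(2)
      by (rule submod_finsum[OF A(1) sub A(3)])
        (use c(1) mspan_superset[of A R M] submodD(7)[OF A(1) sub] in auto)
  qed
  then have "mspan R M A = carrier M" using submodD(1)[OF A(1) sub] by auto
  then show ?thesis using A unfolding fgm_def by auto
qed

lemma mspan_image:
  assumes "module R M" "module R N" "f \<in> mod_hom R M N" "S \<subseteq> carrier M"
  shows "mspan R N (f ` S) = f ` mspan R M S"
proof
  have f: "f ` S \<subseteq> carrier N" using assms by (auto intro: hom_closed)
  show "mspan R N (f ` S) \<subseteq> f ` mspan R M S"
    by (intro mspan_least submod_image[OF assms(1-3)] assms mspan_submod image_mono mspan_superset)
  have "mspan R M S \<subseteq> {x \<in> carrier M. f x \<in> mspan R N (f ` S)}"
    using mspan_superset[of "f ` S" R N] assms(4)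
    by (intro mspan_least submod_vimage[OF assms(1-3)] mspan_submod assms f) auto
  then show "f ` mspan R M S \<subseteq> mspan R N (f ` S)" by blast
qed

lemma fgm_image:
  assumes "fgm R M" "module R N" "f \<in> mod_hom R M N" "f ` carrier M = carrier N"
  shows "fgm R N"
proof -
  obtain S where S: "module R M" "S \<subseteq> carrier M" "finite S" "mspan R M S = carrier M"
    using assms(1) unfolding fgm_def by blast
  have "mspan R N (f ` S) = carrier N" using mspan_image[OF S(1) assms(2,3) S(2)] S(4) assms(4) by simp
  moreover have "f ` S \<subseteq> carrier N" "finite (f ` S)" using S(2,3) assms(3) by (auto intro: hom_closed)
  ultimately show ?thesis unfolding fgm_def using assms(2) by auto
qed

lemma mspan_sub:
  assumes "module R M" "submodule A R M" "S \<subseteq> A"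
  shows "mspan R (M \<restriction> A) S = mspan R M S"
proof
  have "mspan R M S \<subseteq> A" by (rule mspan_least[OF assms(2,3)])
  moreover have "S \<subseteq> carrier M" using assms submodD(1) by blast
  ultimately show "mspan R (M \<restriction> A) S \<subseteq> mspan R M S"
    by (intro mspan_least submod_sub assms mspan_submod mspan_superset)
  show "mspan R M S \<subseteq> mspan R (M \<restriction> A) S"
    by (intro mspan_least submod_trans[OF assms(1,2)] mspan_submod module_sub assms mspan_superset) (use assms in auto)
qed

section \<open>Quotients and modules of homomorphisms\<close>

text \<open>\<open>Q\<close> is a bare record here, and \<open>mod_hom\<close> presupposes no module
  axioms. Each axiom can be checked on preimages under \<open>p\<close>, so the image of a module
  inherits them all. This is how quotients become modules.\<close>

lemma module_hom_image:
  assumes "module R M" "p \<in> mod_hom R M Q" "p ` carrier M = carrier Q" "\<zero>\<^bsub>Q\<^esub> = p \<zero>\<^bsub>M\<^esub>"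
  shows "module R Q"
proof -
  interpret M: module R M by fact
  have ex: "\<exists>u\<in>carrier M. x = p u" if "x \<in> carrier Q" for x using that unfolding assms(3)[symmetric] by (rule imageE) auto
  note h = hom_add[OF assms(2), symmetric] hom_smult[OF assms(2), symmetric] hom_closed[OF assms(2)]
  show ?thesis
  proof (rule moduleI)
    show "cring R" by (rule M.R.is_cring)
    show "abelian_group Q"
    proof (rule abelian_groupI)
      fix x assume "x \<in> carrier Q"
      then obtain u where u: "u \<in> carrier M" "x = p u" using ex by metis
      have "p (\<ominus>\<^bsub>M\<^esub> u) \<oplus>\<^bsub>Q\<^esub> x = \<zero>\<^bsub>Q\<^esub>" using u h by (simp add: M.l_neg assms(4))
      then show "\<exists>y\<in>carrier Q. y \<oplus>\<^bsub>Q\<^esub> x = \<zero>\<^bsub>Q\<^esub>" using h(3)[of "\<ominus>\<^bsub>M\<^esub> u"] u by (intro bexI[of _ "p (\<ominus>\<^bsub>M\<^esub> u)"]) auto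
    next
      fix x y assume "x \<in> carrier Q" "y \<in> carrier Q"
      then obtain u v where u: "u \<in> carrier M" "x = p u" "v \<in> carrier M" "y = p v" using ex by metis
      show "x \<oplus>\<^bsub>Q\<^esub> y \<in> carrier Q" "x \<oplus>\<^bsub>Q\<^esub> y = y \<oplus>\<^bsub>Q\<^esub> x" using u by (auto simp: h M.a_comm)
    next
      fix x y z assume "x \<in> carrier Q" "y \<in> carrier Q" "z \<in> carrier Q"
      then obtain u v w where u: "u \<in> carrier M" "x = p u" "v \<in> carrier M" "y = p v" "w \<in> carrier M" "z = p w"
        using ex by metis
      show "x \<oplus>\<^bsub>Q\<^esub> y \<oplus>\<^bsub>Q\<^esub> z = x \<oplus>\<^bsub>Q\<^esub> (y \<oplus>\<^bsub>Q\<^esub> z)" using u by (simp add: h M.a_assoc)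
    next
      fix x assume "x \<in> carrier Q"
      then obtain u where u: "u \<in> carrier M" "x = p u" using ex by metis
      show "\<zero>\<^bsub>Q\<^esub> \<oplus>\<^bsub>Q\<^esub> x = x" using u by (simp add: h assms(4))
    qed (simp add: assms(4) h)
  next
    fix a b x assume ab: "a \<in> carrier R" "b \<in> carrier R" and "x \<in> carrier Q"
    then obtain u where u: "u \<in> carrier M" "x = p u" using ex by metis
    show "a \<odot>\<^bsub>Q\<^esub> x \<in> carrier Q" "(a \<oplus>\<^bsub>R\<^esub> b) \<odot>\<^bsub>Q\<^esub> x = a \<odot>\<^bsub>Q\<^esub> x \<oplus>\<^bsub>Q\<^esub> b \<odot>\<^bsub>Q\<^esub> x"
      "(a \<otimes>\<^bsub>R\<^esub> b) \<odot>\<^bsub>Q\<^esub> x = a \<odot>\<^bsub>Q\<^esub> (b \<odot>\<^bsub>Q\<^esub> x)"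
      using u ab by (simp_all add: h M.smult_l_distr M.smult_assoc1)
  next
    fix a x y assume ab: "a \<in> carrier R" and "x \<in> carrier Q" "y \<in> carrier Q"
    then obtain u v where u: "u \<in> carrier M" "x = p u" "v \<in> carrier M" "y = p v" using ex by metis
    show "a \<odot>\<^bsub>Q\<^esub> (x \<oplus>\<^bsub>Q\<^esub> y) = a \<odot>\<^bsub>Q\<^esub> x \<oplus>\<^bsub>Q\<^esub> a \<odot>\<^bsub>Q\<^esub> y" using u ab by (simp add: h M.smult_r_distr)
  next
    fix x assume "x \<in> carrier Q"
    then obtain u where u: "u \<in> carrier M" "x = p u" using ex by metis
    show "\<one>\<^bsub>R\<^esub> \<odot>\<^bsub>Q\<^esub> x = x" using u by (simp add: h)
  qed
qed

lemma submod_abelian_subgroup: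
  assumes "module R M" "submodule N R M" shows "abelian_subgroup N M"
proof -
  interpret M: module R M by fact
  have "subgroup N (add_monoid M)" using assms(2) by (simp add: submodule_def)
  then show ?thesis by (intro abelian_subgroupI3 additive_subgroup.intro) (auto simp: M.abelian_group_axioms)
qed

lemma quot_coset_eq_iff:
  assumes "module R M" "submodule N R M" "x \<in> carrier M" "y \<in> carrier M"
  shows "N +>\<^bsub>M\<^esub> x = N +>\<^bsub>M\<^esub> y \<longleftrightarrow> x \<ominus>\<^bsub>M\<^esub> y \<in> N"
proof -
  interpret M: module R M by fact
  interpret abelian_subgroup N M by (rule submod_abelian_subgroup[OF assms(1,2)])
  have "x \<in> N +>\<^bsub>M\<^esub> y \<longleftrightarrow> x \<oplus>\<^bsub>M\<^esub> \<ominus>\<^bsub>M\<^esub> y \<in> N" using assms(3,4) by (intro a_rcos_module)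
  moreover have "N +>\<^bsub>M\<^esub> x = N +>\<^bsub>M\<^esub> y \<longleftrightarrow> x \<in> N +>\<^bsub>M\<^esub> y"
    using a_rcos_self[OF assms(3)] a_repr_independence'[OF _ assms(4)] by metis
  ultimately show ?thesis by (simp add: a_minus_def)
qed

lemma quot_coset_hom:
  assumes "module R M" "submodule N R M"
  shows "(\<lambda>x. N +>\<^bsub>M\<^esub> x) \<in> mod_hom R M (quot_module M N)"
proof (rule mod_homI)
  interpret M: module R M by fact
  interpret abelian_subgroup N M by (rule submod_abelian_subgroup[OF assms(1,2)])
  fix x assume x: "x \<in> carrier M"
  then show "N +>\<^bsub>M\<^esub> x \<in> carrier (quot_module M N)"
    using submodD(1)[OF assms] by (auto simp: quot_module_def A_RCOSETS_def')
  show "N +>\<^bsub>M\<^esub> (x \<oplus>\<^bsub>M\<^esub> y) = (N +>\<^bsub>M\<^esub> x) \<oplus>\<^bsub>quot_module M N\<^esub> (N +>\<^bsub>M\<^esub> y)" if "y \<in> carrier M" for y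
    using a_rcos_sum[OF x that] by (simp add: quot_module_def)
  show "N +>\<^bsub>M\<^esub> (a \<odot>\<^bsub>M\<^esub> x) = a \<odot>\<^bsub>quot_module M N\<^esub> (N +>\<^bsub>M\<^esub> x)" if a: "a \<in> carrier R" for a
  proof -
    have "N +>\<^bsub>M\<^esub> (a \<odot>\<^bsub>M\<^esub> y) = N +>\<^bsub>M\<^esub> (a \<odot>\<^bsub>M\<^esub> x)" if y: "y \<in> N +>\<^bsub>M\<^esub> x" for y
    proof -
      obtain h where h: "h \<in> N" "y = h \<oplus>\<^bsub>M\<^esub> x" using y by (auto simp: a_r_coset_def')
      have hM: "h \<in> carrier M" using h submodD(3)[OF assms] by blast
      have "a \<odot>\<^bsub>M\<^esub> y \<ominus>\<^bsub>M\<^esub> a \<odot>\<^bsub>M\<^esub> x = a \<odot>\<^bsub>M\<^esub> h" using h hM x a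
        by (simp add: M.smult_r_distr a_minus_def M.a_assoc M.r_neg)
      then show ?thesis using quot_coset_eq_iff[OF assms] h hM x a submodD(7)[OF assms] by simp
    qed
    note * = this
    have "N +>\<^bsub>M\<^esub> x \<noteq> {}" using a_rcos_self[OF x] by (metis empty_iff)
    then have "(\<Union>y\<in>N +>\<^bsub>M\<^esub> x. N +>\<^bsub>M\<^esub> (a \<odot>\<^bsub>M\<^esub> y)) = N +>\<^bsub>M\<^esub> (a \<odot>\<^bsub>M\<^esub> x)" by (rule SUP_eq_const) (rule *)
    then show ?thesis by (simp add: quot_module_def)
  qed
qed

lemma quot_carrier: "carrier (quot_module M N) = (\<lambda>x. N +>\<^bsub>M\<^esub> x) ` carrier M"
  by (auto simp: quot_module_def A_RCOSETS_def')

lemma quot_coset_zero_iff: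
  assumes "module R M" "submodule N R M" "x \<in> carrier M"
  shows "N +>\<^bsub>M\<^esub> x = \<zero>\<^bsub>quot_module M N\<^esub> \<longleftrightarrow> x \<in> N"
proof -
  interpret M: module R M by fact
  have "N +>\<^bsub>M\<^esub> \<zero>\<^bsub>M\<^esub> = N" using submodD(1)[OF assms(1,2)] by simp
  then show ?thesis using quot_coset_eq_iff[OF assms M.zero_closed] assms(3)
    by (simp add: quot_module_def a_minus_def a_inv_def)
qed

lemma module_quot:
  assumes "module R M" "submodule N R M" shows "module R (quot_module M N)"
proof -
  interpret M: module R M by fact
  have "N +>\<^bsub>M\<^esub> \<zero>\<^bsub>M\<^esub> = N" using submodD(1)[OF assms(1,2)] by simp
  then have "\<zero>\<^bsub>quot_module M N\<^esub> = N +>\<^bsub>M\<^esub> \<zero>\<^bsub>M\<^esub>" by (simp add: quot_module_def)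
  then show ?thesis by (rule module_hom_image[OF assms(1) quot_coset_hom[OF assms] quot_carrier[symmetric]])
qed

lemma Hom_carrier: "f \<in> carrier (Hom_module R M N) \<longleftrightarrow> f \<in> mod_hom R M N \<and> f \<in> extensional (carrier M)"
  by (simp add: Hom_module_def)

lemma Hom_apply:
  "\<zero>\<^bsub>Hom_module R M N\<^esub> = (\<lambda>x\<in>carrier M. \<zero>\<^bsub>N\<^esub>)"
  "f \<oplus>\<^bsub>Hom_module R M N\<^esub> g = (\<lambda>x\<in>carrier M. f x \<oplus>\<^bsub>N\<^esub> g x)"
  "a \<odot>\<^bsub>Hom_module R M N\<^esub> f = (\<lambda>x\<in>carrier M. a \<odot>\<^bsub>N\<^esub> f x)"
  by (simp_all add: Hom_module_def)

lemma restrict_eqI: "f \<in> extensional A \<Longrightarrow> (\<And>x. x \<in> A \<Longrightarrow> f x = g x) \<Longrightarrow> f = restrict g A"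
  by (rule extensionalityI[of _ A]) auto

lemma restrict_in_Hom: "module R M \<Longrightarrow> f \<in> mod_hom R M N \<Longrightarrow> restrict f (carrier M) \<in> carrier (Hom_module R M N)"
  by (simp add: Hom_carrier hom_restrict)

lemma module_Hom:
  assumes "module R M" "module R N" shows "module R (Hom_module R M N)"
proof (rule moduleI)
  interpret M: module R M by fact
  interpret N: module R N by fact
  show "cring R" by (rule M.R.is_cring)
  show "abelian_group (Hom_module R M N)"
  proof (rule abelian_groupI)
    fix f assume f: "f \<in> carrier (Hom_module R M N)"
    show "\<exists>g\<in>carrier (Hom_module R M N). g \<oplus>\<^bsub>Hom_module R M N\<^esub> f = \<zero>\<^bsub>Hom_module R M N\<^esub>"
      using f restrict_in_Hom[OF assms(1) hom_uminus[OF assms(2)], of f]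
      by (intro bexI[of _ "\<lambda>x\<in>carrier M. \<ominus>\<^bsub>N\<^esub> f x"]) (auto simp: Hom_carrier Hom_apply hom_closed N.l_neg cong: restrict_cong)
  next
    fix f g assume "f \<in> carrier (Hom_module R M N)" "g \<in> carrier (Hom_module R M N)"
    then show "f \<oplus>\<^bsub>Hom_module R M N\<^esub> g \<in> carrier (Hom_module R M N)"
      "f \<oplus>\<^bsub>Hom_module R M N\<^esub> g = g \<oplus>\<^bsub>Hom_module R M N\<^esub> f"
      using restrict_in_Hom[OF assms(1) hom_plus[OF assms(2)], of f g]
      by (auto simp: Hom_carrier Hom_apply hom_closed N.a_comm cong: restrict_cong)
  next
    fix f g h assume "f \<in> carrier (Hom_module R M N)" "g \<in> carrier (Hom_module R M N)" "h \<in> carrier (Hom_module R M N)"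
    then show "f \<oplus>\<^bsub>Hom_module R M N\<^esub> g \<oplus>\<^bsub>Hom_module R M N\<^esub> h = f \<oplus>\<^bsub>Hom_module R M N\<^esub> (g \<oplus>\<^bsub>Hom_module R M N\<^esub> h)"
      by (auto simp: Hom_carrier Hom_apply hom_closed N.a_assoc cong: restrict_cong)
  next
    fix f assume f: "f \<in> carrier (Hom_module R M N)"
    then show "\<zero>\<^bsub>Hom_module R M N\<^esub> \<oplus>\<^bsub>Hom_module R M N\<^esub> f = f"
      by (intro extensionalityI[of _ "carrier M"]) (auto simp: Hom_carrier Hom_apply hom_closed)
  next
    show "\<zero>\<^bsub>Hom_module R M N\<^esub> \<in> carrier (Hom_module R M N)"
      using restrict_in_Hom[OF assms(1) hom_zero_map[OF assms(2)]] by (simp add: Hom_apply)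
  qed
next
  interpret M: module R M by fact
  interpret N: module R N by fact
  fix a b f assume ab: "a \<in> carrier R" "b \<in> carrier R" and f: "f \<in> carrier (Hom_module R M N)"
  then show "a \<odot>\<^bsub>Hom_module R M N\<^esub> f \<in> carrier (Hom_module R M N)"
    using restrict_in_Hom[OF assms(1) hom_scale[OF assms(2)], of f a] by (auto simp: Hom_carrier Hom_apply)
  show "(a \<oplus>\<^bsub>R\<^esub> b) \<odot>\<^bsub>Hom_module R M N\<^esub> f = a \<odot>\<^bsub>Hom_module R M N\<^esub> f \<oplus>\<^bsub>Hom_module R M N\<^esub> b \<odot>\<^bsub>Hom_module R M N\<^esub> f"
    "(a \<otimes>\<^bsub>R\<^esub> b) \<odot>\<^bsub>Hom_module R M N\<^esub> f = a \<odot>\<^bsub>Hom_module R M N\<^esub> (b \<odot>\<^bsub>Hom_module R M N\<^esub> f)"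
    using ab f by (auto simp: Hom_carrier Hom_apply hom_closed N.smult_l_distr N.smult_assoc1 cong: restrict_cong)
next
  interpret M: module R M by fact
  interpret N: module R N by fact
  fix a f g assume ab: "a \<in> carrier R" and f: "f \<in> carrier (Hom_module R M N)" "g \<in> carrier (Hom_module R M N)"
  then show "a \<odot>\<^bsub>Hom_module R M N\<^esub> (f \<oplus>\<^bsub>Hom_module R M N\<^esub> g) = a \<odot>\<^bsub>Hom_module R M N\<^esub> f \<oplus>\<^bsub>Hom_module R M N\<^esub> a \<odot>\<^bsub>Hom_module R M N\<^esub> g"
    by (auto simp: Hom_carrier Hom_apply hom_closed N.smult_r_distr cong: restrict_cong)
next
  interpret M: module R M by fact
  interpret N: module R N by fact
  fix f assume f: "f \<in> carrier (Hom_module R M N)"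
  then show "\<one>\<^bsub>R\<^esub> \<odot>\<^bsub>Hom_module R M N\<^esub> f = f"
      by (intro extensionalityI[of _ "carrier M"]) (auto simp: Hom_carrier Hom_apply hom_closed)
qed

lemma Hom_eval_hom:
  assumes "x \<in> carrier M" shows "(\<lambda>f. f x) \<in> mod_hom R (Hom_module R M N) N"
  using assms by (intro mod_homI) (auto simp: Hom_carrier Hom_apply hom_closed)

lemma Hom_eqI:
  assumes "f \<in> carrier (Hom_module R M N)" "g \<in> carrier (Hom_module R M N)" "\<And>x. x \<in> carrier M \<Longrightarrow> f x = g x"
  shows "f = g"
  using assms by (intro extensionalityI[of _ "carrier M"]) (auto simp: Hom_carrier)

lemma precomp_hom:
  assumes A: "module R A" and g: "g \<in> mod_hom R A B"
  shows "(\<lambda>u. \<lambda>x\<in>carrier A. u (g x)) \<in> mod_hom R (Hom_module R B W) (Hom_module R A W)"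
proof (rule mod_homI)
  fix u assume "u \<in> carrier (Hom_module R B W)"
  then have "u \<in> mod_hom R B W" by (simp add: Hom_carrier)
  then show "(\<lambda>x\<in>carrier A. u (g x)) \<in> carrier (Hom_module R A W)"
    by (intro restrict_in_Hom[OF A] hom_comp[OF g])
qed (use hom_closed[OF g] in \<open>auto simp: Hom_apply cong: restrict_cong\<close>)

text \<open>Precomposition is injective because \<open>g\<close> is onto, and its image is found by
  factoring through \<open>g\<close>.\<close>

lemma Hom_left_exact:
  assumes A: "module R A" and B: "module R B" and W: "module R W" and g: "g \<in> mod_hom R A B" "g ` carrier A = carrier B"
  shows "bij_betw (\<lambda>u. \<lambda>x\<in>carrier A. u (g x)) (carrier (Hom_module R B W))
     {u \<in> carrier (Hom_module R A W). \<forall>x\<in>carrier A. g x = \<zero>\<^bsub>B\<^esub> \<longrightarrow> u x = \<zero>\<^bsub>W\<^esub>}" (is "bij_betw ?q _ ?N")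
  unfolding bij_betw_def
proof
  have gc: "g x \<in> carrier B" if "x \<in> carrier A" for x using hom_closed[OF g(1) that] .
  show "inj_on ?q (carrier (Hom_module R B W))"
  proof (rule inj_onI)
    fix u v assume uv: "u \<in> carrier (Hom_module R B W)" "v \<in> carrier (Hom_module R B W)" "?q u = ?q v"
    show "u = v"
    proof (rule Hom_eqI[OF uv(1,2)])
      fix y assume "y \<in> carrier B"
      then obtain x where x: "y = g x" "x \<in> carrier A" unfolding g(2)[symmetric] by (rule imageE)
      have "?q u x = ?q v x" using uv(3) by simp
      then show "u y = v y" using x by simp
    qed
  qed
  show "?q ` carrier (Hom_module R B W) = ?N"
  proof
    show "?q ` carrier (Hom_module R B W) \<subseteq> ?N"
    proof (rule image_subsetI)
      fix u assume u: "u \<in> carrier (Hom_module R B W)"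
      then have "u \<in> mod_hom R B W" by (simp add: Hom_carrier)
      then show "?q u \<in> ?N" using hom_closed[OF precomp_hom[OF A g(1)] u] hom_zero[OF B W] by auto
    qed
    show "?N \<subseteq> ?q ` carrier (Hom_module R B W)"
    proof
      fix v assume v: "v \<in> ?N"
      then have vh: "v \<in> mod_hom R A W" "v \<in> extensional (carrier A)" by (auto simp: Hom_carrier)
      obtain k where k: "k \<in> mod_hom R B W" "\<forall>x\<in>carrier A. k (g x) = v x"
        using hom_factor[OF A B W g vh(1)] v by auto
      have "v = ?q (restrict k (carrier B))" using k(2) vh(2) gc by (intro restrict_eqI) auto
      then show "v \<in> ?q ` carrier (Hom_module R B W)" using restrict_in_Hom[OF B k(1)] by (rule image_eqI)
    qed
  qed
qed

section \<open>Ideals of a Noetherian local ring\<close>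

definition msum :: "('a,'b,'m) module_scheme \<Rightarrow> 'b set \<Rightarrow> 'b set \<Rightarrow> 'b set" where
  "msum M A B = {a \<oplus>\<^bsub>M\<^esub> b | a b. a \<in> A \<and> b \<in> B}"

text \<open>The annihilator of the class of \<open>x\<close> in M / A; \<open>ann_quot\<close> below
  is the annihilator of the whole quotient.\<close>

definition colon_ideal :: "('a,'r) ring_scheme \<Rightarrow> ('a,'b,'m) module_scheme \<Rightarrow> 'b set \<Rightarrow> 'b \<Rightarrow> 'a set" where
  "colon_ideal R M A x = {r \<in> carrier R. r \<odot>\<^bsub>M\<^esub> x \<in> A}"

definition ann_quot :: "('a,'r) ring_scheme \<Rightarrow> ('a,'b,'m) module_scheme \<Rightarrow> 'b set \<Rightarrow> 'a set" where
  "ann_quot R M A = {r \<in> carrier R. \<forall>x\<in>carrier M. r \<odot>\<^bsub>M\<^esub> x \<in> A}"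

lemma submod_msum: "module R M \<Longrightarrow> submodule A R M \<Longrightarrow> submodule B R M \<Longrightarrow> submodule (msum M A B) R M"
  unfolding msum_def by (rule submod_plus)

lemma msum_superset:
  assumes "module R M" "submodule A R M" "submodule B R M" shows "A \<subseteq> msum M A B" "B \<subseteq> msum M A B"
proof -
  interpret M: module R M by fact
  note A = submodD[OF assms(1,2)] and B = submodD[OF assms(1,3)]
  have "a \<in> msum M A B" if "a \<in> A" for a unfolding msum_def
    using A(3)[OF that] that B(2) by (intro CollectI exI[of _ a] exI[of _ "\<zero>\<^bsub>M\<^esub>"]) auto
  then show "A \<subseteq> msum M A B" ..
  have "b \<in> msum M A B" if "b \<in> B" for b unfolding msum_def
    using B(3)[OF that] that A(2) by (intro CollectI exI[of _ b] exI[of _ "\<zero>\<^bsub>M\<^esub>"]) auto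
  then show "B \<subseteq> msum M A B" ..
qed

lemma msumI: "a \<in> A \<Longrightarrow> b \<in> B \<Longrightarrow> a \<oplus>\<^bsub>M\<^esub> b \<in> msum M A B" unfolding msum_def by blast

lemma msumE: assumes "x \<in> msum M A B" obtains a b where "a \<in> A" "b \<in> B" "x = a \<oplus>\<^bsub>M\<^esub> b"
  using assms unfolding msum_def by blast

lemma msum_least: "module R M \<Longrightarrow> submodule C R M \<Longrightarrow> A \<subseteq> C \<Longrightarrow> B \<subseteq> C \<Longrightarrow> msum M A B \<subseteq> C"
  using submodD(5)[of R M C] by (auto simp: msum_def subset_iff)

context cring begin

lemma ideal_iff_submod: "ideal I R \<longleftrightarrow> submodule I R (self_module R)"
proof
  assume "ideal I R"
  then interpret ideal I R .
  show "submodule I R (self_module R)"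
    by (rule submodI[OF module_self]) (auto simp: is_cring I_l_closed)
next
  assume "submodule I R (self_module R)"
  note * = submodD[OF module_self[OF is_cring] this, simplified]
  show "ideal I R"
  proof (rule idealI)
    show "subgroup I (add_monoid R)" using * by (intro add.subgroupI) (auto simp: a_inv_self)
    show "x \<otimes> a \<in> I" "a \<otimes> x \<in> I" if "a \<in> I" "x \<in> carrier R" for a x
      using *(7)[OF that(2,1)] m_comm[OF *(3)[OF that(1)] that(2)] by simp_all
  qed (rule ring_axioms)
qed

lemma ideal_colon_ideal:
  assumes "module R M" "submodule A R M" "x \<in> carrier M"
  shows "ideal (colon_ideal R M A x) R"
proof -
  have "submodule {r \<in> carrier (self_module R). r \<odot>\<^bsub>M\<^esub> x \<in> A} R (self_module R)"
    by (rule submod_vimage[OF module_self[OF is_cring] assms(1) hom_smult_elem assms(2)]) (use assms in auto)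
  then show ?thesis by (simp add: ideal_iff_submod colon_ideal_def)
qed

lemma submod_smult_all:
  assumes "module R M" "y \<in> carrier R"
  shows "submodule ((\<lambda>w. y \<odot>\<^bsub>M\<^esub> w) ` carrier M) R M"
  by (rule submod_image[OF assms(1) assms(1) hom_smult_id submod_carrier]) (use assms in auto)

end

lemma (in module) minus_add_cancel': "x \<in> carrier M \<Longrightarrow> y \<in> carrier M \<Longrightarrow> x \<oplus>\<^bsub>M\<^esub> y \<ominus>\<^bsub>M\<^esub> x = y"
  by (simp add: a_minus_def M.a_assoc M.r_neg2 M.a_comm[of y])

lemma (in module) add_minus_cancel': "x \<in> carrier M \<Longrightarrow> y \<in> carrier M \<Longrightarrow> x \<oplus>\<^bsub>M\<^esub> y \<ominus>\<^bsub>M\<^esub> y = x"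
  by (simp add: a_minus_def M.a_assoc M.r_neg)

lemma (in module) minus_plus_cancel': "x \<in> carrier M \<Longrightarrow> y \<in> carrier M \<Longrightarrow> (x \<ominus>\<^bsub>M\<^esub> y) \<oplus>\<^bsub>M\<^esub> y = x"
  by (simp add: a_minus_def M.a_assoc M.l_neg)

context noetherian_local_ring begin

text \<open>Induction on the generators, as for Hilbert's basis theorem. For a new generator
  \<open>a\<close>, the ideal \<open>J\<close> collects the coefficients of \<open>a\<close> in the
  elements of \<open>N\<close>, taken modulo the span of \<open>S\<close>. Finitely many elements of
  \<open>N\<close> realize generators of \<open>J\<close>; what remains after subtracting a
  combination of them lies in the intersection of \<open>N\<close> with the span of
  \<open>S\<close>, where the induction hypothesis applies.\<close>

lemma noetherian_mspan:
  assumes "module R M" "finite S" "S \<subseteq> carrier M" "submodule N R M" "N \<subseteq> mspan R M S"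
  shows "\<exists>T. T \<subseteq> N \<and> finite T \<and> mspan R M T = N"
  using assms(2-5)
proof (induction S arbitrary: N rule: finite_induct)
  case empty
  then have "N = {\<zero>\<^bsub>M\<^esub>}" using mspan_empty[OF assms(1)] submodD(2)[OF assms(1) empty(2)] by auto
  then show ?case using mspan_empty[OF assms(1)] by (intro exI[of _ "{}"]) auto
next
  case (insert a S N)
  interpret M: module R M by fact
  have a: "a \<in> carrier M" and S: "S \<subseteq> carrier M" using insert.prems by auto
  have sS: "submodule (mspan R M S) R M" by (rule mspan_submod[OF assms(1) S])
  note N = submodD[OF assms(1) insert.prems(2)] and D = submodD[OF assms(1) sS]
  define J where "J = colon_ideal R M (msum M N (mspan R M S)) a"
  have "ideal J R" unfolding J_def by (intro ideal_colon_ideal submod_msum assms(1) insert.prems sS a)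
  then obtain G where G: "G \<subseteq> carrier R" "finite G" "J = Idl G" using finetely_gen by metis
  have GJ: "G \<subseteq> J" unfolding G(3) by (rule genideal_self[OF G(1)])
  have "\<exists>n. n \<in> N \<and> (\<exists>s\<in>mspan R M S. g \<odot>\<^bsub>M\<^esub> a = n \<oplus>\<^bsub>M\<^esub> s)" if g: "g \<in> G" for g
  proof -
    have "g \<odot>\<^bsub>M\<^esub> a \<in> msum M N (mspan R M S)" using GJ g unfolding J_def colon_ideal_def by auto
    then show ?thesis by (elim msumE) (intro exI conjI bexI)
  qed
  then obtain n where n: "\<And>g. g \<in> G \<Longrightarrow> n g \<in> N" "\<And>g. g \<in> G \<Longrightarrow> \<exists>s\<in>mspan R M S. g \<odot>\<^bsub>M\<^esub> a = n g \<oplus>\<^bsub>M\<^esub> s"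
    by metis
  obtain T0 where T0: "T0 \<subseteq> N \<inter> mspan R M S" "finite T0" "mspan R M T0 = N \<inter> mspan R M S"
    using insert.IH[OF S submod_Int[OF assms(1) insert.prems(2) sS]] by auto
  define T where "T = T0 \<union> n ` G"
  have TN: "T \<subseteq> N" using T0 n(1) by (auto simp: T_def)
  then have sT: "submodule (mspan R M T) R M" using N(1) by (intro mspan_submod assms(1)) auto
  have TN': "mspan R M T \<subseteq> N" by (rule mspan_least[OF insert.prems(2) TN])
  have "G \<subseteq> colon_ideal R M (msum M (mspan R M T) (mspan R M S)) a"
  proof
    fix g assume g: "g \<in> G"
    then obtain s where "s \<in> mspan R M S" "g \<odot>\<^bsub>M\<^esub> a = n g \<oplus>\<^bsub>M\<^esub> s" using n(2) by metis
    moreover have "n g \<in> mspan R M T" using g mspan_superset[of T R M] by (auto simp: T_def)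
    ultimately show "g \<in> colon_ideal R M (msum M (mspan R M T) (mspan R M S)) a"
      using g G(1) by (auto simp: colon_ideal_def intro: msumI)
  qed
  then have J: "J \<subseteq> colon_ideal R M (msum M (mspan R M T) (mspan R M S)) a" unfolding G(3)
    by (intro genideal_minimal ideal_colon_ideal submod_msum assms(1) sT sS a)
  have "N \<subseteq> mspan R M T"
  proof
    fix x assume x: "x \<in> N"
    then obtain r s where rs: "r \<in> carrier R" "s \<in> mspan R M S" "x = r \<odot>\<^bsub>M\<^esub> a \<oplus>\<^bsub>M\<^esub> s"
      using insert.prems(3) mspan_insert[OF assms(1) S a] by auto
    have "r \<odot>\<^bsub>M\<^esub> a = x \<oplus>\<^bsub>M\<^esub> (\<ominus>\<^bsub>M\<^esub> s)" using rs a D(3) by (simp add: M.a_assoc M.r_neg)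
    then have "r \<in> J" using rs(1) x D(4)[OF rs(2)] by (auto simp: J_def colon_ideal_def intro: msumI)
    then have "r \<odot>\<^bsub>M\<^esub> a \<in> msum M (mspan R M T) (mspan R M S)" using J unfolding colon_ideal_def by auto
    then obtain n' s' where n': "n' \<in> mspan R M T" "s' \<in> mspan R M S" "r \<odot>\<^bsub>M\<^esub> a = n' \<oplus>\<^bsub>M\<^esub> s'"
      by (rule msumE)
    have n'N: "n' \<in> N" using n'(1) TN' by auto
    \<comment> \<open>Subtracting \<open>n'\<close>, which has the same component along
      \<open>a\<close> as \<open>x\<close>, leaves an element of the span of
      \<open>S\<close>.\<close>
    have xx: "x = n' \<oplus>\<^bsub>M\<^esub> (s' \<oplus>\<^bsub>M\<^esub> s)" unfolding rs(3) n'(3) using n' n'N N(3) D(3) rs by (simp add: M.a_assoc)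
    have "s' \<oplus>\<^bsub>M\<^esub> s = x \<ominus>\<^bsub>M\<^esub> n'" unfolding xx using n' n'N N(3) D(3) rs
      by (simp add: M.minus_add_cancel')
    then have "s' \<oplus>\<^bsub>M\<^esub> s \<in> N \<inter> mspan R M S" using N(6)[OF x n'N] D(5)[OF n'(2) rs(2)] by simp
    then have "s' \<oplus>\<^bsub>M\<^esub> s \<in> mspan R M T" using T0(3) mspan_mono[of T0 T R M] by (auto simp: T_def)
    then show "x \<in> mspan R M T" unfolding xx using n'(1) submodD(5)[OF assms(1) sT] by auto
  qed
  then show ?case using TN TN' T0(2) G(2) by (intro exI[of _ T]) (auto simp: T_def)
qed

lemma fgm_sub:
  assumes "fgm R M" "submodule N R M" shows "fgm R (M \<restriction> N)"
proof -
  obtain S where S: "module R M" "S \<subseteq> carrier M" "finite S" "mspan R M S = carrier M"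
    using assms(1) unfolding fgm_def by auto
  obtain T where "T \<subseteq> N" "finite T" "mspan R M T = N"
    using noetherian_mspan[OF S(1,3,2) assms(2)] submodD(1)[OF S(1) assms(2)] S(4) by auto
  then show ?thesis unfolding fgm_def using module_sub[OF S(1) assms(2)] mspan_sub[OF S(1) assms(2)] by auto
qed

text \<open>In a Noetherian ring the union of a nonempty chain of ideals belongs to the chain, so
  Zorn's lemma applies to every nonempty family of ideals. All Noetherian inductions below use this
  form.\<close>

lemma ideal_maximal:
  assumes "F \<noteq> {}" "\<And>I. I \<in> F \<Longrightarrow> ideal I R"
  shows "\<exists>I\<in>F. \<forall>J\<in>F. I \<subseteq> J \<longrightarrow> J = I"
proof (rule subset_Zorn_nonempty[OF assms(1)])
  fix C assume C: "C \<noteq> {}" "subset.chain F C"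
  then have "subset.chain {I. ideal I R} C" using assms(2) by (auto simp: subset.chain_def)
  then have "\<Union>C \<in> C" by (rule ideal_chain_is_trivial[OF C(1)])
  then show "\<Union>C \<in> F" using C(2) by (auto simp: subset.chain_def)
qed

section \<open>The maximal ideal and Nakayama's lemma\<close>

abbreviation "\<mm> \<equiv> max_ideal R"

lemma max_ideal: "maximalideal \<mm> R"
  unfolding max_ideal_def by (rule theI'[OF ex1_maximalideal])

lemma max_ideal_unique: "maximalideal I R \<Longrightarrow> I = \<mm>"
  using ex1_maximalideal max_ideal by metis

lemma ideal_max: "ideal \<mm> R" by (rule maximalideal.axioms(1)[OF max_ideal])

lemma prime_max: "primeideal \<mm> R" by (rule maximalideal_prime[OF max_ideal])

lemma one_notin_max: "\<one> \<notin> \<mm>"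
  using maximalideal.I_notcarr[OF max_ideal] ideal.one_imp_carrier[OF ideal_max] by metis

lemma max_carr: "a \<in> \<mm> \<Longrightarrow> a \<in> carrier R"
  by (rule ideal.Icarr[OF ideal_max])

lemma ideal_le_max:
  assumes "ideal I R" "I \<noteq> carrier R" shows "I \<subseteq> \<mm>"
proof -
  let ?F = "{J. ideal J R \<and> I \<subseteq> J \<and> J \<noteq> carrier R}"
  have "\<exists>J\<in>?F. \<forall>K\<in>?F. J \<subseteq> K \<longrightarrow> K = J"
  proof (rule ideal_maximal)
    show "?F \<noteq> {}" using assms by blast
  qed simp
  then obtain J where JF: "J \<in> ?F" "\<forall>K\<in>?F. J \<subseteq> K \<longrightarrow> K = J" by (rule bexE)
  then have J: "ideal J R" "I \<subseteq> J" "J \<noteq> carrier R"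
    "\<And>K. ideal K R \<Longrightarrow> I \<subseteq> K \<Longrightarrow> K \<noteq> carrier R \<Longrightarrow> J \<subseteq> K \<Longrightarrow> K = J" by simp_all
  have "maximalideal J R"
  proof (rule maximalidealI)
    show "K = J \<or> K = carrier R" if "ideal K R" "J \<subseteq> K" "K \<subseteq> carrier R" for K
      using J(4)[OF that(1) _ _ that(2)] J(2) that by (metis order_trans)
  qed (use J(1,3) in simp_all)
  then show ?thesis using max_ideal_unique J(2) by metis
qed

lemma notin_max_Unit:
  assumes "a \<in> carrier R" "a \<notin> \<mm>" shows "a \<in> Units R"
proof -
  have "PIdl a = carrier R"
    using ideal_le_max[OF cgenideal_ideal[OF assms(1)]] cgenideal_self[OF assms(1)] assms(2) by auto
  then have "\<one> \<in> PIdl a" by simp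
  then obtain b where b: "b \<in> carrier R" "\<one> = b \<otimes> a" unfolding cgenideal_def by auto
  then show ?thesis using assms(1) m_comm[OF b(1) assms(1)] unfolding Units_def by auto
qed

lemma one_minus_Unit: assumes "a \<in> \<mm>" shows "\<one> \<ominus> a \<in> Units R"
proof (rule notin_max_Unit)
  show "\<one> \<ominus> a \<in> carrier R" using max_carr[OF assms] by simp
  show "\<one> \<ominus> a \<notin> \<mm>"
  proof
    assume "\<one> \<ominus> a \<in> \<mm>"
    then have "(\<one> \<ominus> a) \<oplus> a \<in> \<mm>" using assms ideal_max
      by (simp add: additive_subgroup.a_closed ideal.axioms(1))
    moreover have "(\<one> \<ominus> a) \<oplus> a = \<one>" using max_carr[OF assms] by (simp add: a_minus_def a_assoc l_neg)
    ultimately show False using one_notin_max by simp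
  qed
qed

text \<open>The relative form: A / B is finitely generated and equal to \<mm> (A / B). The induction
  discards one generator \<open>s\<close> at a time. Modulo the other generators and
  \<open>B\<close>, the hypothesis yields \<open>s\<close> = \<open>r s\<close> + \<open>t\<close>
  with \<open>r\<close> in \<mm>, and 1 - \<open>r\<close> is a unit, so \<open>s\<close> is
  redundant. \<open>A\<close> itself stays fixed throughout.\<close>

lemma nakayama:
  assumes M: "module R M" and A: "submodule A R M" and B: "submodule B R M" "B \<subseteq> A"
    and fin: "finite S" "S \<subseteq> A" "A \<subseteq> mspan R M (S \<union> B)"
    and gen: "A \<subseteq> mspan R M (B \<union> {a \<odot>\<^bsub>M\<^esub> x | a x. a \<in> \<mm> \<and> x \<in> A})"
  shows "A = B"
  using fin
proof (induction S rule: finite_induct)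
  case empty
  then show ?case using mspan_eq[OF B(1)] B(2) by simp
next
  case (insert s S)
  interpret M: module R M by fact
  note AD = submodD[OF M A]
  have s: "s \<in> A" "s \<in> carrier M" and SB: "S \<union> B \<subseteq> carrier M" using insert.prems AD(3) B(2) by auto
  have sp: "submodule (mspan R M (S \<union> B)) R M" by (rule mspan_submod[OF M SB])
  note D = submodD[OF M sp]
  let ?C = "msum M {r \<odot>\<^bsub>M\<^esub> s | r. r \<in> \<mm>} (mspan R M (S \<union> B))"
  have sm: "submodule {r \<odot>\<^bsub>M\<^esub> s | r. r \<in> \<mm>} R M" by (rule submod_smult_ideal[OF M ideal_max s(2)])
  have C: "submodule ?C R M" by (rule submod_msum[OF M sm sp])
  have "B \<subseteq> ?C" using msum_superset(2)[OF M sm sp] mspan_superset[of "S \<union> B" R M] by auto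
  moreover have "{a \<odot>\<^bsub>M\<^esub> x | a x. a \<in> \<mm> \<and> x \<in> A} \<subseteq> ?C"
  proof clarify
    fix a x assume ax: "a \<in> \<mm>" "x \<in> A"
    then obtain r t where rt: "r \<in> carrier R" "t \<in> mspan R M (S \<union> B)" "x = r \<odot>\<^bsub>M\<^esub> s \<oplus>\<^bsub>M\<^esub> t"
      using subsetD[OF insert.prems(2) ax(2)] unfolding Un_insert_left mspan_insert[OF M SB s(2)] by (elim CollectE exE conjE)
    have a: "a \<in> carrier R" by (rule max_carr[OF ax(1)])
    have "a \<odot>\<^bsub>M\<^esub> x = (a \<otimes> r) \<odot>\<^bsub>M\<^esub> s \<oplus>\<^bsub>M\<^esub> a \<odot>\<^bsub>M\<^esub> t"
      using a rt s D(3) by (simp add: M.smult_r_distr M.smult_assoc1)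
    moreover have "a \<otimes> r \<in> \<mm>" using ideal.I_r_closed[OF ideal_max ax(1) rt(1)] .
    ultimately show "a \<odot>\<^bsub>M\<^esub> x \<in> ?C" using D(7)[OF a rt(2)] by (auto intro: msumI)
  qed
  ultimately have "A \<subseteq> ?C" using order_trans[OF gen mspan_least[OF C]] by simp
  then obtain r t where rt: "r \<in> \<mm>" "t \<in> mspan R M (S \<union> B)" "s = r \<odot>\<^bsub>M\<^esub> s \<oplus>\<^bsub>M\<^esub> t"
    using s(1) by (auto elim!: msumE)
  have r: "r \<in> carrier R" by (rule max_carr[OF rt(1)])
  have u: "\<one> \<ominus> r \<in> Units R" by (rule one_minus_Unit[OF rt(1)])
  have "(\<one> \<ominus> r) \<odot>\<^bsub>M\<^esub> s = s \<ominus>\<^bsub>M\<^esub> r \<odot>\<^bsub>M\<^esub> s"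
    using r s by (simp add: a_minus_def M.smult_l_distr M.smult_l_minus)
  also have "\<dots> = t" using rt(3) r s(2) D(3)[OF rt(2)] by (metis M.minus_add_cancel' M.smult_closed)
  finally have "inv (\<one> \<ominus> r) \<odot>\<^bsub>M\<^esub> t = s" using u r s(2)
    by (metis M.smult_assoc1 M.smult_one Units_closed Units_inv_closed Units_l_inv)
  then have "s \<in> mspan R M (S \<union> B)" using D(7)[OF Units_inv_closed[OF u] rt(2)] by simp
  then have "mspan R M (insert s (S \<union> B)) \<subseteq> mspan R M (S \<union> B)"
    using mspan_superset[of "S \<union> B" R M] by (intro mspan_least[OF sp]) auto
  then show ?case using insert by auto
qed

text \<open>A colon ideal that is maximal among those contained in \<open>Q\<close> is prime.\<close>

lemma prime_below:
  assumes W: "fgm R W" and A: "submodule A R W" and y: "\<And>w. w \<in> carrier W \<Longrightarrow> y \<odot>\<^bsub>W\<^esub> w \<in> A \<Longrightarrow> w \<in> A"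
    and Q: "primeideal Q R" "y \<in> Q" "ann_quot R W A \<subseteq> Q"
  shows "\<exists>p. primeideal p R \<and> p \<subseteq> Q \<and> y \<notin> p \<and> ann_quot R W A \<subseteq> p"
proof -
  obtain S where S: "module R W" "S \<subseteq> carrier W" "finite S" "mspan R W S = carrier W"
    using W unfolding fgm_def by auto
  interpret W: module R W by (rule S(1))
  note Qp = primeideal.I_prime[OF Q(1)]
  have n1: "\<one> \<notin> Q" using primeideal.I_notcarr[OF Q(1)] ideal.one_imp_carrier[OF primeideal.axioms(1)[OF Q(1)]] by metis
  note AD = submodD[OF S(1) A]
  define F where "F = {colon_ideal R W A z | z. z \<in> carrier W \<and> colon_ideal R W A z \<subseteq> Q}"
  \<comment> \<open>Otherwise every element of \<open>W\<close> is moved into \<open>A\<close> by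
    some ring element outside \<open>Q\<close>. The product of such elements over the finitely many
    generators is outside \<open>Q\<close>, as \<open>Q\<close> is prime, but annihilates W /
    A.\<close>
  have "F \<noteq> {}"
  proof
    assume "F = {}"
    then have "\<forall>z\<in>carrier W. \<exists>s\<in>carrier R. s \<notin> Q \<and> s \<odot>\<^bsub>W\<^esub> z \<in> A" unfolding F_def colon_ideal_def by auto
    then obtain c where c: "\<And>z. z \<in> carrier W \<Longrightarrow> c z \<in> carrier R \<and> c z \<notin> Q \<and> c z \<odot>\<^bsub>W\<^esub> z \<in> A" by metis
    have "\<exists>s\<in>carrier R. s \<notin> Q \<and> (\<forall>z\<in>S. s \<odot>\<^bsub>W\<^esub> z \<in> A)" using S(3,2)
    proof (induction S rule: finite_induct)
      case empty then show ?case using n1 by (intro bexI[of _ \<one>]) auto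
    next
      case (insert x T)
      then obtain s where s: "s \<in> carrier R" "s \<notin> Q" "\<forall>z\<in>T. s \<odot>\<^bsub>W\<^esub> z \<in> A" by auto
      have cx: "c x \<in> carrier R" "c x \<notin> Q" "c x \<odot>\<^bsub>W\<^esub> x \<in> A" using c[of x] insert.prems by auto
      show ?case
      proof (intro bexI[of _ "s \<otimes> c x"] conjI ballI)
        show "s \<otimes> c x \<notin> Q" using Qp[OF s(1) cx(1)] s cx by metis
        fix z assume z: "z \<in> insert x T"
        then have zW: "z \<in> carrier W" using insert.prems by auto
        have e: "(s \<otimes> c x) \<odot>\<^bsub>W\<^esub> z = s \<odot>\<^bsub>W\<^esub> (c x \<odot>\<^bsub>W\<^esub> z)" "(s \<otimes> c x) \<odot>\<^bsub>W\<^esub> z = c x \<odot>\<^bsub>W\<^esub> (s \<odot>\<^bsub>W\<^esub> z)"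
          using s cx zW by (simp_all add: W.smult_assoc1[symmetric] m_comm)
        show "(s \<otimes> c x) \<odot>\<^bsub>W\<^esub> z \<in> A"
          using z cx s AD(7) e by (cases "z = x") (metis, metis insert_iff)
      qed (use s cx in auto)
    qed
    then obtain s where s: "s \<in> carrier R" "s \<notin> Q" "\<forall>z\<in>S. s \<odot>\<^bsub>W\<^esub> z \<in> A" by metis
    have "mspan R W S \<subseteq> {x \<in> carrier W. s \<odot>\<^bsub>W\<^esub> x \<in> A}"
      by (intro mspan_least submod_vimage[OF S(1) S(1) hom_smult_id A] S(1) s(1)) (use s S(2) in auto)
    then have "s \<in> ann_quot R W A" using s S(4) by (auto simp: ann_quot_def)
    then show False using s Q(3) by auto
  qed
  moreover have "ideal I R" if "I \<in> F" for I using that ideal_colon_ideal[OF S(1) A] by (auto simp: F_def)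
  ultimately obtain P where "P \<in> F" and Pmax: "\<And>J. J \<in> F \<Longrightarrow> P \<subseteq> J \<Longrightarrow> J = P" using ideal_maximal[of F] by metis
  then obtain z where z: "z \<in> carrier W" "P = colon_ideal R W A z" "P \<subseteq> Q" unfolding F_def by auto
  have P: "ideal P R" unfolding z(2) by (rule ideal_colon_ideal[OF S(1) A z(1)])
  have zA: "z \<notin> A"
  proof
    assume "z \<in> A"
    then have "\<one> \<in> P" using z(1) by (simp add: z(2) colon_ideal_def)
    then show False using z(3) n1 by auto
  qed
  have "primeideal P R"
  proof (rule primeidealI)
    show "carrier R \<noteq> P" using z(3) n1 by auto
    fix a b assume ab: "a \<in> carrier R" "b \<in> carrier R" "a \<otimes> b \<in> P"
    show "a \<in> P \<or> b \<in> P"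
    proof (rule disjCI)
      assume b: "b \<notin> P"
      have abz: "a \<odot>\<^bsub>W\<^esub> (b \<odot>\<^bsub>W\<^esub> z) \<in> A" using ab z W.smult_assoc1 by (auto simp: colon_ideal_def)
      have sub: "P \<subseteq> colon_ideal R W A (c \<odot>\<^bsub>W\<^esub> z)" if c: "c \<in> carrier R" for c
      proof
        fix r assume r: "r \<in> P"
        then have rr: "r \<in> carrier R" "r \<odot>\<^bsub>W\<^esub> z \<in> A" by (auto simp: z(2) colon_ideal_def)
        have "r \<odot>\<^bsub>W\<^esub> (c \<odot>\<^bsub>W\<^esub> z) = c \<odot>\<^bsub>W\<^esub> (r \<odot>\<^bsub>W\<^esub> z)" using rr c z(1) by (simp add: W.smult_assoc1[symmetric] m_comm)
        then show "r \<in> colon_ideal R W A (c \<odot>\<^bsub>W\<^esub> z)" using AD(7)[OF c rr(2)] rr(1) by (simp add: colon_ideal_def)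
      qed
      show "a \<in> P"
      proof (cases "colon_ideal R W A (b \<odot>\<^bsub>W\<^esub> z) \<subseteq> Q")
        case True
        then have "colon_ideal R W A (b \<odot>\<^bsub>W\<^esub> z) = P" using sub[OF ab(2)] z(1) ab(2)
          by (intro Pmax) (auto simp: F_def)
        then show ?thesis using abz ab by (auto simp: colon_ideal_def)
      next
        \<comment> \<open>Now some \<open>s\<close> outside \<open>Q\<close> moves
          \<open>b z\<close> into \<open>A\<close>. The element \<open>s z\<close> replaces
          \<open>z\<close>: its colon ideal is still contained in \<open>Q\<close>, hence equals
          \<open>P\<close> by maximality, and it contains \<open>b\<close>.\<close>
        case False
        then obtain s where s: "s \<in> carrier R" "s \<odot>\<^bsub>W\<^esub> (b \<odot>\<^bsub>W\<^esub> z) \<in> A" "s \<notin> Q" by (auto simp: colon_ideal_def)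
        have "colon_ideal R W A (s \<odot>\<^bsub>W\<^esub> z) \<subseteq> Q"
        proof
          fix t assume t: "t \<in> colon_ideal R W A (s \<odot>\<^bsub>W\<^esub> z)"
          then have tt: "t \<in> carrier R" "(t \<otimes> s) \<odot>\<^bsub>W\<^esub> z \<in> A" using s z(1) by (auto simp: colon_ideal_def W.smult_assoc1)
          then have "t \<otimes> s \<in> P" using s by (simp add: z(2) colon_ideal_def)
          then show "t \<in> Q" using z(3) Qp[OF tt(1) s(1)] s(3) by auto
        qed
        then have "colon_ideal R W A (s \<odot>\<^bsub>W\<^esub> z) = P" using sub[OF s(1)] z(1) s(1)
          by (intro Pmax) (auto simp: F_def)
        moreover have "b \<in> colon_ideal R W A (s \<odot>\<^bsub>W\<^esub> z)"
        proof -
          have "b \<odot>\<^bsub>W\<^esub> (s \<odot>\<^bsub>W\<^esub> z) = s \<odot>\<^bsub>W\<^esub> (b \<odot>\<^bsub>W\<^esub> z)" using s(1) ab(2) z(1)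
            by (simp add: W.smult_assoc1[symmetric] m_comm)
          then show ?thesis using s(2) ab(2) by (simp add: colon_ideal_def)
        qed
        ultimately show ?thesis using b by simp
      qed
    qed
  qed (rule P, rule is_cring)
  \<comment> \<open>Multiplication by \<open>y\<close> is injective on W / A, so \<open>y\<close>
    cannot kill the nonzero class of \<open>z\<close>.\<close>
  moreover have "y \<notin> P" using y[OF z(1)] zA by (auto simp: z(2) colon_ideal_def)
  moreover have "ann_quot R W A \<subseteq> P" using z(1) by (auto simp: z(2) colon_ideal_def ann_quot_def)
  ultimately show ?thesis using z(3) by (intro exI[of _ P]) simp
qed

text \<open>A colon ideal that is maximal among those of elements outside \<open>A\<close> is an
  associated prime of W / A. It contains the annihilator, so by hypothesis it is the maximal ideal,
  and the element that defines it lies in the socle of W / A.\<close>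

lemma socle_exists:
  assumes W: "module R W" and A: "submodule A R W" "A \<noteq> carrier W"
    and Q: "\<And>Q. primeideal Q R \<Longrightarrow> ann_quot R W A \<subseteq> Q \<Longrightarrow> Q = \<mm>"
  shows "\<exists>z\<in>carrier W. z \<notin> A \<and> (\<forall>a\<in>\<mm>. a \<odot>\<^bsub>W\<^esub> z \<in> A)"
proof -
  interpret W: module R W by (rule W)
  note AD = submodD[OF W A(1)]
  define F where "F = {colon_ideal R W A z | z. z \<in> carrier W \<and> z \<notin> A}"
  have "F \<noteq> {}" using A(2) AD(1) by (auto simp: F_def)
  moreover have "ideal I R" if "I \<in> F" for I using that ideal_colon_ideal[OF W A(1)] by (auto simp: F_def)
  ultimately obtain P where "P \<in> F" and Pmax: "\<And>J. J \<in> F \<Longrightarrow> P \<subseteq> J \<Longrightarrow> J = P" using ideal_maximal[of F] by metis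
  then obtain z where z: "z \<in> carrier W" "P = colon_ideal R W A z" "z \<notin> A" unfolding F_def by auto
  have P: "ideal P R" unfolding z(2) by (rule ideal_colon_ideal[OF W A(1) z(1)])
  have "primeideal P R"
  proof (rule primeidealI)
    have "\<one> \<notin> P" using z(1,3) by (simp add: z(2) colon_ideal_def)
    then show "carrier R \<noteq> P" by auto
    fix a b assume ab: "a \<in> carrier R" "b \<in> carrier R" "a \<otimes> b \<in> P"
    show "a \<in> P \<or> b \<in> P"
    proof (rule disjCI)
      assume b: "b \<notin> P"
      have abz: "a \<odot>\<^bsub>W\<^esub> (b \<odot>\<^bsub>W\<^esub> z) \<in> A" using ab z W.smult_assoc1 by (auto simp: colon_ideal_def)
      have bz: "b \<odot>\<^bsub>W\<^esub> z \<in> carrier W" "b \<odot>\<^bsub>W\<^esub> z \<notin> A" using b ab z by (auto simp: colon_ideal_def)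
      have "P \<subseteq> colon_ideal R W A (b \<odot>\<^bsub>W\<^esub> z)"
      proof
        fix r assume r: "r \<in> P"
        then have rr: "r \<in> carrier R" "r \<odot>\<^bsub>W\<^esub> z \<in> A" by (auto simp: z(2) colon_ideal_def)
        have "r \<odot>\<^bsub>W\<^esub> (b \<odot>\<^bsub>W\<^esub> z) = b \<odot>\<^bsub>W\<^esub> (r \<odot>\<^bsub>W\<^esub> z)" using rr ab z(1) by (simp add: W.smult_assoc1[symmetric] m_comm)
        then show "r \<in> colon_ideal R W A (b \<odot>\<^bsub>W\<^esub> z)" using AD(7)[OF ab(2) rr(2)] rr(1) by (simp add: colon_ideal_def)
      qed
      then have "colon_ideal R W A (b \<odot>\<^bsub>W\<^esub> z) = P" using bz by (intro Pmax) (auto simp: F_def)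
      then show "a \<in> P" using abz ab by (auto simp: colon_ideal_def)
    qed
  qed (rule P, rule is_cring)
  moreover have "ann_quot R W A \<subseteq> P" using z(1) by (auto simp: z(2) colon_ideal_def ann_quot_def)
  ultimately have "P = \<mm>" by (rule Q)
  then show ?thesis using z by (intro bexI[of _ z]) (auto simp: colon_ideal_def)
qed

end

section \<open>Regular sequences\<close>

text \<open>For the submodules \<open>A i = A 0 + (y 0, \<dots>, y (i - 1)) W\<close> this says that \<open>y 0, \<dots>, y (n - 1)\<close> is weakly
  regular on \<open>W / A 0\<close>. Here and below a quotient is replaced by a pair of a module and a submodule.\<close>

definition regular_chain :: "('a,'r) ring_scheme \<Rightarrow> ('a,'b,'m) module_scheme \<Rightarrow> (nat \<Rightarrow> 'a) \<Rightarrow> (nat \<Rightarrow> 'b set) \<Rightarrow> nat \<Rightarrow> bool" where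
  "regular_chain R W y A n \<longleftrightarrow> (\<forall>i\<le>n. submodule (A i) R W) \<and>
    (\<forall>i<n. y i \<in> max_ideal R \<and> (\<forall>w\<in>carrier W. y i \<odot>\<^bsub>W\<^esub> w \<in> A i \<longrightarrow> w \<in> A i) \<and>
       A (Suc i) = msum W (A i) ((\<lambda>w. y i \<odot>\<^bsub>W\<^esub> w) ` carrier W))"

lemma module_zero_closed: "module R M \<Longrightarrow> \<zero>\<^bsub>M\<^esub> \<in> carrier M"
  by (simp add: abelian_group.axioms(1) abelian_monoid.zero_closed module.axioms(2))

lemma regular_chain_Suc: "regular_chain R W y A (Suc n) \<Longrightarrow> regular_chain R W y A n"
  by (auto simp: regular_chain_def)

lemma set_smult_submod: assumes "module R W" "S \<subseteq> carrier R" shows "submodule (set_smult R W S) R W"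
proof (rule submodI[OF assms(1)])
  interpret W: module R W by (rule assms)
  show "set_smult R W S \<subseteq> carrier W" unfolding set_smult_def
    using submod_carrier[OF assms(1)] assms(2) by (intro Inter_lower) auto
qed (auto simp: set_smult_def submodD[OF assms(1)])

lemma set_smult_empty: assumes "module R W" shows "set_smult R W {} = {\<zero>\<^bsub>W\<^esub>}"
  using submod_zero[OF assms] submodD(2)[OF assms set_smult_submod[OF assms, of "{}", simplified]]
  unfolding set_smult_def by auto

lemma set_smult_insert:
  assumes "module R W" "a \<in> carrier R" "S \<subseteq> carrier R"
  shows "set_smult R W (insert a S) = msum W (set_smult R W S) ((\<lambda>w. a \<odot>\<^bsub>W\<^esub> w) ` carrier W)" (is "?L = ?R")
proof
  interpret W: module R W by (rule assms)
  have sa: "submodule ((\<lambda>w. a \<odot>\<^bsub>W\<^esub> w) ` carrier W) R W"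
    by (rule W.submod_smult_all[OF assms(1,2)])
  note ss = set_smult_submod[OF assms(1,3)]
  note sup = msum_superset[OF assms(1) ss sa]
  have "b \<odot>\<^bsub>W\<^esub> x \<in> set_smult R W S" if "b \<in> S" "x \<in> carrier W" for b x using that unfolding set_smult_def by auto
  then have "\<forall>b\<in>insert a S. \<forall>x\<in>carrier W. b \<odot>\<^bsub>W\<^esub> x \<in> ?R" using sup by blast
  then show "?L \<subseteq> ?R" unfolding set_smult_def[of R W "insert a S"]
    using submod_msum[OF assms(1) ss sa] by (intro Inter_lower) simp
  have "set_smult R W S \<subseteq> ?L" "(\<lambda>w. a \<odot>\<^bsub>W\<^esub> w) ` carrier W \<subseteq> ?L" unfolding set_smult_def by auto
  then show "?R \<subseteq> ?L" by (intro msum_least[OF assms(1)] set_smult_submod) (use assms in auto)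
qed

text \<open>The successor matters: the supremum of the empty set is 0, so a supremum equal to 0 need
  not be attained.\<close>

lemma Sup_enat_attained:
  assumes "Sup (V :: enat set) = enat (Suc e)" shows "enat (Suc e) \<in> V"
proof (rule ccontr)
  assume *: "enat (Suc e) \<notin> V"
  have "x \<le> enat e" if "x \<in> V" for x
  proof -
    have "x \<le> enat (Suc e)" using Sup_upper[OF that] assms by simp
    then obtain k where "x = enat k" using enat_ile by blast
    then show ?thesis using \<open>x \<le> enat (Suc e)\<close> * that by (cases "k = Suc e") auto
  qed
  then have "Sup V \<le> enat e" by (rule Sup_least)
  then show False using assms by simp
qed

context noetherian_local_ring begin

text \<open>The passage from \<open>depth\<close>, a supremum over lists that are regular on
  quotient modules, to a chain of submodules of \<open>W\<close>. For \<open>d\<close> = 0 no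
  regular sequence is extracted; the empty chain serves, because \<open>W\<close> is
  nonzero.\<close>

lemma depth_imp_regular_chain:
  assumes W: "module R W" "\<not> zero_module W" "depth R W = enat d"
  shows "\<exists>y A. regular_chain R W y A d \<and> A 0 = {\<zero>\<^bsub>W\<^esub>} \<and> A d \<noteq> carrier W"
proof (cases d)
  case 0
  have "regular_chain R W y (\<lambda>_. {\<zero>\<^bsub>W\<^esub>}) 0" for y using submod_zero[OF W(1)] by (auto simp: regular_chain_def)
  then show ?thesis using 0 W(2) unfolding zero_module_def by auto
next
  case (Suc e)
  then obtain xs where xs: "set xs \<subseteq> \<mm>" "regular_sequence R W xs" "length xs = d"
    using Sup_enat_attained[of _ e] W(3) unfolding depth_def by fastforce
  define A where "A i = set_smult R W (set (take i xs))" for i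
  have tk: "set (take i xs) \<subseteq> carrier R" for i using xs(1) max_carr set_take_subset[of i xs] by auto
  have sA: "submodule (A i) R W" for i unfolding A_def by (rule set_smult_submod[OF W(1) tk])
  interpret W: module R W by (rule W(1))
  have "regular_chain R W (\<lambda>i. xs ! i) A d" unfolding regular_chain_def
  proof (intro conjI allI impI ballI)
    fix i assume i: "i < d"
    then show xm: "xs ! i \<in> \<mm>" using xs by auto
    then have xc: "xs ! i \<in> carrier R" by (rule max_carr)
    have "take (Suc i) xs = take i xs @ [xs ! i]" using i xs(3) by (simp add: take_Suc_conv_app_nth)
    then have "set (take (Suc i) xs) = insert (xs ! i) (set (take i xs))" by simp
    then show "A (Suc i) = msum W (A i) ((\<lambda>w. xs ! i \<odot>\<^bsub>W\<^esub> w) ` carrier W)"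
      unfolding A_def using set_smult_insert[OF W(1) xc tk] by simp
    fix w assume w: "w \<in> carrier W" "xs ! i \<odot>\<^bsub>W\<^esub> w \<in> A i"
    have h: "(\<lambda>w. A i +>\<^bsub>W\<^esub> w) \<in> mod_hom R W (quot_module W (A i))" by (rule quot_coset_hom[OF W(1) sA])
    have reg: "regular_on (quot_module W (A i)) (xs ! i)" using xs(2,3) i by (auto simp: regular_sequence_def A_def)
    have "xs ! i \<odot>\<^bsub>quot_module W (A i)\<^esub> (A i +>\<^bsub>W\<^esub> w) = \<zero>\<^bsub>quot_module W (A i)\<^esub>"
      using hom_smult[OF h xc w(1)] quot_coset_zero_iff[OF W(1) sA[of i], of "xs ! i \<odot>\<^bsub>W\<^esub> w"] w xc by simp
    then have "A i +>\<^bsub>W\<^esub> w = \<zero>\<^bsub>quot_module W (A i)\<^esub>"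
      using reg hom_closed[OF h w(1)] unfolding regular_on_def by simp
    then show "w \<in> A i" using quot_coset_zero_iff[OF W(1) sA w(1)] by simp
  qed (rule sA)
  moreover have "A 0 = {\<zero>\<^bsub>W\<^esub>}" using set_smult_empty[OF W(1)] by (simp add: A_def)
  moreover have "A d \<noteq> carrier W"
  proof
    assume eq: "A d = carrier W"
    have "\<not> zero_module (quot_module W (A d))" using xs(2,3) by (simp add: regular_sequence_def A_def)
    moreover have "C = \<zero>\<^bsub>quot_module W (A d)\<^esub>" if "C \<in> carrier (quot_module W (A d))" for C
      using that quot_coset_zero_iff[OF W(1) sA, of _ d] eq unfolding quot_carrier by auto
    moreover have "\<zero>\<^bsub>quot_module W (A d)\<^esub> \<in> carrier (quot_module W (A d))"
      by (rule module_zero_closed[OF module_quot[OF W(1) sA]])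
    ultimately show False unfolding zero_module_def by blast
  qed
  ultimately show ?thesis by blast
qed

text \<open>The element \<open>y n\<close> lies in \<open>Q\<close> because it kills W / A(n + 1),
  yet it is a nonzerodivisor on W / A(n). Hence \<open>prime_below\<close> finds a prime strictly
  below \<open>Q\<close>, which serves for the shorter chain. So every regular element costs one
  step in a chain of primes.\<close>

lemma regular_chain_prime_chain:
  assumes "fgm R W" "regular_chain R W y A n" "primeideal Q R" "ann_quot R W (A n) \<subseteq> Q"
  shows "\<exists>p. (\<forall>i\<le>n. primeideal (p i) R) \<and> (\<forall>i<n. p i \<subset> p (Suc i)) \<and> p n = Q"
  using assms(2-4)
proof (induction n arbitrary: Q)
  case 0
  then show ?case by (intro exI[of _ "\<lambda>_. Q"]) auto
next
  case (Suc n)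
  have W: "module R W" using assms(1) by (simp add: fgm_def)
  interpret W: module R W by (rule W)
  have sA: "submodule (A n) R W" and y: "y n \<in> \<mm>" "\<And>w. w \<in> carrier W \<Longrightarrow> y n \<odot>\<^bsub>W\<^esub> w \<in> A n \<Longrightarrow> w \<in> A n" and
    A: "A (Suc n) = msum W (A n) ((\<lambda>w. y n \<odot>\<^bsub>W\<^esub> w) ` carrier W)" using Suc.prems(1) by (auto simp: regular_chain_def)
  have sup: "A n \<subseteq> A (Suc n)" "(\<lambda>w. y n \<odot>\<^bsub>W\<^esub> w) ` carrier W \<subseteq> A (Suc n)" unfolding A
    using msum_superset[OF W sA submod_smult_all[OF W max_carr[OF y(1)]]] by auto
  have yQ: "y n \<in> Q" using sup(2) Suc.prems(3) max_carr[OF y(1)] by (auto simp: ann_quot_def)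
  have "ann_quot R W (A n) \<subseteq> Q" using Suc.prems(3) sup(1) by (auto simp: ann_quot_def)
  from prime_below[OF assms(1) sA y(2) Suc.prems(2) yQ this] obtain P
    where P: "primeideal P R" "P \<subseteq> Q" "y n \<notin> P" "ann_quot R W (A n) \<subseteq> P" by auto
  from Suc.IH[OF regular_chain_Suc[OF Suc.prems(1)] P(1,4)] obtain p where
    p: "\<forall>i\<le>n. primeideal (p i) R" "\<forall>i<n. p i \<subset> p (Suc i)" "p n = P" by auto
  have "P \<subset> Q" using P yQ by auto
  then show ?case using p Suc.prems(2) by (intro exI[of _ "p(Suc n := Q)"]) (auto simp: less_Suc_eq le_Suc_eq)
qed

text \<open>A prime strictly below \<mm> would end a chain of length \<open>d\<close> that \<mm>
  prolongs to length \<open>d\<close> + 1. So after dividing by a regular sequence of the full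
  length \<open>d\<close>, only \<mm> is left in the support.\<close>

lemma regular_chain_prime_eq_max:
  assumes "fgm R W" "regular_chain R W y A d" "krull_dim R = enat d" "primeideal Q R" "ann_quot R W (A d) \<subseteq> Q"
  shows "Q = \<mm>"
proof (rule ccontr)
  assume "Q \<noteq> \<mm>"
  moreover have "Q \<subseteq> \<mm>" using assms(4) ideal_le_max[of Q] primeideal.I_notcarr[OF assms(4)]
    by (auto simp: primeideal_def)
  ultimately have lt: "Q \<subset> \<mm>" by auto
  obtain p where p: "\<forall>i\<le>d. primeideal (p i) R" "\<forall>i<d. p i \<subset> p (Suc i)" "p d = Q"
    using regular_chain_prime_chain[OF assms(1,2,4,5)] by auto
  have "(\<forall>i\<le>Suc d. primeideal ((p(Suc d := \<mm>)) i) R) \<and> (\<forall>i<Suc d. (p(Suc d := \<mm>)) i \<subset> (p(Suc d := \<mm>)) (Suc i))"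
    using p lt prime_max by (auto simp: less_Suc_eq le_Suc_eq)
  then have "enat (Suc d) \<le> krull_dim R" unfolding krull_dim_def by (intro Sup_upper) blast
  then show False using assms(3) by simp
qed

lemma regular_chain_socle:
  assumes "fgm R W" "regular_chain R W y A d" "krull_dim R = enat d" "A d \<noteq> carrier W"
  shows "\<exists>z\<in>carrier W. z \<notin> A d \<and> (\<forall>a\<in>\<mm>. a \<odot>\<^bsub>W\<^esub> z \<in> A d)"
proof (rule socle_exists)
  show "module R W" "submodule (A d) R W" using assms by (auto simp: fgm_def regular_chain_def)
  show "Q = \<mm>" if "primeideal Q R" "ann_quot R W (A d) \<subseteq> Q" for Q by (rule regular_chain_prime_eq_max[OF assms(1-3) that])
qed (rule assms(4))

end

section \<open>Free modules of finitely supported functions\<close>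

definition fin_mod :: "('a,'r) ring_scheme \<Rightarrow> 'x set \<Rightarrow> ('a, 'x \<Rightarrow> 'a) module" where
  "fin_mod R S = \<lparr>carrier = {f. (\<forall>x\<in>S. f x \<in> carrier R) \<and> (\<forall>x. x \<notin> S \<longrightarrow> f x = \<zero>\<^bsub>R\<^esub>) \<and> finite {x. f x \<noteq> \<zero>\<^bsub>R\<^esub>}},
     monoid.mult = undefined, one = undefined, ring.zero = (\<lambda>_. \<zero>\<^bsub>R\<^esub>),
     ring.add = (\<lambda>f g x. f x \<oplus>\<^bsub>R\<^esub> g x), module.smult = (\<lambda>a f x. a \<otimes>\<^bsub>R\<^esub> f x)\<rparr>"

definition fin_unit :: "('a,'r) ring_scheme \<Rightarrow> 'x \<Rightarrow> 'x \<Rightarrow> 'a" where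
  "fin_unit R x = (\<lambda>y. if y = x then \<one>\<^bsub>R\<^esub> else \<zero>\<^bsub>R\<^esub>)"

text \<open>The linear map that sends the unit vector at \<open>x\<close> to \<open>w x\<close>.
  Summing over the support keeps the index set out of the formula and allows it to be infinite, as
  it is for the free module on all elements of a module.\<close>

definition lin_ext :: "('a,'r) ring_scheme \<Rightarrow> ('a,'b,'m) module_scheme \<Rightarrow> ('x \<Rightarrow> 'b) \<Rightarrow> ('x \<Rightarrow> 'a) \<Rightarrow> 'b" where
  "lin_ext R M w f = (\<Oplus>\<^bsub>M\<^esub>x\<in>{x. f x \<noteq> \<zero>\<^bsub>R\<^esub>}. f x \<odot>\<^bsub>M\<^esub> w x)"

lemma fin_mod_simps:
  "\<zero>\<^bsub>fin_mod R S\<^esub> = (\<lambda>_. \<zero>\<^bsub>R\<^esub>)" "f \<oplus>\<^bsub>fin_mod R S\<^esub> g = (\<lambda>x. f x \<oplus>\<^bsub>R\<^esub> g x)" "a \<odot>\<^bsub>fin_mod R S\<^esub> f = (\<lambda>x. a \<otimes>\<^bsub>R\<^esub> f x)"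
  by (simp_all add: fin_mod_def)

context cring begin

lemma fin_mod_carrier:
  "f \<in> carrier (fin_mod R S) \<longleftrightarrow> (\<forall>x\<in>S. f x \<in> carrier R) \<and> (\<forall>x. x \<notin> S \<longrightarrow> f x = \<zero>) \<and> finite {x. f x \<noteq> \<zero>}"
  by (simp add: fin_mod_def)

lemma fin_mod_val: "f \<in> carrier (fin_mod R S) \<Longrightarrow> f x \<in> carrier R"
  by (cases "x \<in> S") (auto simp: fin_mod_carrier)

lemma fin_mod_supp: "f \<in> carrier (fin_mod R S) \<Longrightarrow> finite {x. f x \<noteq> \<zero>}" "f \<in> carrier (fin_mod R S) \<Longrightarrow> {x. f x \<noteq> \<zero>} \<subseteq> S"
  by (auto simp: fin_mod_carrier)

lemma fin_mod_add: "f \<in> carrier (fin_mod R S) \<Longrightarrow> g \<in> carrier (fin_mod R S) \<Longrightarrow> (\<lambda>x. f x \<oplus> g x) \<in> carrier (fin_mod R S)"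
  unfolding fin_mod_carrier
  by (auto intro!: rev_finite_subset[of "{x. f x \<noteq> \<zero>} \<union> {x. g x \<noteq> \<zero>}" "{x. f x \<oplus> g x \<noteq> \<zero>}"])

lemma fin_mod_smult: "a \<in> carrier R \<Longrightarrow> f \<in> carrier (fin_mod R S) \<Longrightarrow> (\<lambda>x. a \<otimes> f x) \<in> carrier (fin_mod R S)"
  unfolding fin_mod_carrier
  by (auto intro!: rev_finite_subset[of "{x. f x \<noteq> \<zero>}" "{x. a \<otimes> f x \<noteq> \<zero>}"])

lemma module_fin_mod: "module R (fin_mod R S)"
proof (rule moduleI)
  show "abelian_group (fin_mod R S)"
  proof (rule abelian_groupI)
    fix f assume f: "f \<in> carrier (fin_mod R S)"
    have "(\<lambda>x. (\<ominus> \<one>) \<otimes> f x) \<in> carrier (fin_mod R S)" by (rule fin_mod_smult) (use f in auto)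
    moreover have "(\<ominus> \<one>) \<otimes> f x \<oplus> f x = \<zero>" for x using fin_mod_val[OF f] by (simp add: l_minus l_neg)
    ultimately show "\<exists>g\<in>carrier (fin_mod R S). g \<oplus>\<^bsub>fin_mod R S\<^esub> f = \<zero>\<^bsub>fin_mod R S\<^esub>"
      unfolding fin_mod_simps by (intro bexI[of _ "\<lambda>x. (\<ominus> \<one>) \<otimes> f x"]) auto
  next
    show "\<zero>\<^bsub>fin_mod R S\<^esub> \<in> carrier (fin_mod R S)" by (simp add: fin_mod_simps fin_mod_carrier)
  next
    fix f g assume f: "f \<in> carrier (fin_mod R S)" "g \<in> carrier (fin_mod R S)"
    then show "f \<oplus>\<^bsub>fin_mod R S\<^esub> g = g \<oplus>\<^bsub>fin_mod R S\<^esub> f" using fin_mod_val[of f S] fin_mod_val[of g S] by (simp add: fin_mod_simps a_comm)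
    show "f \<oplus>\<^bsub>fin_mod R S\<^esub> g \<in> carrier (fin_mod R S)" using f by (simp add: fin_mod_simps fin_mod_add)
    fix h assume h: "h \<in> carrier (fin_mod R S)"
    show "f \<oplus>\<^bsub>fin_mod R S\<^esub> g \<oplus>\<^bsub>fin_mod R S\<^esub> h = f \<oplus>\<^bsub>fin_mod R S\<^esub> (g \<oplus>\<^bsub>fin_mod R S\<^esub> h)"
      using f h fin_mod_val[of _ S] by (simp add: fin_mod_simps a_assoc)
  next
    fix f assume f: "f \<in> carrier (fin_mod R S)"
    then show "\<zero>\<^bsub>fin_mod R S\<^esub> \<oplus>\<^bsub>fin_mod R S\<^esub> f = f" using fin_mod_val[of _ S] by (simp add: fin_mod_simps)
  qed
qed (auto simp: is_cring fin_mod_simps fin_mod_smult l_distr r_distr m_assoc fin_mod_val)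

lemma fin_unit_carrier: "x \<in> S \<Longrightarrow> fin_unit R x \<in> carrier (fin_mod R S)"
  by (auto simp: fin_mod_carrier fin_unit_def intro!: rev_finite_subset[of "{x}" "{y. (y = x \<longrightarrow> \<one> \<noteq> \<zero>) \<and> y = x}"])

text \<open>Zero coefficients contribute nothing, so several functions can be summed over one common
  finite set.\<close>

lemma lin_ext_alt:
  assumes "module R M" "f \<in> carrier (fin_mod R S)" "w \<in> S \<rightarrow> carrier M" "finite A" "A \<subseteq> S" "{x. f x \<noteq> \<zero>} \<subseteq> A"
  shows "lin_ext R M w f = (\<Oplus>\<^bsub>M\<^esub>x\<in>A. f x \<odot>\<^bsub>M\<^esub> w x)"
proof -
  interpret M: module R M by fact
  show ?thesis unfolding lin_ext_def
    by (rule M.add.finprod_mono_neutral_cong_left)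
       (use assms fin_mod_val[OF assms(2)] in \<open>auto simp: Pi_def subset_iff\<close>)
qed

lemma lin_ext_hom:
  assumes M: "module R M" and w: "w \<in> S \<rightarrow> carrier M"
  shows "lin_ext R M w \<in> mod_hom R (fin_mod R S) M"
proof (rule mod_homI)
  interpret M: module R M by fact
  note v = fin_mod_val
  fix f assume f: "f \<in> carrier (fin_mod R S)"
  have wf: "w x \<in> carrier M" if "x \<in> {x. f x \<noteq> \<zero>}" for x using that w fin_mod_supp(2)[OF f] by auto
  then show "lin_ext R M w f \<in> carrier M" unfolding lin_ext_def
    using v[OF f] by (intro M.finsum_closed) auto
  show "lin_ext R M w (f \<oplus>\<^bsub>fin_mod R S\<^esub> g) = lin_ext R M w f \<oplus>\<^bsub>M\<^esub> lin_ext R M w g" if g: "g \<in> carrier (fin_mod R S)" for g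
  proof -
    let ?A = "{x. f x \<noteq> \<zero>} \<union> {x. g x \<noteq> \<zero>}"
    have A: "finite ?A" "?A \<subseteq> S" using fin_mod_supp[OF f] fin_mod_supp[OF g] by auto
    have wA: "f x \<noteq> \<zero> \<Longrightarrow> w x \<in> carrier M" "g x \<noteq> \<zero> \<Longrightarrow> w x \<in> carrier M" for x using w A(2) by auto
    have "lin_ext R M w (f \<oplus>\<^bsub>fin_mod R S\<^esub> g) = (\<Oplus>\<^bsub>M\<^esub>x\<in>?A. (f x \<oplus> g x) \<odot>\<^bsub>M\<^esub> w x)"
      unfolding fin_mod_simps by (rule lin_ext_alt[OF M fin_mod_add[OF f g] w A]) auto
    also have "\<dots> = (\<Oplus>\<^bsub>M\<^esub>x\<in>?A. f x \<odot>\<^bsub>M\<^esub> w x \<oplus>\<^bsub>M\<^esub> g x \<odot>\<^bsub>M\<^esub> w x)"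
      by (rule M.finsum_cong') (use v[OF f] v[OF g] wA in \<open>auto simp: M.smult_l_distr\<close>)
    also have "\<dots> = (\<Oplus>\<^bsub>M\<^esub>x\<in>?A. f x \<odot>\<^bsub>M\<^esub> w x) \<oplus>\<^bsub>M\<^esub> (\<Oplus>\<^bsub>M\<^esub>x\<in>?A. g x \<odot>\<^bsub>M\<^esub> w x)"
      by (rule M.finsum_addf) (use v[OF f] v[OF g] wA in auto)
    also have "\<dots> = lin_ext R M w f \<oplus>\<^bsub>M\<^esub> lin_ext R M w g"
      using lin_ext_alt[OF M f w A] lin_ext_alt[OF M g w A] by auto
    finally show ?thesis .
  qed
  show "lin_ext R M w (a \<odot>\<^bsub>fin_mod R S\<^esub> f) = a \<odot>\<^bsub>M\<^esub> lin_ext R M w f" if a: "a \<in> carrier R" for a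
  proof -
    let ?A = "{x. f x \<noteq> \<zero>}"
    have A: "finite ?A" "?A \<subseteq> S" using fin_mod_supp[OF f] by auto
    have "lin_ext R M w (a \<odot>\<^bsub>fin_mod R S\<^esub> f) = (\<Oplus>\<^bsub>M\<^esub>x\<in>?A. (a \<otimes> f x) \<odot>\<^bsub>M\<^esub> w x)"
      unfolding fin_mod_simps by (rule lin_ext_alt[OF M fin_mod_smult[OF a f] w A]) (use a in auto)
    also have "\<dots> = (\<Oplus>\<^bsub>M\<^esub>x\<in>?A. a \<odot>\<^bsub>M\<^esub> (f x \<odot>\<^bsub>M\<^esub> w x))"
      by (rule M.finsum_cong') (use v[OF f] a wf in \<open>auto simp: M.smult_assoc1\<close>)
    also have "\<dots> = a \<odot>\<^bsub>M\<^esub> lin_ext R M w f" unfolding lin_ext_def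
      by (rule M.finsum_smult_ldistr[symmetric]) (use v[OF f] a wf A in auto)
    finally show ?thesis .
  qed
qed

lemma lin_ext_unit:
  assumes "module R M" "w \<in> S \<rightarrow> carrier M" "x \<in> S"
  shows "lin_ext R M w (fin_unit R x) = w x"
proof -
  interpret M: module R M by fact
  have "lin_ext R M w (fin_unit R x) = (\<Oplus>\<^bsub>M\<^esub>y\<in>{x}. fin_unit R x y \<odot>\<^bsub>M\<^esub> w y)"
    by (rule lin_ext_alt[OF assms(1) fin_unit_carrier[OF assms(3)] assms(2)]) (use assms in \<open>auto simp: fin_unit_def\<close>)
  then show ?thesis using assms by (simp add: fin_unit_def Pi_def)
qed

lemma mspan_fin_unit: "mspan R (fin_mod R S) (fin_unit R ` S) = carrier (fin_mod R S)"
proof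
  have sub: "submodule (mspan R (fin_mod R S) (fin_unit R ` S)) R (fin_mod R S)"
    by (rule mspan_submod[OF module_fin_mod]) (auto intro: fin_unit_carrier)
  note D = submodD[OF module_fin_mod sub, unfolded fin_mod_simps]
  show "mspan R (fin_mod R S) (fin_unit R ` S) \<subseteq> carrier (fin_mod R S)" by (rule D(1))
  have "f \<in> mspan R (fin_mod R S) (fin_unit R ` S)"
    if "finite A" "A \<subseteq> S" "f \<in> carrier (fin_mod R S)" "{x. f x \<noteq> \<zero>} \<subseteq> A" for A f
    using that
  proof (induction A arbitrary: f rule: finite_induct)
    case empty
    then have "f = (\<lambda>_. \<zero>)" by auto
    then show ?case using D(2) by simp
  next
    case (insert a A f)
    have fa: "f a \<in> carrier R" by (rule fin_mod_val[OF insert.prems(2)])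
    have g: "f(a := \<zero>) \<in> carrier (fin_mod R S)"
    proof -
      have "finite {x. (f(a := \<zero>)) x \<noteq> \<zero>}"
        by (rule rev_finite_subset[OF fin_mod_supp(1)[OF insert.prems(2)]]) auto
      then show ?thesis using insert.prems(2) by (auto simp: fin_mod_carrier)
    qed
    have "f(a := \<zero>) \<in> mspan R (fin_mod R S) (fin_unit R ` S)"
      by (rule insert.IH[OF _ g]) (use insert.prems in auto)
    moreover have "(\<lambda>x. f a \<otimes> fin_unit R a x) \<in> mspan R (fin_mod R S) (fin_unit R ` S)"
      using insert.prems(1) by (intro D(7) fa subsetD[OF mspan_superset]) auto
    ultimately have "(\<lambda>x. f a \<otimes> fin_unit R a x \<oplus> (f(a := \<zero>)) x) \<in> mspan R (fin_mod R S) (fin_unit R ` S)"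
      by (intro D(5))
    moreover have "(\<lambda>x. f a \<otimes> fin_unit R a x \<oplus> (f(a := \<zero>)) x) = f"
      using fin_mod_val[OF insert.prems(2)] by (auto simp: fin_unit_def)
    ultimately show ?case by simp
  qed
  note * = this
  show "carrier (fin_mod R S) \<subseteq> mspan R (fin_mod R S) (fin_unit R ` S)"
    by (rule subsetI, rule *[OF fin_mod_supp]) auto
qed

lemma fin_mod_hom_eqI:
  assumes "module R M" "f \<in> mod_hom R (fin_mod R S) M" "g \<in> mod_hom R (fin_mod R S) M"
    "\<And>x. x \<in> S \<Longrightarrow> f (fin_unit R x) = g (fin_unit R x)" "u \<in> carrier (fin_mod R S)"
  shows "f u = g u"
proof (rule hom_eq_on_span[OF module_fin_mod assms(1-3), of "fin_unit R ` S"])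
  show "u \<in> mspan R (fin_mod R S) (fin_unit R ` S)" using assms(5) by (simp add: mspan_fin_unit)
qed (use assms(4) fin_unit_carrier in auto)

text \<open>Preimages are chosen for the values on unit vectors. The condition compares images
  instead of asking that \<open>g\<close> be onto, since exactness of a complex supplies precisely
  such an inclusion.\<close>

lemma fin_mod_lift:
  assumes "module R Y" "module R Z" "f \<in> mod_hom R (fin_mod R S) Z" "g \<in> mod_hom R Y Z"
    "f ` carrier (fin_mod R S) \<subseteq> g ` carrier Y"
  shows "\<exists>h\<in>mod_hom R (fin_mod R S) Y. \<forall>x\<in>carrier (fin_mod R S). g (h x) = f x"
proof -
  have "\<exists>y\<in>carrier Y. g y = f (fin_unit R x)" if "x \<in> S" for x
  proof -
    have "f (fin_unit R x) \<in> g ` carrier Y" using assms(5) fin_unit_carrier[OF that] by auto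
    then obtain y where "y \<in> carrier Y" "f (fin_unit R x) = g y" by (rule imageE)
    then show ?thesis by (intro bexI[of _ y]) simp_all
  qed
  then obtain w where w: "\<And>x. x \<in> S \<Longrightarrow> w x \<in> carrier Y" "\<And>x. x \<in> S \<Longrightarrow> g (w x) = f (fin_unit R x)" by metis
  have w': "w \<in> S \<rightarrow> carrier Y" using w(1) by auto
  note h = lin_ext_hom[OF assms(1) w']
  show ?thesis
  proof (rule bexI[OF _ h], rule ballI)
    fix x assume x: "x \<in> carrier (fin_mod R S)"
    show "g (lin_ext R Y w x) = f x"
      by (rule fin_mod_hom_eqI[OF assms(2) hom_comp[OF h assms(4)] assms(3) _ x])
         (simp_all add: lin_ext_unit[OF assms(1) w'] w(2))
  qed
qed

end

section \<open>Projective and free modules\<close>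

text \<open>The canonical surjection from the free module on the elements of \<open>P\<close> splits. Unlike
  \<open>projective_module\<close>, this does not restrict the types of the modules in the lifting property.\<close>

definition proj_mod :: "('a,'r) ring_scheme \<Rightarrow> ('a,'b,'m) module_scheme \<Rightarrow> bool" where
  "proj_mod R P \<longleftrightarrow> module R P \<and>
     (\<exists>s\<in>mod_hom R P (fin_mod R (carrier P)). \<forall>x\<in>carrier P. lin_ext R P (\<lambda>x. x) (s x) = x)"

lemma is_basis_indep:
  assumes "is_basis R P B" "A \<subseteq> B" "finite A" "c \<in> A \<rightarrow> carrier R" "(\<Oplus>\<^bsub>P\<^esub>a\<in>A. c a \<odot>\<^bsub>P\<^esub> a) = \<zero>\<^bsub>P\<^esub>" "a \<in> A"
  shows "c a = \<zero>\<^bsub>R\<^esub>"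
  using assms unfolding is_basis_def by blast

lemma is_basis_gen:
  assumes "is_basis R P B" "x \<in> carrier P"
  obtains A c where "A \<subseteq> B" "finite A" "c \<in> A \<rightarrow> carrier R" "x = (\<Oplus>\<^bsub>P\<^esub>a\<in>A. c a \<odot>\<^bsub>P\<^esub> a)"
  using assms unfolding is_basis_def by blast

context noetherian_local_ring begin

lemma one_neq_zero: "\<one> \<noteq> \<zero>"
  using one_notin_max additive_subgroup.zero_closed[OF ideal.axioms(1)[OF ideal_max]] by metis

lemma fin_unit_image: "fin_unit R ` S \<subseteq> carrier (fin_mod R S)"
  using fin_unit_carrier by auto

lemma lin_ext_id_hom: "module R P \<Longrightarrow> S \<subseteq> carrier P \<Longrightarrow> lin_ext R P (\<lambda>x. x) \<in> mod_hom R (fin_mod R S) P"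
  by (rule lin_ext_hom) auto

lemma lin_ext_id_surj:
  assumes "module R P" shows "lin_ext R P (\<lambda>x. x) ` carrier (fin_mod R (carrier P)) = carrier P"
proof
  show "lin_ext R P (\<lambda>x. x) ` carrier (fin_mod R (carrier P)) \<subseteq> carrier P"
    using hom_closed[OF lin_ext_id_hom[OF assms order_refl]] by auto
  show "carrier P \<subseteq> lin_ext R P (\<lambda>x. x) ` carrier (fin_mod R (carrier P))"
  proof
    fix x assume x: "x \<in> carrier P"
    have "lin_ext R P (\<lambda>x. x) (fin_unit R x) = x" by (rule lin_ext_unit[OF assms _ x]) auto
    then show "x \<in> lin_ext R P (\<lambda>x. x) ` carrier (fin_mod R (carrier P))"
      using fin_unit_carrier[OF x] by (intro image_eqI[of _ _ "fin_unit R x"]) auto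
  qed
qed

lemma proj_lift:
  assumes P: "proj_mod R P" and "module R Y" "module R Z" "f \<in> mod_hom R P Z" "g \<in> mod_hom R Y Z"
    "f ` carrier P \<subseteq> g ` carrier Y"
  shows "\<exists>h\<in>mod_hom R P Y. \<forall>x\<in>carrier P. g (h x) = f x"
proof -
  obtain s where mP: "module R P" and s: "s \<in> mod_hom R P (fin_mod R (carrier P))" "\<forall>x\<in>carrier P. lin_ext R P (\<lambda>x. x) (s x) = x"
    using P unfolding proj_mod_def by metis
  let ?r = "lin_ext R P (\<lambda>x. x)"
  have r: "?r \<in> mod_hom R (fin_mod R (carrier P)) P" by (rule lin_ext_id_hom[OF mP order_refl])
  have "(\<lambda>x. f (?r x)) ` carrier (fin_mod R (carrier P)) \<subseteq> g ` carrier Y"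
  proof -
    have "f (?r x) \<in> f ` carrier P" if "x \<in> carrier (fin_mod R (carrier P))" for x
      using hom_closed[OF r that] by simp
    then show ?thesis using assms(6) by auto
  qed
  from fin_mod_lift[OF assms(2,3) hom_comp[OF r assms(4)] assms(5) this] obtain h where
    h: "h \<in> mod_hom R (fin_mod R (carrier P)) Y" "\<forall>x\<in>carrier (fin_mod R (carrier P)). g (h x) = f (?r x)" by metis
  show ?thesis
    by (rule bexI[OF _ hom_comp[OF s(1) h(1)]]) (use h(2) s hom_closed[OF s(1)] in simp)
qed

text \<open>The free module on the elements of \<open>P\<close> has exactly the type against which
  \<open>projective_module\<close> tests lifting, so the identity of \<open>P\<close> lifts along
  the canonical surjection.\<close>

lemma projective_imp_proj_mod:
  fixes P :: "('a,'c) module"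
  assumes "projective_module R P" shows "proj_mod R P"
proof -
  have mP: "module R P" using assms by (simp add: projective_module_def)
  have "\<exists>h\<in>mod_hom R P (fin_mod R (carrier P)). \<forall>x\<in>carrier P. lin_ext R P (\<lambda>x. x) (h x) = x"
    using assms module_fin_mod lin_ext_id_hom[OF mP order_refl] hom_id lin_ext_id_surj[OF mP]
    unfolding projective_module_def by metis
  then show ?thesis using mP by (simp add: proj_mod_def)
qed

lemma proj_mod_iso_fin:
  assumes P: "module R P" and F: "F \<in> mod_hom R (fin_mod R S) P" "bij_betw F (carrier (fin_mod R S)) (carrier P)"
  shows "proj_mod R P"
proof -
  have img: "F ` carrier (fin_mod R S) = carrier P" using F(2) by (simp add: bij_betw_def)
  have "\<exists>h\<in>mod_hom R (fin_mod R S) (fin_mod R (carrier P)). \<forall>x\<in>carrier (fin_mod R S). lin_ext R P (\<lambda>x. x) (h x) = F x"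
    by (rule fin_mod_lift[OF module_fin_mod P F(1) lin_ext_id_hom[OF P order_refl]]) (simp add: img lin_ext_id_surj[OF P])
  then obtain h where h: "h \<in> mod_hom R (fin_mod R S) (fin_mod R (carrier P))"
    "\<And>x. x \<in> carrier (fin_mod R S) \<Longrightarrow> lin_ext R P (\<lambda>x. x) (h x) = F x" by metis
  let ?g = "inv_into (carrier (fin_mod R S)) F"
  have g: "?g \<in> mod_hom R P (fin_mod R S)" by (rule hom_inv[OF module_fin_mod P F])
  show ?thesis unfolding proj_mod_def
  proof (intro conjI P bexI[OF _ hom_comp[OF g h(1)]] ballI)
    fix x assume x: "x \<in> carrier P"
    show "lin_ext R P (\<lambda>x. x) (h (?g x)) = x" using h(2)[OF hom_closed[OF g x]] x img by (simp add: f_inv_into_f)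
  qed
qed

lemma proj_fin_mod: "proj_mod R (fin_mod R S)"
  by (rule proj_mod_iso_fin[OF module_fin_mod hom_id[of R]]) (simp add: bij_betw_def)

section \<open>Bases, minimal covers and minimal resolutions\<close>

lemma basis_iso:
  assumes P: "module R P" and B: "is_basis R P B"
  shows "bij_betw (lin_ext R P (\<lambda>x. x)) (carrier (fin_mod R B)) (carrier P)"
proof -
  interpret P: module R P by (rule P)
  have BP: "B \<subseteq> carrier P" using B by (simp add: is_basis_def)
  let ?F = "lin_ext R P (\<lambda>x. x)"
  have F: "?F \<in> mod_hom R (fin_mod R B) P" by (rule lin_ext_id_hom[OF P BP])
  have idB: "(\<lambda>x. x) \<in> B \<rightarrow> carrier P" using BP by auto
  have "inj_on ?F (carrier (fin_mod R B))"
  proof (subst hom_inj_iff[OF module_fin_mod P F], intro ballI impI)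
    fix f assume f: "f \<in> carrier (fin_mod R B)" "?F f = \<zero>\<^bsub>P\<^esub>"
    let ?A = "{x. f x \<noteq> \<zero>}"
    have A: "finite ?A" "?A \<subseteq> B" using fin_mod_supp[OF f(1)] by auto
    have "(\<Oplus>\<^bsub>P\<^esub>a\<in>?A. f a \<odot>\<^bsub>P\<^esub> a) = \<zero>\<^bsub>P\<^esub>" using f(2) by (simp add: lin_ext_def)
    moreover have "f \<in> ?A \<rightarrow> carrier R" using fin_mod_val[OF f(1)] by auto
    ultimately have "f a = \<zero>" if "a \<in> ?A" for a by (intro is_basis_indep[OF B A(2,1) _ _ that])
    then show "f = \<zero>\<^bsub>fin_mod R B\<^esub>" by (auto simp: fin_mod_simps)
  qed
  moreover have "?F ` carrier (fin_mod R B) = carrier P"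
  proof
    show "?F ` carrier (fin_mod R B) \<subseteq> carrier P" using hom_closed[OF F] by auto
    show "carrier P \<subseteq> ?F ` carrier (fin_mod R B)"
    proof
      fix x assume x: "x \<in> carrier P"
      obtain A c where A: "A \<subseteq> B" "finite A" "c \<in> A \<rightarrow> carrier R" "x = (\<Oplus>\<^bsub>P\<^esub>a\<in>A. c a \<odot>\<^bsub>P\<^esub> a)"
        by (rule is_basis_gen[OF B x])
      let ?f = "\<lambda>a. if a \<in> A then c a else \<zero>"
      have "{x. ?f x \<noteq> \<zero>} \<subseteq> A" by auto
      then have f: "?f \<in> carrier (fin_mod R B)" "{x. ?f x \<noteq> \<zero>} \<subseteq> A"
        using A(1,3) finite_subset[OF _ A(2)] by (auto simp: fin_mod_carrier Pi_def)
      have "?F ?f = (\<Oplus>\<^bsub>P\<^esub>a\<in>A. ?f a \<odot>\<^bsub>P\<^esub> a)" by (rule lin_ext_alt[OF P f(1) idB A(2,1) f(2)])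
      also have "\<dots> = x" unfolding A(4)
      proof (rule P.finsum_cong')
        have c: "c a \<in> carrier R" "a \<in> carrier P" if "a \<in> A" for a using A(1,3) BP that by auto
        show "(\<lambda>a. c a \<odot>\<^bsub>P\<^esub> a) \<in> A \<rightarrow> carrier P" using c by simp
      qed simp_all
      finally show "x \<in> ?F ` carrier (fin_mod R B)" by (rule image_eqI[OF sym f(1)])
    qed
  qed
  ultimately show ?thesis by (simp add: bij_betw_def)
qed

lemma basis_proj: "module R P \<Longrightarrow> is_basis R P B \<Longrightarrow> proj_mod R P"
  by (rule proj_mod_iso_fin[OF _ lin_ext_id_hom basis_iso]) (auto simp: is_basis_def)

lemma basis_hom_ex:
  assumes P: "module R P" "is_basis R P B" and M: "module R M" "w \<in> B \<rightarrow> carrier M"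
  shows "\<exists>f\<in>mod_hom R P M. \<forall>b\<in>B. f b = w b"
proof -
  let ?F = "lin_ext R P (\<lambda>x. x)"
  have BP: "B \<subseteq> carrier P" using P(2) by (simp add: is_basis_def)
  have idB: "(\<lambda>x. x) \<in> B \<rightarrow> carrier P" using BP by auto
  note bij = basis_iso[OF P]
  note F = lin_ext_id_hom[OF P(1) BP]
  have g: "inv_into (carrier (fin_mod R B)) ?F \<in> mod_hom R P (fin_mod R B)" by (rule hom_inv[OF module_fin_mod P(1) F bij])
  show ?thesis
  proof (rule bexI[OF _ hom_comp[OF g lin_ext_hom[OF M]]], rule ballI)
    fix b assume b: "b \<in> B"
    have "?F (fin_unit R b) = b" by (rule lin_ext_unit[OF P(1) idB b])
    then have "inv_into (carrier (fin_mod R B)) ?F b = fin_unit R b"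
      using bij fin_unit_carrier[OF b] by (metis bij_betw_def inv_into_f_f)
    then show "lin_ext R M w (inv_into (carrier (fin_mod R B)) ?F b) = w b" using lin_ext_unit[OF M b] by simp
  qed
qed

lemma basis_span:
  assumes P: "module R P" and B: "is_basis R P B" shows "mspan R P B = carrier P"
proof -
  have BP: "B \<subseteq> carrier P" using B by (simp add: is_basis_def)
  let ?F = "lin_ext R P (\<lambda>x. x)"
  have idB: "(\<lambda>x. x) \<in> B \<rightarrow> carrier P" using BP by auto
  note F = lin_ext_id_hom[OF P(1) BP]
  have "?F ` fin_unit R ` B = B" using lin_ext_unit[OF P idB] by (force simp: image_iff)
  then show ?thesis
    using mspan_image[OF module_fin_mod P F fin_unit_image] mspan_fin_unit[of B] basis_iso[OF P B]
    by (simp add: bij_betw_def)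
qed

text \<open>Finitely many generators involve only a finite set \<open>T\<close> of basis elements.
  The elements with coefficients supported in \<open>T\<close> form a submodule that contains the
  generators, hence everything. A basis element outside \<open>T\<close> would have the coefficient
  1 outside \<open>T\<close>, against 1 \<noteq> 0.\<close>

lemma basis_finite:
  assumes P: "fgm R P" and B: "is_basis R P B" shows "finite B"
proof -
  obtain S where S: "module R P" "S \<subseteq> carrier P" "finite S" "mspan R P S = carrier P"
    using P unfolding fgm_def by metis
  interpret P: module R P by (rule S(1))
  have BP: "B \<subseteq> carrier P" using B by (simp add: is_basis_def)
  let ?F = "lin_ext R P (\<lambda>x. x)" and ?M = "fin_mod R B"
  have idB: "(\<lambda>x. x) \<in> B \<rightarrow> carrier P" using BP by auto
  note F = lin_ext_id_hom[OF S(1) BP] and bij = basis_iso[OF S(1) B]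
  have "\<exists>f. f \<in> carrier ?M \<and> ?F f = x" if "x \<in> S" for x
  proof -
    have "x \<in> ?F ` carrier ?M" using bij that S(2) by (simp add: bij_betw_def subset_iff)
    then obtain f where "x = ?F f" "f \<in> carrier ?M" by (rule imageE)
    then show ?thesis by (intro exI[of _ f]) simp
  qed
  then obtain f where f: "\<And>x. x \<in> S \<Longrightarrow> f x \<in> carrier ?M" "\<And>x. x \<in> S \<Longrightarrow> ?F (f x) = x" by metis
  define T where "T = (\<Union>x\<in>S. {b. f x b \<noteq> \<zero>})"
  have T: "finite T" unfolding T_def using S(3) fin_mod_supp(1)[OF f(1)] by auto
  have sub: "submodule {u \<in> carrier ?M. \<forall>b. b \<notin> T \<longrightarrow> u b = \<zero>} R ?M"
    by (rule submodI[OF module_fin_mod])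
       (auto simp: fin_mod_simps fin_mod_add fin_mod_smult, simp add: fin_mod_carrier)
  let ?U = "?F ` {u \<in> carrier ?M. \<forall>b. b \<notin> T \<longrightarrow> u b = \<zero>}"
  have "S \<subseteq> ?U"
  proof
    fix x assume x: "x \<in> S"
    show "x \<in> ?U" by (rule image_eqI[of _ _ "f x"]) (use f[OF x] x in \<open>auto simp: T_def\<close>)
  qed
  from mspan_least[OF submod_image[OF module_fin_mod S(1) F sub] this] have U: "carrier P \<subseteq> ?U" unfolding S(4) .
  have "B \<subseteq> T"
  proof
    fix b assume b: "b \<in> B"
    then obtain u where u: "u \<in> carrier ?M" "\<forall>b. b \<notin> T \<longrightarrow> u b = \<zero>" "?F u = b" using U BP by (auto simp: subset_iff image_iff)
    have "?F (fin_unit R b) = b" by (rule lin_ext_unit[OF S(1) idB b])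
    then have "u = fin_unit R b" using bij u fin_unit_carrier[OF b] by (metis bij_betw_def inj_onD)
    then show "b \<in> T" using u(2) one_neq_zero by (auto simp: fin_unit_def)
  qed
  then show ?thesis using T finite_subset by auto
qed

text \<open>Unit vectors are distinct because 1 \<noteq> 0, and \<open>F\<close> is injective. Hence
  sums indexed by \<open>S\<close> can be reindexed by the images of the unit vectors, which is the
  form that \<open>is_basis\<close> asks for.\<close>

lemma iso_fin_basis:
  assumes P: "module R P" and F: "F \<in> mod_hom R (fin_mod R S) P" "bij_betw F (carrier (fin_mod R S)) (carrier P)"
  shows "is_basis R P ((\<lambda>s. F (fin_unit R s)) ` S)"
proof -
  interpret P: module R P by (rule P)
  let ?b = "\<lambda>s. F (fin_unit R s)"
  have bP: "?b s \<in> carrier P" if "s \<in> S" for s using hom_closed[OF F(1) fin_unit_carrier[OF that]] .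
  have bw: "?b \<in> S \<rightarrow> carrier P" using bP by auto
  have unit_inj: "s = t" if "fin_unit R s = fin_unit R t" "s \<in> S" for s t
  proof -
    have "fin_unit R s s = fin_unit R t s" using that by simp
    then show ?thesis using one_neq_zero by (simp add: fin_unit_def split: if_splits)
  qed
  have binj: "inj_on ?b S"
  proof (rule inj_onI)
    fix s t assume st: "s \<in> S" "t \<in> S" "?b s = ?b t"
    then have "fin_unit R s = fin_unit R t" using F(2) fin_unit_carrier by (metis bij_betw_def inj_onD)
    then show "s = t" by (rule unit_inj) (rule st(1))
  qed
  have Flin: "F u = lin_ext R P ?b u" if "u \<in> carrier (fin_mod R S)" for u
    by (rule fin_mod_hom_eqI[OF P F(1) lin_ext_hom[OF P bw] _ that]) (simp add: lin_ext_unit[OF P bw])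
  show ?thesis unfolding is_basis_def
  proof (intro conjI ballI allI impI)
    show "?b ` S \<subseteq> carrier P" using bP by auto
    fix x assume "x \<in> carrier P"
    then have "x \<in> F ` carrier (fin_mod R S)" using F(2) by (simp add: bij_betw_def)
    then obtain u where u: "x = F u" "u \<in> carrier (fin_mod R S)" by (rule imageE)
    note u = u(2,1)
    let ?A = "{s. u s \<noteq> \<zero>}"
    have A: "finite ?A" "?A \<subseteq> S" using fin_mod_supp[OF u(1)] by auto
    let ?c = "\<lambda>y. u (inv_into S ?b y)"
    have inv: "inv_into S ?b (?b s) = s" if "s \<in> ?A" for s using binj A(2) that by (auto intro: inv_into_f_f)
    have "x = (\<Oplus>\<^bsub>P\<^esub>s\<in>?A. u s \<odot>\<^bsub>P\<^esub> ?b s)" using u Flin by (simp add: lin_ext_def)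
    also have "\<dots> = (\<Oplus>\<^bsub>P\<^esub>s\<in>?A. ?c (?b s) \<odot>\<^bsub>P\<^esub> ?b s)"
    proof (rule P.finsum_cong')
      have "u s \<in> carrier R" "?b s \<in> carrier P" if "s \<in> ?A" for s using fin_mod_val[OF u(1)] bP A(2) that by auto
      then show "(\<lambda>s. ?c (?b s) \<odot>\<^bsub>P\<^esub> ?b s) \<in> ?A \<rightarrow> carrier P" using inv by (simp add: Pi_def)
    qed (use inv in simp_all)
    also have "\<dots> = (\<Oplus>\<^bsub>P\<^esub>y\<in>?b ` ?A. ?c y \<odot>\<^bsub>P\<^esub> y)"
    proof (rule P.finsum_reindex[symmetric])
      have "u s \<in> carrier R" "?b s \<in> carrier P" if "s \<in> ?A" for s using fin_mod_val[OF u(1)] bP A(2) that by auto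
      then show "(\<lambda>y. ?c y \<odot>\<^bsub>P\<^esub> y) \<in> ?b ` ?A \<rightarrow> carrier P" using inv by (intro funcsetI) (elim imageE, simp)
    qed (rule inj_on_subset[OF binj A(2)])
    finally show "\<exists>A\<subseteq>?b ` S. finite A \<and> (\<exists>c\<in>A \<rightarrow> carrier R. x = (\<Oplus>\<^bsub>P\<^esub>a\<in>A. c a \<odot>\<^bsub>P\<^esub> a))"
      using A fin_mod_val[OF u(1)] by (intro exI[of _ "?b ` ?A"] conjI bexI[of _ ?c]) (simp_all add: image_mono)
  next
    fix A c a assume A: "A \<subseteq> ?b ` S" "finite A" and c: "c \<in> A \<rightarrow> carrier R" "(\<Oplus>\<^bsub>P\<^esub>a\<in>A. c a \<odot>\<^bsub>P\<^esub> a) = \<zero>\<^bsub>P\<^esub>" and a: "a \<in> A"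
    obtain T where T: "T \<subseteq> S" "A = ?b ` T" using A(1) by (meson subset_imageE)
    have Tf: "finite T" using A(2) T binj by (metis finite_imageD inj_on_subset)
    let ?u = "\<lambda>s. if s \<in> T then c (?b s) else \<zero>"
    have cb: "c (?b s) \<in> carrier R" "?b s \<in> carrier P" if "s \<in> T" for s using T c(1) bP that by auto
    have "finite {s. ?u s \<noteq> \<zero>}" by (rule rev_finite_subset[OF Tf]) auto
    then have u: "?u \<in> carrier (fin_mod R S)"
      using T(1) cb(1) by (simp add: fin_mod_carrier subset_iff)
    have "F ?u = (\<Oplus>\<^bsub>P\<^esub>s\<in>T. ?u s \<odot>\<^bsub>P\<^esub> ?b s)" unfolding Flin[OF u]
      by (rule lin_ext_alt[OF P u bw Tf T(1)]) auto
    also have "\<dots> = (\<Oplus>\<^bsub>P\<^esub>s\<in>T. c (?b s) \<odot>\<^bsub>P\<^esub> ?b s)"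
    proof (rule P.finsum_cong')
      show "(\<lambda>s. c (?b s) \<odot>\<^bsub>P\<^esub> ?b s) \<in> T \<rightarrow> carrier P" using cb by simp
    qed simp_all
    also have "\<dots> = (\<Oplus>\<^bsub>P\<^esub>a\<in>A. c a \<odot>\<^bsub>P\<^esub> a)" unfolding T(2)
    proof (rule P.finsum_reindex[symmetric])
      show "(\<lambda>y. c y \<odot>\<^bsub>P\<^esub> y) \<in> ?b ` T \<rightarrow> carrier P" using cb by (intro funcsetI) (elim imageE, simp)
    qed (rule inj_on_subset[OF binj T(1)])
    finally have "F ?u = \<zero>\<^bsub>P\<^esub>" using c(2) by simp
    then have "?u = \<zero>\<^bsub>fin_mod R S\<^esub>" using hom_inj_iff[OF module_fin_mod P F(1)] F(2) u by (simp add: bij_betw_def)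
    then have *: "?u s = \<zero>" for s by (simp add: fin_mod_simps fun_eq_iff)
    obtain t where "t \<in> T" "a = ?b t" using a T(2) by auto
    then show "c a = \<zero>" using *[of t] by simp
  qed
qed

lemma free_iso:
  assumes "free_module R P" "module R Q" "F \<in> mod_hom R P Q" "bij_betw F (carrier P) (carrier Q)"
  shows "free_module R Q"
proof -
  obtain B where P: "module R P" and B: "is_basis R P B" using assms(1) unfolding free_module_def by metis
  have BP: "B \<subseteq> carrier P" using B by (simp add: is_basis_def)
  show ?thesis unfolding free_module_def
    using iso_fin_basis[OF assms(2) hom_comp[OF lin_ext_id_hom[OF P BP] assms(3)]
      bij_betw_trans[OF basis_iso[OF P B] assms(4), unfolded comp_def]] assms(2) by metis
qed

lemma free_fin_mod: "free_module R (fin_mod R S)"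
  unfolding free_module_def
proof (intro conjI module_fin_mod exI)
  show "is_basis R (fin_mod R S) ((\<lambda>s. fin_unit R s) ` S)"
    by (rule iso_fin_basis[OF module_fin_mod hom_id]) (simp add: bij_betw_def)
qed

lemma finite_basis_fg:
  assumes P: "module R P" and B: "is_basis R P B" "finite B" shows "fg_module R P"
proof -
  interpret P: module R P by (rule P)
  have BP: "B \<subseteq> carrier P" using B by (simp add: is_basis_def)
  have "\<exists>c\<in>B \<rightarrow> carrier R. x = (\<Oplus>\<^bsub>P\<^esub>a\<in>B. c a \<odot>\<^bsub>P\<^esub> a)" if xP: "x \<in> carrier P" for x
  proof -
    have "x \<in> lin_ext R P (\<lambda>x. x) ` carrier (fin_mod R B)" using basis_iso[OF P B(1)] xP by (simp add: bij_betw_def)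
    then obtain u where "x = lin_ext R P (\<lambda>x. x) u" "u \<in> carrier (fin_mod R B)" by (rule imageE)
    note u = this(2,1)
    have "x = (\<Oplus>\<^bsub>P\<^esub>a\<in>B. u a \<odot>\<^bsub>P\<^esub> a)" unfolding u(2)
      by (rule lin_ext_alt[OF P u(1) _ B(2) order_refl fin_mod_supp(2)[OF u(1)]]) (use BP in auto)
    then show ?thesis using fin_mod_val[OF u(1)] by (intro bexI[of _ u]) auto
  qed
  then show ?thesis unfolding fg_module_def using P BP B(2) by (intro conjI exI[of _ B]) auto
qed

lemma fg_fin_mod: assumes "finite S" shows "fg_module R (fin_mod R S)"
proof -
  have "is_basis R (fin_mod R S) ((\<lambda>s. fin_unit R s) ` S)"
    by (rule iso_fin_basis[OF module_fin_mod hom_id]) (simp add: bij_betw_def)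
  then show ?thesis using finite_basis_fg[OF module_fin_mod] assms by auto
qed

lemma fgm_fin_mod: "finite S \<Longrightarrow> fgm R (fin_mod R S)"
  by (rule fg_module_imp_fgm[OF fg_fin_mod])

text \<open>The generating set has least cardinality. A relation with a coefficient outside \<mm>,
  that is a unit, would express one generator by the others and allow it to be dropped.\<close>

lemma minimal_cover:
  fixes V :: "('a,'x,'y) module_scheme"
  assumes "fgm R V"
  shows "\<exists>n (p :: (nat \<Rightarrow> 'a) \<Rightarrow> 'x). p \<in> mod_hom R (fin_mod R {..<n}) V \<and> p ` carrier (fin_mod R {..<n}) = carrier V \<and>
     (\<forall>u\<in>carrier (fin_mod R {..<n}). p u = \<zero>\<^bsub>V\<^esub> \<longrightarrow> (\<forall>i. u i \<in> \<mm>))"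
proof -
  define G where "G S \<longleftrightarrow> S \<subseteq> carrier V \<and> finite S \<and> mspan R V S = carrier V" for S
  have V: "module R V" and "\<exists>S. G S" using assms unfolding fgm_def G_def by auto
  then obtain S0 where "G S0" by auto
  define S where "S = arg_min card G"
  have S: "G S" and Smin: "\<And>T. G T \<Longrightarrow> card S \<le> card T"
    using arg_min_natI[of G S0 card] arg_min_nat_le[of G _ card] \<open>G S0\<close> by (auto simp: S_def)
  interpret V: module R V by (rule V)
  have SV: "S \<subseteq> carrier V" "finite S" "mspan R V S = carrier V" using S by (auto simp: G_def)
  obtain w where w: "bij_betw w {..<card S} S" using ex_bij_betw_nat_finite[OF SV(2)] by (auto simp: atLeast0LessThan)
  let ?n = "card S" let ?M = "fin_mod R {..<?n}"
  have wV: "w \<in> {..<?n} \<rightarrow> carrier V" using w SV(1) by (auto simp: bij_betw_def)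
  let ?p = "lin_ext R V w"
  have p: "?p \<in> mod_hom R ?M V" by (rule lin_ext_hom[OF V wV])
  have "(\<lambda>i. ?p (fin_unit R i)) ` {..<?n} = w ` {..<?n}"
    by (rule image_cong[OF refl]) (rule lin_ext_unit[OF V wV])
  then have "?p ` fin_unit R ` {..<?n} = S" using w by (simp add: image_image bij_betw_def)
  then have img: "?p ` carrier ?M = carrier V"
    using mspan_image[OF module_fin_mod V p fin_unit_image] mspan_fin_unit[of "{..<?n}"] SV(3) by simp
  have min: "u i \<in> \<mm>" if u: "u \<in> carrier ?M" "?p u = \<zero>\<^bsub>V\<^esub>" for u i
  proof (rule ccontr)
    assume ui: "u i \<notin> \<mm>"
    have z: "\<zero> \<in> \<mm>" using additive_subgroup.zero_closed[OF ideal.axioms(1)[OF ideal_max]] .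
    have i: "i < ?n" using u(1) ui z unfolding fin_mod_carrier by (metis lessThan_iff)
    have uc: "u i \<in> carrier R" by (rule fin_mod_val[OF u(1)])
    have un: "u i \<in> Units R" by (rule notin_max_Unit[OF uc ui])
    let ?T = "S - {w i}"
    have wi: "w i \<in> S" using w i by (auto simp: bij_betw_def)
    have sT: "submodule (mspan R V ?T) R V" using SV(1) by (intro mspan_submod[OF V]) auto
    note D = submodD[OF V sT]
    have winj: "inj_on w {..<?n}" and wS: "w ` {..<?n} = S" using w by (auto simp only: bij_betw_def)
    have "w x \<in> ?T" if "x < ?n" "x \<noteq> i" for x
      using inj_onD[OF winj, of x i] wS i that by blast
    then have wT: "w x \<in> mspan R V ?T" if "x \<in> {..<?n} - {i}" for x
      using mspan_superset[of ?T R V] that by auto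
    have "?p u = (\<Oplus>\<^bsub>V\<^esub>x\<in>{..<?n}. u x \<odot>\<^bsub>V\<^esub> w x)"
      by (rule lin_ext_alt[OF V u(1) wV _ order_refl fin_mod_supp(2)[OF u(1)]]) auto
    also have "{..<?n} = insert i ({..<?n} - {i})" using i by auto
    also have "(\<Oplus>\<^bsub>V\<^esub>x\<in>\<dots>. u x \<odot>\<^bsub>V\<^esub> w x) = u i \<odot>\<^bsub>V\<^esub> w i \<oplus>\<^bsub>V\<^esub> (\<Oplus>\<^bsub>V\<^esub>x\<in>{..<?n} - {i}. u x \<odot>\<^bsub>V\<^esub> w x)"
      by (rule V.finsum_insert) (use fin_mod_val[OF u(1)] wV i in auto)
    finally have eq: "u i \<odot>\<^bsub>V\<^esub> w i \<oplus>\<^bsub>V\<^esub> (\<Oplus>\<^bsub>V\<^esub>x\<in>{..<?n} - {i}. u x \<odot>\<^bsub>V\<^esub> w x) = \<zero>\<^bsub>V\<^esub>" using u(2) by simp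
    have t: "(\<Oplus>\<^bsub>V\<^esub>x\<in>{..<?n} - {i}. u x \<odot>\<^bsub>V\<^esub> w x) \<in> mspan R V ?T"
      by (rule submod_finsum[OF V sT]) (use wT D(7) fin_mod_val[OF u(1)] in auto)
    have wiV: "w i \<in> carrier V" using wi SV(1) by auto
    have "u i \<odot>\<^bsub>V\<^esub> w i = \<ominus>\<^bsub>V\<^esub> (\<Oplus>\<^bsub>V\<^esub>x\<in>{..<?n} - {i}. u x \<odot>\<^bsub>V\<^esub> w x)"
      by (rule sym, rule V.minus_equality[OF eq]) (use uc wiV D(3)[OF t] in auto)
    then have "u i \<odot>\<^bsub>V\<^esub> w i \<in> mspan R V ?T" using D(4)[OF t] by simp
    then have "inv (u i) \<odot>\<^bsub>V\<^esub> (u i \<odot>\<^bsub>V\<^esub> w i) \<in> mspan R V ?T" by (rule D(7)[OF Units_inv_closed[OF un]])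
    moreover have "inv (u i) \<odot>\<^bsub>V\<^esub> (u i \<odot>\<^bsub>V\<^esub> w i) = w i"
      using wiV un uc by (simp add: V.smult_assoc1[symmetric])
    ultimately have "w i \<in> mspan R V ?T" by simp
    then have "S \<subseteq> mspan R V ?T" using mspan_superset[of ?T R V] by auto
    then have "mspan R V ?T = carrier V" using mspan_least[OF sT] SV(3) D(1) by (metis subset_antisym)
    then have "G ?T" using SV by (auto simp: G_def)
    then show False using Smin[of ?T] wi SV(2) by (metis card_Diff1_less linorder_not_le)
  qed
  then show ?thesis using p img by (intro exI[of _ ?n] exI[of _ ?p]) auto
qed

text \<open>Iteration of \<open>minimal_cover\<close> on kernels. Minimality of each cover says that
  the next kernel, which is the image of the next differential, has coordinates in \<mm>. The state
  of the recursion is a rank, a kernel and a map.\<close>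

lemma minimal_resolution:
  fixes V :: "('a,'x,'y) module_scheme"
  assumes "fgm R V"
  shows "\<exists>(n :: nat \<Rightarrow> nat) \<delta> \<epsilon>. left_resolution R V (\<lambda>i. fin_mod R {..<n i}) \<delta> \<epsilon> \<and>
     (\<forall>i. \<forall>x\<in>carrier (fin_mod R {..<n (Suc i)}). \<forall>k. \<delta> i x k \<in> \<mm>)"
proof -
  let ?M = "\<lambda>n::nat. fin_mod R {..<n}"
  have V: "module R V" using assms by (simp add: fgm_def)
  obtain n0 e where e: "e \<in> mod_hom R (?M n0) V" "e ` carrier (?M n0) = carrier V"
     "\<forall>u\<in>carrier (?M n0). e u = \<zero>\<^bsub>V\<^esub> \<longrightarrow> (\<forall>i. u i \<in> \<mm>)" using minimal_cover[OF assms] by metis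
  define K0 where "K0 = mod_ker (?M n0) V e"
  have K0: "submodule K0 R (?M n0)" unfolding K0_def mod_ker_def by (rule submod_ker[OF module_fin_mod V e(1)])
  have K0m: "u i \<in> \<mm>" if "u \<in> K0" for u i using that e(3) by (auto simp: K0_def mod_ker_def)
  define P where "P j s = (case s of (n, K, f) \<Rightarrow> (j = 0 \<longrightarrow> n = n0 \<and> K = K0) \<and> submodule K R (?M n) \<and> (\<forall>u\<in>K. \<forall>i. u i \<in> \<mm>))"
    for j :: nat and s :: "nat \<times> (nat \<Rightarrow> 'a) set \<times> ((nat \<Rightarrow> 'a) \<Rightarrow> (nat \<Rightarrow> 'a))"
  define Q where "Q (j::nat) s s' = (case s of (n, K, f :: (nat \<Rightarrow> 'a) \<Rightarrow> (nat \<Rightarrow> 'a)) \<Rightarrow> case s' of (n', K', f') \<Rightarrow>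
     f' \<in> mod_hom R (?M n') (?M n) \<and> f' ` carrier (?M n') = K \<and> K' = mod_ker (?M n') (?M n) f')"
    for j and s s' :: "nat \<times> (nat \<Rightarrow> 'a) set \<times> ((nat \<Rightarrow> 'a) \<Rightarrow> (nat \<Rightarrow> 'a))"
  have "\<exists>g. \<forall>j. P j (g j) \<and> Q j (g j) (g (Suc j))"
  proof (rule dependent_nat_choice)
    \<comment> \<open>The cover of \<open>V\<close> has another type than the differentials and
      stays outside the recursion, which starts from its kernel \<open>K0\<close>; the map in the
      starting state is arbitrary.\<close>
    show "\<exists>s. P 0 s" using K0 K0m by (intro exI[of _ "(n0, K0, undefined)"]) (auto simp: P_def)
    fix s j assume "P j s"
    then obtain n K f where s: "s = (n, K, f)" "submodule K R (?M n)" "\<forall>u\<in>K. \<forall>i. u i \<in> \<mm>" by (cases s) (auto simp: P_def)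
    have "fgm R (?M n \<restriction> K)" by (rule fgm_sub[OF fgm_fin_mod s(2)]) auto
    from minimal_cover[OF this] obtain n' p where p: "p \<in> mod_hom R (?M n') (?M n \<restriction> K)" "p ` carrier (?M n') = K"
      "\<forall>u\<in>carrier (?M n'). p u = \<zero>\<^bsub>?M n\<^esub> \<longrightarrow> (\<forall>i. u i \<in> \<mm>)" by auto
    have p': "p \<in> mod_hom R (?M n') (?M n)" by (rule hom_cod_sup[OF p(1) submodD(1)[OF module_fin_mod s(2)]])
    have "P (Suc j) (n', mod_ker (?M n') (?M n) p, p)"
      using p(3) submod_ker[OF module_fin_mod module_fin_mod p'] by (auto simp: P_def mod_ker_def)
    then show "\<exists>s'. P (Suc j) s' \<and> Q j s s'" using p(2) p' s by (intro exI[of _ "(n', mod_ker (?M n') (?M n) p, p)"]) (auto simp: Q_def)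
  qed
  then obtain g where g: "\<And>j. P j (g j)" "\<And>j. Q j (g j) (g (Suc j))" by metis
  define n where "n j = fst (g j)" for j
  define K where "K j = fst (snd (g j))" for j
  define f where "f j = snd (snd (g j))" for j
  have gj: "g j = (n j, K j, f j)" for j by (simp add: n_def K_def f_def)
  have P: "n 0 = n0" "K 0 = K0" "\<forall>u\<in>K j. \<forall>i. u i \<in> \<mm>" for j using g(1)[of 0] g(1)[of j] by (auto simp: gj P_def)
  have Q: "f (Suc j) \<in> mod_hom R (?M (n (Suc j))) (?M (n j))" "f (Suc j) ` carrier (?M (n (Suc j))) = K j"
    "K (Suc j) = mod_ker (?M (n (Suc j))) (?M (n j)) (f (Suc j))" for j
    using g(2)[of j] by (auto simp: gj Q_def)
  have mm: "module R (?M j)" for j by (rule module_fin_mod)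
  show ?thesis
  proof (intro exI[of _ n] exI[of _ "\<lambda>i. f (Suc i)"] exI[of _ e] conjI allI ballI)
    show "left_resolution R V (\<lambda>i. ?M (n i)) (\<lambda>i. f (Suc i)) e"
      unfolding left_resolution_def using e P Q mm by (simp add: K0_def)
    fix i x k assume "x \<in> carrier (?M (n (Suc i)))"
    then show "f (Suc i) x k \<in> \<mm>" using Q(2)[of i] P(3)[of i] by auto
  qed
qed

end

section \<open>Extension of homomorphisms into injective modules\<close>

lemma msub_carrier_eq [simp]: "M \<restriction> carrier M = M" by simp

text \<open>The map is a + c \<mapsto> f a + k c. Two decompositions of the same element differ by
  an element of the intersection, where \<open>f\<close> and \<open>k\<close> agree.\<close>

lemma hom_glue:
  assumes U: "module R U" and W: "module R W" and A: "submodule A R U" and C: "submodule C R U"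
    and f: "f \<in> mod_hom R (U \<restriction> A) W" and k: "k \<in> mod_hom R (U \<restriction> C) W"
    and eq: "\<And>z. z \<in> A \<Longrightarrow> z \<in> C \<Longrightarrow> f z = k z"
  shows "\<exists>g\<in>mod_hom R (U \<restriction> msum U A C) W. (\<forall>z\<in>A. g z = f z) \<and> (\<forall>z\<in>C. g z = k z)"
proof -
  interpret U: module R U by (rule U)
  interpret W: module R W by (rule W)
  note AD = submodD[OF U A] and CD = submodD[OF U C]
  note fh = hom_closed[OF f, simplified] hom_add[OF f, simplified] hom_smult[OF f, simplified]
  note kh = hom_closed[OF k, simplified] hom_add[OF k, simplified] hom_smult[OF k, simplified]
  have f0: "f \<zero>\<^bsub>U\<^esub> = \<zero>\<^bsub>W\<^esub>" using hom_zero[OF module_sub[OF U A] W f] by simp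
  have k0: "k \<zero>\<^bsub>U\<^esub> = \<zero>\<^bsub>W\<^esub>" using hom_zero[OF module_sub[OF U C] W k] by simp
  have wd: "f a \<oplus>\<^bsub>W\<^esub> k c = f a' \<oplus>\<^bsub>W\<^esub> k c'"
    if *: "a \<in> A" "a' \<in> A" "c \<in> C" "c' \<in> C" "a \<oplus>\<^bsub>U\<^esub> c = a' \<oplus>\<^bsub>U\<^esub> c'" for a a' c c'
  proof -
    have cc: "a \<in> carrier U" "a' \<in> carrier U" "c \<in> carrier U" "c' \<in> carrier U"
      using AD(3)[OF *(1)] AD(3)[OF *(2)] CD(3)[OF *(3)] CD(3)[OF *(4)] .
    define d where "d = c' \<ominus>\<^bsub>U\<^esub> c"
    have dC: "d \<in> C" "d \<in> carrier U" unfolding d_def using CD(6)[OF *(4,3)] cc by auto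
    have c': "c' = c \<oplus>\<^bsub>U\<^esub> d" unfolding d_def using cc U.minus_plus_cancel'[of c' c] by (simp add: U.a_comm)
    have "a \<oplus>\<^bsub>U\<^esub> c = (a' \<oplus>\<^bsub>U\<^esub> d) \<oplus>\<^bsub>U\<^esub> c" using *(5) cc dC by (simp add: c' U.a_ac)
    then have a: "a = a' \<oplus>\<^bsub>U\<^esub> d" using cc dC by simp
    have "d = a \<ominus>\<^bsub>U\<^esub> a'" unfolding a using cc dC by (simp add: U.minus_add_cancel')
    then have dA: "d \<in> A" using AD(6)[OF *(1,2)] by simp
    have fc: "f a' \<in> carrier W" "f d \<in> carrier W" "k c \<in> carrier W" "k d \<in> carrier W"
      using fh(1)[OF *(2)] fh(1)[OF dA] kh(1)[OF *(3)] kh(1)[OF dC(1)] .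
    show ?thesis unfolding c' a using fh(2)[OF *(2) dA] kh(2)[OF *(3) dC(1)] eq[OF dA dC(1)] fc
      by (simp add: W.a_ac)
  qed
  define g where "g z = (SOME v. \<exists>a\<in>A. \<exists>c\<in>C. z = a \<oplus>\<^bsub>U\<^esub> c \<and> v = f a \<oplus>\<^bsub>W\<^esub> k c)" for z
  have g: "g (a \<oplus>\<^bsub>U\<^esub> c) = f a \<oplus>\<^bsub>W\<^esub> k c" if "a \<in> A" "c \<in> C" for a c
  proof -
    have "\<exists>a'\<in>A. \<exists>c'\<in>C. a \<oplus>\<^bsub>U\<^esub> c = a' \<oplus>\<^bsub>U\<^esub> c' \<and> g (a \<oplus>\<^bsub>U\<^esub> c) = f a' \<oplus>\<^bsub>W\<^esub> k c'"
      unfolding g_def by (rule someI[of _ "f a \<oplus>\<^bsub>W\<^esub> k c"]) (use that in auto)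
    then obtain a' c' where "a' \<in> A" "c' \<in> C" "a \<oplus>\<^bsub>U\<^esub> c = a' \<oplus>\<^bsub>U\<^esub> c'" "g (a \<oplus>\<^bsub>U\<^esub> c) = f a' \<oplus>\<^bsub>W\<^esub> k c'"
      by (elim bexE conjE)
    then show ?thesis using wd that by metis
  qed
  have "g \<in> mod_hom R (U \<restriction> msum U A C) W"
  proof (rule mod_homI, simp_all)
    fix x assume "x \<in> msum U A C"
    then obtain a c where x: "a \<in> A" "c \<in> C" "x = a \<oplus>\<^bsub>U\<^esub> c" by (rule msumE)
    have v: "f a \<in> carrier W" "k c \<in> carrier W" using fh(1)[OF x(1)] kh(1)[OF x(2)] .
    have xu: "a \<in> carrier U" "c \<in> carrier U" using AD(3)[OF x(1)] CD(3)[OF x(2)] .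
    show "g x \<in> carrier W" using v by (simp add: x(3) g x(1,2))
    show "g (r \<odot>\<^bsub>U\<^esub> x) = r \<odot>\<^bsub>W\<^esub> g x" if r: "r \<in> carrier R" for r
    proof -
      have "r \<odot>\<^bsub>U\<^esub> x = r \<odot>\<^bsub>U\<^esub> a \<oplus>\<^bsub>U\<^esub> r \<odot>\<^bsub>U\<^esub> c" using r xu by (simp add: x(3) U.smult_r_distr)
      then show ?thesis using r v g[OF AD(7)[OF r x(1)] CD(7)[OF r x(2)]] g[OF x(1,2)] fh(3)[OF r x(1)] kh(3)[OF r x(2)]
        by (simp add: x(3) W.smult_r_distr)
    qed
    fix x' assume "x' \<in> msum U A C"
    then obtain a' c' where x': "a' \<in> A" "c' \<in> C" "x' = a' \<oplus>\<^bsub>U\<^esub> c'" by (rule msumE)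
    have v': "f a' \<in> carrier W" "k c' \<in> carrier W" using fh(1)[OF x'(1)] kh(1)[OF x'(2)] .
    have xu': "a' \<in> carrier U" "c' \<in> carrier U" using AD(3)[OF x'(1)] CD(3)[OF x'(2)] .
    have "x \<oplus>\<^bsub>U\<^esub> x' = (a \<oplus>\<^bsub>U\<^esub> a') \<oplus>\<^bsub>U\<^esub> (c \<oplus>\<^bsub>U\<^esub> c')" using xu xu' by (simp add: x(3) x'(3) U.a_ac)
    then show "g (x \<oplus>\<^bsub>U\<^esub> x') = g x \<oplus>\<^bsub>W\<^esub> g x'"
      using v v' g[OF AD(5)[OF x(1) x'(1)] CD(5)[OF x(2) x'(2)]] g[OF x(1,2)] g[OF x'(1,2)]
        fh(2)[OF x(1) x'(1)] kh(2)[OF x(2) x'(2)]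
      by (simp add: x(3) x'(3) W.a_ac)
  qed
  moreover have "g z = f z" if "z \<in> A" for z
    using g[OF that CD(2)] AD(3)[OF that] fh(1)[OF that] k0 by simp
  moreover have "g z = k z" if "z \<in> C" for z
    using g[OF AD(2) that] CD(3)[OF that] kh(1)[OF that] f0 by simp
  ultimately show ?thesis by (intro bexI[of _ g]) simp_all
qed

context noetherian_local_ring begin

text \<open>The ring as a module over itself has type \<open>'a\<close>, so
  \<open>injective_module\<close> applies to its ideals directly. The extension to the whole ring is
  determined by its value at 1.\<close>

lemma baer_elem:
  fixes E :: "('a,'x,'y) module_scheme"
  assumes "injective_module R E" "ideal I R" "f \<in> mod_hom R (self_module R \<restriction> I) E"
  shows "\<exists>e\<in>carrier E. \<forall>r\<in>I. f r = r \<odot>\<^bsub>E\<^esub> e"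
proof -
  have "submodule I R (self_module R)" using assms(2) by (simp add: ideal_iff_submod)
  then obtain g where g: "g \<in> mod_hom R (self_module R) E" "\<forall>x\<in>I. g x = f x"
    using assms(1,3) module_self[OF is_cring] unfolding injective_module_def by metis
  have "f r = r \<odot>\<^bsub>E\<^esub> g \<one>" if "r \<in> I" for r
    using hom_self_eq[OF is_cring g(1) ideal.Icarr[OF assms(2) that]] g(2) that by simp
  moreover have "g \<one> \<in> carrier E" using hom_closed[OF g(1)] by simp
  ultimately show ?thesis by (intro bexI[of _ "g \<one>"]) simp_all
qed

text \<open>On the colon ideal (A : a) the map r \<mapsto> f(r a) is multiplication by some
  \<open>e\<close> in \<open>E\<close>. Sending \<open>a\<close> to \<open>e\<close> is therefore
  well defined on R a and agrees with \<open>f\<close> on the overlap with \<open>A\<close>, and the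
  two maps are glued.\<close>

lemma baer_step:
  assumes E: "injective_module R E" and U: "module R U" and A: "submodule A R U"
    and f: "f \<in> mod_hom R (U \<restriction> A) E" and a: "a \<in> carrier U"
  shows "\<exists>C g. submodule C R U \<and> A \<subseteq> C \<and> a \<in> C \<and> g \<in> mod_hom R (U \<restriction> C) E \<and> (\<forall>x\<in>A. g x = f x)"
proof -
  interpret U: module R U by (rule U)
  have mE: "module R E" using E by (simp add: injective_module_def)
  interpret E: module R E by (rule mE)
  note AD = submodD[OF U A]
  let ?I = "colon_ideal R U A a"
  have I: "ideal ?I R" by (rule ideal_colon_ideal[OF U A a])
  have sI: "submodule ?I R (self_module R)" using I by (simp add: ideal_iff_submod)
  have ra: "(\<lambda>r. r \<odot>\<^bsub>U\<^esub> a) \<in> mod_hom R (self_module R) U" by (rule hom_smult_elem[OF U a])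
  have "(\<lambda>r. r \<odot>\<^bsub>U\<^esub> a) \<in> mod_hom R (self_module R \<restriction> ?I) (U \<restriction> A)"
    by (rule hom_cod_sub[OF hom_dom_sub[OF ra]]) (auto simp: colon_ideal_def)
  from hom_comp[OF this f] have "(\<lambda>r. f (r \<odot>\<^bsub>U\<^esub> a)) \<in> mod_hom R (self_module R \<restriction> ?I) E" .
  from baer_elem[OF E I this] obtain e where e: "e \<in> carrier E" "\<And>r. r \<in> ?I \<Longrightarrow> f (r \<odot>\<^bsub>U\<^esub> a) = r \<odot>\<^bsub>E\<^esub> e" by metis
  let ?C = "{r \<odot>\<^bsub>U\<^esub> a | r. r \<in> carrier R}"
  have sC: "submodule ?C R U" by (rule submod_smult_ideal[OF U ideal_carrier[OF is_cring] a])
  have "\<exists>g\<in>mod_hom R (U \<restriction> ?C) E. \<forall>r\<in>carrier (self_module R). g (r \<odot>\<^bsub>U\<^esub> a) = r \<odot>\<^bsub>E\<^esub> e"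
  proof (rule hom_factor[OF module_self[OF is_cring] module_sub[OF U sC] mE])
    show "(\<lambda>r. r \<odot>\<^bsub>U\<^esub> a) \<in> mod_hom R (self_module R) (U \<restriction> ?C)"
      by (rule hom_cod_sub[OF ra]) auto
    show "(\<lambda>r. r \<odot>\<^bsub>U\<^esub> a) ` carrier (self_module R) = carrier (U \<restriction> ?C)" by auto
    show "(\<lambda>r. r \<odot>\<^bsub>E\<^esub> e) \<in> mod_hom R (self_module R) E" by (rule hom_smult_elem[OF mE e(1)])
    fix r assume r: "r \<in> carrier (self_module R)" "r \<odot>\<^bsub>U\<^esub> a = \<zero>\<^bsub>U \<restriction> ?C\<^esub>"
    then have "r \<in> ?I" using AD(2) by (simp add: colon_ideal_def)
    then have "r \<odot>\<^bsub>E\<^esub> e = f (r \<odot>\<^bsub>U\<^esub> a)" using e(2) by simp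
    then show "r \<odot>\<^bsub>E\<^esub> e = \<zero>\<^bsub>E\<^esub>" using r hom_zero[OF module_sub[OF U A] mE f] by simp
  qed
  then obtain k where k: "k \<in> mod_hom R (U \<restriction> ?C) E" "\<And>r. r \<in> carrier R \<Longrightarrow> k (r \<odot>\<^bsub>U\<^esub> a) = r \<odot>\<^bsub>E\<^esub> e" by auto
  have "\<exists>g\<in>mod_hom R (U \<restriction> msum U A ?C) E. (\<forall>z\<in>A. g z = f z) \<and> (\<forall>z\<in>?C. g z = k z)"
  proof (rule hom_glue[OF U mE A sC f k(1)])
    fix z assume z: "z \<in> A" "z \<in> ?C"
    then obtain r where r: "z = r \<odot>\<^bsub>U\<^esub> a" "r \<in> carrier R" by auto
    then have "r \<in> ?I" using z(1) by (simp add: colon_ideal_def)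
    then show "f z = k z" using r k(2)[OF r(2)] e(2) by simp
  qed
  moreover have "a \<in> ?C" using a by (intro CollectI exI[of _ \<one>]) simp
  ultimately show ?thesis using msum_superset[OF U A sC] submod_msum[OF U A sC]
    by (elim bexE conjE, intro exI[of _ "msum U A ?C"] exI conjI) auto
qed

text \<open>The module \<open>U\<close> may have any type, although \<open>injective_module\<close>
  tests only one. As \<open>U\<close> is finitely generated, adjoining its generators one by one
  replaces the use of Zorn's lemma in Baer's criterion.\<close>

lemma inj_extend:
  assumes E: "injective_module R E" and U: "fgm R U" and A: "submodule A R U" and f: "f \<in> mod_hom R (U \<restriction> A) E"
  shows "\<exists>g\<in>mod_hom R U E. \<forall>x\<in>A. g x = f x"
proof -
  obtain S where S: "module R U" "S \<subseteq> carrier U" "finite S" "mspan R U S = carrier U"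
    using U unfolding fgm_def by metis
  have "\<exists>C g. submodule C R U \<and> A \<subseteq> C \<and> S \<subseteq> C \<and> g \<in> mod_hom R (U \<restriction> C) E \<and> (\<forall>x\<in>A. g x = f x)"
    using S(3,2)
  proof (induction S rule: finite_induct)
    case empty then show ?case using A f by (intro exI[of _ A] exI[of _ f]) simp
  next
    case (insert a T)
    then obtain C g where C: "submodule C R U" "A \<subseteq> C" "T \<subseteq> C" "g \<in> mod_hom R (U \<restriction> C) E" "\<forall>x\<in>A. g x = f x" by auto
    obtain C' g' where "submodule C' R U" "C \<subseteq> C'" "a \<in> C'" "g' \<in> mod_hom R (U \<restriction> C') E" "\<forall>x\<in>C. g' x = g x"
      using baer_step[OF E S(1) C(1,4), of a] insert.prems by auto
    then show ?case using C by (intro exI[of _ C'] exI[of _ g']) auto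
  qed
  then obtain C g where C: "submodule C R U" "S \<subseteq> C" "g \<in> mod_hom R (U \<restriction> C) E" "\<forall>x\<in>A. g x = f x" by auto
  have "C = carrier U" using mspan_least[OF C(1,2)] S(4) submodD(1)[OF S(1) C(1)] by simp
  then show ?thesis using C(3,4) by (intro bexI[of _ g]) simp_all
qed

text \<open>A map is determined by its values on generators of \<open>U\<close>, so finitely many
  maps are collected that realize these values one generator after the other. Finite generation is
  asked of a submodule \<open>Z\<close> that contains the values and not of \<open>W\<close>,
  because \<open>W\<close> will be an injective module.\<close>

lemma Hom_submod_fg:
  assumes U: "fgm R U" and W: "module R W" and H: "submodule H R (Hom_module R U W)"
    and Z: "submodule Z R W" "fgm R (W \<restriction> Z)" "\<And>f x. f \<in> H \<Longrightarrow> x \<in> carrier U \<Longrightarrow> f x \<in> Z"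
  shows "\<exists>T. T \<subseteq> H \<and> finite T \<and> mspan R (Hom_module R U W) T = H"
proof -
  obtain S where S: "module R U" "S \<subseteq> carrier U" "finite S" "mspan R U S = carrier U"
    using U unfolding fgm_def by metis
  let ?H = "Hom_module R U W"
  have mH: "module R ?H" by (rule module_Hom[OF S(1) W])
  interpret W: module R W by (rule W)
  interpret H: module R ?H by (rule mH)
  note HD = submodD[OF mH H]
  have sp: "submodule (mspan R ?H T) R ?H" if "T \<subseteq> H" for T by (rule mspan_submod[OF mH]) (use that HD(1) in auto)
  have spH: "mspan R ?H T \<subseteq> H" if "T \<subseteq> H" for T by (rule mspan_least[OF H that])
  have ev: "(\<lambda>f. f x) \<in> mod_hom R ?H W" if "x \<in> carrier U" for x by (rule Hom_eval_hom[OF that])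
  obtain G where G: "finite G" "G \<subseteq> Z" "mspan R W G = Z"
  proof -
    obtain G where "G \<subseteq> Z" "finite G" "mspan R (W \<restriction> Z) G = Z" using Z(2) unfolding fgm_def by auto
    then show ?thesis using that mspan_sub[OF W Z(1)] by auto
  qed
  have GW: "G \<subseteq> carrier W" using G(2) submodD(1)[OF W Z(1)] by auto
  have "\<exists>T\<subseteq>H. finite T \<and> (\<forall>f\<in>H. \<exists>t\<in>mspan R ?H T. \<forall>s\<in>S. f s = t s)"
    using S(3,2)
  proof (induction S rule: finite_induct)
    case empty
    have "\<zero>\<^bsub>?H\<^esub> \<in> mspan R ?H {}" using submodD(2)[OF mH sp[of "{}"]] by simp
    then show ?case by (intro exI[of _ "{}"]) auto
  next
    case (insert a S)
    then obtain T where T: "T \<subseteq> H" "finite T" "\<And>f. f \<in> H \<Longrightarrow> \<exists>t\<in>mspan R ?H T. \<forall>s\<in>S. f s = t s" by auto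
    have aU: "a \<in> carrier U" and SU: "S \<subseteq> carrier U" using insert.prems by auto
    \<comment> \<open>The freedom that is left once the values on the earlier generators are
      matched. The values of these maps at the new generator form a submodule of \<open>Z\<close>,
      hence a finitely generated one.\<close>
    define H0 where "H0 = {f \<in> H. \<forall>s\<in>S. f s = \<zero>\<^bsub>W\<^esub>}"
    have H0: "submodule H0 R ?H"
    proof (rule submodI[OF mH])
      show "H0 \<subseteq> carrier ?H" using HD(1) by (auto simp: H0_def)
      show "\<zero>\<^bsub>?H\<^esub> \<in> H0" using HD(2) SU by (auto simp: H0_def Hom_apply)
      show "f \<oplus>\<^bsub>?H\<^esub> g \<in> H0" if "f \<in> H0" "g \<in> H0" for f g
        using that HD(5)[of f g] SU by (auto simp: H0_def Hom_apply subset_iff)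
      show "r \<odot>\<^bsub>?H\<^esub> f \<in> H0" if "r \<in> carrier R" "f \<in> H0" for r f
        using that HD(7)[of r f] SU by (auto simp: H0_def Hom_apply subset_iff)
    qed
    let ?V = "(\<lambda>f. f a) ` H0"
    have "?V \<subseteq> Z" using Z(3) aU by (auto simp: H0_def)
    then obtain V where V: "V \<subseteq> ?V" "finite V" "mspan R W V = ?V"
      using noetherian_mspan[OF W G(1) GW submod_image[OF mH W ev[OF aU] H0]] G(3) by auto
    have "\<forall>v\<in>V. \<exists>f\<in>H0. f a = v" using V(1) by auto
    then obtain F where F: "\<And>v. v \<in> V \<Longrightarrow> F v \<in> H0" "\<And>v. v \<in> V \<Longrightarrow> F v a = v" by metis
    have FH: "F ` V \<subseteq> H" using F(1) by (auto simp: H0_def)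
    have FH0: "mspan R ?H (F ` V) \<subseteq> H0" by (rule mspan_least[OF H0]) (use F(1) in auto)
    have "(\<lambda>f. f a) ` F ` V = V" using F(2) by (force simp: image_iff)
    then have evF: "(\<lambda>f. f a) ` mspan R ?H (F ` V) = ?V"
      using mspan_image[OF mH W ev[OF aU], of "F ` V"] FH HD(1) V(3) by simp
    have TF: "T \<union> F ` V \<subseteq> H" using T(1) FH by simp
    show ?case
    proof (intro exI[of _ "T \<union> F ` V"] conjI ballI)
      fix f assume f: "f \<in> H"
      then obtain t where t: "t \<in> mspan R ?H T" "\<forall>s\<in>S. f s = t s" using T(3) by auto
      have tH: "t \<in> H" using spH[OF T(1)] t(1) by auto
      have fC: "f \<in> carrier ?H" "t \<in> carrier ?H" using HD(3)[OF f] HD(3)[OF tH] .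
      have fv: "f x \<in> carrier W" "t x \<in> carrier W" "(f \<ominus>\<^bsub>?H\<^esub> t) x = f x \<ominus>\<^bsub>W\<^esub> t x" if "x \<in> carrier U" for x
        using hom_closed[OF ev[OF that]] hom_diff[OF mH W ev[OF that]] fC by auto
      have "f \<ominus>\<^bsub>?H\<^esub> t \<in> H0" using HD(6)[OF f tH] t(2) SU fv by (auto simp: H0_def W.minus_eq_zero_iff subset_iff)
      then have "(f \<ominus>\<^bsub>?H\<^esub> t) a \<in> (\<lambda>f. f a) ` mspan R ?H (F ` V)" unfolding evF by (rule imageI)
      then obtain t' where t': "(f \<ominus>\<^bsub>?H\<^esub> t) a = t' a" "t' \<in> mspan R ?H (F ` V)" by (rule imageE)
      have t'0: "t' \<in> H0" using t'(2) FH0 by auto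
      have t'C: "t' \<in> carrier ?H" using submodD(3)[OF mH H0 t'0] .
      show "\<exists>t\<in>mspan R ?H (T \<union> F ` V). \<forall>s\<in>insert a S. f s = t s"
      proof (rule bexI)
        show "t \<oplus>\<^bsub>?H\<^esub> t' \<in> mspan R ?H (T \<union> F ` V)"
          using submodD(5)[OF mH sp[OF TF]] t(1) t'(2) mspan_mono[of T "T \<union> F ` V" R ?H] mspan_mono[of "F ` V" "T \<union> F ` V" R ?H]
          by auto
        have "f a = t a \<oplus>\<^bsub>W\<^esub> (f a \<ominus>\<^bsub>W\<^esub> t a)" using fv(1,2)[OF aU] W.minus_plus_cancel' by (simp add: W.a_comm)
        then show "\<forall>s\<in>insert a S. f s = (t \<oplus>\<^bsub>?H\<^esub> t') s"
          using t' fv(3)[OF aU] t(2) t'0 SU aU fv(2) by (auto simp: Hom_apply H0_def subset_iff)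
      qed
    qed (use TF T(2) V(2) in auto)
  qed
  then obtain T where T: "T \<subseteq> H" "finite T" "\<And>f. f \<in> H \<Longrightarrow> \<exists>t\<in>mspan R ?H T. \<forall>s\<in>S. f s = t s" by auto
  have "f \<in> mspan R ?H T" if f: "f \<in> H" for f
  proof -
    obtain t where t: "t \<in> mspan R ?H T" "\<forall>s\<in>S. f s = t s" using T(3)[OF f] by auto
    have tH: "t \<in> H" using spH[OF T(1)] t(1) by auto
    have fC: "f \<in> carrier ?H" "t \<in> carrier ?H" using HD(3)[OF f] HD(3)[OF tH] .
    have "f = t"
    proof (rule Hom_eqI[OF fC])
      fix x assume "x \<in> carrier U"
      then show "f x = t x"
        using hom_eq_on_span[OF S(1) W _ _ S(2), of f t x] fC t(2) S(4) by (simp add: Hom_carrier)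
    qed
    then show ?thesis using t(1) by simp
  qed
  then show ?thesis using T spH[OF T(1)] by (intro exI[of _ T]) auto
qed

lemma fgm_Hom: assumes "fgm R U" "fgm R W" shows "fgm R (Hom_module R U W)"
proof -
  have m: "module R U" "module R W" using assms by (auto simp: fgm_def)
  have mH: "module R (Hom_module R U W)" by (rule module_Hom[OF m])
  have "\<exists>T. T \<subseteq> carrier (Hom_module R U W) \<and> finite T \<and> mspan R (Hom_module R U W) T = carrier (Hom_module R U W)"
    by (rule Hom_submod_fg[OF assms(1) m(2) submod_carrier[OF mH] submod_carrier[OF m(2)]])
       (use assms(2) in \<open>auto simp: Hom_carrier hom_closed\<close>)
  then show ?thesis using mH by (auto simp: fgm_def)
qed

lemma fgm_self: "fgm R (self_module R)"
proof -
  have "mspan R (self_module R) {\<one>} = carrier R"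
  proof
    have s: "submodule (mspan R (self_module R) {\<one>}) R (self_module R)" by (rule mspan_submod[OF module_self[OF is_cring]]) simp
    note D = submodD[OF module_self[OF is_cring] s, simplified]
    show "mspan R (self_module R) {\<one>} \<subseteq> carrier R" by (rule D(1))
    show "carrier R \<subseteq> mspan R (self_module R) {\<one>}"
    proof
      fix r assume r: "r \<in> carrier R"
      have "r \<otimes> \<one> \<in> mspan R (self_module R) {\<one>}" by (rule D(7)[OF r]) (use mspan_superset[of "{\<one>}" R "self_module R"] in simp)
      then show "r \<in> mspan R (self_module R) {\<one>}" using r by simp
    qed
  qed
  then show ?thesis unfolding fgm_def using module_self[OF is_cring] by (intro conjI exI[of _ "{\<one>}"]) simp_all
qed

end

section \<open>Ext into a module with an injective resolution\<close>

abbreviation addmul :: "('a,'b,'m) module_scheme \<Rightarrow> 'b set \<Rightarrow> 'a \<Rightarrow> 'b set" where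
  "addmul M A x \<equiv> msum M A ((\<lambda>u. x \<odot>\<^bsub>M\<^esub> u) ` carrier M)"

text \<open>In terms of multiplication by \<open>x\<close> on M / A, \<open>colon_submod\<close>
  describes the kernel and \<open>addmul\<close> the cokernel.\<close>

definition colon_submod :: "('a,'b,'m) module_scheme \<Rightarrow> 'b set \<Rightarrow> 'a \<Rightarrow> 'b set" where
  "colon_submod M A x = {u \<in> carrier M. x \<odot>\<^bsub>M\<^esub> u \<in> A}"

lemma (in cring) submod_colon_submod: "module R M \<Longrightarrow> submodule A R M \<Longrightarrow> x \<in> carrier R \<Longrightarrow> submodule (colon_submod M A x) R M"
  unfolding colon_submod_def by (rule submod_vimage) (auto intro: hom_smult_id)

lemma (in cring) submod_addmul: "module R M \<Longrightarrow> submodule A R M \<Longrightarrow> x \<in> carrier R \<Longrightarrow> submodule (addmul M A x) R M"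
  by (intro submod_msum submod_smult_all)

lemma (in cring) addmul_superset:
  assumes "module R M" "submodule A R M" "x \<in> carrier R"
  shows "A \<subseteq> addmul M A x" "u \<in> carrier M \<Longrightarrow> x \<odot>\<^bsub>M\<^esub> u \<in> addmul M A x"
  using msum_superset[OF assms(1,2) submod_smult_all[OF assms(1,3)]] by auto

lemma hom_addmul_zero:
  assumes "module R M" "module R N" "f \<in> mod_hom R M N" "submodule A R M" "x \<in> carrier R"
    and "\<And>a. a \<in> A \<Longrightarrow> f a = \<zero>\<^bsub>N\<^esub>" "\<And>u. u \<in> carrier M \<Longrightarrow> f (x \<odot>\<^bsub>M\<^esub> u) = \<zero>\<^bsub>N\<^esub>" "z \<in> addmul M A x"
  shows "f z = \<zero>\<^bsub>N\<^esub>"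
proof -
  interpret M: module R M by fact
  interpret N: module R N by fact
  obtain a b where z: "a \<in> A" "b \<in> (\<lambda>u. x \<odot>\<^bsub>M\<^esub> u) ` carrier M" "z = a \<oplus>\<^bsub>M\<^esub> b" using assms(8) by (rule msumE)
  from z(2) obtain u where u: "b = x \<odot>\<^bsub>M\<^esub> u" "u \<in> carrier M" by (rule imageE)
  have "a \<in> carrier M" using submodD(3)[OF assms(1,4) z(1)] .
  then show ?thesis using z u assms(5-7) by (simp add: hom_add[OF assms(3)])
qed

text \<open>An injective resolution of a finitely generated module, with no bound on its length. The
  modules of the resolution have a type of their own and need not be finitely generated.\<close>

locale inj_res = noetherian_local_ring R for R (structure) +
  fixes \<omega> :: "('a,'w,'z) module_scheme" and E :: "nat \<Rightarrow> ('a,'v) module" and D h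
  assumes fg_omega: "fgm R \<omega>" and res: "right_resolution R \<omega> E D h"
    and inj: "\<And>i. injective_module R (E i)"
begin

lemma modE: "module R (E i)" and modW: "module R \<omega>"
  using res fg_omega by (auto simp: right_resolution_def fgm_def)

lemma D_hom: "D i \<in> mod_hom R (E i) (E (Suc i))" and h_hom: "h \<in> mod_hom R \<omega> (E 0)"
  using res by (auto simp: right_resolution_def)

lemma DD: assumes "e \<in> carrier (E i)" shows "D (Suc i) (D i e) = \<zero>\<^bsub>E (Suc (Suc i))\<^esub>"
proof -
  have "mod_ker (E (Suc i)) (E (Suc (Suc i))) (D (Suc i)) = D i ` carrier (E i)" using res by (simp add: right_resolution_def)
  moreover have "D i e \<in> D i ` carrier (E i)" using assms by (rule imageI)
  ultimately show ?thesis by (auto simp: mod_ker_def)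
qed

lemma D_exact: assumes "e \<in> carrier (E (Suc i))" "D (Suc i) e = \<zero>\<^bsub>E (Suc (Suc i))\<^esub>" shows "\<exists>e'\<in>carrier (E i). D i e' = e"
proof -
  have "mod_ker (E (Suc i)) (E (Suc (Suc i))) (D (Suc i)) = D i ` carrier (E i)" using res by (simp add: right_resolution_def)
  then have "e \<in> D i ` carrier (E i)" using assms by (auto simp: mod_ker_def)
  then show ?thesis by (elim imageE) auto
qed

lemma h_ker: assumes "w \<in> carrier \<omega>" shows "h w = \<zero>\<^bsub>E 0\<^esub> \<longleftrightarrow> w = \<zero>\<^bsub>\<omega>\<^esub>"
proof -
  have "mod_ker \<omega> (E 0) h = {\<zero>\<^bsub>\<omega>\<^esub>}" using res by (simp add: right_resolution_def)
  then show ?thesis using assms hom_zero[OF modW modE h_hom] by (auto simp: mod_ker_def)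
qed

lemma h_exact: assumes "e \<in> carrier (E 0)" shows "D 0 e = \<zero>\<^bsub>E 1\<^esub> \<longleftrightarrow> e \<in> h ` carrier \<omega>"
proof -
  have "mod_ker (E 0) (E 1) (D 0) = h ` carrier \<omega>" using res by (simp add: right_resolution_def)
  then show ?thesis using assms by (auto simp: mod_ker_def)
qed

lemma Dz: "D i \<zero>\<^bsub>E i\<^esub> = \<zero>\<^bsub>E (Suc i)\<^esub>" by (rule hom_zero[OF modE modE D_hom])

lemmas Dc = hom_closed[OF D_hom]

lemma DhomI: "f \<in> mod_hom R U (E i) \<Longrightarrow> (\<lambda>x. D i (f x)) \<in> mod_hom R U (E (Suc i))"
  by (rule hom_comp[OF _ D_hom])

text \<open>\<open>Ext\<close> in degree \<open>j + 1\<close> from \<open>U / A\<close> to \<open>\<omega>\<close> vanishes: a map on \<open>U / A\<close> is a map on \<open>U\<close> that is zero on \<open>A\<close>.\<close>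

definition Ext_vanish :: "nat \<Rightarrow> ('a,'x,'y) module_scheme \<Rightarrow> 'x set \<Rightarrow> bool" where
  "Ext_vanish j U A \<longleftrightarrow> (\<forall>f\<in>mod_hom R U (E (Suc j)). (\<forall>x\<in>A. f x = \<zero>\<^bsub>E (Suc j)\<^esub>) \<longrightarrow>
      (\<forall>x\<in>carrier U. D (Suc j) (f x) = \<zero>\<^bsub>E (Suc (Suc j))\<^esub>) \<longrightarrow>
      (\<exists>g\<in>mod_hom R U (E j). (\<forall>x\<in>A. g x = \<zero>\<^bsub>E j\<^esub>) \<and> (\<forall>x\<in>carrier U. D j (g x) = f x)))"

lemma Ext_vanishI:
  assumes "\<And>f. f \<in> mod_hom R U (E (Suc j)) \<Longrightarrow> (\<And>x. x \<in> A \<Longrightarrow> f x = \<zero>\<^bsub>E (Suc j)\<^esub>) \<Longrightarrow>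
      (\<And>x. x \<in> carrier U \<Longrightarrow> D (Suc j) (f x) = \<zero>\<^bsub>E (Suc (Suc j))\<^esub>) \<Longrightarrow>
      \<exists>g\<in>mod_hom R U (E j). (\<forall>x\<in>A. g x = \<zero>\<^bsub>E j\<^esub>) \<and> (\<forall>x\<in>carrier U. D j (g x) = f x)"
  shows "Ext_vanish j U A"
  using assms unfolding Ext_vanish_def by simp

lemma Ext_vanishD:
  assumes "Ext_vanish j U A" "f \<in> mod_hom R U (E (Suc j))" "\<And>x. x \<in> A \<Longrightarrow> f x = \<zero>\<^bsub>E (Suc j)\<^esub>"
      "\<And>x. x \<in> carrier U \<Longrightarrow> D (Suc j) (f x) = \<zero>\<^bsub>E (Suc (Suc j))\<^esub>"
  obtains g where "g \<in> mod_hom R U (E j)" "\<And>x. x \<in> A \<Longrightarrow> g x = \<zero>\<^bsub>E j\<^esub>" "\<And>x. x \<in> carrier U \<Longrightarrow> D j (g x) = f x"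
proof -
  have "\<exists>g\<in>mod_hom R U (E j). (\<forall>x\<in>A. g x = \<zero>\<^bsub>E j\<^esub>) \<and> (\<forall>x\<in>carrier U. D j (g x) = f x)"
    using assms unfolding Ext_vanish_def by simp
  then show ?thesis using that by (elim bexE conjE) simp
qed

text \<open>Multiplication by \<open>x\<close> embeds \<open>U / (A : x)\<close> into \<open>U / A\<close>, with cokernel \<open>U / (A + x U)\<close>, which gives a
  long exact sequence of \<open>Ext\<close> modules.\<close>

lemma ext_smult:
  assumes U: "fgm R U" and A: "submodule A R U" and x: "x \<in> carrier R" and g: "g \<in> mod_hom R U (E i)"
    and gz: "\<And>u. u \<in> carrier U \<Longrightarrow> x \<odot>\<^bsub>U\<^esub> u \<in> A \<Longrightarrow> g u = \<zero>\<^bsub>E i\<^esub>"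
  obtains k where "k \<in> mod_hom R U (E i)" "\<And>a. a \<in> A \<Longrightarrow> k a = \<zero>\<^bsub>E i\<^esub>" "\<And>u. u \<in> carrier U \<Longrightarrow> k (x \<odot>\<^bsub>U\<^esub> u) = g u"
proof -
  have mU: "module R U" using U by (simp add: fgm_def)
  note AD = submodD[OF mU A]
  let ?B = "(\<lambda>u. x \<odot>\<^bsub>U\<^esub> u) ` carrier U"
  have B: "submodule ?B R U" by (rule submod_smult_all[OF mU x])
  \<comment> \<open>The map is first defined on x U, then glued with zero on \<open>A\<close>, and
    finally extended to \<open>U\<close> by injectivity.\<close>
  have "\<exists>q\<in>mod_hom R (U \<restriction> ?B) (E i). \<forall>u\<in>carrier U. q (x \<odot>\<^bsub>U\<^esub> u) = g u"
  proof (rule hom_factor[OF mU module_sub[OF mU B] modE _ _ g])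
    show "(\<lambda>u. x \<odot>\<^bsub>U\<^esub> u) \<in> mod_hom R U (U \<restriction> ?B)" by (rule hom_cod_sub[OF hom_smult_id[OF mU x]]) auto
    fix u assume "u \<in> carrier U" "x \<odot>\<^bsub>U\<^esub> u = \<zero>\<^bsub>U \<restriction> ?B\<^esub>"
    then show "g u = \<zero>\<^bsub>E i\<^esub>" using gz AD(2) by simp
  qed simp
  then obtain q where q: "q \<in> mod_hom R (U \<restriction> ?B) (E i)" "\<And>u. u \<in> carrier U \<Longrightarrow> q (x \<odot>\<^bsub>U\<^esub> u) = g u" by metis
  have "\<exists>k\<in>mod_hom R (U \<restriction> msum U A ?B) (E i). (\<forall>z\<in>A. k z = \<zero>\<^bsub>E i\<^esub>) \<and> (\<forall>z\<in>?B. k z = q z)"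
  proof (rule hom_glue[OF mU modE A B hom_zero_map[OF modE] q(1)])
    fix z assume z: "z \<in> A" "z \<in> ?B"
    then obtain u where u: "z = x \<odot>\<^bsub>U\<^esub> u" "u \<in> carrier U" by (elim imageE)
    then show "\<zero>\<^bsub>E i\<^esub> = q z" using q(2)[OF u(2)] gz[OF u(2)] z(1) by simp
  qed
  then obtain k where k: "k \<in> mod_hom R (U \<restriction> msum U A ?B) (E i)" "\<forall>z\<in>A. k z = \<zero>\<^bsub>E i\<^esub>" "\<forall>z\<in>?B. k z = q z" by metis
  have sub: "submodule (msum U A ?B) R U" by (rule submod_msum[OF mU A B])
  obtain l where l: "l \<in> mod_hom R U (E i)" "\<forall>z\<in>msum U A ?B. l z = k z"
    using inj_extend[OF inj U sub k(1)] by metis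
  note sup = msum_superset[OF mU A B]
  show thesis
  proof (rule that[OF l(1)])
    show "l a = \<zero>\<^bsub>E i\<^esub>" if "a \<in> A" for a using l(2) k(2) sup(1) that by auto
    fix u assume u: "u \<in> carrier U"
    then have "x \<odot>\<^bsub>U\<^esub> u \<in> ?B" by (rule imageI)
    then have "l (x \<odot>\<^bsub>U\<^esub> u) = q (x \<odot>\<^bsub>U\<^esub> u)" using l(2) k(3) sup(2) by auto
    then show "l (x \<odot>\<^bsub>U\<^esub> u) = g u" using q(2)[OF u] by simp
  qed
qed

lemma cocycle_diff:
  assumes U: "module R U" and f: "f \<in> mod_hom R U (E (Suc j))" and g: "g \<in> mod_hom R U (E j)" and x: "x \<in> carrier U"
  shows "D (Suc j) (f x \<ominus>\<^bsub>E (Suc j)\<^esub> D j (g x)) = D (Suc j) (f x)"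
proof -
  interpret E2: module R "E (Suc (Suc j))" by (rule modE)
  have c: "f x \<in> carrier (E (Suc j))" "D j (g x) \<in> carrier (E (Suc j))" "g x \<in> carrier (E j)"
    using hom_closed[OF f x] hom_closed[OF g x] Dc by auto
  show ?thesis using hom_diff[OF modE modE D_hom c(1,2)] DD[OF c(3)] Dc[OF c(1)]
    by (simp add: a_minus_def a_inv_def)
qed

text \<open>The middle term of U/(A : x) \<rightarrow> U/A \<rightarrow> U/(A + x U). A cocycle
  \<open>f\<close> on U/A becomes a coboundary of \<open>g'\<close> after pulling back along
  multiplication by \<open>x\<close>. Extending \<open>g'\<close> to \<open>g\<close> on U/A and
  subtracting the differential of \<open>g\<close> turns \<open>f\<close> into a cocycle on the
  cokernel.\<close>

lemma Ext_vanish_of_colon: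
  assumes U: "fgm R U" and A: "submodule A R U" and x: "x \<in> carrier R"
    and v: "Ext_vanish j U (colon_submod U A x)" "Ext_vanish j U (addmul U A x)"
  shows "Ext_vanish j U A"
proof (rule Ext_vanishI)
  fix f assume f: "f \<in> mod_hom R U (E (Suc j))" and fA: "\<And>a. a \<in> A \<Longrightarrow> f a = \<zero>\<^bsub>E (Suc j)\<^esub>"
    and fD: "\<And>u. u \<in> carrier U \<Longrightarrow> D (Suc j) (f u) = \<zero>\<^bsub>E (Suc (Suc j))\<^esub>"
  have mU: "module R U" using U by (simp add: fgm_def)
  interpret U: module R U by (rule mU)
  interpret E: module R "E j" by (rule modE)
  interpret E1: module R "E (Suc j)" by (rule modE)
  note AD = submodD[OF mU A]
  have fx: "(\<lambda>u. f (x \<odot>\<^bsub>U\<^esub> u)) \<in> mod_hom R U (E (Suc j))" by (rule hom_comp[OF hom_smult_id[OF mU x] f])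
  obtain g' where g': "g' \<in> mod_hom R U (E j)" "\<And>u. u \<in> colon_submod U A x \<Longrightarrow> g' u = \<zero>\<^bsub>E j\<^esub>"
     "\<And>u. u \<in> carrier U \<Longrightarrow> D j (g' u) = f (x \<odot>\<^bsub>U\<^esub> u)"
    by (rule Ext_vanishD[OF v(1) fx]) (use fA fD x in \<open>auto simp: colon_submod_def\<close>)
  obtain g where g: "g \<in> mod_hom R U (E j)" "\<And>a. a \<in> A \<Longrightarrow> g a = \<zero>\<^bsub>E j\<^esub>" "\<And>u. u \<in> carrier U \<Longrightarrow> g (x \<odot>\<^bsub>U\<^esub> u) = g' u"
    by (rule ext_smult[OF U A x g'(1)]) (use g'(2) in \<open>auto simp: colon_submod_def\<close>)
  let ?k = "\<lambda>u. f u \<ominus>\<^bsub>E (Suc j)\<^esub> D j (g u)"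
  have k: "?k \<in> mod_hom R U (E (Suc j))" by (rule hom_minus[OF modE f DhomI[OF g(1)]])
  have kz: "?k z = \<zero>\<^bsub>E (Suc j)\<^esub>" if "z \<in> addmul U A x" for z
  proof (rule hom_addmul_zero[OF mU modE k A x _ _ that])
    show "?k a = \<zero>\<^bsub>E (Suc j)\<^esub>" if "a \<in> A" for a using fA[OF that] g(2)[OF that] Dz by (simp add: E1.minus_eq_zero_iff)
    show "?k (x \<odot>\<^bsub>U\<^esub> u) = \<zero>\<^bsub>E (Suc j)\<^esub>" if "u \<in> carrier U" for u
      using g(3)[OF that] g'(3)[OF that] hom_closed[OF fx that] by (simp add: E1.minus_eq_zero_iff)
  qed
  obtain g'' where g'': "g'' \<in> mod_hom R U (E j)" "\<And>u. u \<in> addmul U A x \<Longrightarrow> g'' u = \<zero>\<^bsub>E j\<^esub>"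
     "\<And>u. u \<in> carrier U \<Longrightarrow> D j (g'' u) = ?k u"
    by (rule Ext_vanishD[OF v(2) k kz]) (use fD cocycle_diff[OF mU f g(1)] in auto)
  show "\<exists>g\<in>mod_hom R U (E j). (\<forall>x\<in>A. g x = \<zero>\<^bsub>E j\<^esub>) \<and> (\<forall>x\<in>carrier U. D j (g x) = f x)"
  proof (rule bexI[OF _ hom_plus[OF modE g''(1) g(1)]], intro conjI ballI)
    show "g'' a \<oplus>\<^bsub>E j\<^esub> g a = \<zero>\<^bsub>E j\<^esub>" if "a \<in> A" for a
      using g''(2)[of a] g(2)[OF that] addmul_superset(1)[OF mU A x] that by auto
    fix u assume u: "u \<in> carrier U"
    have c: "f u \<in> carrier (E (Suc j))" "D j (g u) \<in> carrier (E (Suc j))" using hom_closed[OF f u] hom_closed[OF g(1) u] Dc by auto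
    show "D j (g'' u \<oplus>\<^bsub>E j\<^esub> g u) = f u"
      using hom_add[OF D_hom hom_closed[OF g''(1) u] hom_closed[OF g(1) u]] g''(3)[OF u] E1.minus_plus_cancel'[OF c] by simp
  qed
qed

text \<open>In the same sequence the Ext of U/(A : s) lies between the Ext of U/A in the same degree
  and the Ext of the cokernel one degree higher. Later this goes from R modulo a regular sequence to
  the residue field.\<close>

lemma Ext_vanish_colon:
  assumes U: "fgm R U" and A: "submodule A R U" and s: "s \<in> carrier R"
    and v: "Ext_vanish j U A" "Ext_vanish (Suc j) U (addmul U A s)"
  shows "Ext_vanish j U (colon_submod U A s)"
proof (rule Ext_vanishI)
  fix f assume f: "f \<in> mod_hom R U (E (Suc j))" and fA: "\<And>a. a \<in> colon_submod U A s \<Longrightarrow> f a = \<zero>\<^bsub>E (Suc j)\<^esub>"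
    and fD: "\<And>u. u \<in> carrier U \<Longrightarrow> D (Suc j) (f u) = \<zero>\<^bsub>E (Suc (Suc j))\<^esub>"
  have mU: "module R U" using U by (simp add: fgm_def)
  interpret U: module R U by (rule mU)
  interpret E1: module R "E (Suc j)" by (rule modE)
  interpret E2: module R "E (Suc (Suc j))" by (rule modE)
  note AD = submodD[OF mU A] and sup = addmul_superset[OF mU A s]
  obtain k where k: "k \<in> mod_hom R U (E (Suc j))" "\<And>a. a \<in> A \<Longrightarrow> k a = \<zero>\<^bsub>E (Suc j)\<^esub>" "\<And>u. u \<in> carrier U \<Longrightarrow> k (s \<odot>\<^bsub>U\<^esub> u) = f u"
    by (rule ext_smult[OF U A s f]) (use fA in \<open>auto simp: colon_submod_def\<close>)
  have Dk: "(\<lambda>u. D (Suc j) (k u)) \<in> mod_hom R U (E (Suc (Suc j)))" by (rule DhomI[OF k(1)])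
  have Dkz: "D (Suc j) (k z) = \<zero>\<^bsub>E (Suc (Suc j))\<^esub>" if "z \<in> addmul U A s" for z
    by (rule hom_addmul_zero[OF mU modE Dk A s _ _ that]) (use k fD Dz in auto)
  obtain g where g: "g \<in> mod_hom R U (E (Suc j))" "\<And>u. u \<in> addmul U A s \<Longrightarrow> g u = \<zero>\<^bsub>E (Suc j)\<^esub>"
     "\<And>u. u \<in> carrier U \<Longrightarrow> D (Suc j) (g u) = D (Suc j) (k u)"
    by (rule Ext_vanishD[OF v(2) Dk Dkz]) (use DD hom_closed[OF k(1)] in auto)
  let ?l = "\<lambda>u. k u \<ominus>\<^bsub>E (Suc j)\<^esub> g u"
  have l: "?l \<in> mod_hom R U (E (Suc j))" by (rule hom_minus[OF modE k(1) g(1)])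
  have lA: "?l a = \<zero>\<^bsub>E (Suc j)\<^esub>" if "a \<in> A" for a using k(2)[OF that] g(2)[of a] sup(1) that by (auto simp: E1.minus_eq_zero_iff)
  have lD: "D (Suc j) (?l u) = \<zero>\<^bsub>E (Suc (Suc j))\<^esub>" if u: "u \<in> carrier U" for u
    using hom_diff[OF modE modE D_hom hom_closed[OF k(1) u] hom_closed[OF g(1) u]] g(3)[OF u] Dc[OF hom_closed[OF k(1) u]]
    by (simp add: E2.minus_eq_zero_iff)
  obtain q where q: "q \<in> mod_hom R U (E j)" "\<And>u. u \<in> A \<Longrightarrow> q u = \<zero>\<^bsub>E j\<^esub>"
     "\<And>u. u \<in> carrier U \<Longrightarrow> D j (q u) = ?l u"
    by (rule Ext_vanishD[OF v(1) l lA lD]) auto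
  show "\<exists>g\<in>mod_hom R U (E j). (\<forall>x\<in>colon_submod U A s. g x = \<zero>\<^bsub>E j\<^esub>) \<and> (\<forall>x\<in>carrier U. D j (g x) = f x)"
  proof (rule bexI[OF _ hom_comp[OF hom_smult_id[OF mU s] q(1)]], intro conjI ballI)
    show "q (s \<odot>\<^bsub>U\<^esub> u) = \<zero>\<^bsub>E j\<^esub>" if "u \<in> colon_submod U A s" for u using that q(2) by (simp add: colon_submod_def)
    fix u assume u: "u \<in> carrier U"
    have su: "s \<odot>\<^bsub>U\<^esub> u \<in> carrier U" using s u by simp
    show "D j (q (s \<odot>\<^bsub>U\<^esub> u)) = f u" using q(3)[OF su] k(3)[OF u] g(2)[OF sup(2)[OF u]] hom_closed[OF f u]
      by (simp add: a_minus_def a_inv_def)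
  qed
qed

text \<open>For regular \<open>x\<close> the kernel term is U/A itself, so the Ext of the cokernel
  is caught between the Ext of U/A in two neighbouring degrees.\<close>

lemma Ext_vanish_mult_quot:
  assumes U: "fgm R U" and A: "submodule A R U" and x: "x \<in> carrier R"
    and reg: "\<And>u. u \<in> carrier U \<Longrightarrow> x \<odot>\<^bsub>U\<^esub> u \<in> A \<Longrightarrow> u \<in> A"
    and v: "Ext_vanish j U A" "Ext_vanish (Suc j) U A"
  shows "Ext_vanish (Suc j) U (addmul U A x)"
proof (rule Ext_vanishI)
  let ?j = "Suc j"
  fix f assume f: "f \<in> mod_hom R U (E (Suc ?j))" and fA: "\<And>a. a \<in> addmul U A x \<Longrightarrow> f a = \<zero>\<^bsub>E (Suc ?j)\<^esub>"
    and fD: "\<And>u. u \<in> carrier U \<Longrightarrow> D (Suc ?j) (f u) = \<zero>\<^bsub>E (Suc (Suc ?j))\<^esub>"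
  have mU: "module R U" using U by (simp add: fgm_def)
  interpret U: module R U by (rule mU)
  interpret E1: module R "E (Suc j)" by (rule modE)
  interpret E2: module R "E (Suc (Suc j))" by (rule modE)
  note AD = submodD[OF mU A] and sup = addmul_superset[OF mU A x]
  obtain g where g: "g \<in> mod_hom R U (E (Suc j))" "\<And>u. u \<in> A \<Longrightarrow> g u = \<zero>\<^bsub>E (Suc j)\<^esub>"
     "\<And>u. u \<in> carrier U \<Longrightarrow> D (Suc j) (g u) = f u"
    by (rule Ext_vanishD[OF v(2) f fA]) (use fD sup in auto)
  have gx: "(\<lambda>u. g (x \<odot>\<^bsub>U\<^esub> u)) \<in> mod_hom R U (E (Suc j))" by (rule hom_comp[OF hom_smult_id[OF mU x] g(1)])
  obtain h' where h': "h' \<in> mod_hom R U (E j)" "\<And>u. u \<in> A \<Longrightarrow> h' u = \<zero>\<^bsub>E j\<^esub>"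
     "\<And>u. u \<in> carrier U \<Longrightarrow> D j (h' u) = g (x \<odot>\<^bsub>U\<^esub> u)"
    by (rule Ext_vanishD[OF v(1) gx]) (use g fA sup(2) AD(7)[OF x] x in auto)
  obtain k where k: "k \<in> mod_hom R U (E j)" "\<And>a. a \<in> A \<Longrightarrow> k a = \<zero>\<^bsub>E j\<^esub>" "\<And>u. u \<in> carrier U \<Longrightarrow> k (x \<odot>\<^bsub>U\<^esub> u) = h' u"
    by (rule ext_smult[OF U A x h'(1)]) (use h'(2) reg in auto)
  let ?l = "\<lambda>u. g u \<ominus>\<^bsub>E (Suc j)\<^esub> D j (k u)"
  have l: "?l \<in> mod_hom R U (E (Suc j))" by (rule hom_minus[OF modE g(1) DhomI[OF k(1)]])
  show "\<exists>g\<in>mod_hom R U (E ?j). (\<forall>x\<in>addmul U A x. g x = \<zero>\<^bsub>E ?j\<^esub>) \<and> (\<forall>x\<in>carrier U. D ?j (g x) = f x)"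
  proof (rule bexI[OF _ l], intro conjI ballI)
    show "?l z = \<zero>\<^bsub>E (Suc j)\<^esub>" if "z \<in> addmul U A x" for z
    proof (rule hom_addmul_zero[OF mU modE l A x _ _ that])
      show "?l a = \<zero>\<^bsub>E (Suc j)\<^esub>" if "a \<in> A" for a using k(2)[OF that] g(2)[OF that] Dz by (simp add: E1.minus_eq_zero_iff)
      show "?l (x \<odot>\<^bsub>U\<^esub> u) = \<zero>\<^bsub>E (Suc j)\<^esub>" if u: "u \<in> carrier U" for u
        using k(3)[OF u] h'(3)[OF u] hom_closed[OF gx u] by (simp add: E1.minus_eq_zero_iff)
    qed
    show "D (Suc j) (?l u) = f u" if u: "u \<in> carrier U" for u
      using cocycle_diff[OF mU g(1) k(1) u] g(3)[OF u] by simp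
  qed
qed

text \<open>In the long exact sequence the cokernel of \<open>y\<close> on the Ext of U/A embeds
  into the Ext of U/(A + y U) one degree higher. Here \<open>f\<close> is even equal to
  \<open>y g\<close>, with no coboundary left over, because \<open>ext_smult\<close> divides the map
  itself.\<close>

lemma cocycle_divisible:
  assumes U: "fgm R U" and A: "submodule A R U" and y: "y \<in> carrier R"
    and reg: "\<And>u. u \<in> carrier U \<Longrightarrow> y \<odot>\<^bsub>U\<^esub> u \<in> A \<Longrightarrow> u \<in> A"
    and v: "Ext_vanish (Suc j) U (addmul U A y)"
    and f: "f \<in> mod_hom R U (E (Suc j))" and fA: "\<And>a. a \<in> A \<Longrightarrow> f a = \<zero>\<^bsub>E (Suc j)\<^esub>"
    and fD: "\<And>u. u \<in> carrier U \<Longrightarrow> D (Suc j) (f u) = \<zero>\<^bsub>E (Suc (Suc j))\<^esub>"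
  obtains g where "g \<in> mod_hom R U (E (Suc j))" "\<And>a. a \<in> A \<Longrightarrow> g a = \<zero>\<^bsub>E (Suc j)\<^esub>"
    "\<And>u. u \<in> carrier U \<Longrightarrow> D (Suc j) (g u) = \<zero>\<^bsub>E (Suc (Suc j))\<^esub>" "\<And>u. u \<in> carrier U \<Longrightarrow> f u = y \<odot>\<^bsub>E (Suc j)\<^esub> g u"
proof -
  have mU: "module R U" using U by (simp add: fgm_def)
  interpret U: module R U by (rule mU)
  interpret E1: module R "E (Suc j)" by (rule modE)
  interpret E2: module R "E (Suc (Suc j))" by (rule modE)
  note AD = submodD[OF mU A] and sup = addmul_superset[OF mU A y]
  obtain k where k: "k \<in> mod_hom R U (E (Suc j))" "\<And>a. a \<in> A \<Longrightarrow> k a = \<zero>\<^bsub>E (Suc j)\<^esub>" "\<And>u. u \<in> carrier U \<Longrightarrow> k (y \<odot>\<^bsub>U\<^esub> u) = f u"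
    by (rule ext_smult[OF U A y f]) (use fA reg in auto)
  have Dk: "(\<lambda>u. D (Suc j) (k u)) \<in> mod_hom R U (E (Suc (Suc j)))" by (rule DhomI[OF k(1)])
  have Dkz: "D (Suc j) (k z) = \<zero>\<^bsub>E (Suc (Suc j))\<^esub>" if "z \<in> addmul U A y" for z
    by (rule hom_addmul_zero[OF mU modE Dk A y _ _ that]) (use k fD Dz in auto)
  obtain g where g: "g \<in> mod_hom R U (E (Suc j))" "\<And>u. u \<in> addmul U A y \<Longrightarrow> g u = \<zero>\<^bsub>E (Suc j)\<^esub>"
     "\<And>u. u \<in> carrier U \<Longrightarrow> D (Suc j) (g u) = D (Suc j) (k u)"
    by (rule Ext_vanishD[OF v Dk Dkz]) (use DD hom_closed[OF k(1)] in auto)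
  let ?l = "\<lambda>u. k u \<ominus>\<^bsub>E (Suc j)\<^esub> g u"
  have l: "?l \<in> mod_hom R U (E (Suc j))" by (rule hom_minus[OF modE k(1) g(1)])
  show thesis
  proof (rule that[OF l])
    show "?l a = \<zero>\<^bsub>E (Suc j)\<^esub>" if "a \<in> A" for a using k(2)[OF that] g(2)[of a] sup(1) that by (auto simp: E1.minus_eq_zero_iff)
    show "D (Suc j) (?l u) = \<zero>\<^bsub>E (Suc (Suc j))\<^esub>" if u: "u \<in> carrier U" for u
      using hom_diff[OF modE modE D_hom hom_closed[OF k(1) u] hom_closed[OF g(1) u]] g(3)[OF u] Dc[OF hom_closed[OF k(1) u]]
      by (simp add: E2.minus_eq_zero_iff)
    show "f u = y \<odot>\<^bsub>E (Suc j)\<^esub> ?l u" if u: "u \<in> carrier U" for u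
      using hom_smult[OF l y u] k(3)[OF u] g(2)[OF sup(2)[OF u]] hom_closed[OF f u] by (simp add: a_minus_def a_inv_def)
  qed
qed

text \<open>Degree 1 is the obstruction to extending maps. Composed with the inclusion of \<omega>
  into \<open>E 0\<close> the map extends to some \<open>k\<close>. The differential of
  \<open>k\<close> vanishes on \<open>A\<close>, hence is the differential of a map \<open>g\<close>
  that vanishes on \<open>A\<close>, and the difference of \<open>k\<close> and \<open>g\<close> has
  values in \<omega> again.\<close>

lemma hom_ext_of_Ext_vanish:
  assumes U: "fgm R U" and A: "submodule A R U" and v: "Ext_vanish 0 U A" and f: "f \<in> mod_hom R (U \<restriction> A) \<omega>"
  shows "\<exists>g\<in>mod_hom R U \<omega>. \<forall>a\<in>A. g a = f a"
proof -
  have mU: "module R U" using U by (simp add: fgm_def)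
  interpret U: module R U by (rule mU)
  interpret E0: module R "E 0" by (rule modE)
  interpret E1: module R "E (Suc 0)" by (rule modE)
  note AD = submodD[OF mU A]
  obtain k where k: "k \<in> mod_hom R U (E 0)" "\<forall>a\<in>A. k a = h (f a)"
    using inj_extend[OF inj U A hom_comp[OF f h_hom]] by metis
  have fa: "f a \<in> carrier \<omega>" if "a \<in> A" for a using hom_closed[OF f] that by simp
  have Dk: "(\<lambda>u. D 0 (k u)) \<in> mod_hom R U (E (Suc 0))" by (rule DhomI[OF k(1)])
  have Dka: "D 0 (k a) = \<zero>\<^bsub>E (Suc 0)\<^esub>" if a: "a \<in> A" for a
    using k(2) a h_exact[OF hom_closed[OF h_hom fa[OF a]]] fa[OF a] by simp
  obtain g where g: "g \<in> mod_hom R U (E 0)" "\<And>u. u \<in> A \<Longrightarrow> g u = \<zero>\<^bsub>E 0\<^esub>" "\<And>u. u \<in> carrier U \<Longrightarrow> D 0 (g u) = D 0 (k u)"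
    by (rule Ext_vanishD[OF v Dk Dka]) (use DD hom_closed[OF k(1)] in auto)
  let ?l = "\<lambda>u. k u \<ominus>\<^bsub>E 0\<^esub> g u"
  have l: "?l \<in> mod_hom R U (E 0)" by (rule hom_minus[OF modE k(1) g(1)])
  have lw: "?l u \<in> h ` carrier \<omega>" if u: "u \<in> carrier U" for u
  proof -
    have "D 0 (?l u) = \<zero>\<^bsub>E 1\<^esub>"
      using hom_diff[OF modE modE D_hom hom_closed[OF k(1) u] hom_closed[OF g(1) u]] g(3)[OF u] Dc[OF hom_closed[OF k(1) u]]
      by (simp add: E1.minus_eq_zero_iff)
    then show ?thesis using h_exact[OF hom_closed[OF l u]] by simp
  qed
  have hinj: "inj_on h (carrier \<omega>)" using hom_inj_iff[OF modW modE h_hom] h_ker by simp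
  have him: "submodule (h ` carrier \<omega>) R (E 0)" by (rule submod_image[OF modW modE h_hom submod_carrier[OF modW]])
  have h': "h \<in> mod_hom R \<omega> (E 0 \<restriction> (h ` carrier \<omega>))" by (rule hom_cod_sub[OF h_hom]) simp
  have "inv_into (carrier \<omega>) h \<in> mod_hom R (E 0 \<restriction> (h ` carrier \<omega>)) \<omega>"
    by (rule hom_inv[OF modW module_sub[OF modE him] h']) (simp add: bij_betw_def hinj)
  moreover have "?l \<in> mod_hom R U (E 0 \<restriction> (h ` carrier \<omega>))" by (rule hom_cod_sub[OF l]) (use lw in auto)
  ultimately have m: "(\<lambda>u. inv_into (carrier \<omega>) h (?l u)) \<in> mod_hom R U \<omega>" by (rule hom_comp[rotated])
  show ?thesis
  proof (rule bexI[OF _ m], rule ballI)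
    fix a assume a: "a \<in> A"
    have "?l a = h (f a)" using k(2) a g(2)[OF a] hom_closed[OF h_hom fa[OF a]] by (simp add: a_minus_def a_inv_def)
    then show "inv_into (carrier \<omega>) h (?l a) = f a" using inv_into_f_f[OF hinj fa[OF a]] by simp
  qed
qed

text \<open>The Ext of \<open>A\<close> lies between the Ext of \<open>U\<close> in the same degree
  and the Ext of U/A one degree higher. The obstruction to extending a cocycle from \<open>A\<close>
  to \<open>U\<close> lives on U/A.\<close>

lemma Ext_vanish_submodule:
  assumes U: "fgm R U" and A: "submodule A R U" and v: "Ext_vanish j U {\<zero>\<^bsub>U\<^esub>}" "Ext_vanish (Suc j) U A"
  shows "Ext_vanish j (U \<restriction> A) {\<zero>\<^bsub>U\<^esub>}"
proof (rule Ext_vanishI, simp_all)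
  fix f assume f: "f \<in> mod_hom R (U \<restriction> A) (E (Suc j))" and f0: "f \<zero>\<^bsub>U\<^esub> = \<zero>\<^bsub>E (Suc j)\<^esub>"
    and fD: "\<And>u. u \<in> A \<Longrightarrow> D (Suc j) (f u) = \<zero>\<^bsub>E (Suc (Suc j))\<^esub>"
  have mU: "module R U" using U by (simp add: fgm_def)
  interpret U: module R U by (rule mU)
  interpret E1: module R "E (Suc j)" by (rule modE)
  interpret E2: module R "E (Suc (Suc j))" by (rule modE)
  note AD = submodD[OF mU A]
  obtain k where k: "k \<in> mod_hom R U (E (Suc j))" "\<forall>a\<in>A. k a = f a"
    using inj_extend[OF inj U A f] by metis
  have Dk: "(\<lambda>u. D (Suc j) (k u)) \<in> mod_hom R U (E (Suc (Suc j)))" by (rule DhomI[OF k(1)])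
  obtain g where g: "g \<in> mod_hom R U (E (Suc j))" "\<And>u. u \<in> A \<Longrightarrow> g u = \<zero>\<^bsub>E (Suc j)\<^esub>"
     "\<And>u. u \<in> carrier U \<Longrightarrow> D (Suc j) (g u) = D (Suc j) (k u)"
    by (rule Ext_vanishD[OF v(2) Dk]) (use DD hom_closed[OF k(1)] k(2) fD in auto)
  let ?l = "\<lambda>u. k u \<ominus>\<^bsub>E (Suc j)\<^esub> g u"
  have l: "?l \<in> mod_hom R U (E (Suc j))" by (rule hom_minus[OF modE k(1) g(1)])
  have lD: "D (Suc j) (?l u) = \<zero>\<^bsub>E (Suc (Suc j))\<^esub>" if u: "u \<in> carrier U" for u
      using hom_diff[OF modE modE D_hom hom_closed[OF k(1) u] hom_closed[OF g(1) u]] g(3)[OF u] Dc[OF hom_closed[OF k(1) u]]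
      by (simp add: E2.minus_eq_zero_iff)
  have l0: "?l x = \<zero>\<^bsub>E (Suc j)\<^esub>" if "x \<in> {\<zero>\<^bsub>U\<^esub>}" for x using that hom_zero[OF mU modE l] by simp
  obtain q where q: "q \<in> mod_hom R U (E j)" "\<And>u. u \<in> {\<zero>\<^bsub>U\<^esub>} \<Longrightarrow> q u = \<zero>\<^bsub>E j\<^esub>" "\<And>u. u \<in> carrier U \<Longrightarrow> D j (q u) = ?l u"
    by (rule Ext_vanishD[OF v(1) l l0 lD]) auto
  show "\<exists>g\<in>mod_hom R (U \<restriction> A) (E j). g \<zero>\<^bsub>U\<^esub> = \<zero>\<^bsub>E j\<^esub> \<and> (\<forall>x\<in>A. D j (g x) = f x)"
  proof (rule bexI[OF _ hom_dom_sub[OF q(1) AD(1)]], intro conjI ballI)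
    show "q \<zero>\<^bsub>U\<^esub> = \<zero>\<^bsub>E j\<^esub>" using q(2) by simp
    fix a assume a: "a \<in> A"
    have "f a \<in> carrier (E (Suc j))" using hom_closed[OF f, of a] a by simp
    then show "D j (q a) = f a" using q(3)[OF AD(3)[OF a]] g(2)[OF a] k(2) a by (simp add: a_minus_def a_inv_def)
  qed
qed

text \<open>The passage from a module \<open>W\<close> to a pair that represents it as a quotient;
  cocycles on the pair factor through \<open>p\<close>.\<close>

lemma Ext_vanish_of_surj:
  assumes U: "module R U" and W: "module R W" and p: "p \<in> mod_hom R U W" "p ` carrier U = carrier W"
    and A: "A = {u \<in> carrier U. p u = \<zero>\<^bsub>W\<^esub>}" and v: "Ext_vanish j W {\<zero>\<^bsub>W\<^esub>}"
  shows "Ext_vanish j U A"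
proof (rule Ext_vanishI)
  fix f assume f: "f \<in> mod_hom R U (E (Suc j))" and fA: "\<And>a. a \<in> A \<Longrightarrow> f a = \<zero>\<^bsub>E (Suc j)\<^esub>"
    and fD: "\<And>u. u \<in> carrier U \<Longrightarrow> D (Suc j) (f u) = \<zero>\<^bsub>E (Suc (Suc j))\<^esub>"
  obtain k where k: "k \<in> mod_hom R W (E (Suc j))" "\<And>x. x \<in> carrier U \<Longrightarrow> k (p x) = f x"
    using hom_factor[OF U W modE p f] fA A by auto
  have kD: "D (Suc j) (k w) = \<zero>\<^bsub>E (Suc (Suc j))\<^esub>" if w: "w \<in> carrier W" for w
  proof -
    obtain u where "w = p u" "u \<in> carrier U" using w unfolding p(2)[symmetric] by (rule imageE)
    then show ?thesis using k(2) fD by simp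
  qed
  have k0: "k x = \<zero>\<^bsub>E (Suc j)\<^esub>" if "x \<in> {\<zero>\<^bsub>W\<^esub>}" for x using that hom_zero[OF W modE k(1)] by simp
  obtain q where q: "q \<in> mod_hom R W (E j)" "\<And>u. u \<in> {\<zero>\<^bsub>W\<^esub>} \<Longrightarrow> q u = \<zero>\<^bsub>E j\<^esub>" "\<And>u. u \<in> carrier W \<Longrightarrow> D j (q u) = k u"
    by (rule Ext_vanishD[OF v k(1) k0 kD]) auto
  show "\<exists>g\<in>mod_hom R U (E j). (\<forall>x\<in>A. g x = \<zero>\<^bsub>E j\<^esub>) \<and> (\<forall>x\<in>carrier U. D j (g x) = f x)"
    by (rule bexI[OF _ hom_comp[OF p(1) q(1)]]) (use q k(2) A hom_closed[OF p(1)] in auto)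
qed

lemma Ext_vanish_iso:
  assumes U: "module R U" and W: "module R W" and p: "p \<in> mod_hom R U W" "bij_betw p (carrier U) (carrier W)"
    and v: "Ext_vanish j W {\<zero>\<^bsub>W\<^esub>}"
  shows "Ext_vanish j U {\<zero>\<^bsub>U\<^esub>}"
proof (rule Ext_vanish_of_surj[OF U W p(1) _ _ v])
  show "p ` carrier U = carrier W" using p(2) by (simp add: bij_betw_def)
  show "{\<zero>\<^bsub>U\<^esub>} = {u \<in> carrier U. p u = \<zero>\<^bsub>W\<^esub>}"
  proof -
    have "\<forall>x\<in>carrier U. p x = \<zero>\<^bsub>W\<^esub> \<longrightarrow> x = \<zero>\<^bsub>U\<^esub>" using hom_inj_iff[OF U W p(1)] bij_betw_imp_inj_on[OF p(2)] by simp
    then show ?thesis using hom_zero[OF U W p(1)] module_zero_closed[OF U] by blast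
  qed
qed

lemma Ext_vanish_fin_mod: "Ext_vanish j (fin_mod R S) {\<zero>\<^bsub>fin_mod R S\<^esub>}"
proof (rule Ext_vanishI)
  fix f assume f: "f \<in> mod_hom R (fin_mod R S) (E (Suc j))"
    and fD: "\<And>u. u \<in> carrier (fin_mod R S) \<Longrightarrow> D (Suc j) (f u) = \<zero>\<^bsub>E (Suc (Suc j))\<^esub>"
  have im: "f ` carrier (fin_mod R S) \<subseteq> D j ` carrier (E j)"
  proof
    fix y assume "y \<in> f ` carrier (fin_mod R S)"
    then obtain u where u: "y = f u" "u \<in> carrier (fin_mod R S)" by (rule imageE)
    obtain e where "e \<in> carrier (E j)" "D j e = f u" using D_exact[OF hom_closed[OF f u(2)] fD[OF u(2)]] by (elim bexE)
    then show "y \<in> D j ` carrier (E j)" using u(1) by (intro image_eqI[of _ _ e]) simp_all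
  qed
  obtain g where g: "g \<in> mod_hom R (fin_mod R S) (E j)" "\<forall>x\<in>carrier (fin_mod R S). D j (g x) = f x"
    using fin_mod_lift[OF modE modE f D_hom im] by metis
  then show "\<exists>g\<in>mod_hom R (fin_mod R S) (E j). (\<forall>x\<in>{\<zero>\<^bsub>fin_mod R S\<^esub>}. g x = \<zero>\<^bsub>E j\<^esub>) \<and> (\<forall>x\<in>carrier (fin_mod R S). D j (g x) = f x)"
    using hom_zero[OF module_fin_mod modE g(1)] by (intro bexI[of _ g]) auto
qed

lemma Ext_vanish_self: "Ext_vanish j (self_module R) {\<zero>}"
proof -
  interpret S: module R "self_module R" by (rule module_self[OF is_cring])
  have "Ext_vanish j (self_module R) {\<zero>\<^bsub>self_module R\<^esub>}"
  proof (rule Ext_vanishI)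
    fix f assume f: "f \<in> mod_hom R (self_module R) (E (Suc j))"
      and fD: "\<And>u. u \<in> carrier (self_module R) \<Longrightarrow> D (Suc j) (f u) = \<zero>\<^bsub>E (Suc (Suc j))\<^esub>"
    obtain e where e: "e \<in> carrier (E j)" "D j e = f \<one>"
      using D_exact[OF hom_closed[OF f] fD, of \<one>] by auto
    have "D j (r \<odot>\<^bsub>E j\<^esub> e) = f r" if "r \<in> carrier R" for r
      using hom_smult[OF D_hom that e(1)] hom_self_eq[OF is_cring f that] e(2) by simp
    then show "\<exists>g\<in>mod_hom R (self_module R) (E j). (\<forall>x\<in>{\<zero>\<^bsub>self_module R\<^esub>}. g x = \<zero>\<^bsub>E j\<^esub>) \<and> (\<forall>x\<in>carrier (self_module R). D j (g x) = f x)"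
      using hom_smult_elem[OF modE e(1)] hom_zero[OF module_self[OF is_cring] modE hom_smult_elem[OF modE e(1)]]
      by (intro bexI[of _ "\<lambda>r. r \<odot>\<^bsub>E j\<^esub> e"]) auto
  qed
  then show ?thesis by simp
qed

end

section \<open>Finite generation of Ext\<close>

context inj_res begin

text \<open>The cocycles of Hom(U/A, E), viewed inside Hom(U, E). They are extensional, so that they
  form a submodule of \<open>Hom_module\<close> and Nakayama's lemma can be applied to them.\<close>

definition inj_cocycles :: "nat \<Rightarrow> ('a,'x,'y) module_scheme \<Rightarrow> 'x set \<Rightarrow> ('x \<Rightarrow> 'v) set" where
  "inj_cocycles i U A = {f \<in> carrier (Hom_module R U (E i)). (\<forall>x\<in>A. f x = \<zero>\<^bsub>E i\<^esub>) \<and>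
     (\<forall>x\<in>carrier U. D i (f x) = \<zero>\<^bsub>E (Suc i)\<^esub>)}"

fun inj_coboundaries :: "nat \<Rightarrow> ('a,'x,'y) module_scheme \<Rightarrow> 'x set \<Rightarrow> ('x \<Rightarrow> 'v) set" where
  "inj_coboundaries 0 U A = {\<zero>\<^bsub>Hom_module R U (E 0)\<^esub>}"
| "inj_coboundaries (Suc i) U A = (\<lambda>g. \<lambda>x\<in>carrier U. D i (g x)) ` {g \<in> carrier (Hom_module R U (E i)). \<forall>x\<in>A. g x = \<zero>\<^bsub>E i\<^esub>}"

lemma submod_killers:
  assumes U: "module R U" and A: "submodule A R U" and W: "module R W"
  shows "submodule {g \<in> carrier (Hom_module R U W). \<forall>x\<in>A. g x = \<zero>\<^bsub>W\<^esub>} R (Hom_module R U W)"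
proof (rule submodI[OF module_Hom[OF U W]])
  interpret W: module R W by (rule W)
  interpret H: module R "Hom_module R U W" by (rule module_Hom[OF U W])
  have AU: "x \<in> carrier U" if "x \<in> A" for x using submodD(3)[OF U A that] .
  show "\<zero>\<^bsub>Hom_module R U W\<^esub> \<in> {g \<in> carrier (Hom_module R U W). \<forall>x\<in>A. g x = \<zero>\<^bsub>W\<^esub>}"
    using AU H.zero_closed by (simp add: Hom_apply del: H.zero_closed)
  fix f g assume "f \<in> {g \<in> carrier (Hom_module R U W). \<forall>x\<in>A. g x = \<zero>\<^bsub>W\<^esub>}" "g \<in> {g \<in> carrier (Hom_module R U W). \<forall>x\<in>A. g x = \<zero>\<^bsub>W\<^esub>}"
  then show "f \<oplus>\<^bsub>Hom_module R U W\<^esub> g \<in> {g \<in> carrier (Hom_module R U W). \<forall>x\<in>A. g x = \<zero>\<^bsub>W\<^esub>}"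
    using AU H.add.m_closed[of f g] by (simp add: Hom_apply)
next
  interpret W: module R W by (rule W)
  interpret H: module R "Hom_module R U W" by (rule module_Hom[OF U W])
  have AU: "x \<in> carrier U" if "x \<in> A" for x using submodD(3)[OF U A that] .
  fix r g assume "r \<in> carrier R" "g \<in> {g \<in> carrier (Hom_module R U W). \<forall>x\<in>A. g x = \<zero>\<^bsub>W\<^esub>}"
  then show "r \<odot>\<^bsub>Hom_module R U W\<^esub> g \<in> {g \<in> carrier (Hom_module R U W). \<forall>x\<in>A. g x = \<zero>\<^bsub>W\<^esub>}"
    using AU H.smult_closed[of r g] by (simp add: Hom_apply del: H.smult_closed)
qed auto

lemma postcomp_hom:
  assumes U: "module R U" and W: "module R W" "module R Y" and p: "p \<in> mod_hom R W Y"
  shows "(\<lambda>g. \<lambda>x\<in>carrier U. p (g x)) \<in> mod_hom R (Hom_module R U W) (Hom_module R U Y)"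
proof (rule mod_homI)
  interpret U: module R U by (rule U)
  fix f assume f: "f \<in> carrier (Hom_module R U W)"
  then have fh: "f \<in> mod_hom R U W" by (simp add: Hom_carrier)
  then show "(\<lambda>x\<in>carrier U. p (f x)) \<in> carrier (Hom_module R U Y)" using restrict_in_Hom[OF U hom_comp[OF fh p]] by simp
  show "(\<lambda>x\<in>carrier U. p ((f \<oplus>\<^bsub>Hom_module R U W\<^esub> g) x)) = (\<lambda>x\<in>carrier U. p (f x)) \<oplus>\<^bsub>Hom_module R U Y\<^esub> (\<lambda>x\<in>carrier U. p (g x))"
    if "g \<in> carrier (Hom_module R U W)" for g
  proof -
    have gh: "g \<in> mod_hom R U W" using that by (simp add: Hom_carrier)
    show ?thesis using hom_add[OF p] hom_closed[OF fh] hom_closed[OF gh] by (simp add: Hom_apply cong: restrict_cong)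
  qed
  show "(\<lambda>x\<in>carrier U. p ((a \<odot>\<^bsub>Hom_module R U W\<^esub> f) x)) = a \<odot>\<^bsub>Hom_module R U Y\<^esub> (\<lambda>x\<in>carrier U. p (f x))"
    if "a \<in> carrier R" for a
    using hom_smult[OF p that] hom_closed[OF fh] by (simp add: Hom_apply cong: restrict_cong)
qed

lemma submod_inj_cocycles:
  assumes U: "module R U" and A: "submodule A R U"
  shows "submodule (inj_cocycles i U A) R (Hom_module R U (E i))"
proof -
  have s1: "submodule {g \<in> carrier (Hom_module R U (E i)). \<forall>x\<in>A. g x = \<zero>\<^bsub>E i\<^esub>} R (Hom_module R U (E i))" by (rule submod_killers[OF U A modE])
  have s2: "submodule {g \<in> carrier (Hom_module R U (E i)). (\<lambda>x\<in>carrier U. D i (g x)) = \<zero>\<^bsub>Hom_module R U (E (Suc i))\<^esub>} R (Hom_module R U (E i))"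
    by (rule submod_ker[OF module_Hom[OF U modE] module_Hom[OF U modE] postcomp_hom[OF U modE modE D_hom]])
  have "(\<lambda>x\<in>carrier U. D i (g x)) = \<zero>\<^bsub>Hom_module R U (E (Suc i))\<^esub> \<longleftrightarrow> (\<forall>x\<in>carrier U. D i (g x) = \<zero>\<^bsub>E (Suc i)\<^esub>)" for g
    unfolding Hom_apply by (auto simp: fun_eq_iff restrict_def)
  then have "inj_cocycles i U A = {g \<in> carrier (Hom_module R U (E i)). \<forall>x\<in>A. g x = \<zero>\<^bsub>E i\<^esub>} \<inter>
      {g \<in> carrier (Hom_module R U (E i)). (\<lambda>x\<in>carrier U. D i (g x)) = \<zero>\<^bsub>Hom_module R U (E (Suc i))\<^esub>}"
    unfolding inj_cocycles_def by blast
  then show ?thesis using submod_Int[OF module_Hom[OF U modE] s1 s2] by simp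
qed

lemma submod_inj_coboundaries:
  assumes U: "module R U" and A: "submodule A R U"
  shows "submodule (inj_coboundaries i U A) R (Hom_module R U (E i))"
proof (cases i)
  case 0 then show ?thesis using submod_zero[OF module_Hom[OF U modE]] by simp
next
  case (Suc k)
  show ?thesis unfolding Suc inj_coboundaries.simps
    by (rule submod_image[OF module_Hom[OF U modE] module_Hom[OF U modE] postcomp_hom[OF U modE modE D_hom] submod_killers[OF U A modE]])
qed

lemma inj_coboundaries_Suc_le_inj_cocycles:
  assumes U: "module R U" and A: "submodule A R U" shows "inj_coboundaries (Suc i) U A \<subseteq> inj_cocycles (Suc i) U A"
proof
  fix f assume "f \<in> inj_coboundaries (Suc i) U A"
  then obtain g where g: "f = (\<lambda>x\<in>carrier U. D i (g x))" "g \<in> mod_hom R U (E i)" "\<forall>x\<in>A. g x = \<zero>\<^bsub>E i\<^esub>"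
    by (auto simp: Hom_carrier)
  have AU: "x \<in> carrier U" if "x \<in> A" for x using submodD(3)[OF U A that] .
  show "f \<in> inj_cocycles (Suc i) U A" unfolding inj_cocycles_def g(1)
    using restrict_in_Hom[OF U DhomI[OF g(2)]] g(3) AU Dz DD[OF hom_closed[OF g(2)]] by simp
qed

text \<open>The \<open>i\<close>-th \<open>Ext\<close> from \<open>U / A\<close> to \<open>\<omega>\<close> is finitely generated.\<close>

definition Ext_fg :: "nat \<Rightarrow> ('a,'x,'y) module_scheme \<Rightarrow> 'x set \<Rightarrow> bool" where
  "Ext_fg i U A \<longleftrightarrow> (\<exists>S. finite S \<and> S \<subseteq> inj_cocycles i U A \<and> inj_cocycles i U A \<subseteq> mspan R (Hom_module R U (E i)) (S \<union> inj_coboundaries i U A))"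

text \<open>The module \<open>E 0\<close> need not be finitely generated, but cocycles of degree 0
  have values in the image of \<omega>, which is.\<close>

lemma Ext_fg_0:
  assumes U: "fgm R U" and A: "submodule A R U" shows "Ext_fg 0 U A"
proof -
  have mU: "module R U" using U by (simp add: fgm_def)
  have him: "submodule (h ` carrier \<omega>) R (E 0)" by (rule submod_image[OF modW modE h_hom submod_carrier[OF modW]])
  have "fgm R (E 0 \<restriction> (h ` carrier \<omega>))"
    by (rule fgm_image[OF fg_omega module_sub[OF modE him] hom_cod_sub[OF h_hom]]) auto
  moreover have "f x \<in> h ` carrier \<omega>" if f: "f \<in> inj_cocycles 0 U A" and x: "x \<in> carrier U" for f x
  proof -
    have "f \<in> mod_hom R U (E 0)" and D0: "D 0 (f x) = \<zero>\<^bsub>E (Suc 0)\<^esub>" using f x by (auto simp: inj_cocycles_def Hom_carrier)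
    then have "f x \<in> carrier (E 0)" using hom_closed x by metis
    then show ?thesis using h_exact D0 by simp
  qed
  ultimately obtain S where S: "S \<subseteq> inj_cocycles 0 U A" "finite S" "mspan R (Hom_module R U (E 0)) S = inj_cocycles 0 U A"
    using Hom_submod_fg[OF U modE submod_inj_cocycles[OF mU A] him] by metis
  have "mspan R (Hom_module R U (E 0)) S \<subseteq> mspan R (Hom_module R U (E 0)) (S \<union> inj_coboundaries 0 U A)" by (rule mspan_mono[OF Un_upper1])
  then show ?thesis unfolding Ext_fg_def S(3) using S(1,2) by (intro exI[of _ S] conjI)
qed

text \<open>Dimension shifting: with \<open>K\<close> the kernel of the free cover F \<rightarrow>
  U/A, the connecting map from the Ext of \<open>K\<close> to that of U/A in the next degree is
  onto. A finite set of generators is carried over by it.\<close>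

lemma Ext_fg_Suc:
  assumes U: "fgm R U" and A: "submodule A R U" and p: "p \<in> mod_hom R (fin_mod R S0) U" "p ` carrier (fin_mod R S0) = carrier U"
    and S0: "finite S0"
    and K: "K = {u \<in> carrier (fin_mod R S0). p u \<in> A}" and fg: "Ext_fg i (fin_mod R S0 \<restriction> K) {\<zero>\<^bsub>fin_mod R S0\<^esub>}"
  shows "Ext_fg (Suc i) U A"
proof -
  let ?F = "fin_mod R S0" let ?FK = "?F \<restriction> K"
  have mU: "module R U" using U by (simp add: fgm_def)
  have mF: "module R ?F" by (rule module_fin_mod)
  have sK: "submodule K R ?F" unfolding K by (rule submod_vimage[OF mF mU p(1) A])
  have fF: "fgm R ?F" by (rule fgm_fin_mod[OF S0])
  have mK: "module R ?FK" by (rule module_sub[OF mF sK])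
  have zK: "submodule {\<zero>\<^bsub>?F\<^esub>} R ?FK" using submod_zero[OF mK] by simp
  note AD = submodD[OF mU A] and KD = submodD[OF mF sK]
  let ?HK = "Hom_module R ?FK (E i)" and ?HU = "Hom_module R U (E (Suc i))"
  have mHK: "module R ?HK" by (rule module_Hom[OF mK modE])
  have mHU: "module R ?HU" by (rule module_Hom[OF mU modE])
  interpret E: module R "E i" by (rule modE)
  interpret E1: module R "E (Suc i)" by (rule modE)
  \<comment> \<open>The connecting map as a relation between cocycles: some \<open>l\<close> on the
    free module extends \<open>k\<close> and has the pullback of \<open>f\<close> as its
    differential. A relation avoids the choices that a map would need.\<close>
  define Conn where "Conn k f \<longleftrightarrow> (\<exists>l\<in>mod_hom R ?F (E i). (\<forall>u\<in>K. l u = k u) \<and> (\<forall>u\<in>carrier ?F. D i (l u) = f (p u)))" for k f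
  have pc: "p u \<in> carrier U" if "u \<in> carrier ?F" for u using hom_closed[OF p(1) that] .
  have pK: "u \<in> K" if "u \<in> carrier ?F" "p u = \<zero>\<^bsub>U\<^esub>" for u using that AD(2) by (simp add: K)
  have psurj: "\<exists>u\<in>carrier ?F. x = p u" if x: "x \<in> carrier U" for x using x unfolding p(2)[symmetric] by (rule imageE) auto
  have tot: "\<exists>f\<in>inj_cocycles (Suc i) U A. Conn k f" if k: "k \<in> inj_cocycles i ?FK {\<zero>\<^bsub>?F\<^esub>}" for k
  proof -
    have kh: "k \<in> mod_hom R ?FK (E i)" "\<forall>u\<in>K. D i (k u) = \<zero>\<^bsub>E (Suc i)\<^esub>" using k by (auto simp: inj_cocycles_def Hom_carrier)
    obtain l where l: "l \<in> mod_hom R ?F (E i)" "\<forall>u\<in>K. l u = k u" using inj_extend[OF inj fF sK kh(1)] by metis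
    obtain f where f: "f \<in> mod_hom R U (E (Suc i))" "\<And>u. u \<in> carrier ?F \<Longrightarrow> f (p u) = D i (l u)"
      using hom_factor[OF mF mU modE p DhomI[OF l(1)]] pK l(2) kh(2) by auto
    have fA: "f a = \<zero>\<^bsub>E (Suc i)\<^esub>" if a: "a \<in> A" for a
    proof -
      obtain u where u: "u \<in> carrier ?F" "a = p u" using psurj[OF AD(3)[OF a]] by (elim bexE)
      then have "u \<in> K" using a by (simp add: K)
      then show ?thesis using f(2)[OF u(1)] u(2) l(2) kh(2) by simp
    qed
    have fD: "D (Suc i) (f x) = \<zero>\<^bsub>E (Suc (Suc i))\<^esub>" if x: "x \<in> carrier U" for x
    proof -
      obtain u where u: "u \<in> carrier ?F" "x = p u" using psurj[OF x] by (elim bexE)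
      then show ?thesis using f(2)[OF u(1)] DD[OF hom_closed[OF l(1) u(1)]] by simp
    qed
    have "restrict f (carrier U) \<in> inj_cocycles (Suc i) U A"
      using restrict_in_Hom[OF mU f(1)] fA fD AD(3) by (simp add: inj_cocycles_def)
    moreover have "Conn k (restrict f (carrier U))" unfolding Conn_def
      using l f(2) pc by (intro bexI[of _ l]) auto
    ultimately show ?thesis by (intro bexI)
  qed
  obtain S where S: "finite S" "S \<subseteq> inj_cocycles i ?FK {\<zero>\<^bsub>?F\<^esub>}" "inj_cocycles i ?FK {\<zero>\<^bsub>?F\<^esub>} \<subseteq> mspan R ?HK (S \<union> inj_coboundaries i ?FK {\<zero>\<^bsub>?F\<^esub>})"
    using fg unfolding Ext_fg_def by metis
  have "\<forall>k\<in>S. \<exists>f. f \<in> inj_cocycles (Suc i) U A \<and> Conn k f" using tot S(2) by (auto simp: subset_iff)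
  then obtain c where c: "\<And>k. k \<in> S \<Longrightarrow> c k \<in> inj_cocycles (Suc i) U A" "\<And>k. k \<in> S \<Longrightarrow> Conn k (c k)" by metis
  let ?N = "mspan R ?HU (c ` S \<union> inj_coboundaries (Suc i) U A)"
  have sub: "c ` S \<union> inj_coboundaries (Suc i) U A \<subseteq> carrier ?HU" using c(1) submodD(1)[OF mHU submod_inj_cocycles[OF mU A]] submodD(1)[OF mHU submod_inj_coboundaries[OF mU A]] by auto
  have sN: "submodule ?N R ?HU" by (rule mspan_submod[OF mHU sub])
  note ND = submodD[OF mHU sN]
  \<comment> \<open>The cocycles on \<open>K\<close> that are related to something in the span of
    the chosen cocycles and the coboundaries. This is a submodule, so it is enough to find the
    generators in it.\<close>
  define T where "T = {k \<in> inj_cocycles i ?FK {\<zero>\<^bsub>?F\<^esub>}. \<exists>f\<in>?N. Conn k f}"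
  note CD = submodD[OF mHK submod_inj_cocycles[OF mK zK, of i]]
  have Conn0: "Conn k \<zero>\<^bsub>?HU\<^esub>" if "l \<in> mod_hom R ?F (E i)" "\<And>u. u \<in> K \<Longrightarrow> l u = k u" "\<And>u. u \<in> carrier ?F \<Longrightarrow> D i (l u) = \<zero>\<^bsub>E (Suc i)\<^esub>" for k l
    unfolding Conn_def using that pc by (intro bexI[of _ l]) (auto simp: Hom_apply)
  have sT: "submodule T R ?HK"
  proof (rule submodI[OF mHK])
    show "T \<subseteq> carrier ?HK" using CD(1) by (auto simp: T_def)
    have "Conn \<zero>\<^bsub>?HK\<^esub> \<zero>\<^bsub>?HU\<^esub>" by (rule Conn0[OF hom_zero_map[OF modE]]) (auto simp: Hom_apply Dz)
    then show "\<zero>\<^bsub>?HK\<^esub> \<in> T" using CD(2) ND(2) by (auto simp: T_def)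
    fix k k' assume "k \<in> T" "k' \<in> T"
    then obtain f f' where *: "k \<in> inj_cocycles i ?FK {\<zero>\<^bsub>?F\<^esub>}" "k' \<in> inj_cocycles i ?FK {\<zero>\<^bsub>?F\<^esub>}" "f \<in> ?N" "f' \<in> ?N" "Conn k f" "Conn k' f'"
      by (auto simp: T_def)
    obtain l where l: "l\<in>mod_hom R ?F (E i)" "\<forall>u\<in>K. l u = k u" "\<forall>u\<in>carrier ?F. D i (l u) = f (p u)" using *(5) unfolding Conn_def by metis
    obtain l' where l': "l'\<in>mod_hom R ?F (E i)" "\<forall>u\<in>K. l' u = k' u" "\<forall>u\<in>carrier ?F. D i (l' u) = f' (p u)" using *(6) unfolding Conn_def by metis
    have "Conn (k \<oplus>\<^bsub>?HK\<^esub> k') (f \<oplus>\<^bsub>?HU\<^esub> f')" unfolding Conn_def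
      using l l' pc hom_add[OF D_hom hom_closed[OF l(1)] hom_closed[OF l'(1)]]
      by (intro bexI[OF _ hom_plus[OF modE l(1) l'(1)]]) (auto simp: Hom_apply)
    then show "k \<oplus>\<^bsub>?HK\<^esub> k' \<in> T" using CD(5)[OF *(1,2)] ND(5)[OF *(3,4)] by (auto simp: T_def)
  next
    fix r k assume r: "r \<in> carrier R" and "k \<in> T"
    then obtain f where *: "k \<in> inj_cocycles i ?FK {\<zero>\<^bsub>?F\<^esub>}" "f \<in> ?N" "Conn k f" by (auto simp: T_def)
    obtain l where l: "l\<in>mod_hom R ?F (E i)" "\<forall>u\<in>K. l u = k u" "\<forall>u\<in>carrier ?F. D i (l u) = f (p u)" using *(3) unfolding Conn_def by metis
    have "Conn (r \<odot>\<^bsub>?HK\<^esub> k) (r \<odot>\<^bsub>?HU\<^esub> f)" unfolding Conn_def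
      using l pc hom_smult[OF D_hom r hom_closed[OF l(1)]]
      by (intro bexI[OF _ hom_scale[OF modE l(1) r]]) (auto simp: Hom_apply)
    then show "r \<odot>\<^bsub>?HK\<^esub> k \<in> T" using CD(7)[OF r *(1)] ND(7)[OF r *(2)] by (auto simp: T_def)
  qed
  have "S \<subseteq> T"
  proof
    fix k assume k: "k \<in> S"
    then have "c k \<in> ?N" by (intro subsetD[OF mspan_superset]) simp
    then show "k \<in> T" using c(2)[OF k] S(2) k by (auto simp only: T_def)
  qed
  moreover have "inj_coboundaries i ?FK {\<zero>\<^bsub>?F\<^esub>} \<inter> inj_cocycles i ?FK {\<zero>\<^bsub>?F\<^esub>} \<subseteq> T"
  proof
    fix k assume k: "k \<in> inj_coboundaries i ?FK {\<zero>\<^bsub>?F\<^esub>} \<inter> inj_cocycles i ?FK {\<zero>\<^bsub>?F\<^esub>}"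
    \<comment> \<open>A coboundary on \<open>K\<close> extends to a coboundary on the free module,
      whose differential is zero; in degree 0 the zero map does.\<close>
    have "\<exists>l\<in>mod_hom R ?F (E i). (\<forall>u\<in>K. l u = k u) \<and> (\<forall>u\<in>carrier ?F. D i (l u) = \<zero>\<^bsub>E (Suc i)\<^esub>)"
    proof (cases i)
      case 0
      then show ?thesis using k hom_zero_map[OF modE] Dz by (intro bexI[of _ "\<lambda>_. \<zero>\<^bsub>E i\<^esub>"]) (auto simp: Hom_apply)
    next
      case (Suc i')
      then obtain g where g: "k = (\<lambda>x\<in>K. D i' (g x))" "g \<in> mod_hom R ?FK (E i')" using k by (auto simp: Hom_carrier)
      obtain l where l: "l \<in> mod_hom R ?F (E i')" "\<forall>u\<in>K. l u = g u" using inj_extend[OF inj fF sK g(2)] by metis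
      show ?thesis unfolding Suc using DhomI[OF l(1)] l(2) g(1) DD[OF hom_closed[OF l(1)]]
        by (intro bexI[of _ "\<lambda>x. D i' (l x)"]) auto
    qed
    then have "Conn k \<zero>\<^bsub>?HU\<^esub>" using Conn0 by auto
    then show "k \<in> T" using k ND(2) by (auto simp: T_def)
  qed
  moreover have "inj_coboundaries i ?FK {\<zero>\<^bsub>?F\<^esub>} \<subseteq> inj_cocycles i ?FK {\<zero>\<^bsub>?F\<^esub>}"
    using inj_coboundaries_Suc_le_inj_cocycles[OF mK zK] CD(2) by (cases i) auto
  ultimately have "S \<union> inj_coboundaries i ?FK {\<zero>\<^bsub>?F\<^esub>} \<subseteq> T" by auto
  from order_trans[OF S(3) mspan_least[OF sT this]] have "inj_cocycles i ?FK {\<zero>\<^bsub>?F\<^esub>} \<subseteq> T" .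
  then have key: "\<exists>f\<in>?N. Conn k f" if "k \<in> inj_cocycles i ?FK {\<zero>\<^bsub>?F\<^esub>}" for k using that unfolding T_def by (simp only: subset_iff mem_Collect_eq)
  have "f \<in> ?N" if f: "f \<in> inj_cocycles (Suc i) U A" for f
  proof -
    have fh: "f \<in> carrier ?HU" "f \<in> mod_hom R U (E (Suc i))" "\<And>x. x \<in> A \<Longrightarrow> f x = \<zero>\<^bsub>E (Suc i)\<^esub>" "\<And>x. x \<in> carrier U \<Longrightarrow> D (Suc i) (f x) = \<zero>\<^bsub>E (Suc (Suc i))\<^esub>"
      using f by (auto simp: inj_cocycles_def Hom_carrier)
    have fp: "(\<lambda>u. f (p u)) \<in> mod_hom R ?F (E (Suc i))" by (rule hom_comp[OF p(1) fh(2)])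
    have fp0: "f (p x) = \<zero>\<^bsub>E (Suc i)\<^esub>" if "x \<in> {\<zero>\<^bsub>?F\<^esub>}" for x using that hom_zero[OF mF modE fp] by simp
    obtain g where g: "g \<in> mod_hom R ?F (E i)" "\<And>u. u \<in> {\<zero>\<^bsub>?F\<^esub>} \<Longrightarrow> g u = \<zero>\<^bsub>E i\<^esub>" "\<And>u. u \<in> carrier ?F \<Longrightarrow> D i (g u) = f (p u)"
      by (rule Ext_vanishD[OF Ext_vanish_fin_mod fp fp0]) (use fh(4) pc in auto)
    have gK: "D i (g u) = \<zero>\<^bsub>E (Suc i)\<^esub>" if "u \<in> K" for u
      using g(3)[OF KD(3)[OF that]] fh(3)[of "p u"] that by (simp add: K)
    have "restrict g K \<in> carrier ?HK" using restrict_in_Hom[OF mK hom_dom_sub[OF g(1) KD(1)]] by simp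
    then have "restrict g K \<in> inj_cocycles i ?FK {\<zero>\<^bsub>?F\<^esub>}" unfolding inj_cocycles_def
      using g(2) gK KD(2) by simp
    then obtain f' where f': "f' \<in> ?N" "Conn (restrict g K) f'" using key by metis
    obtain l where l: "l\<in>mod_hom R ?F (E i)" "\<forall>u\<in>K. l u = restrict g K u" "\<forall>u\<in>carrier ?F. D i (l u) = f' (p u)" using f'(2) unfolding Conn_def by metis
    \<comment> \<open>The differentials of \<open>g\<close> and \<open>l\<close> are the pullbacks
      of \<open>f\<close> and \<open>f'\<close>, and both maps agree on \<open>K\<close>. So their
      difference descends to \<open>U\<close>, vanishes on \<open>A\<close>, and shows that
      \<open>f\<close> and \<open>f'\<close> differ by a coboundary.\<close>
    have gl: "(\<lambda>u. g u \<ominus>\<^bsub>E i\<^esub> l u) \<in> mod_hom R ?F (E i)" by (rule hom_minus[OF modE g(1) l(1)])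
    have glK: "g u \<ominus>\<^bsub>E i\<^esub> l u = \<zero>\<^bsub>E i\<^esub>" if "u \<in> K" for u using l(2) that hom_closed[OF g(1) KD(3)[OF that]] by (simp add: E.minus_eq_zero_iff)
    obtain e where e: "e \<in> mod_hom R U (E i)" "\<And>u. u \<in> carrier ?F \<Longrightarrow> e (p u) = g u \<ominus>\<^bsub>E i\<^esub> l u"
      using hom_factor[OF mF mU modE p gl] pK glK by auto
    have eA: "e a = \<zero>\<^bsub>E i\<^esub>" if a: "a \<in> A" for a
    proof -
      obtain u where u: "u \<in> carrier ?F" "a = p u" using psurj[OF AD(3)[OF a]] by (elim bexE)
      then have "u \<in> K" using a by (simp add: K)
      then show ?thesis using e(2)[OF u(1)] u(2) glK by simp
    qed
    have f'c: "f' \<in> carrier ?HU" using ND(3)[OF f'(1)] .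
    have f'h: "f' \<in> mod_hom R U (E (Suc i))" using f'c by (simp add: Hom_carrier)
    define b where "b = (\<lambda>x\<in>carrier U. D i (restrict e (carrier U) x))"
    have b: "b \<in> inj_coboundaries (Suc i) U A" unfolding b_def inj_coboundaries.simps
      by (rule imageI, rule CollectI, intro conjI restrict_in_Hom[OF mU e(1)]) (use eA AD(3) in simp)
    then have bN: "b \<in> ?N" using mspan_superset[of "c ` S \<union> inj_coboundaries (Suc i) U A" R ?HU] by auto
    have "f = f' \<oplus>\<^bsub>?HU\<^esub> b"
    proof (rule Hom_eqI[OF fh(1)])
      show "f' \<oplus>\<^bsub>?HU\<^esub> b \<in> carrier ?HU" using ND(3)[OF ND(5)[OF f'(1) bN]] .
      fix x assume x: "x \<in> carrier U"
      then obtain u where u: "u \<in> carrier ?F" "x = p u" using psurj[OF x] by (elim bexE)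
      have "b x = D i (g u \<ominus>\<^bsub>E i\<^esub> l u)" using x e(2)[OF u(1)] by (simp add: b_def u(2))
      also have "\<dots> = f x \<ominus>\<^bsub>E (Suc i)\<^esub> f' x"
        using hom_diff[OF modE modE D_hom hom_closed[OF g(1) u(1)] hom_closed[OF l(1) u(1)]] g(3)[OF u(1)] l(3) u by simp
      finally show "f x = (f' \<oplus>\<^bsub>?HU\<^esub> b) x"
        using x hom_closed[OF fh(2) x] hom_closed[OF f'h x] E1.minus_plus_cancel'[of "f x" "f' x"] by (simp add: Hom_apply E1.a_comm)
    qed
    then show ?thesis using ND(5)[OF f'(1) bN] by simp
  qed
  then show ?thesis unfolding Ext_fg_def using S(1) c(1) by (intro exI[of _ "c ` S"]) auto
qed

text \<open>An induction cannot change the type of \<open>U\<close>. Kernels of covers by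
  \<open>fin_mod\<close> over sets of natural numbers all have this type, and
  \<open>Ext_fg_all\<close> prepends one step from an arbitrary type.\<close>

lemma Ext_fg_nat:
  fixes U :: "('a, nat \<Rightarrow> 'a) module"
  assumes "fgm R U" "submodule A R U" shows "Ext_fg i U A"
  using assms
proof (induction i arbitrary: U A)
  case 0 then show ?case by (rule Ext_fg_0)
next
  case (Suc i)
  obtain n p where p: "p \<in> mod_hom R (fin_mod R {..<n::nat}) U" "p ` carrier (fin_mod R {..<n}) = carrier U"
    using minimal_cover[OF Suc.prems(1)] by metis
  let ?K = "{u \<in> carrier (fin_mod R {..<n}). p u \<in> A}"
  have mU: "module R U" using Suc.prems(1) by (simp add: fgm_def)
  have sK: "submodule ?K R (fin_mod R {..<n})" by (rule submod_vimage[OF module_fin_mod mU p(1) Suc.prems(2)])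
  have "Ext_fg i (fin_mod R {..<n} \<restriction> ?K) {\<zero>\<^bsub>fin_mod R {..<n}\<^esub>}"
    by (rule Suc.IH[OF fgm_sub[OF fgm_fin_mod sK]])
       (use submod_zero[OF module_sub[OF module_fin_mod sK]] in auto)
  then show ?case by (intro Ext_fg_Suc[OF Suc.prems p _ refl]) auto
qed

lemma Ext_fg_all:
  assumes "fgm R U" "submodule A R U" shows "Ext_fg i U A"
proof (cases i)
  case 0 then show ?thesis using Ext_fg_0[OF assms] by simp
next
  case (Suc i')
  obtain n p where p: "p \<in> mod_hom R (fin_mod R {..<n::nat}) U" "p ` carrier (fin_mod R {..<n}) = carrier U"
    using minimal_cover[OF assms(1)] by metis
  let ?K = "{u \<in> carrier (fin_mod R {..<n}). p u \<in> A}"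
  have mU: "module R U" using assms(1) by (simp add: fgm_def)
  have sK: "submodule ?K R (fin_mod R {..<n})" by (rule submod_vimage[OF module_fin_mod mU p(1) assms(2)])
  have "Ext_fg i' (fin_mod R {..<n} \<restriction> ?K) {\<zero>\<^bsub>fin_mod R {..<n}\<^esub>}"
    by (rule Ext_fg_nat[OF fgm_sub[OF fgm_fin_mod sK]])
       (use submod_zero[OF module_sub[OF module_fin_mod sK]] in auto)
  then show ?thesis unfolding Suc by (intro Ext_fg_Suc[OF assms p _ refl]) auto
qed

text \<open>By the long exact sequence \<open>y\<close> acts surjectively on the \<open>Ext\<close> module that is to vanish, so Nakayama's
  lemma applies.\<close>

lemma Ext_vanish_descend:
  assumes U: "fgm R U" and A: "submodule A R U" and y: "y \<in> \<mm>"
    and reg: "\<And>u. u \<in> carrier U \<Longrightarrow> y \<odot>\<^bsub>U\<^esub> u \<in> A \<Longrightarrow> u \<in> A"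
    and v: "Ext_vanish (Suc j) U (addmul U A y)"
  shows "Ext_vanish j U A"
proof -
  have mU: "module R U" using U by (simp add: fgm_def)
  note AD = submodD[OF mU A]
  let ?H = "Hom_module R U (E (Suc j))"
  have mH: "module R ?H" by (rule module_Hom[OF mU modE])
  obtain S where S: "finite S" "S \<subseteq> inj_cocycles (Suc j) U A" "inj_cocycles (Suc j) U A \<subseteq> mspan R ?H (S \<union> inj_coboundaries (Suc j) U A)"
    using Ext_fg_all[OF U A, of "Suc j"] unfolding Ext_fg_def by metis
  have yR: "y \<in> carrier R" by (rule max_carr[OF y])
  have "inj_cocycles (Suc j) U A = inj_coboundaries (Suc j) U A"
  proof (rule nakayama[OF mH submod_inj_cocycles[OF mU A] submod_inj_coboundaries[OF mU A] inj_coboundaries_Suc_le_inj_cocycles[OF mU A] S])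
    let ?G = "inj_coboundaries (Suc j) U A \<union> {a \<odot>\<^bsub>?H\<^esub> x | a x. a \<in> \<mm> \<and> x \<in> inj_cocycles (Suc j) U A}"
    have "inj_cocycles (Suc j) U A \<subseteq> ?G"
    proof
      fix f assume f: "f \<in> inj_cocycles (Suc j) U A"
      then have fh: "f \<in> carrier ?H" "f \<in> mod_hom R U (E (Suc j))" "\<And>x. x \<in> A \<Longrightarrow> f x = \<zero>\<^bsub>E (Suc j)\<^esub>"
        "\<And>x. x \<in> carrier U \<Longrightarrow> D (Suc j) (f x) = \<zero>\<^bsub>E (Suc (Suc j))\<^esub>"
        by (auto simp: inj_cocycles_def Hom_carrier)
      obtain g where g: "g \<in> mod_hom R U (E (Suc j))" "\<And>a. a \<in> A \<Longrightarrow> g a = \<zero>\<^bsub>E (Suc j)\<^esub>"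
        "\<And>u. u \<in> carrier U \<Longrightarrow> D (Suc j) (g u) = \<zero>\<^bsub>E (Suc (Suc j))\<^esub>" "\<And>u. u \<in> carrier U \<Longrightarrow> f u = y \<odot>\<^bsub>E (Suc j)\<^esub> g u"
        by (rule cocycle_divisible[OF U A yR reg v fh(2-4)]) auto
      have g': "restrict g (carrier U) \<in> inj_cocycles (Suc j) U A"
        using restrict_in_Hom[OF mU g(1)] g(2,3) AD(3) by (simp add: inj_cocycles_def)
      have "f = y \<odot>\<^bsub>?H\<^esub> restrict g (carrier U)" unfolding Hom_apply
        using g(4) fh(1) by (intro restrict_eqI) (simp_all add: Hom_carrier)
      then show "f \<in> ?G" using y g' by blast
    qed
    also have "?G \<subseteq> mspan R ?H ?G" by (rule mspan_superset)
    finally show "inj_cocycles (Suc j) U A \<subseteq> mspan R ?H ?G" .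
  qed
  note eq = this
  show ?thesis
  proof (rule Ext_vanishI)
    fix f assume f: "f \<in> mod_hom R U (E (Suc j))" "\<And>a. a \<in> A \<Longrightarrow> f a = \<zero>\<^bsub>E (Suc j)\<^esub>"
      "\<And>u. u \<in> carrier U \<Longrightarrow> D (Suc j) (f u) = \<zero>\<^bsub>E (Suc (Suc j))\<^esub>"
    have "restrict f (carrier U) \<in> inj_cocycles (Suc j) U A"
      using restrict_in_Hom[OF mU f(1)] f(2,3) AD(3) by (simp add: inj_cocycles_def)
    then have "restrict f (carrier U) \<in> inj_coboundaries (Suc j) U A" unfolding eq .
    then obtain g where g: "restrict f (carrier U) = (\<lambda>x\<in>carrier U. D j (g x))" "g \<in> mod_hom R U (E j)" "\<forall>x\<in>A. g x = \<zero>\<^bsub>E j\<^esub>"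
      by (auto simp: Hom_carrier)
    have "D j (g x) = f x" if "x \<in> carrier U" for x using fun_cong[OF g(1), of x] that by simp
    then show "\<exists>g\<in>mod_hom R U (E j). (\<forall>x\<in>A. g x = \<zero>\<^bsub>E j\<^esub>) \<and> (\<forall>x\<in>carrier U. D j (g x) = f x)"
      using g(2,3) by (intro bexI[of _ g]) auto
  qed
qed

end

section \<open>Vanishing of Ext into the canonical module\<close>

text \<open>The Cohen-Macaulay property of the ring and of \<omega>, unpacked into regular chains
  whose length is the dimension \<open>d\<close>. The length \<open>n\<close> of the injective
  resolution is not related to \<open>d\<close>.\<close>

locale cm_inj_res = inj_res +
  fixes d n :: nat and xs :: "nat \<Rightarrow> 'a" and I :: "nat \<Rightarrow> 'a set" and ys :: "nat \<Rightarrow> 'a" and A\<omega> :: "nat \<Rightarrow> 'c set"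
  assumes dim: "krull_dim R = enat d"
    and xs: "regular_chain R (self_module R) xs I d" "I 0 = {\<zero>}" "I d \<noteq> carrier R"
    and ys: "regular_chain R \<omega> ys A\<omega> d" "A\<omega> 0 = {\<zero>\<^bsub>\<omega>\<^esub>}" "A\<omega> d \<noteq> carrier \<omega>"
    and E_zero: "\<And>i. i > n \<Longrightarrow> zero_module (E i)"
begin

lemma Ext_vanish_top: assumes "j \<ge> n" shows "Ext_vanish j U A"
proof (rule Ext_vanishI)
  fix f assume f: "f \<in> mod_hom R U (E (Suc j))"
  have "f u = \<zero>\<^bsub>E (Suc j)\<^esub>" if "u \<in> carrier U" for u
    using hom_closed[OF f that] E_zero[of "Suc j"] assms by (simp add: zero_module_def)
  then show "\<exists>g\<in>mod_hom R U (E j). (\<forall>x\<in>A. g x = \<zero>\<^bsub>E j\<^esub>) \<and> (\<forall>x\<in>carrier U. D j (g x) = f x)"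
    using hom_zero_map[OF modE] Dz by (intro bexI[of _ "\<lambda>_. \<zero>\<^bsub>E j\<^esub>"]) auto
qed

text \<open>R modulo \<open>i\<close> regular elements has projective dimension \<open>i\<close>.
  Here this is seen element by element, starting from the free module R.\<close>

lemma Ext_vanish_regular_ideal: assumes "i \<le> d" "i \<le> j" shows "Ext_vanish j (self_module R) (I i)"
  using assms
proof (induction i arbitrary: j)
  case 0 then show ?case using Ext_vanish_self xs(2) by simp
next
  case (Suc i)
  obtain j' where j: "j = Suc j'" "i \<le> j'" using Suc.prems(2) by (cases j) auto
  have i: "i < d" using Suc.prems(1) by simp
  have sI: "submodule (I i) R (self_module R)" and x: "xs i \<in> \<mm>"
    and reg: "\<And>u. u \<in> carrier (self_module R) \<Longrightarrow> xs i \<odot>\<^bsub>self_module R\<^esub> u \<in> I i \<Longrightarrow> u \<in> I i"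
    and eq: "I (Suc i) = addmul (self_module R) (I i) (xs i)"
    using xs(1) i unfolding regular_chain_def by auto
  show ?case unfolding j eq
    by (rule Ext_vanish_mult_quot[OF fgm_self sI max_carr[OF x] reg]) (use Suc.IH i j in auto)
qed

text \<open>A socle element modulo the regular sequence: multiplication by \<open>z\<close> embeds
  the residue field into R / I(d), about which Ext is already known.\<close>

lemma socle_colon: "\<exists>z\<in>carrier R. colon_submod (self_module R) (I d) z = \<mm>"
proof -
  have sI: "submodule (I d) R (self_module R)" using xs(1) by (simp add: regular_chain_def)
  have "\<exists>z\<in>carrier (self_module R). z \<notin> I d \<and> (\<forall>a\<in>\<mm>. a \<odot>\<^bsub>self_module R\<^esub> z \<in> I d)"
    by (rule regular_chain_socle[OF fgm_self xs(1) dim]) (use xs(3) in simp)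
  then obtain z where z: "z \<in> carrier R" "z \<notin> I d" "\<And>a. a \<in> \<mm> \<Longrightarrow> a \<otimes> z \<in> I d" by auto
  let ?C = "colon_submod (self_module R) (I d) z"
  have "ideal ?C R" unfolding ideal_iff_submod by (rule submod_colon_submod[OF module_self[OF is_cring] sI z(1)])
  moreover have "\<one> \<notin> ?C" using z by (simp add: colon_submod_def)
  then have "?C \<noteq> carrier R" by auto
  ultimately have "?C \<subseteq> \<mm>" by (rule ideal_le_max)
  moreover have "\<mm> \<subseteq> ?C"
  proof
    fix a assume a: "a \<in> \<mm>"
    have aR: "a \<in> carrier R" by (rule max_carr[OF a])
    show "a \<in> ?C" using z(3)[OF a] aR m_comm[OF z(1) aR] by (simp add: colon_submod_def)
  qed
  ultimately show ?thesis using z(1) by blast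
qed

text \<open>Downward induction on \<open>j\<close>, starting from the length of the injective resolution. In each degree the
  maximal ideal comes first: it is the colon of \<open>I d\<close> by a socle element. Noetherian induction on \<open>J\<close> does the rest.\<close>

lemma Ext_vanish_ideal: assumes "j \<ge> d" "ideal J R" shows "Ext_vanish j (self_module R) J"
proof -
  \<comment> \<open>The induction variable \<open>k\<close> bounds how far \<open>j\<close> lies
    below \<open>n\<close>; at \<open>n\<close> and above, the injective resolution is zero.\<close>
  have "\<forall>j\<ge>d. j + k \<ge> n \<longrightarrow> (\<forall>J. ideal J R \<longrightarrow> Ext_vanish j (self_module R) J)" for k
  proof (induction k)
    case 0 then show ?case by (intro allI impI, intro Ext_vanish_top) simp
  next
    case (Suc k)
    show ?case
    proof (intro allI impI)
      fix j J assume j: "d \<le> j" "n \<le> j + Suc k" and "ideal J R"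
      have up: "Ext_vanish (Suc j) (self_module R) J" if "ideal J R" for J using Suc.IH j that by simp
      have sub: "submodule J R (self_module R) \<longleftrightarrow> ideal J R" for J by (simp add: ideal_iff_submod)
      note mS = module_self[OF is_cring]
      have sI: "submodule (I d) R (self_module R)" using xs(1) by (simp add: regular_chain_def)
      obtain z where z: "z \<in> carrier R" "colon_submod (self_module R) (I d) z = \<mm>" using socle_colon by metis
      have m: "Ext_vanish j (self_module R) \<mm>" unfolding z(2)[symmetric]
      proof (rule Ext_vanish_colon[OF fgm_self sI z(1)])
        show "Ext_vanish j (self_module R) (I d)" using Ext_vanish_regular_ideal j(1) by simp
        show "Ext_vanish (Suc j) (self_module R) (addmul (self_module R) (I d) z)"
          by (rule up) (use submod_addmul[OF mS sI z(1)] sub in metis)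
      qed
      show "Ext_vanish j (self_module R) J"
      proof (rule ccontr)
        assume "\<not> Ext_vanish j (self_module R) J"
        then have "\<exists>Q\<in>{Q. ideal Q R \<and> \<not> Ext_vanish j (self_module R) Q}. \<forall>Q'\<in>{Q. ideal Q R \<and> \<not> Ext_vanish j (self_module R) Q}. Q \<subseteq> Q' \<longrightarrow> Q' = Q"
          using \<open>ideal J R\<close> by (intro ideal_maximal) auto
        then obtain Q where Q: "ideal Q R" "\<not> Ext_vanish j (self_module R) Q"
          and Qmax: "\<And>Q'. ideal Q' R \<Longrightarrow> Q \<subseteq> Q' \<Longrightarrow> Q' \<noteq> Q \<Longrightarrow> Ext_vanish j (self_module R) Q'" by auto
        have sQ: "submodule Q R (self_module R)" using Q(1) sub by simp
        have "Q \<noteq> carrier R"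
        proof
          assume eq: "Q = carrier R"
          have "Ext_vanish j (self_module R) Q"
          proof (rule Ext_vanishI)
            fix f assume "\<And>x. x \<in> Q \<Longrightarrow> f x = \<zero>\<^bsub>E (Suc j)\<^esub>"
            then show "\<exists>g\<in>mod_hom R (self_module R) (E j). (\<forall>x\<in>Q. g x = \<zero>\<^bsub>E j\<^esub>) \<and> (\<forall>x\<in>carrier (self_module R). D j (g x) = f x)"
              using hom_zero_map[OF modE] Dz eq by (intro bexI[of _ "\<lambda>_. \<zero>\<^bsub>E j\<^esub>"]) auto
          qed
          then show False using Q(2) by simp
        qed
        then have "Q \<subseteq> \<mm>" using ideal_le_max[OF Q(1)] by simp
        moreover have "Q \<noteq> \<mm>" using Q(2) m by auto
        ultimately obtain x where x: "x \<in> \<mm>" "x \<notin> Q" by auto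
        have xR: "x \<in> carrier R" by (rule max_carr[OF x(1)])
        have i1: "ideal (colon_submod (self_module R) Q x) R" using submod_colon_submod[OF mS sQ xR] sub by simp
        have i2: "ideal (addmul (self_module R) Q x) R" using submod_addmul[OF mS sQ xR] sub by simp
        show False
        \<comment> \<open>If \<open>x\<close> is regular modulo \<open>Q\<close>, vanishing descends
          from the next degree. If not, both (Q : x) and Q + x R are strictly larger than
          \<open>Q\<close>, so maximality covers them and the exact sequence covers
          \<open>Q\<close>.\<close>
        proof (cases "\<forall>u\<in>carrier R. x \<otimes> u \<in> Q \<longrightarrow> u \<in> Q")
          case True
          have "Ext_vanish j (self_module R) Q"
            by (rule Ext_vanish_descend[OF fgm_self sQ x(1) _ up[OF i2]]) (use True in simp)
          then show False using Q(2) by simp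
        next
          case False
          then obtain u where u: "u \<in> carrier R" "x \<otimes> u \<in> Q" "u \<notin> Q" by auto
          have "Q \<subseteq> colon_submod (self_module R) Q x"
            using ideal.I_l_closed[OF Q(1) _ xR] ideal.Icarr[OF Q(1)] by (auto simp: colon_submod_def)
          moreover have "u \<in> colon_submod (self_module R) Q x" using u by (simp add: colon_submod_def)
          ultimately have v1: "Ext_vanish j (self_module R) (colon_submod (self_module R) Q x)" using Qmax[OF i1] u(3) by auto
          have "x \<in> addmul (self_module R) Q x" using addmul_superset(2)[OF mS sQ xR, of \<one>] xR by simp
          then have v2: "Ext_vanish j (self_module R) (addmul (self_module R) Q x)"
            using Qmax[OF i2] x(2) addmul_superset(1)[OF mS sQ xR] by auto
          show False using Ext_vanish_of_colon[OF fgm_self sQ xR v1 v2] Q(2) by simp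
        qed
      qed
    qed
  qed
  from this[of n] show ?thesis using assms by simp
qed

text \<open>Extending \<open>g\<close> to \<open>l\<close> on \<open>U\<close> leaves an error f - D
  l, which vanishes on \<open>C\<close>. Its value \<open>e\<close> at \<open>a\<close> is a cocycle
  on R/J, where \<open>J\<close> is the colon ideal (C : a). Vanishing for R/J corrects
  \<open>l\<close> on R a without changing it on \<open>C\<close>.\<close>

lemma Ext_vanish_fg_step:
  assumes U: "fgm R U" and f: "f \<in> mod_hom R U (E (Suc j))"
    and fD: "\<And>u. u \<in> carrier U \<Longrightarrow> D (Suc j) (f u) = \<zero>\<^bsub>E (Suc (Suc j))\<^esub>" and j: "j \<ge> d"
    and C: "submodule C R U" "g \<in> mod_hom R (U \<restriction> C) (E j)" "\<And>x. x \<in> C \<Longrightarrow> D j (g x) = f x" and a: "a \<in> carrier U"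
  shows "\<exists>C' g'. submodule C' R U \<and> C \<subseteq> C' \<and> a \<in> C' \<and> g' \<in> mod_hom R (U \<restriction> C') (E j) \<and> (\<forall>x\<in>C'. D j (g' x) = f x) \<and> (\<forall>x\<in>C. g' x = g x)"
proof -
  have mU: "module R U" using U by (simp add: fgm_def)
  note mS = module_self[OF is_cring]
  interpret U: module R U by (rule mU)
  interpret E0: module R "E j" by (rule modE)
  interpret E1: module R "E (Suc j)" by (rule modE)
  note CD = submodD[OF mU C(1)]
  obtain l where l: "l \<in> mod_hom R U (E j)" "\<forall>x\<in>C. l x = g x" using inj_extend[OF inj U C(1,2)] by metis
  let ?k = "\<lambda>u. f u \<ominus>\<^bsub>E (Suc j)\<^esub> D j (l u)"
  have k: "?k \<in> mod_hom R U (E (Suc j))" by (rule hom_minus[OF modE f DhomI[OF l(1)]])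
  have kC: "?k x = \<zero>\<^bsub>E (Suc j)\<^esub>" if x: "x \<in> C" for x
    using l(2) C(3)[OF x] x hom_closed[OF f CD(3)[OF x]] by (simp add: E1.minus_eq_zero_iff)
  define J where "J = colon_ideal R U C a"
  have iJ: "ideal J R" unfolding J_def by (rule ideal_colon_ideal[OF mU C(1) a])
  define e where "e = ?k a"
  have e: "e \<in> carrier (E (Suc j))" unfolding e_def by (rule hom_closed[OF k a])
  have re: "r \<odot>\<^bsub>E (Suc j)\<^esub> e = ?k (r \<odot>\<^bsub>U\<^esub> a)" if "r \<in> carrier R" for r
    unfolding e_def using hom_smult[OF k that a] by simp
  have De: "D (Suc j) e = \<zero>\<^bsub>E (Suc (Suc j))\<^esub>" unfolding e_def using cocycle_diff[OF mU f l(1) a] fD[OF a] by simp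
  have eJ: "r \<odot>\<^bsub>E (Suc j)\<^esub> e = \<zero>\<^bsub>E (Suc j)\<^esub>" if "r \<in> J" for r
    using that re[of r] kC[of "r \<odot>\<^bsub>U\<^esub> a"] by (simp add: J_def colon_ideal_def)
  have eD: "D (Suc j) (r \<odot>\<^bsub>E (Suc j)\<^esub> e) = \<zero>\<^bsub>E (Suc (Suc j))\<^esub>" if "r \<in> carrier (self_module R)" for r
    using that hom_smult[OF D_hom _ e, of r] De module.smult_r_null[OF modE] by simp
  obtain q where q: "q \<in> mod_hom R (self_module R) (E j)" "\<And>x. x \<in> J \<Longrightarrow> q x = \<zero>\<^bsub>E j\<^esub>"
     "\<And>r. r \<in> carrier R \<Longrightarrow> D j (q r) = r \<odot>\<^bsub>E (Suc j)\<^esub> e"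
    by (rule Ext_vanishD[OF Ext_vanish_ideal[OF j iJ] hom_smult_elem[OF modE e] eJ eD]) simp_all
  let ?B = "{r \<odot>\<^bsub>U\<^esub> a | r. r \<in> carrier R}"
  have sB: "submodule ?B R U" by (rule submod_smult_ideal[OF mU ideal_carrier[OF is_cring] a])
  have ra: "(\<lambda>r. r \<odot>\<^bsub>U\<^esub> a) \<in> mod_hom R (self_module R) (U \<restriction> ?B)"
    by (rule hom_cod_sub[OF hom_smult_elem[OF mU a]]) auto
  have "\<exists>t\<in>mod_hom R (U \<restriction> ?B) (E j). \<forall>r\<in>carrier (self_module R). t (r \<odot>\<^bsub>U\<^esub> a) = q r"
  proof (rule hom_factor[OF mS module_sub[OF mU sB] modE ra _ q(1)])
    show "(\<lambda>r. r \<odot>\<^bsub>U\<^esub> a) ` carrier (self_module R) = carrier (U \<restriction> ?B)" by auto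
    fix r assume "r \<in> carrier (self_module R)" "r \<odot>\<^bsub>U\<^esub> a = \<zero>\<^bsub>U \<restriction> ?B\<^esub>"
    then have "r \<in> J" using CD(2) by (simp add: J_def colon_ideal_def)
    then show "q r = \<zero>\<^bsub>E j\<^esub>" by (rule q(2))
  qed
  then obtain t where t: "t \<in> mod_hom R (U \<restriction> ?B) (E j)" "\<And>r. r \<in> carrier R \<Longrightarrow> t (r \<odot>\<^bsub>U\<^esub> a) = q r" by auto
  have "\<exists>s\<in>mod_hom R (U \<restriction> msum U C ?B) (E j). (\<forall>x\<in>C. s x = \<zero>\<^bsub>E j\<^esub>) \<and> (\<forall>x\<in>?B. s x = t x)"
  proof (rule hom_glue[OF mU modE C(1) sB hom_zero_map[OF modE] t(1)])
    fix x assume x: "x \<in> C" "x \<in> ?B"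
    then obtain r where r: "x = r \<odot>\<^bsub>U\<^esub> a" "r \<in> carrier R" by auto
    then have "r \<in> J" using x(1) by (simp add: J_def colon_ideal_def)
    then show "\<zero>\<^bsub>E j\<^esub> = t x" using t(2)[OF r(2)] q(2) r(1) by simp
  qed
  then obtain s where s: "s \<in> mod_hom R (U \<restriction> msum U C ?B) (E j)" "\<forall>x\<in>C. s x = \<zero>\<^bsub>E j\<^esub>" "\<forall>x\<in>?B. s x = t x" by (elim bexE conjE)
  let ?C' = "msum U C ?B"
  have sC': "submodule ?C' R U" by (rule submod_msum[OF mU C(1) sB])
  note C'D = submodD[OF mU sC'] and sup = msum_superset[OF mU C(1) sB]
  have g': "(\<lambda>x. l x \<oplus>\<^bsub>E j\<^esub> s x) \<in> mod_hom R (U \<restriction> ?C') (E j)" by (rule hom_plus[OF modE hom_dom_sub[OF l(1) C'D(1)] s(1)])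
  have "D j (l x \<oplus>\<^bsub>E j\<^esub> s x) = f x" if x: "x \<in> ?C'" for x
  proof -
    obtain c b where cb: "c \<in> C" "b \<in> ?B" "x = c \<oplus>\<^bsub>U\<^esub> b" using x by (rule msumE)
    obtain r where r: "b = r \<odot>\<^bsub>U\<^esub> a" "r \<in> carrier R" using cb(2) by auto
    have cU: "c \<in> carrier U" "b \<in> carrier U" "x \<in> carrier U" using CD(3)[OF cb(1)] r a C'D(3)[OF x] by auto
    have inC: "c \<in> ?C'" "b \<in> ?C'" using sup cb by auto
    have qc: "q r \<in> carrier (E j)" using hom_closed[OF q(1)] r(2) by simp
    have "s x = s c \<oplus>\<^bsub>E j\<^esub> s b" using hom_add[OF s(1), of c b] inC cb(3) by simp
    also have "\<dots> = q r" using s(2,3) cb t(2)[OF r(2)] r(1) qc by simp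
    finally have sx: "s x = q r" .
    have "D j (s x) = ?k b" using sx q(3)[OF r(2)] re[OF r(2)] r(1) by simp
    also have "\<dots> = ?k x"
      using hom_add[OF k cU(1,2)] kC[OF cb(1)] hom_closed[OF k cU(2)] cb(3) by simp
    finally have "D j (l x \<oplus>\<^bsub>E j\<^esub> s x) = D j (l x) \<oplus>\<^bsub>E (Suc j)\<^esub> ?k x"
      using hom_add[OF D_hom hom_closed[OF l(1) cU(3)], of "s x"] sx qc by simp
    then show ?thesis using hom_closed[OF f cU(3)] Dc[OF hom_closed[OF l(1) cU(3)]] E1.minus_plus_cancel'[of "f x" "D j (l x)"]
      by (simp add: E1.a_comm)
  qed
  moreover have "a \<in> ?C'" using sup(2) a by (intro subsetD[OF sup(2)]) (auto intro!: exI[of _ \<one>])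
  moreover have "l x \<oplus>\<^bsub>E j\<^esub> s x = g x" if "x \<in> C" for x using l(2) s(2) that hom_closed[OF C(2), of x] by simp
  ultimately show ?thesis using sC' sup(1) g' by (intro exI[of _ ?C'] exI[of _ "\<lambda>x. l x \<oplus>\<^bsub>E j\<^esub> s x"]) simp
qed

text \<open>From cyclic modules to finitely generated ones: the cochain that bounds \<open>f\<close>
  is built up along the generators of \<open>U\<close>, starting from zero on
  \<open>A\<close>.\<close>

lemma Ext_vanish_fg:
  assumes U: "fgm R U" and A: "submodule A R U" and j: "j \<ge> d"
  shows "Ext_vanish j U A"
proof (rule Ext_vanishI)
  fix f assume f: "f \<in> mod_hom R U (E (Suc j))" and fA: "\<And>x. x \<in> A \<Longrightarrow> f x = \<zero>\<^bsub>E (Suc j)\<^esub>"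
    and fD: "\<And>x. x \<in> carrier U \<Longrightarrow> D (Suc j) (f x) = \<zero>\<^bsub>E (Suc (Suc j))\<^esub>"
  obtain S where S: "module R U" "S \<subseteq> carrier U" "finite S" "mspan R U S = carrier U"
    using U unfolding fgm_def by metis
  have "\<exists>C g. submodule C R U \<and> A \<subseteq> C \<and> S \<subseteq> C \<and> g \<in> mod_hom R (U \<restriction> C) (E j) \<and> (\<forall>x\<in>C. D j (g x) = f x) \<and> (\<forall>x\<in>A. g x = \<zero>\<^bsub>E j\<^esub>)"
    using S(3,2)
  proof (induction S rule: finite_induct)
    case empty
    then show ?case using A hom_zero_map[OF modE] fA Dz by (intro exI[of _ A] exI[of _ "\<lambda>_. \<zero>\<^bsub>E j\<^esub>"]) simp
  next
    case (insert a T)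
    then obtain C g where C: "submodule C R U" "A \<subseteq> C" "T \<subseteq> C" "g \<in> mod_hom R (U \<restriction> C) (E j)" "\<forall>x\<in>C. D j (g x) = f x" "\<forall>x\<in>A. g x = \<zero>\<^bsub>E j\<^esub>" by auto
    have a: "a \<in> carrier U" using insert.prems by simp
    obtain C' g' where "submodule C' R U" "C \<subseteq> C'" "a \<in> C'" "g' \<in> mod_hom R (U \<restriction> C') (E j)" "\<forall>x\<in>C'. D j (g' x) = f x" "\<forall>x\<in>C. g' x = g x"
      using Ext_vanish_fg_step[OF U f fD j C(1,4) _ a] C(5) by auto
    then show ?case using C by (intro exI[of _ C'] exI[of _ g']) auto
  qed
  then obtain C g where C: "submodule C R U" "A \<subseteq> C" "S \<subseteq> C" "g \<in> mod_hom R (U \<restriction> C) (E j)" "\<forall>x\<in>C. D j (g x) = f x" "\<forall>x\<in>A. g x = \<zero>\<^bsub>E j\<^esub>" by auto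
  have "C = carrier U" using mspan_least[OF C(1,3)] S(4) submodD(1)[OF S(1) C(1)] by simp
  then show "\<exists>g\<in>mod_hom R U (E j). (\<forall>x\<in>A. g x = \<zero>\<^bsub>E j\<^esub>) \<and> (\<forall>x\<in>carrier U. D j (g x) = f x)"
    using C by (intro bexI[of _ g]) simp_all
qed

text \<open>After division by all \<open>d\<close> elements of the regular sequence the Ext in
  degree j + d + 1 vanishes, because it does so for every finite module. Giving the elements back
  one at a time lowers the degree by one each, by the Nakayama argument. The induction on
  \<open>k\<close> counts the elements given back.\<close>

lemma Ext_vanish_omega: "Ext_vanish j \<omega> {\<zero>\<^bsub>\<omega>\<^esub>}"
proof -
  have "Ext_vanish (j + (d - k)) \<omega> (A\<omega> (d - k))" if "k \<le> d" for k j
    using that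
  proof (induction k arbitrary: j)
    case 0
    have "submodule (A\<omega> d) R \<omega>" using ys(1) by (simp add: regular_chain_def)
    then show ?case using Ext_vanish_fg[OF fg_omega] by simp
  next
    case (Suc k)
    define i where "i = d - Suc k"
    have i: "i < d" "d - k = Suc i" using Suc.prems by (auto simp: i_def)
    have sA: "submodule (A\<omega> i) R \<omega>" and y: "ys i \<in> \<mm>"
      and reg: "\<And>u. u \<in> carrier \<omega> \<Longrightarrow> ys i \<odot>\<^bsub>\<omega>\<^esub> u \<in> A\<omega> i \<Longrightarrow> u \<in> A\<omega> i"
      and eq: "A\<omega> (Suc i) = addmul \<omega> (A\<omega> i) (ys i)"
      using ys(1) i(1) unfolding regular_chain_def by auto
    have "Ext_vanish (j + Suc i) \<omega> (A\<omega> (Suc i))" using Suc.IH[of j] Suc.prems i(2) by simp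
    then have "Ext_vanish (Suc (j + i)) \<omega> (addmul \<omega> (A\<omega> i) (ys i))" by (simp add: eq)
    from Ext_vanish_descend[OF fg_omega sA y reg this] show ?case by (simp add: i_def)
  qed
  from this[of d j] ys(2) show ?thesis by simp
qed

end

section \<open>Duality into the canonical module\<close>

text \<open>Projectivity enters as \<open>proj_mod\<close>, which lifts against surjections of all
  types. Resolutions of one module in different types can therefore be compared.\<close>

definition proj_resolution :: "('a,'r) ring_scheme \<Rightarrow> ('a,'b,'m) module_scheme \<Rightarrow> (nat \<Rightarrow> ('a,'u) module) \<Rightarrow> (nat \<Rightarrow> 'u \<Rightarrow> 'u) \<Rightarrow> ('u \<Rightarrow> 'b) \<Rightarrow> bool" where
  "proj_resolution R V P \<delta> \<epsilon> \<longleftrightarrow> module R V \<and> left_resolution R V P \<delta> \<epsilon> \<and> (\<forall>i. proj_mod R (P i))"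

lemma proj_resolutionD:
  assumes "proj_resolution R V P \<delta> \<epsilon>"
  shows "module R V" "module R (P i)" "proj_mod R (P i)" "\<epsilon> \<in> mod_hom R (P 0) V" "\<delta> i \<in> mod_hom R (P (Suc i)) (P i)"
    "\<epsilon> ` carrier (P 0) = carrier V"
    "\<And>x. x \<in> carrier (P 0) \<Longrightarrow> \<epsilon> x = \<zero>\<^bsub>V\<^esub> \<longleftrightarrow> x \<in> \<delta> 0 ` carrier (P (Suc 0))"
    "\<And>x. x \<in> carrier (P (Suc i)) \<Longrightarrow> \<delta> i x = \<zero>\<^bsub>P i\<^esub> \<longleftrightarrow> x \<in> \<delta> (Suc i) ` carrier (P (Suc (Suc i)))"
    "\<And>x. x \<in> carrier (P (Suc 0)) \<Longrightarrow> \<epsilon> (\<delta> 0 x) = \<zero>\<^bsub>V\<^esub>"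
    "\<And>x. x \<in> carrier (P (Suc (Suc i))) \<Longrightarrow> \<delta> i (\<delta> (Suc i) x) = \<zero>\<^bsub>P i\<^esub>"
proof -
  have k0: "mod_ker (P 0) V \<epsilon> = \<delta> 0 ` carrier (P 1)" and k: "mod_ker (P (Suc i)) (P i) (\<delta> i) = \<delta> (Suc i) ` carrier (P (Suc (Suc i)))" for i
    using assms by (auto simp: proj_resolution_def left_resolution_def)
  show "module R V" "module R (P i)" "proj_mod R (P i)" "\<epsilon> \<in> mod_hom R (P 0) V" "\<delta> i \<in> mod_hom R (P (Suc i)) (P i)"
    "\<epsilon> ` carrier (P 0) = carrier V"
    using assms by (auto simp: proj_resolution_def left_resolution_def)
  show "\<And>x. x \<in> carrier (P 0) \<Longrightarrow> \<epsilon> x = \<zero>\<^bsub>V\<^esub> \<longleftrightarrow> x \<in> \<delta> 0 ` carrier (P (Suc 0))"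
    using k0 by (auto simp: mod_ker_def set_eq_iff)
  show "\<And>x. x \<in> carrier (P (Suc i)) \<Longrightarrow> \<delta> i x = \<zero>\<^bsub>P i\<^esub> \<longleftrightarrow> x \<in> \<delta> (Suc i) ` carrier (P (Suc (Suc i)))"
    using k[of i] by (auto simp: mod_ker_def set_eq_iff)
  show "\<epsilon> (\<delta> 0 x) = \<zero>\<^bsub>V\<^esub>" if "x \<in> carrier (P (Suc 0))" for x
  proof -
    have "\<delta> 0 x \<in> mod_ker (P 0) V \<epsilon>" unfolding k0 using that by simp
    then show ?thesis by (simp add: mod_ker_def)
  qed
  show "\<delta> i (\<delta> (Suc i) x) = \<zero>\<^bsub>P i\<^esub>" if "x \<in> carrier (P (Suc (Suc i)))" for x
  proof -
    have "\<delta> (Suc i) x \<in> mod_ker (P (Suc i)) (P i) (\<delta> i)" unfolding k using that by simp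
    then show ?thesis by (simp add: mod_ker_def)
  qed
qed

lemma proj_resolution_ker:
  assumes "proj_resolution R V P \<delta> \<epsilon>"
  shows "\<delta> 0 ` carrier (P (Suc 0)) = {x \<in> carrier (P 0). \<epsilon> x = \<zero>\<^bsub>V\<^esub>}"
    "\<delta> (Suc i) ` carrier (P (Suc (Suc i))) = {x \<in> carrier (P (Suc i)). \<delta> i x = \<zero>\<^bsub>P i\<^esub>}"
  using assms by (auto simp: proj_resolution_def left_resolution_def mod_ker_def)

context cm_inj_res begin

lemma Ext_vanish_proj: assumes P: "proj_mod R P" shows "Ext_vanish j P {\<zero>\<^bsub>P\<^esub>}"
proof (rule Ext_vanishI)
  fix f assume f: "f \<in> mod_hom R P (E (Suc j))"
    and fD: "\<And>u. u \<in> carrier P \<Longrightarrow> D (Suc j) (f u) = \<zero>\<^bsub>E (Suc (Suc j))\<^esub>"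
  have mP: "module R P" using P by (simp add: proj_mod_def)
  have im: "f ` carrier P \<subseteq> D j ` carrier (E j)"
  proof
    fix y assume "y \<in> f ` carrier P"
    then obtain u where u: "y = f u" "u \<in> carrier P" by (rule imageE)
    obtain e where "e \<in> carrier (E j)" "D j e = f u" using D_exact[OF hom_closed[OF f u(2)] fD[OF u(2)]] by (elim bexE)
    then show "y \<in> D j ` carrier (E j)" using u(1) by (intro image_eqI[of _ _ e]) simp_all
  qed
  obtain g where g: "g \<in> mod_hom R P (E j)" "\<forall>x\<in>carrier P. D j (g x) = f x"
    using proj_lift[OF P modE modE f D_hom im] by metis
  then show "\<exists>g\<in>mod_hom R P (E j). (\<forall>x\<in>{\<zero>\<^bsub>P\<^esub>}. g x = \<zero>\<^bsub>E j\<^esub>) \<and> (\<forall>x\<in>carrier P. D j (g x) = f x)"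
    using hom_zero[OF mP modE g(1)] by (intro bexI[of _ g]) auto
qed

text \<open>Dimension shifting: the Ext of the syzygy is the Ext of \<open>U\<close> one degree
  higher, so vanishing in all positive degrees is inherited.\<close>

lemma Ext_vanish_syzygy:
  assumes P: "proj_mod R P" "fgm R P" and U: "module R U" and p: "p \<in> mod_hom R P U" "p ` carrier P = carrier U"
    and K: "K = {u \<in> carrier P. p u = \<zero>\<^bsub>U\<^esub>}" and v: "\<And>j. Ext_vanish j U {\<zero>\<^bsub>U\<^esub>}"
  shows "Ext_vanish j P K" "Ext_vanish j (P \<restriction> K) {\<zero>\<^bsub>P\<^esub>}" "submodule K R P"
proof -
  have mP: "module R P" using P by (simp add: proj_mod_def)
  show 1: "Ext_vanish j P K" for j by (rule Ext_vanish_of_surj[OF mP U p K v])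
  show 2: "submodule K R P" unfolding K by (rule submod_ker[OF mP U p(1)])
  show "Ext_vanish j (P \<restriction> K) {\<zero>\<^bsub>P\<^esub>}" by (rule Ext_vanish_submodule[OF P(2) 2 Ext_vanish_proj[OF P(1)] 1])
qed

text \<open>Hom from a finite free module to \<omega> is a finite sum of copies of \<omega>. No
  direct sums are formed. Instead a bounding cochain is found for maps whose values at the unit
  vectors outside \<open>T\<close> are zero, and \<open>T\<close> grows by one element at a
  time.\<close>

lemma Ext_vanish_Hom_fin_mod:
  assumes S: "finite S"
  shows "Ext_vanish j (Hom_module R (fin_mod R S) \<omega>) {\<zero>\<^bsub>Hom_module R (fin_mod R S) \<omega>\<^esub>}"
proof (rule Ext_vanishI)
  let ?F = "fin_mod R S" let ?H = "Hom_module R ?F \<omega>"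
  fix f assume f: "f \<in> mod_hom R ?H (E (Suc j))"
    and fD: "\<And>u. u \<in> carrier ?H \<Longrightarrow> D (Suc j) (f u) = \<zero>\<^bsub>E (Suc (Suc j))\<^esub>"
  have mF: "module R ?F" by (rule module_fin_mod)
  have mH: "module R ?H" by (rule module_Hom[OF mF modW])
  interpret H: module R ?H by (rule mH)
  interpret W: module R \<omega> by (rule modW)
  have e: "fin_unit R b \<in> carrier ?F" if "b \<in> S" for b by (rule fin_unit_carrier[OF that])
  have "\<exists>g\<in>mod_hom R ?H (E j). \<forall>u\<in>carrier ?H. (\<forall>s\<in>S - T. u (fin_unit R s) = \<zero>\<^bsub>\<omega>\<^esub>) \<longrightarrow> D j (g u) = f u" if "T \<subseteq> S" for T
    using finite_subset[OF that S] that
  proof (induction T rule: finite_induct)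
    case empty
    have "f u = \<zero>\<^bsub>E (Suc j)\<^esub>" if u: "u \<in> carrier ?H" "\<forall>s\<in>S. u (fin_unit R s) = \<zero>\<^bsub>\<omega>\<^esub>" for u
    proof -
      have "u = \<zero>\<^bsub>?H\<^esub>"
      proof (rule Hom_eqI[OF u(1) H.zero_closed])
        fix x assume x: "x \<in> carrier ?F"
        have "u x = \<zero>\<^bsub>\<omega>\<^esub>"
          by (rule fin_mod_hom_eqI[OF modW _ hom_zero_map[OF modW] _ x]) (use u in \<open>auto simp: Hom_carrier\<close>)
        then show "u x = \<zero>\<^bsub>?H\<^esub> x" using x by (simp add: Hom_apply)
      qed
      then show ?thesis using hom_zero[OF mH modE f] by simp
    qed
    then show ?case using Dz hom_zero_map[OF modE] by (intro bexI[of _ "\<lambda>_. \<zero>\<^bsub>E j\<^esub>"]) auto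
  next
    case (insert b T)
    then obtain g where g: "g \<in> mod_hom R ?H (E j)"
      "\<And>u. u \<in> carrier ?H \<Longrightarrow> \<forall>s\<in>S - T. u (fin_unit R s) = \<zero>\<^bsub>\<omega>\<^esub> \<Longrightarrow> D j (g u) = f u" by auto
    have b: "b \<in> S" using insert.prems by simp
    \<comment> \<open>The inclusion of the copy of \<omega> that belongs to the unit vector at
      \<open>b\<close>; evaluation at this unit vector retracts it.\<close>
    let ?i = "\<lambda>w. \<lambda>x\<in>carrier ?F. x b \<odot>\<^bsub>\<omega>\<^esub> w"
    have vb: "x b \<in> carrier R" if "x \<in> carrier ?F" for x by (rule fin_mod_val[OF that])
    have i: "?i \<in> mod_hom R \<omega> ?H"
    proof (rule mod_homI)
      fix w assume w: "w \<in> carrier \<omega>"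
      have "(\<lambda>x. x b \<odot>\<^bsub>\<omega>\<^esub> w) \<in> mod_hom R ?F \<omega>"
        using w vb by (intro mod_homI) (simp_all add: fin_mod_simps W.smult_l_distr W.smult_assoc1)
      then show "?i w \<in> carrier ?H" by (rule restrict_in_Hom[OF mF])
      show "?i (w \<oplus>\<^bsub>\<omega>\<^esub> w') = ?i w \<oplus>\<^bsub>?H\<^esub> ?i w'" if "w' \<in> carrier \<omega>" for w'
        using w that vb by (simp add: Hom_apply W.smult_r_distr cong: restrict_cong)
      show "?i (a \<odot>\<^bsub>\<omega>\<^esub> w) = a \<odot>\<^bsub>?H\<^esub> ?i w" if "a \<in> carrier R" for a
        using w that vb by (simp add: Hom_apply W.smult_assoc1[symmetric] m_comm cong: restrict_cong)
    qed
    have fi: "(\<lambda>w. f (?i w)) \<in> mod_hom R \<omega> (E (Suc j))" by (rule hom_comp[OF i f])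
    have fi0: "f (?i x) = \<zero>\<^bsub>E (Suc j)\<^esub>" if "x \<in> {\<zero>\<^bsub>\<omega>\<^esub>}" for x using that hom_zero[OF modW modE fi] by simp
    obtain k where k: "k \<in> mod_hom R \<omega> (E j)" "\<And>u. u \<in> {\<zero>\<^bsub>\<omega>\<^esub>} \<Longrightarrow> k u = \<zero>\<^bsub>E j\<^esub>" "\<And>u. u \<in> carrier \<omega> \<Longrightarrow> D j (k u) = f (?i u)"
      by (rule Ext_vanishD[OF Ext_vanish_omega fi fi0]) (use fD hom_closed[OF i] in auto)
    have ev: "(\<lambda>u. u (fin_unit R b)) \<in> mod_hom R ?H \<omega>" by (rule Hom_eval_hom[OF e[OF b]])
    have ie: "(\<lambda>u. ?i (u (fin_unit R b))) \<in> mod_hom R ?H ?H" by (rule hom_comp[OF ev i])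
    have red: "(\<lambda>u. u \<ominus>\<^bsub>?H\<^esub> ?i (u (fin_unit R b))) \<in> mod_hom R ?H ?H" by (rule hom_minus[OF mH hom_id ie])
    have "(\<lambda>u. g (u \<ominus>\<^bsub>?H\<^esub> ?i (u (fin_unit R b))) \<oplus>\<^bsub>E j\<^esub> k (u (fin_unit R b))) \<in> mod_hom R ?H (E j)"
      by (rule hom_plus[OF modE hom_comp[OF red g(1)] hom_comp[OF ev k(1)]])
    moreover have "D j (g (u \<ominus>\<^bsub>?H\<^esub> ?i (u (fin_unit R b))) \<oplus>\<^bsub>E j\<^esub> k (u (fin_unit R b))) = f u"
      if u: "u \<in> carrier ?H" "\<forall>s\<in>S - insert b T. u (fin_unit R s) = \<zero>\<^bsub>\<omega>\<^esub>" for u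
    proof -
      let ?v = "u \<ominus>\<^bsub>?H\<^esub> ?i (u (fin_unit R b))"
      have ub: "u (fin_unit R b) \<in> carrier \<omega>" by (rule hom_closed[OF ev u(1)])
      have iu: "?i (u (fin_unit R b)) \<in> carrier ?H" by (rule hom_closed[OF i ub])
      have v: "?v \<in> carrier ?H" by (rule hom_closed[OF red u(1)])
      have "?v (fin_unit R s) = \<zero>\<^bsub>\<omega>\<^esub>" if s: "s \<in> S - T" for s
      proof -
        have sS: "s \<in> S" using s by simp
        have "?v (fin_unit R s) = u (fin_unit R s) \<ominus>\<^bsub>\<omega>\<^esub> ?i (u (fin_unit R b)) (fin_unit R s)"
          by (rule hom_diff[OF mH modW Hom_eval_hom[OF e[OF sS]] u(1) iu])
        also have "\<dots> = \<zero>\<^bsub>\<omega>\<^esub>"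
          using s u(2) ub e[OF sS] by (cases "s = b") (auto simp: fin_unit_def W.minus_eq_zero_iff)
        finally show ?thesis .
      qed
      then have gv: "D j (g ?v) = f ?v" using g(2)[OF v] by simp
      have "D j (g ?v \<oplus>\<^bsub>E j\<^esub> k (u (fin_unit R b))) = f ?v \<oplus>\<^bsub>E (Suc j)\<^esub> f (?i (u (fin_unit R b)))"
        using hom_add[OF D_hom hom_closed[OF g(1) v] hom_closed[OF k(1) ub]] gv k(3)[OF ub] by simp
      also have "\<dots> = f (?v \<oplus>\<^bsub>?H\<^esub> ?i (u (fin_unit R b)))" by (rule hom_add[OF f v iu, symmetric])
      also have "?v \<oplus>\<^bsub>?H\<^esub> ?i (u (fin_unit R b)) = u" by (rule H.minus_plus_cancel'[OF u(1) iu])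
      finally show ?thesis .
    qed
    ultimately show ?case by (intro bexI) auto
  qed
  from this[OF order_refl] obtain g where g: "g \<in> mod_hom R ?H (E j)" "\<And>u. u \<in> carrier ?H \<Longrightarrow> D j (g u) = f u" by auto
  then show "\<exists>g\<in>mod_hom R ?H (E j). (\<forall>x\<in>{\<zero>\<^bsub>?H\<^esub>}. g x = \<zero>\<^bsub>E j\<^esub>) \<and> (\<forall>x\<in>carrier ?H. D j (g x) = f x)"
    using hom_zero[OF mH modE g(1)] by (intro bexI[of _ g]) auto
qed

text \<open>The sequence \<open>0 \<rightarrow> Hom(U, \<omega>) \<rightarrow> Hom(F, \<omega>) \<rightarrow> Hom(K, \<omega>) \<rightarrow> 0\<close> is exact, where \<open>K\<close> is the kernel of the free cover \<open>F\<close> of \<open>U\<close>.\<close>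

lemma Ext_vanish_dual_step:
  assumes S: "finite S" and U: "module R U" and p: "p \<in> mod_hom R (fin_mod R S) U" "p ` carrier (fin_mod R S) = carrier U"
    and K: "K = {u \<in> carrier (fin_mod R S). p u = \<zero>\<^bsub>U\<^esub>}" and v: "\<And>j. Ext_vanish j U {\<zero>\<^bsub>U\<^esub>}"
    and vK: "Ext_vanish (Suc j) (Hom_module R (fin_mod R S \<restriction> K) \<omega>) {\<zero>\<^bsub>Hom_module R (fin_mod R S \<restriction> K) \<omega>\<^esub>}"
  shows "Ext_vanish j (Hom_module R U \<omega>) {\<zero>\<^bsub>Hom_module R U \<omega>\<^esub>}"
proof -
  let ?F = "fin_mod R S" let ?H = "Hom_module R ?F \<omega>" and ?HK = "Hom_module R (fin_mod R S \<restriction> K) \<omega>" and ?HU = "Hom_module R U \<omega>"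
  have mF: "module R ?F" by (rule module_fin_mod)
  have fF: "fgm R ?F" by (rule fgm_fin_mod[OF S])
  note syz = Ext_vanish_syzygy[OF proj_fin_mod fF U p K v]
  have sK: "submodule K R ?F" by (rule syz(3))
  note KD = submodD[OF mF sK]
  have mK: "module R (?F \<restriction> K)" by (rule module_sub[OF mF sK])
  have mH: "module R ?H" and mHK: "module R ?HK" and mHU: "module R ?HU"
    using module_Hom[OF mF modW] module_Hom[OF mK modW] module_Hom[OF U modW] by auto
  let ?r = "\<lambda>u. restrict u K"
  have r: "?r \<in> mod_hom R ?H ?HK"
  proof (rule mod_homI)
    fix u assume "u \<in> carrier ?H"
    then have "u \<in> mod_hom R ?F \<omega>" by (simp add: Hom_carrier)
    then have "u \<in> mod_hom R (?F \<restriction> K) \<omega>" by (rule hom_dom_sub[OF _ KD(1)])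
    then show "?r u \<in> carrier ?HK" using restrict_in_Hom[OF mK] by auto
  qed (use KD(3) in \<open>auto simp: Hom_apply restrict_def fun_eq_iff\<close>)
  have rs: "?r ` carrier ?H = carrier ?HK"
  proof
    show "?r ` carrier ?H \<subseteq> carrier ?HK" using hom_closed[OF r] by auto
    show "carrier ?HK \<subseteq> ?r ` carrier ?H"
    proof
      fix f assume f: "f \<in> carrier ?HK"
      then have fh: "f \<in> mod_hom R (?F \<restriction> K) \<omega>" "f \<in> extensional K" by (auto simp: Hom_carrier)
      obtain g where g: "g \<in> mod_hom R ?F \<omega>" "\<forall>a\<in>K. g a = f a" using hom_ext_of_Ext_vanish[OF fF sK syz(1) fh(1)] by metis
      have "f = ?r (restrict g (carrier ?F))" using g(2) fh(2) KD(3) by (intro restrict_eqI) auto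
      then show "f \<in> ?r ` carrier ?H" using restrict_in_Hom[OF mF g(1)] by (rule image_eqI)
    qed
  qed
  \<comment> \<open>The maps that vanish on \<open>K\<close> are, by left exactness of Hom, a copy
    of Hom(U, \<omega>) inside Hom(F, \<omega>).\<close>
  let ?N = "{u \<in> carrier ?H. ?r u = \<zero>\<^bsub>?HK\<^esub>}"
  have sN: "submodule ?N R ?H" by (rule submod_ker[OF mH mHK r])
  have "Ext_vanish (Suc j) ?H ?N" by (rule Ext_vanish_of_surj[OF mH mHK r rs refl vK])
  from Ext_vanish_submodule[OF fgm_Hom[OF fF fg_omega] sN Ext_vanish_Hom_fin_mod[OF S] this]
  have vN: "Ext_vanish j (?H \<restriction> ?N) {\<zero>\<^bsub>?H \<restriction> ?N\<^esub>}" by simp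
  have rz: "?r u = \<zero>\<^bsub>?HK\<^esub> \<longleftrightarrow> (\<forall>x\<in>K. u x = \<zero>\<^bsub>\<omega>\<^esub>)" for u unfolding Hom_apply by (auto simp: fun_eq_iff restrict_def)
  let ?q = "\<lambda>u. \<lambda>x\<in>carrier ?F. u (p x)"
  have NK: "?N = {u \<in> carrier ?H. \<forall>x\<in>carrier ?F. p x = \<zero>\<^bsub>U\<^esub> \<longrightarrow> u x = \<zero>\<^bsub>\<omega>\<^esub>}" unfolding rz by (auto simp: K)
  have b: "bij_betw ?q (carrier ?HU) ?N" unfolding NK by (rule Hom_left_exact[OF mF U modW p])
  have q: "?q \<in> mod_hom R ?HU (?H \<restriction> ?N)"
    by (rule hom_cod_sub[OF precomp_hom[OF mF p(1)]]) (use b in \<open>simp add: bij_betw_def\<close>)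
  show ?thesis by (rule Ext_vanish_iso[OF mHU module_sub[OF mH sN] q _ vN]) (use b in simp)
qed

text \<open>Dualizing reverses the syzygy sequence: Hom(U, \<omega>) becomes a syzygy of Hom(K,
  \<omega>), so degree \<open>j\<close> for \<open>U\<close> is settled by degree j + 1 for
  \<open>K\<close>. The process stops at degree \<open>d\<close>, where every finite module has
  vanishing Ext. Again the syzygies stay in one type.\<close>

lemma Ext_vanish_dual_nat:
  fixes U :: "('a, nat \<Rightarrow> 'a) module"
  assumes "fgm R U" "\<And>j. Ext_vanish j U {\<zero>\<^bsub>U\<^esub>}" "j + k \<ge> d"
  shows "Ext_vanish j (Hom_module R U \<omega>) {\<zero>\<^bsub>Hom_module R U \<omega>\<^esub>}"
  using assms
proof (induction k arbitrary: U j)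
  case 0
  have "module R U" using 0(1) by (simp add: fgm_def)
  then show ?case using Ext_vanish_fg[OF fgm_Hom[OF 0(1) fg_omega] submod_zero[OF module_Hom[OF _ modW]]] 0(3) by simp
next
  case (Suc k)
  obtain n p where p: "p \<in> mod_hom R (fin_mod R {..<n::nat}) U" "p ` carrier (fin_mod R {..<n}) = carrier U"
    using minimal_cover[OF Suc.prems(1)] by metis
  let ?K = "{u \<in> carrier (fin_mod R {..<n}). p u = \<zero>\<^bsub>U\<^esub>}"
  have mU: "module R U" using Suc.prems(1) by (simp add: fgm_def)
  have fF: "fgm R (fin_mod R {..<n})" by (rule fgm_fin_mod) simp
  note syz = Ext_vanish_syzygy[OF proj_fin_mod fF mU p refl Suc.prems(2)]
  show ?case
    by (rule Ext_vanish_dual_step[OF _ mU p refl Suc.prems(2) Suc.IH[OF fgm_sub[OF fF syz(3)]]])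
       (use syz(2) Suc.prems(3) in simp_all)
qed

lemma Ext_vanish_dual:
  assumes U: "fgm R U" "\<And>j. Ext_vanish j U {\<zero>\<^bsub>U\<^esub>}"
  shows "Ext_vanish j (Hom_module R U \<omega>) {\<zero>\<^bsub>Hom_module R U \<omega>\<^esub>}"
proof -
  obtain n p where p: "p \<in> mod_hom R (fin_mod R {..<n::nat}) U" "p ` carrier (fin_mod R {..<n}) = carrier U"
    using minimal_cover[OF U(1)] by metis
  let ?K = "{u \<in> carrier (fin_mod R {..<n}). p u = \<zero>\<^bsub>U\<^esub>}"
  have mU: "module R U" using U(1) by (simp add: fgm_def)
  have fF: "fgm R (fin_mod R {..<n})" by (rule fgm_fin_mod) simp
  note syz = Ext_vanish_syzygy[OF proj_fin_mod fF mU p refl U(2)]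
  show ?thesis
    by (rule Ext_vanish_dual_step[OF _ mU p refl U(2) Ext_vanish_dual_nat[OF fgm_sub[OF fF syz(3)], of _ d]])
       (use syz(2) in simp_all)
qed

lemma Ext_vanish_resolution:
  assumes r: "proj_resolution R V P \<delta> \<epsilon>" and fg: "\<And>i. fgm R (P i)" and v: "\<And>j. Ext_vanish j V {\<zero>\<^bsub>V\<^esub>}"
  shows "Ext_vanish j (P i) (\<delta> i ` carrier (P (Suc i)))"
proof (induction i arbitrary: j)
  case 0
  from Ext_vanish_syzygy(1)[OF proj_resolutionD(3)[OF r] fg proj_resolutionD(1,4,6)[OF r] proj_resolution_ker(1)[OF r] v] show ?case .
next
  case (Suc i)
  let ?K = "\<delta> i ` carrier (P (Suc i))"
  have sK: "submodule ?K R (P i)" by (rule submod_image[OF proj_resolutionD(2)[OF r] proj_resolutionD(2)[OF r] proj_resolutionD(5)[OF r] submod_carrier[OF proj_resolutionD(2)[OF r]]])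
  have vK: "Ext_vanish j (P i \<restriction> ?K) {\<zero>\<^bsub>P i \<restriction> ?K\<^esub>}" for j
    using Ext_vanish_submodule[OF fg sK Ext_vanish_proj[OF proj_resolutionD(3)[OF r]] Suc.IH] by simp
  have eq: "\<delta> (Suc i) ` carrier (P (Suc (Suc i))) = {x \<in> carrier (P (Suc i)). \<delta> i x = \<zero>\<^bsub>P i \<restriction> ?K\<^esub>}"
    unfolding proj_resolution_ker(2)[OF r] by simp
  show ?case
    by (rule Ext_vanish_syzygy(1)[OF proj_resolutionD(3)[OF r] fg module_sub[OF proj_resolutionD(2)[OF r] sK] hom_cod_sub[OF proj_resolutionD(5)[OF r]] _ eq vK]) simp_all
qed

text \<open>Here vanishing for the injective resolution turns into exactness of Hom(P, \<omega>) in
  positive degrees: a cocycle factors through the image of the differential and extends from there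
  to the whole of \<open>P i\<close>.\<close>

lemma hom_cohomology_zero:
  assumes r: "proj_resolution R V P \<delta> \<epsilon>" and fg: "\<And>i. fgm R (P i)" and v: "\<And>j. Ext_vanish j V {\<zero>\<^bsub>V\<^esub>}"
    and f: "f \<in> mod_hom R (P (Suc i)) \<omega>" "\<And>x. x \<in> carrier (P (Suc (Suc i))) \<Longrightarrow> f (\<delta> (Suc i) x) = \<zero>\<^bsub>\<omega>\<^esub>"
  shows "\<exists>g\<in>mod_hom R (P i) \<omega>. \<forall>x\<in>carrier (P (Suc i)). g (\<delta> i x) = f x"
proof -
  let ?K = "\<delta> i ` carrier (P (Suc i))"
  have sK: "submodule ?K R (P i)" by (rule submod_image[OF proj_resolutionD(2)[OF r] proj_resolutionD(2)[OF r] proj_resolutionD(5)[OF r] submod_carrier[OF proj_resolutionD(2)[OF r]]])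
  have "\<exists>k\<in>mod_hom R (P i \<restriction> ?K) \<omega>. \<forall>x\<in>carrier (P (Suc i)). k (\<delta> i x) = f x"
  proof (rule hom_factor[OF proj_resolutionD(2)[OF r] module_sub[OF proj_resolutionD(2)[OF r] sK] modW hom_cod_sub[OF proj_resolutionD(5)[OF r]] _ f(1)])
    fix x assume "x \<in> carrier (P (Suc i))" "\<delta> i x = \<zero>\<^bsub>P i \<restriction> ?K\<^esub>"
    then show "f x = \<zero>\<^bsub>\<omega>\<^esub>" using proj_resolutionD(8)[OF r, of x i] f(2) by auto
  qed auto
  then obtain k where k: "k \<in> mod_hom R (P i \<restriction> ?K) \<omega>" "\<forall>x\<in>carrier (P (Suc i)). k (\<delta> i x) = f x" by metis
  obtain g where g: "g \<in> mod_hom R (P i) \<omega>" "\<forall>a\<in>?K. g a = k a"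
    using hom_ext_of_Ext_vanish[OF fg sK Ext_vanish_resolution[OF r fg v] k(1)] by metis
  then show ?thesis using k(2) by (intro bexI[of _ g]) auto
qed

end

section \<open>Cohomology modulo a regular sequence\<close>

lemma (in module) minus_telescope:
  "x \<in> carrier M \<Longrightarrow> y \<in> carrier M \<Longrightarrow> z \<in> carrier M \<Longrightarrow> (x \<ominus>\<^bsub>M\<^esub> y) \<oplus>\<^bsub>M\<^esub> (y \<ominus>\<^bsub>M\<^esub> z) = x \<ominus>\<^bsub>M\<^esub> z"
  using M.r_neg1[of y "\<ominus>\<^bsub>M\<^esub> z"] by (simp add: a_minus_def M.a_assoc)

lemma (in module) minus_minus_plus:
  "x \<in> carrier M \<Longrightarrow> y \<in> carrier M \<Longrightarrow> z \<in> carrier M \<Longrightarrow> (x \<ominus>\<^bsub>M\<^esub> y \<ominus>\<^bsub>M\<^esub> z) \<oplus>\<^bsub>M\<^esub> y = x \<ominus>\<^bsub>M\<^esub> z"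
  by (simp add: a_minus_def M.a_ac M.r_neg2)

lemma (in module) smult_minus:
  "a \<in> carrier R \<Longrightarrow> x \<in> carrier M \<Longrightarrow> y \<in> carrier M \<Longrightarrow> a \<odot>\<^bsub>M\<^esub> (x \<ominus>\<^bsub>M\<^esub> y) = a \<odot>\<^bsub>M\<^esub> x \<ominus>\<^bsub>M\<^esub> a \<odot>\<^bsub>M\<^esub> y"
  by (simp add: a_minus_def smult_r_distr smult_r_minus)

lemma (in module) minus_zero_right: "x \<in> carrier M \<Longrightarrow> x \<ominus>\<^bsub>M\<^esub> \<zero>\<^bsub>M\<^esub> = x"
  by (simp add: a_minus_def a_inv_def)

text \<open>Unlike \<open>coboundaries\<close>, these maps are not made extensional, so they can be composed freely.\<close>

fun bdry :: "('a,'r) ring_scheme \<Rightarrow> (nat \<Rightarrow> ('a,'u) module) \<Rightarrow> (nat \<Rightarrow> 'u \<Rightarrow> 'u) \<Rightarrow> ('a,'c,'m) module_scheme \<Rightarrow> nat \<Rightarrow> ('u \<Rightarrow> 'c) set" where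
  "bdry R P \<delta> W 0 = {\<lambda>_. \<zero>\<^bsub>W\<^esub>}"
| "bdry R P \<delta> W (Suc i) = (\<lambda>g x. g (\<delta> i x)) ` mod_hom R (P i) W"

text \<open>The \<open>i\<close>-th cohomology of \<open>Hom(P, W / A)\<close> vanishes; as \<open>P i\<close> is projective, maps to \<open>W / A\<close> lift to \<open>W\<close>.\<close>

definition cohom_vanish :: "('a,'r) ring_scheme \<Rightarrow> (nat \<Rightarrow> ('a,'u) module) \<Rightarrow> (nat \<Rightarrow> 'u \<Rightarrow> 'u) \<Rightarrow> ('a,'c,'m) module_scheme \<Rightarrow> 'c set \<Rightarrow> nat \<Rightarrow> bool" where
  "cohom_vanish R P \<delta> W A i \<longleftrightarrow> (\<forall>f\<in>mod_hom R (P i) W. (\<forall>x\<in>carrier (P (Suc i)). f (\<delta> i x) \<in> A) \<longrightarrow>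
     (\<exists>b\<in>bdry R P \<delta> W i. \<forall>x\<in>carrier (P i). f x \<ominus>\<^bsub>W\<^esub> b x \<in> A))"

lemma cohom_vanishD:
  assumes "cohom_vanish R P \<delta> W A i" "f \<in> mod_hom R (P i) W" "\<And>x. x \<in> carrier (P (Suc i)) \<Longrightarrow> f (\<delta> i x) \<in> A"
  obtains b where "b \<in> bdry R P \<delta> W i" "\<And>x. x \<in> carrier (P i) \<Longrightarrow> f x \<ominus>\<^bsub>W\<^esub> b x \<in> A"
proof -
  have "\<exists>b\<in>bdry R P \<delta> W i. \<forall>x\<in>carrier (P i). f x \<ominus>\<^bsub>W\<^esub> b x \<in> A" using assms unfolding cohom_vanish_def by simp
  then show ?thesis using that by (elim bexE) simp
qed

lemma cohom_vanishI:
  assumes "\<And>f. f \<in> mod_hom R (P i) W \<Longrightarrow> (\<And>x. x \<in> carrier (P (Suc i)) \<Longrightarrow> f (\<delta> i x) \<in> A) \<Longrightarrow>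
     \<exists>b\<in>bdry R P \<delta> W i. \<forall>x\<in>carrier (P i). f x \<ominus>\<^bsub>W\<^esub> b x \<in> A"
  shows "cohom_vanish R P \<delta> W A i"
  using assms unfolding cohom_vanish_def by simp

lemma bdry_props:
  assumes r: "proj_resolution R V P \<delta> \<epsilon>" and W: "module R W" and b: "b \<in> bdry R P \<delta> W i"
  shows "b \<in> mod_hom R (P i) W" "\<And>x. x \<in> carrier (P (Suc i)) \<Longrightarrow> b (\<delta> i x) = \<zero>\<^bsub>W\<^esub>"
proof -
  have "b \<in> mod_hom R (P i) W \<and> (\<forall>x\<in>carrier (P (Suc i)). b (\<delta> i x) = \<zero>\<^bsub>W\<^esub>)"
  proof (cases i)
    case 0 then show ?thesis using b hom_zero_map[OF W] by auto
  next
    case (Suc k)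
    then obtain g where g: "b = (\<lambda>x. g (\<delta> k x))" "g \<in> mod_hom R (P k) W" using b by auto
    show ?thesis unfolding g(1) Suc using hom_comp[OF proj_resolutionD(5)[OF r] g(2)] proj_resolutionD(10)[OF r, of _ k] hom_zero[OF proj_resolutionD(2)[OF r] W g(2)] by simp
  qed
  then show "b \<in> mod_hom R (P i) W" "\<And>x. x \<in> carrier (P (Suc i)) \<Longrightarrow> b (\<delta> i x) = \<zero>\<^bsub>W\<^esub>" by auto
qed

context noetherian_local_ring begin

text \<open>Modulo \<open>A\<close> the map \<open>f\<close> has values in y (W/A), so projectivity
  of \<open>P\<close> lifts it along multiplication by \<open>y\<close> on W/A. This needs the
  quotient as an actual module.\<close>

lemma lift_mod:
  assumes P: "proj_mod R P" and W: "module R W" and A: "submodule A R W" and y: "y \<in> carrier R"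
    and f: "f \<in> mod_hom R P W" "\<And>x. x \<in> carrier P \<Longrightarrow> f x \<in> addmul W A y"
  obtains g where "g \<in> mod_hom R P W" "\<And>x. x \<in> carrier P \<Longrightarrow> f x \<ominus>\<^bsub>W\<^esub> y \<odot>\<^bsub>W\<^esub> g x \<in> A"
proof -
  interpret W: module R W by (rule W)
  note AD = submodD[OF W A]
  let ?Z = "quot_module W A"
  have mZ: "module R ?Z" by (rule module_quot[OF W A])
  have q: "(\<lambda>w. A +>\<^bsub>W\<^esub> w) \<in> mod_hom R W ?Z" by (rule quot_coset_hom[OF W A])
  have qy: "(\<lambda>w. A +>\<^bsub>W\<^esub> (y \<odot>\<^bsub>W\<^esub> w)) \<in> mod_hom R W ?Z" by (rule hom_comp[OF hom_smult_id[OF W y] q])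
  have qf: "(\<lambda>x. A +>\<^bsub>W\<^esub> f x) \<in> mod_hom R P ?Z" by (rule hom_comp[OF f(1) q])
  have "(\<lambda>x. A +>\<^bsub>W\<^esub> f x) ` carrier P \<subseteq> (\<lambda>w. A +>\<^bsub>W\<^esub> (y \<odot>\<^bsub>W\<^esub> w)) ` carrier W"
  proof (rule image_subsetI)
    fix x assume x: "x \<in> carrier P"
    obtain a b where ab: "a \<in> A" "b \<in> (\<lambda>u. y \<odot>\<^bsub>W\<^esub> u) ` carrier W" "f x = a \<oplus>\<^bsub>W\<^esub> b" using f(2)[OF x] by (rule msumE)
    from ab(2) obtain w where w: "b = y \<odot>\<^bsub>W\<^esub> w" "w \<in> carrier W" by (rule imageE)
    have aW: "a \<in> carrier W" by (rule AD(3)[OF ab(1)])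
    have "f x \<ominus>\<^bsub>W\<^esub> y \<odot>\<^bsub>W\<^esub> w = a" using ab(3) w aW y by (simp add: W.add_minus_cancel')
    then have "A +>\<^bsub>W\<^esub> f x = A +>\<^bsub>W\<^esub> (y \<odot>\<^bsub>W\<^esub> w)" using quot_coset_eq_iff[OF W A hom_closed[OF f(1) x], of "y \<odot>\<^bsub>W\<^esub> w"] w y ab(1) by simp
    then show "A +>\<^bsub>W\<^esub> f x \<in> (\<lambda>w. A +>\<^bsub>W\<^esub> (y \<odot>\<^bsub>W\<^esub> w)) ` carrier W" using w(2) by (rule image_eqI)
  qed
  from proj_lift[OF P W mZ qf qy this] obtain g where g: "g \<in> mod_hom R P W"
    "\<forall>x\<in>carrier P. A +>\<^bsub>W\<^esub> (y \<odot>\<^bsub>W\<^esub> g x) = A +>\<^bsub>W\<^esub> f x" by (elim bexE)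
  show ?thesis
  proof (rule that[OF g(1)])
    fix x assume x: "x \<in> carrier P"
    then have "A +>\<^bsub>W\<^esub> f x = A +>\<^bsub>W\<^esub> (y \<odot>\<^bsub>W\<^esub> g x)" using g(2) by simp
    then show "f x \<ominus>\<^bsub>W\<^esub> y \<odot>\<^bsub>W\<^esub> g x \<in> A"
      using quot_coset_eq_iff[OF W A hom_closed[OF f(1) x], of "y \<odot>\<^bsub>W\<^esub> g x"] hom_closed[OF g(1) x] y by simp
  qed
qed

text \<open>From 0 \<rightarrow> W/A \<rightarrow> W/A \<rightarrow> W/(A + y W) \<rightarrow> 0,
  with \<open>y\<close> as the first map: the cohomology of the last term lies between that of W/A
  in degrees \<open>i\<close> and i + 1.\<close>

lemma cohom_vanish_quot:
  assumes r: "proj_resolution R V P \<delta> \<epsilon>" and W: "module R W" and A: "submodule A R W" and y: "y \<in> carrier R"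
    and reg: "\<And>w. w \<in> carrier W \<Longrightarrow> y \<odot>\<^bsub>W\<^esub> w \<in> A \<Longrightarrow> w \<in> A"
    and u: "cohom_vanish R P \<delta> W A i" "cohom_vanish R P \<delta> W A (Suc i)"
  shows "cohom_vanish R P \<delta> W (addmul W A y) i"
proof (rule cohom_vanishI)
  fix f assume f: "f \<in> mod_hom R (P i) W" and fB: "\<And>x. x \<in> carrier (P (Suc i)) \<Longrightarrow> f (\<delta> i x) \<in> addmul W A y"
  interpret W: module R W by (rule W)
  note AD = submodD[OF W A] and sup = addmul_superset[OF W A y] and BD = submodD[OF W submod_addmul[OF W A y]]
  note dl = proj_resolutionD(5)[OF r]
  obtain g where g: "g \<in> mod_hom R (P (Suc i)) W" "\<And>x. x \<in> carrier (P (Suc i)) \<Longrightarrow> f (\<delta> i x) \<ominus>\<^bsub>W\<^esub> y \<odot>\<^bsub>W\<^esub> g x \<in> A"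
    by (rule lift_mod[OF proj_resolutionD(3)[OF r] W A y hom_comp[OF dl f] fB]) auto
  have gz: "g (\<delta> (Suc i) x) \<in> A" if x: "x \<in> carrier (P (Suc (Suc i)))" for x
  proof (rule reg)
    have dx: "\<delta> (Suc i) x \<in> carrier (P (Suc i))" by (rule hom_closed[OF dl x])
    show gc: "g (\<delta> (Suc i) x) \<in> carrier W" by (rule hom_closed[OF g(1) dx])
    have "\<zero>\<^bsub>W\<^esub> \<ominus>\<^bsub>W\<^esub> y \<odot>\<^bsub>W\<^esub> g (\<delta> (Suc i) x) \<in> A" using g(2)[OF dx] proj_resolutionD(10)[OF r x] hom_zero[OF proj_resolutionD(2)[OF r] W f] by simp
    then have "\<ominus>\<^bsub>W\<^esub> (y \<odot>\<^bsub>W\<^esub> g (\<delta> (Suc i) x)) \<in> A" using gc y by (simp add: a_minus_def)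
    then show "y \<odot>\<^bsub>W\<^esub> g (\<delta> (Suc i) x) \<in> A" using AD(4) gc y by fastforce
  qed
  obtain b where b: "b \<in> bdry R P \<delta> W (Suc i)" "\<And>x. x \<in> carrier (P (Suc i)) \<Longrightarrow> g x \<ominus>\<^bsub>W\<^esub> b x \<in> A"
    by (rule cohom_vanishD[OF u(2) g(1) gz]) auto
  from b(1) obtain h where h: "h \<in> mod_hom R (P i) W" "b = (\<lambda>x. h (\<delta> i x))" by auto
  let ?f = "\<lambda>x. f x \<ominus>\<^bsub>W\<^esub> y \<odot>\<^bsub>W\<^esub> h x"
  have f': "?f \<in> mod_hom R (P i) W" by (rule hom_minus[OF W f hom_scale[OF W h(1) y]])
  have f'A: "?f (\<delta> i x) \<in> A" if x: "x \<in> carrier (P (Suc i))" for x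
  proof -
    have c: "f (\<delta> i x) \<in> carrier W" "h (\<delta> i x) \<in> carrier W" "g x \<in> carrier W"
      using hom_closed[OF f hom_closed[OF dl x]] hom_closed[OF h(1) hom_closed[OF dl x]] hom_closed[OF g(1) x] .
    have "?f (\<delta> i x) = (f (\<delta> i x) \<ominus>\<^bsub>W\<^esub> y \<odot>\<^bsub>W\<^esub> g x) \<oplus>\<^bsub>W\<^esub> y \<odot>\<^bsub>W\<^esub> (g x \<ominus>\<^bsub>W\<^esub> h (\<delta> i x))"
      using c y by (simp add: W.smult_minus W.minus_telescope)
    then show ?thesis using AD(5)[OF g(2)[OF x] AD(7)[OF y b(2)[OF x]]] h(2) by simp
  qed
  obtain c where c: "c \<in> bdry R P \<delta> W i" "\<And>x. x \<in> carrier (P i) \<Longrightarrow> ?f x \<ominus>\<^bsub>W\<^esub> c x \<in> A"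
    by (rule cohom_vanishD[OF u(1) f' f'A]) auto
  show "\<exists>b\<in>bdry R P \<delta> W i. \<forall>x\<in>carrier (P i). f x \<ominus>\<^bsub>W\<^esub> b x \<in> addmul W A y"
  proof (rule bexI[OF _ c(1)], rule ballI)
    fix x assume x: "x \<in> carrier (P i)"
    have k: "f x \<in> carrier W" "h x \<in> carrier W" "c x \<in> carrier W"
      using hom_closed[OF f x] hom_closed[OF h(1) x] hom_closed[OF bdry_props(1)[OF r W c(1)] x] .
    have "f x \<ominus>\<^bsub>W\<^esub> c x = (?f x \<ominus>\<^bsub>W\<^esub> c x) \<oplus>\<^bsub>W\<^esub> y \<odot>\<^bsub>W\<^esub> h x" using k y by (simp add: W.minus_minus_plus)
    then show "f x \<ominus>\<^bsub>W\<^esub> c x \<in> addmul W A y" using BD(5)[OF subsetD[OF sup(1) c(2)[OF x]] sup(2)[OF k(2)]] by simp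
  qed
qed

text \<open>The chain map \<open>k\<close> lifts the zero map of \<open>V\<close>, so
  \<open>k 0\<close> has boundaries as values. Projectivity then yields the homotopy degree by
  degree.\<close>

lemma null_homotopy:
  assumes r: "proj_resolution R V P \<delta> \<epsilon>" and k: "\<And>i. k i \<in> mod_hom R (P i) (P i)"
    and kd: "\<And>i x. x \<in> carrier (P (Suc i)) \<Longrightarrow> \<delta> i (k (Suc i) x) = k i (\<delta> i x)"
    and ke: "\<And>x. x \<in> carrier (P 0) \<Longrightarrow> \<epsilon> (k 0 x) = \<zero>\<^bsub>V\<^esub>"
  shows "\<exists>s. (\<forall>i. s i \<in> mod_hom R (P i) (P (Suc i))) \<and> (\<forall>x\<in>carrier (P 0). k 0 x = \<delta> 0 (s 0 x)) \<and>
    (\<forall>i. \<forall>x\<in>carrier (P (Suc i)). k (Suc i) x = \<delta> (Suc i) (s (Suc i) x) \<oplus>\<^bsub>P (Suc i)\<^esub> s i (\<delta> i x))"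
proof -
  note mP = proj_resolutionD(2)[OF r] and dl = proj_resolutionD(5)[OF r]
  \<comment> \<open>The recursion carries the identity of \<open>\<delta> i\<close> after
    \<open>s\<close> with \<open>k i\<close> on boundaries only. That is enough for the next error
    term to be a cycle, and it holds in all degrees, while the full equation holds only for i =
    0.\<close>
  define G where "G i s \<longleftrightarrow> s \<in> mod_hom R (P i) (P (Suc i)) \<and> (\<forall>x\<in>carrier (P (Suc i)). \<delta> i (s (\<delta> i x)) = k i (\<delta> i x)) \<and>
      (i = 0 \<longrightarrow> (\<forall>x\<in>carrier (P 0). \<delta> 0 (s x) = k 0 x))" for i s
  define Q where "Q i s s' \<longleftrightarrow> (\<forall>x\<in>carrier (P (Suc i)). k (Suc i) x = \<delta> (Suc i) (s' x) \<oplus>\<^bsub>P (Suc i)\<^esub> s (\<delta> i x))" for i s s'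
  have "\<exists>s. \<forall>i. G i (s i) \<and> Q i (s i) (s (Suc i))"
  proof (rule dependent_nat_choice)
    have "k 0 ` carrier (P 0) \<subseteq> \<delta> 0 ` carrier (P (Suc 0))"
      using proj_resolutionD(7)[OF r hom_closed[OF k[of 0]]] ke by (intro image_subsetI) simp
    from proj_lift[OF proj_resolutionD(3)[OF r] mP mP k dl this] obtain s where
      "s \<in> mod_hom R (P 0) (P (Suc 0))" "\<forall>x\<in>carrier (P 0). \<delta> 0 (s x) = k 0 x" by (elim bexE)
    then show "\<exists>s. G 0 s" unfolding G_def using hom_closed[OF dl, of _ 0] by (intro exI[of _ s]) simp
  next
    fix s i assume "G i s"
    then have s: "s \<in> mod_hom R (P i) (P (Suc i))" "\<And>x. x \<in> carrier (P (Suc i)) \<Longrightarrow> \<delta> i (s (\<delta> i x)) = k i (\<delta> i x)" by (auto simp: G_def)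
    interpret P: module R "P i" by (rule mP)
    interpret P1: module R "P (Suc i)" by (rule mP)
    let ?f = "\<lambda>x. k (Suc i) x \<ominus>\<^bsub>P (Suc i)\<^esub> s (\<delta> i x)"
    have f: "?f \<in> mod_hom R (P (Suc i)) (P (Suc i))" by (rule hom_minus[OF mP k hom_comp[OF dl s(1)]])
    have "?f ` carrier (P (Suc i)) \<subseteq> \<delta> (Suc i) ` carrier (P (Suc (Suc i)))"
    proof (rule image_subsetI)
      fix x assume x: "x \<in> carrier (P (Suc i))"
      have "\<delta> i (?f x) = \<zero>\<^bsub>P i\<^esub>"
        using hom_diff[OF mP mP dl hom_closed[OF k x] hom_closed[OF s(1) hom_closed[OF dl x]]] kd[OF x] s(2)[OF x]
          hom_closed[OF k hom_closed[OF dl x]] by (simp add: P.minus_eq_zero_iff)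
      then show "?f x \<in> \<delta> (Suc i) ` carrier (P (Suc (Suc i)))" using proj_resolutionD(8)[OF r hom_closed[OF f x]] by simp
    qed
    from proj_lift[OF proj_resolutionD(3)[OF r] mP mP f dl this] obtain s' where
      s': "s' \<in> mod_hom R (P (Suc i)) (P (Suc (Suc i)))" "\<forall>x\<in>carrier (P (Suc i)). \<delta> (Suc i) (s' x) = ?f x" by (elim bexE)
    have "G (Suc i) s'" unfolding G_def
    proof (intro conjI ballI s'(1))
      fix x assume x: "x \<in> carrier (P (Suc (Suc i)))"
      have c: "\<delta> (Suc i) x \<in> carrier (P (Suc i))" by (rule hom_closed[OF dl x])
      show "\<delta> (Suc i) (s' (\<delta> (Suc i) x)) = k (Suc i) (\<delta> (Suc i) x)"
        using s'(2) c proj_resolutionD(10)[OF r x] hom_zero[OF mP mP s(1)] hom_closed[OF k c] by (simp add: P1.minus_zero_right)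
    qed simp
    moreover have "Q i s s'" unfolding Q_def
    proof
      fix x assume x: "x \<in> carrier (P (Suc i))"
      show "k (Suc i) x = \<delta> (Suc i) (s' x) \<oplus>\<^bsub>P (Suc i)\<^esub> s (\<delta> i x)"
        using s'(2) x hom_closed[OF k x] hom_closed[OF s(1) hom_closed[OF dl x]] by (simp add: P1.minus_plus_cancel')
    qed
    ultimately show "\<exists>s'. G (Suc i) s' \<and> Q i s s'" by (intro exI[of _ s'] conjI)
  qed
  then obtain s where s: "\<And>i. G i (s i)" "\<And>i. Q i (s i) (s (Suc i))" by auto
  show ?thesis
  proof (intro exI[of _ s] conjI allI)
    show "s i \<in> mod_hom R (P i) (P (Suc i))" for i using s(1)[of i] by (simp add: G_def)
    show "\<forall>x\<in>carrier (P 0). k 0 x = \<delta> 0 (s 0 x)" using s(1)[of 0] by (simp add: G_def)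
    show "\<forall>x\<in>carrier (P (Suc i)). k (Suc i) x = \<delta> (Suc i) (s (Suc i) x) \<oplus>\<^bsub>P (Suc i)\<^esub> s i (\<delta> i x)" for i
      using s(2)[of i] by (simp add: Q_def)
  qed
qed

text \<open>Since \<open>y\<close> kills \<open>V\<close>, multiplication by \<open>y\<close> on the resolution is null-homotopic.\<close>

lemma cohom_vanish_regular:
  assumes r: "proj_resolution R V P \<delta> \<epsilon>" and W: "module R W" and A: "submodule A R W" and y: "y \<in> carrier R"
    and reg: "\<And>w. w \<in> carrier W \<Longrightarrow> y \<odot>\<^bsub>W\<^esub> w \<in> A \<Longrightarrow> w \<in> A"
    and kill: "\<And>v. v \<in> carrier V \<Longrightarrow> y \<odot>\<^bsub>V\<^esub> v = \<zero>\<^bsub>V\<^esub>"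
  shows "cohom_vanish R P \<delta> W A 0" "cohom_vanish R P \<delta> W (addmul W A y) i \<Longrightarrow> cohom_vanish R P \<delta> W A (Suc i)"
proof -
  note mP = proj_resolutionD(2)[OF r] and dl = proj_resolutionD(5)[OF r]
  interpret W: module R W by (rule W)
  note AD = submodD[OF W A] and sup = addmul_superset[OF W A y] and BD = submodD[OF W submod_addmul[OF W A y]]
  obtain s where s: "\<And>i. s i \<in> mod_hom R (P i) (P (Suc i))" "\<And>x. x \<in> carrier (P 0) \<Longrightarrow> y \<odot>\<^bsub>P 0\<^esub> x = \<delta> 0 (s 0 x)"
    "\<And>i x. x \<in> carrier (P (Suc i)) \<Longrightarrow> y \<odot>\<^bsub>P (Suc i)\<^esub> x = \<delta> (Suc i) (s (Suc i) x) \<oplus>\<^bsub>P (Suc i)\<^esub> s i (\<delta> i x)"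
  proof -
    obtain s where *: "\<forall>i. s i \<in> mod_hom R (P i) (P (Suc i))"
      "\<forall>x\<in>carrier (P 0). y \<odot>\<^bsub>P 0\<^esub> x = \<delta> 0 (s 0 x)"
      "\<forall>i. \<forall>x\<in>carrier (P (Suc i)). y \<odot>\<^bsub>P (Suc i)\<^esub> x = \<delta> (Suc i) (s (Suc i) x) \<oplus>\<^bsub>P (Suc i)\<^esub> s i (\<delta> i x)"
    proof -
      have "\<exists>s. (\<forall>i. s i \<in> mod_hom R (P i) (P (Suc i))) \<and> (\<forall>x\<in>carrier (P 0). y \<odot>\<^bsub>P 0\<^esub> x = \<delta> 0 (s 0 x)) \<and>
        (\<forall>i. \<forall>x\<in>carrier (P (Suc i)). y \<odot>\<^bsub>P (Suc i)\<^esub> x = \<delta> (Suc i) (s (Suc i) x) \<oplus>\<^bsub>P (Suc i)\<^esub> s i (\<delta> i x))"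
        by (rule null_homotopy[OF r hom_smult_id[OF mP y]])
           (use hom_smult[OF dl y] hom_smult[OF proj_resolutionD(4)[OF r] y] kill hom_closed[OF proj_resolutionD(4)[OF r]] in auto)
      then show ?thesis by (elim exE conjE) (rule that)
    qed
    show ?thesis by (rule that[of s]) (use * in blast)+
  qed
  \<comment> \<open>In degree 0 the homotopy makes \<open>y x\<close> a boundary. So
    \<open>y\<close> moves the values of a cocycle into \<open>A\<close>, and by regularity they lie
    in \<open>A\<close> already.\<close>
  show "cohom_vanish R P \<delta> W A 0"
  proof (rule cohom_vanishI)
    fix f assume f: "f \<in> mod_hom R (P 0) W" and fA: "\<And>x. x \<in> carrier (P (Suc 0)) \<Longrightarrow> f (\<delta> 0 x) \<in> A"
    have "f x \<ominus>\<^bsub>W\<^esub> \<zero>\<^bsub>W\<^esub> \<in> A" if x: "x \<in> carrier (P 0)" for x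
    proof -
      have "y \<odot>\<^bsub>W\<^esub> f x = f (\<delta> 0 (s 0 x))" using hom_smult[OF f y x] s(2)[OF x] by simp
      then have "y \<odot>\<^bsub>W\<^esub> f x \<in> A" using fA hom_closed[OF s(1) x] by simp
      then show ?thesis using reg[OF hom_closed[OF f x]] hom_closed[OF f x] by (simp add: W.minus_zero_right)
    qed
    then show "\<exists>b\<in>bdry R P \<delta> W 0. \<forall>x\<in>carrier (P 0). f x \<ominus>\<^bsub>W\<^esub> b x \<in> A" by simp
  qed
  assume u: "cohom_vanish R P \<delta> W (addmul W A y) i"
  show "cohom_vanish R P \<delta> W A (Suc i)"
  proof (rule cohom_vanishI)
    fix f assume f: "f \<in> mod_hom R (P (Suc i)) W" and fA: "\<And>x. x \<in> carrier (P (Suc (Suc i))) \<Longrightarrow> f (\<delta> (Suc i) x) \<in> A"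
    \<comment> \<open>By the homotopy, \<open>y f\<close> equals \<open>g\<close> after the
      differential, up to elements of \<open>A\<close>. Hence \<open>g\<close> is a cocycle modulo A
      + y W. Writing \<open>g\<close> as a coboundary plus \<open>y h\<close> modulo
      \<open>A\<close> and cancelling \<open>y\<close> makes \<open>f\<close> the coboundary of
      \<open>h\<close>.\<close>
    let ?g = "\<lambda>x. f (s i x)"
    have g: "?g \<in> mod_hom R (P i) W" by (rule hom_comp[OF s(1) f])
    have yf: "y \<odot>\<^bsub>W\<^esub> f x = f (\<delta> (Suc i) (s (Suc i) x)) \<oplus>\<^bsub>W\<^esub> ?g (\<delta> i x)" if x: "x \<in> carrier (P (Suc i))" for x
      using hom_smult[OF f y x] s(3)[OF x] hom_add[OF f hom_closed[OF dl hom_closed[OF s(1) x]] hom_closed[OF s(1) hom_closed[OF dl x]]]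
      by simp
    have fd: "f (\<delta> (Suc i) (s (Suc i) x)) \<in> A" if x: "x \<in> carrier (P (Suc i))" for x using fA[OF hom_closed[OF s(1) x]] .
    have gB: "?g (\<delta> i x) \<in> addmul W A y" if x: "x \<in> carrier (P (Suc i))" for x
    proof -
      have "?g (\<delta> i x) = y \<odot>\<^bsub>W\<^esub> f x \<ominus>\<^bsub>W\<^esub> f (\<delta> (Suc i) (s (Suc i) x))"
        unfolding yf[OF x] using AD(3)[OF fd[OF x]] hom_closed[OF g hom_closed[OF dl x]] by (simp add: W.minus_add_cancel')
      then show ?thesis using BD(6)[OF sup(2)[OF hom_closed[OF f x]] subsetD[OF sup(1) fd[OF x]]] by simp
    qed
    obtain b where b: "b \<in> bdry R P \<delta> W i" "\<And>x. x \<in> carrier (P i) \<Longrightarrow> ?g x \<ominus>\<^bsub>W\<^esub> b x \<in> addmul W A y"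
      by (rule cohom_vanishD[OF u g gB]) auto
    note bp = bdry_props[OF r W b(1)]
    obtain h where h: "h \<in> mod_hom R (P i) W" "\<And>x. x \<in> carrier (P i) \<Longrightarrow> ?g x \<ominus>\<^bsub>W\<^esub> b x \<ominus>\<^bsub>W\<^esub> y \<odot>\<^bsub>W\<^esub> h x \<in> A"
      by (rule lift_mod[OF proj_resolutionD(3)[OF r] W A y hom_minus[OF W g bp(1)] b(2)]) auto
    have "f x \<ominus>\<^bsub>W\<^esub> h (\<delta> i x) \<in> A" if x: "x \<in> carrier (P (Suc i))" for x
    proof (rule reg)
      have dx: "\<delta> i x \<in> carrier (P i)" by (rule hom_closed[OF dl x])
      have c: "f x \<in> carrier W" "h (\<delta> i x) \<in> carrier W" "?g (\<delta> i x) \<in> carrier W" "f (\<delta> (Suc i) (s (Suc i) x)) \<in> carrier W"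
        using hom_closed[OF f x] hom_closed[OF h(1) dx] hom_closed[OF g dx] AD(3)[OF fd[OF x]] .
      show "f x \<ominus>\<^bsub>W\<^esub> h (\<delta> i x) \<in> carrier W" using c by simp
      have "?g (\<delta> i x) \<ominus>\<^bsub>W\<^esub> y \<odot>\<^bsub>W\<^esub> h (\<delta> i x) \<in> A" using h(2)[OF dx] bp(2)[OF x] c by (simp add: W.minus_zero_right)
      from AD(5)[OF fd[OF x] this] show "y \<odot>\<^bsub>W\<^esub> (f x \<ominus>\<^bsub>W\<^esub> h (\<delta> i x)) \<in> A"
        unfolding W.smult_minus[OF y c(1,2)] yf[OF x] using c y by (simp add: a_minus_def W.a_assoc)
    qed
    then show "\<exists>b\<in>bdry R P \<delta> W (Suc i). \<forall>x\<in>carrier (P (Suc i)). f x \<ominus>\<^bsub>W\<^esub> b x \<in> A" using h(1) by auto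
  qed
qed

text \<open>One half of Rees' description of depth: Ext from a module killed by \<mm> vanishes below
  the number n - k of regular elements that remain.\<close>

lemma regular_chain_cohom_vanish_less:
  assumes r: "proj_resolution R V P \<delta> \<epsilon>" and W: "module R W" and c: "regular_chain R W ys A n"
    and kill: "\<And>y v. y \<in> \<mm> \<Longrightarrow> v \<in> carrier V \<Longrightarrow> y \<odot>\<^bsub>V\<^esub> v = \<zero>\<^bsub>V\<^esub>"
  shows "k \<le> n \<Longrightarrow> i < n - k \<Longrightarrow> cohom_vanish R P \<delta> W (A k) i"
proof (induction i arbitrary: k)
  case 0
  then have k: "k < n" by simp
  then show ?case using c unfolding regular_chain_def by (intro cohom_vanish_regular(1)[OF r W _ max_carr[of "ys k"] _ kill[of "ys k"]]) auto
next
  case (Suc i)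
  then have k: "k < n" by simp
  have A: "submodule (A k) R W" "ys k \<in> \<mm>" "A (Suc k) = addmul W (A k) (ys k)"
    "\<And>w. w \<in> carrier W \<Longrightarrow> ys k \<odot>\<^bsub>W\<^esub> w \<in> A k \<Longrightarrow> w \<in> A k"
    using c k unfolding regular_chain_def by auto
  have "cohom_vanish R P \<delta> W (A (Suc k)) i" by (rule Suc.IH) (use Suc.prems in auto)
  then show ?case using cohom_vanish_regular(2)[OF r W A(1) max_carr[OF A(2)] A(4) kill[OF A(2)]] A(3) by simp
qed

text \<open>The other half: in the degree that equals the number of remaining elements, dividing by
  one of them lowers the degree by one. At the end stands Hom from \<open>V\<close> to the quotient
  by the whole sequence. Only vanishing is carried along, so no isomorphism is built.\<close>

lemma regular_chain_cohom_vanish_top: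
  assumes r: "proj_resolution R V P \<delta> \<epsilon>" and W: "module R W" and c: "regular_chain R W ys A n"
    and kill: "\<And>y v. y \<in> \<mm> \<Longrightarrow> v \<in> carrier V \<Longrightarrow> y \<odot>\<^bsub>V\<^esub> v = \<zero>\<^bsub>V\<^esub>" and u: "cohom_vanish R P \<delta> W (A 0) n"
  shows "k \<le> n \<Longrightarrow> cohom_vanish R P \<delta> W (A k) (n - k)"
proof (induction k)
  case 0 then show ?case using u by simp
next
  case (Suc k)
  then have k: "k < n" by simp
  have A: "submodule (A k) R W" "ys k \<in> \<mm>" "A (Suc k) = addmul W (A k) (ys k)"
    "\<And>w. w \<in> carrier W \<Longrightarrow> ys k \<odot>\<^bsub>W\<^esub> w \<in> A k \<Longrightarrow> w \<in> A k"
    using c k unfolding regular_chain_def by auto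
  have 1: "cohom_vanish R P \<delta> W (A k) (Suc (n - Suc k))" using Suc k by (simp add: Suc_diff_Suc)
  have 2: "cohom_vanish R P \<delta> W (A k) (n - Suc k)" by (rule regular_chain_cohom_vanish_less[OF r W c kill]) (use k in auto)
  show ?case unfolding A(3) by (rule cohom_vanish_quot[OF r W A(1) max_carr[OF A(2)] A(4) 2 1])
qed

lemma regular_chain_cohom_vanish_all:
  assumes r: "proj_resolution R V P \<delta> \<epsilon>" and W: "module R W" and c: "regular_chain R W ys A n"
    and u: "\<And>i. cohom_vanish R P \<delta> W (A 0) i"
  shows "k \<le> n \<Longrightarrow> cohom_vanish R P \<delta> W (A k) i"
proof (induction k arbitrary: i)
  case 0 then show ?case using u by simp
next
  case (Suc k)
  then have k: "k < n" by simp
  have A: "submodule (A k) R W" "ys k \<in> \<mm>" "A (Suc k) = addmul W (A k) (ys k)"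
    "\<And>w. w \<in> carrier W \<Longrightarrow> ys k \<odot>\<^bsub>W\<^esub> w \<in> A k \<Longrightarrow> w \<in> A k"
    using c k unfolding regular_chain_def by auto
  show ?case unfolding A(3) by (rule cohom_vanish_quot[OF r W A(1) max_carr[OF A(2)] A(4)]) (use Suc k in auto)
qed

section \<open>The residue field and socle elements\<close>

lemma sub_max: "submodule \<mm> R (self_module R)" using ideal_max by (simp add: ideal_iff_submod)

lemma residue_coset_hom: "(\<lambda>a. \<mm> +>\<^bsub>self_module R\<^esub> a) \<in> mod_hom R (self_module R) (residue_module R)"
  unfolding residue_module_def by (rule quot_coset_hom[OF module_self[OF is_cring] sub_max])

lemma residue_carrier: "carrier (residue_module R) = (\<lambda>a. \<mm> +>\<^bsub>self_module R\<^esub> a) ` carrier R"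
  unfolding residue_module_def quot_carrier by simp

lemma residue_zero_iff: "a \<in> carrier R \<Longrightarrow> \<mm> +>\<^bsub>self_module R\<^esub> a = \<zero>\<^bsub>residue_module R\<^esub> \<longleftrightarrow> a \<in> \<mm>"
  unfolding residue_module_def using quot_coset_zero_iff[OF module_self[OF is_cring] sub_max, of a] by simp

lemma module_residue: "module R (residue_module R)"
  unfolding residue_module_def by (rule module_quot[OF module_self[OF is_cring] sub_max])

lemma residue_killed: assumes "y \<in> \<mm>" "v \<in> carrier (residue_module R)" shows "y \<odot>\<^bsub>residue_module R\<^esub> v = \<zero>\<^bsub>residue_module R\<^esub>"
proof -
  from assms(2) obtain a where a: "v = \<mm> +>\<^bsub>self_module R\<^esub> a" "a \<in> carrier R" unfolding residue_carrier by (rule imageE)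
  have y: "y \<in> carrier R" by (rule max_carr[OF assms(1)])
  have "y \<odot>\<^bsub>residue_module R\<^esub> v = \<mm> +>\<^bsub>self_module R\<^esub> (y \<otimes> a)" using hom_smult[OF residue_coset_hom y, of a] a by simp
  moreover have "y \<otimes> a \<in> \<mm>" by (rule ideal.I_r_closed[OF ideal_max assms(1) a(2)])
  ultimately show ?thesis using residue_zero_iff[of "y \<otimes> a"] y a(2) by simp
qed

text \<open>A socle element \<open>z\<close> of W/A gives the nonzero map 1 \<mapsto> z on the
  residue field. It is represented on \<open>P 0\<close> by lifting the augmentation to R and
  multiplying \<open>z\<close> by the result.\<close>

lemma socle_imp_not_cohom_vanish:
  assumes r: "proj_resolution R (residue_module R) P \<delta> \<epsilon>" and W: "module R W" and A: "submodule A R W"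
    and z: "z \<in> carrier W" "z \<notin> A" "\<And>a. a \<in> \<mm> \<Longrightarrow> a \<odot>\<^bsub>W\<^esub> z \<in> A"
  shows "\<not> cohom_vanish R P \<delta> W A 0"
proof
  assume u: "cohom_vanish R P \<delta> W A 0"
  note mP = proj_resolutionD(2)[OF r] and dl = proj_resolutionD(5)[OF r] and eps = proj_resolutionD(4)[OF r]
  interpret W: module R W by (rule W)
  note AD = submodD[OF W A]
  have "\<epsilon> ` carrier (P 0) \<subseteq> (\<lambda>a. \<mm> +>\<^bsub>self_module R\<^esub> a) ` carrier (self_module R)"
    using proj_resolutionD(6)[OF r] residue_carrier by simp
  from proj_lift[OF proj_resolutionD(3)[OF r] module_self[OF is_cring] module_residue eps residue_coset_hom this]
  obtain q where q: "q \<in> mod_hom R (P 0) (self_module R)" "\<forall>x\<in>carrier (P 0). \<mm> +>\<^bsub>self_module R\<^esub> q x = \<epsilon> x" by (elim bexE)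
  have qc: "q x \<in> carrier R" if "x \<in> carrier (P 0)" for x using hom_closed[OF q(1) that] by simp
  have f: "(\<lambda>x. q x \<odot>\<^bsub>W\<^esub> z) \<in> mod_hom R (P 0) W" by (rule hom_comp[OF q(1) hom_smult_elem[OF W z(1)]])
  have fA: "q (\<delta> 0 x) \<odot>\<^bsub>W\<^esub> z \<in> A" if x: "x \<in> carrier (P (Suc 0))" for x
  proof -
    have dx: "\<delta> 0 x \<in> carrier (P 0)" by (rule hom_closed[OF dl x])
    have "\<mm> +>\<^bsub>self_module R\<^esub> q (\<delta> 0 x) = \<zero>\<^bsub>residue_module R\<^esub>" using q(2) dx proj_resolutionD(9)[OF r x] by simp
    then have "q (\<delta> 0 x) \<in> \<mm>" using residue_zero_iff[OF qc[OF dx]] by simp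
    then show ?thesis by (rule z(3))
  qed
  obtain b where b: "b \<in> bdry R P \<delta> W 0" "\<And>x. x \<in> carrier (P 0) \<Longrightarrow> q x \<odot>\<^bsub>W\<^esub> z \<ominus>\<^bsub>W\<^esub> b x \<in> A"
    by (rule cohom_vanishD[OF u f fA]) auto
  have "\<mm> +>\<^bsub>self_module R\<^esub> \<one> \<in> \<epsilon> ` carrier (P 0)" unfolding proj_resolutionD(6)[OF r] residue_carrier by simp
  then obtain x where x: "\<mm> +>\<^bsub>self_module R\<^esub> \<one> = \<epsilon> x" "x \<in> carrier (P 0)" by (rule imageE)
  have "q x \<notin> \<mm>" using residue_zero_iff[OF qc[OF x(2)]] residue_zero_iff[of \<one>] one_notin_max q(2) x by simp
  then have un: "q x \<in> Units R" by (rule notin_max_Unit[OF qc[OF x(2)]])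
  have "q x \<odot>\<^bsub>W\<^esub> z \<in> A" using b(1) b(2)[OF x(2)] qc[OF x(2)] z(1) by (simp add: W.minus_zero_right)
  then have "inv (q x) \<odot>\<^bsub>W\<^esub> (q x \<odot>\<^bsub>W\<^esub> z) \<in> A" by (rule AD(7)[OF Units_inv_closed[OF un]])
  moreover have "inv (q x) \<odot>\<^bsub>W\<^esub> (q x \<odot>\<^bsub>W\<^esub> z) = z" using un z(1) qc[OF x(2)] by (simp add: W.smult_assoc1[symmetric])
  ultimately show False using z(2) by simp
qed

text \<open>For a minimal resolution of any module, multiplying \<open>z\<close> by the first
  coordinate is a cocycle modulo \<open>A\<close>, because the differential has coordinates in
  \<mm>.\<close>

lemma socle_imp_not_cohom_vanish_minimal:
  fixes m :: "nat \<Rightarrow> nat"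
  assumes W: "module R W" and A: "submodule A R W"
    and z: "z \<in> carrier W" "z \<notin> A" "\<And>a. a \<in> \<mm> \<Longrightarrow> a \<odot>\<^bsub>W\<^esub> z \<in> A"
    and min: "\<And>x k. x \<in> carrier (fin_mod R {..<m (Suc 0)}) \<Longrightarrow> \<delta> 0 x k \<in> \<mm>" and m: "m 0 > 0"
  shows "\<not> cohom_vanish R (\<lambda>i. fin_mod R {..<m i}) \<delta> W A 0"
proof
  assume u: "cohom_vanish R (\<lambda>i. fin_mod R {..<m i}) \<delta> W A 0"
  interpret W: module R W by (rule W)
  have f: "(\<lambda>x. x 0 \<odot>\<^bsub>W\<^esub> z) \<in> mod_hom R (fin_mod R {..<m 0}) W"
    using z(1) fin_mod_val[of _ "{..<m 0}"] by (intro mod_homI) (auto simp: fin_mod_simps W.smult_l_distr W.smult_assoc1)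
  obtain b where b: "b \<in> bdry R (\<lambda>i. fin_mod R {..<m i}) \<delta> W 0" "\<And>x. x \<in> carrier (fin_mod R {..<m 0}) \<Longrightarrow> x 0 \<odot>\<^bsub>W\<^esub> z \<ominus>\<^bsub>W\<^esub> b x \<in> A"
    by (rule cohom_vanishD[OF u f]) (use z(3) min in auto)
  have "fin_unit R 0 \<in> carrier (fin_mod R {..<m 0})" by (rule fin_unit_carrier) (use m in simp)
  from b(2)[OF this] have "z \<in> A" using b(1) z(1) by (simp add: fin_unit_def W.minus_zero_right)
  then show False using z(2) by simp
qed

end

section \<open>Modules of finite projective dimension\<close>

context noetherian_local_ring begin

text \<open>The comparison theorem for the identity of \<open>V\<close>. The invariant
  \<open>G\<close> records that boundaries go to boundaries, which is what the next lifting
  needs.\<close>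

lemma chain_map:
  assumes r: "proj_resolution R V P \<delta> \<epsilon>" and q: "proj_resolution R V Q \<eta> \<zeta>"
  shows "\<exists>a. (\<forall>i. a i \<in> mod_hom R (P i) (Q i)) \<and> (\<forall>x\<in>carrier (P 0). \<zeta> (a 0 x) = \<epsilon> x) \<and>
    (\<forall>i. \<forall>x\<in>carrier (P (Suc i)). \<eta> i (a (Suc i) x) = a i (\<delta> i x))"
proof -
  note mP = proj_resolutionD(2)[OF r] and dl = proj_resolutionD(5)[OF r] and mQ = proj_resolutionD(2)[OF q] and et = proj_resolutionD(5)[OF q]
  define G where "G i s \<longleftrightarrow> s \<in> mod_hom R (P i) (Q i) \<and> (\<forall>x\<in>carrier (P (Suc i)). s (\<delta> i x) \<in> \<eta> i ` carrier (Q (Suc i))) \<and>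
      (i = 0 \<longrightarrow> (\<forall>x\<in>carrier (P 0). \<zeta> (s x) = \<epsilon> x))" for i s
  define T where "T i s s' \<longleftrightarrow> (\<forall>x\<in>carrier (P (Suc i)). \<eta> i (s' x) = s (\<delta> i x))" for i s s'
  have "\<exists>s. \<forall>i. G i (s i) \<and> T i (s i) (s (Suc i))"
  proof (rule dependent_nat_choice)
    have "\<epsilon> ` carrier (P 0) \<subseteq> \<zeta> ` carrier (Q 0)" using proj_resolutionD(6)[OF r] proj_resolutionD(6)[OF q] by simp
    from proj_lift[OF proj_resolutionD(3)[OF r] mQ proj_resolutionD(1)[OF r] proj_resolutionD(4)[OF r] proj_resolutionD(4)[OF q] this] obtain s where
      s: "s \<in> mod_hom R (P 0) (Q 0)" "\<forall>x\<in>carrier (P 0). \<zeta> (s x) = \<epsilon> x" by (elim bexE)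
    have "s (\<delta> 0 x) \<in> \<eta> 0 ` carrier (Q (Suc 0))" if x: "x \<in> carrier (P (Suc 0))" for x
      using proj_resolutionD(7)[OF q hom_closed[OF s(1) hom_closed[OF dl x]]] s(2) proj_resolutionD(9)[OF r x] hom_closed[OF dl x] by simp
    then show "\<exists>s. G 0 s" unfolding G_def using s by (intro exI[of _ s]) simp
  next
    fix s i assume "G i s"
    then have s: "s \<in> mod_hom R (P i) (Q i)" "\<And>x. x \<in> carrier (P (Suc i)) \<Longrightarrow> s (\<delta> i x) \<in> \<eta> i ` carrier (Q (Suc i))" by (auto simp: G_def)
    have "(\<lambda>x. s (\<delta> i x)) ` carrier (P (Suc i)) \<subseteq> \<eta> i ` carrier (Q (Suc i))" using s(2) by (intro image_subsetI)
    from proj_lift[OF proj_resolutionD(3)[OF r] mQ mQ hom_comp[OF dl s(1)] et this] obtain s' where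
      s': "s' \<in> mod_hom R (P (Suc i)) (Q (Suc i))" "\<forall>x\<in>carrier (P (Suc i)). \<eta> i (s' x) = s (\<delta> i x)" by (elim bexE)
    have "s' (\<delta> (Suc i) x) \<in> \<eta> (Suc i) ` carrier (Q (Suc (Suc i)))" if x: "x \<in> carrier (P (Suc (Suc i)))" for x
      using proj_resolutionD(8)[OF q hom_closed[OF s'(1) hom_closed[OF dl x]]] s'(2) proj_resolutionD(10)[OF r x] hom_closed[OF dl x] hom_zero[OF mP mQ s(1)] by simp
    then have "G (Suc i) s'" unfolding G_def using s'(1) by simp
    then show "\<exists>s'. G (Suc i) s' \<and> T i s s'" unfolding T_def using s'(2) by (intro exI[of _ s'] conjI)
  qed
  then obtain s where s: "\<And>i. G i (s i)" "\<And>i. T i (s i) (s (Suc i))" by auto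
  show ?thesis
  proof (intro exI[of _ s] conjI allI)
    show "s i \<in> mod_hom R (P i) (Q i)" for i using s(1)[of i] by (simp add: G_def)
    show "\<forall>x\<in>carrier (P 0). \<zeta> (s 0 x) = \<epsilon> x" using s(1)[of 0] by (simp add: G_def)
    show "\<forall>x\<in>carrier (P (Suc i)). \<eta> i (s (Suc i) x) = s i (\<delta> i x)" for i using s(2)[of i] by (simp add: T_def)
  qed
qed

text \<open>The element is a combination of unit vectors with coefficients in \<mm>, and
  \<open>g\<close> is linear.\<close>

lemma fin_mod_hom_max:
  assumes W: "module R W" and g: "g \<in> mod_hom R (fin_mod R S) W" and u: "u \<in> carrier (fin_mod R S)" "\<And>k. u k \<in> \<mm>"
  shows "g u \<in> mspan R W {a \<odot>\<^bsub>W\<^esub> w | a w. a \<in> \<mm> \<and> w \<in> carrier W}"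
proof -
  interpret W: module R W by (rule W)
  let ?G = "{a \<odot>\<^bsub>W\<^esub> w | a w. a \<in> \<mm> \<and> w \<in> carrier W}"
  have w: "(\<lambda>x. g (fin_unit R x)) \<in> S \<rightarrow> carrier W" using hom_closed[OF g fin_unit_carrier] by simp
  have "g u = lin_ext R W (\<lambda>x. g (fin_unit R x)) u"
    by (rule fin_mod_hom_eqI[OF W g lin_ext_hom[OF W w] _ u(1)]) (simp add: lin_ext_unit[OF W w])
  also have "\<dots> \<in> mspan R W ?G" unfolding lin_ext_def
  proof (rule submod_finsum[OF W mspan_submod[OF W] fin_mod_supp(1)[OF u(1)]])
    show "?G \<subseteq> carrier W" using max_carr by auto
    fix x assume "x \<in> {x. u x \<noteq> \<zero>}"
    then have "x \<in> S" using fin_mod_supp(2)[OF u(1)] by auto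
    then have "g (fin_unit R x) \<in> carrier W" using w by auto
    then have "u x \<odot>\<^bsub>W\<^esub> g (fin_unit R x) \<in> ?G" using u(2) by blast
    then show "u x \<odot>\<^bsub>W\<^esub> g (fin_unit R x) \<in> mspan R W ?G" by (rule subsetD[OF mspan_superset])
  qed
  finally show ?thesis .
qed

lemma fin_mod_hom_max_coord:
  assumes g: "g \<in> mod_hom R (fin_mod R S) (fin_mod R T)" and u: "u \<in> carrier (fin_mod R S)" "\<And>k. u k \<in> \<mm>"
  shows "g u k \<in> \<mm>"
proof -
  note mS = module_self[OF is_cring]
  have ev: "(\<lambda>x. x k) \<in> mod_hom R (fin_mod R T) (self_module R)"
    using fin_mod_val[of _ T] by (intro mod_homI) (auto simp: fin_mod_simps)
  have "g u k \<in> mspan R (self_module R) {a \<odot>\<^bsub>self_module R\<^esub> w | a w. a \<in> \<mm> \<and> w \<in> carrier (self_module R)}"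
    by (rule fin_mod_hom_max[OF mS hom_comp[OF g ev] u])
  also have "\<dots> \<subseteq> \<mm>"
    by (rule mspan_least[OF sub_max]) (use ideal.I_r_closed[OF ideal_max] in auto)
  finally show ?thesis .
qed

lemma nakayama_fgm:
  assumes W: "fgm R W" and e: "carrier W \<subseteq> mspan R W {a \<odot>\<^bsub>W\<^esub> w | a w. a \<in> \<mm> \<and> w \<in> carrier W}"
  shows "zero_module W"
proof -
  obtain S where S: "module R W" "S \<subseteq> carrier W" "finite S" "mspan R W S = carrier W"
    using W unfolding fgm_def by metis
  have "carrier W = {\<zero>\<^bsub>W\<^esub>}"
  proof (rule nakayama[OF S(1) submod_carrier[OF S(1)] submod_zero[OF S(1)] _ S(3,2)])
    show "{\<zero>\<^bsub>W\<^esub>} \<subseteq> carrier W" using module_zero_closed[OF S(1)] by simp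
    show "carrier W \<subseteq> mspan R W (S \<union> {\<zero>\<^bsub>W\<^esub>})" using mspan_mono[OF Un_upper1, of R W S "{\<zero>\<^bsub>W\<^esub>}"] S(4) by simp
    show "carrier W \<subseteq> mspan R W ({\<zero>\<^bsub>W\<^esub>} \<union> {a \<odot>\<^bsub>W\<^esub> x |a x. a \<in> \<mm> \<and> x \<in> carrier W})"
      using e mspan_mono[OF Un_upper2] by (rule order_trans)
  qed
  then show ?thesis by (simp add: zero_module_def)
qed

text \<open>The comparison maps between the two resolutions compose to a map homotopic to the identity. In degree
  \<open>p + 1\<close> it is zero, so there the identity takes values in the maximal ideal by minimality.\<close>

lemma minimal_length:
  fixes m :: "nat \<Rightarrow> nat"
  assumes r: "proj_resolution R V (\<lambda>i. fin_mod R {..<m i}) \<delta> \<epsilon>" and min: "\<And>i x k. x \<in> carrier (fin_mod R {..<m (Suc i)}) \<Longrightarrow> \<delta> i x k \<in> \<mm>"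
    and q: "proj_resolution R V Q \<eta> \<zeta>" and z: "zero_module (Q (Suc p))"
  shows "m (Suc p) = 0"
proof (rule ccontr)
  assume m: "m (Suc p) \<noteq> 0"
  let ?P = "\<lambda>i. fin_mod R {..<m i}"
  note mP = proj_resolutionD(2)[OF r] and dl = proj_resolutionD(5)[OF r] and mQ = proj_resolutionD(2)[OF q]
  obtain a where a: "\<And>i. a i \<in> mod_hom R (?P i) (Q i)" "\<And>x. x \<in> carrier (?P 0) \<Longrightarrow> \<zeta> (a 0 x) = \<epsilon> x"
    "\<And>i x. x \<in> carrier (?P (Suc i)) \<Longrightarrow> \<eta> i (a (Suc i) x) = a i (\<delta> i x)" using chain_map[OF r q] by metis
  obtain b where b: "\<And>i. b i \<in> mod_hom R (Q i) (?P i)" "\<And>x. x \<in> carrier (Q 0) \<Longrightarrow> \<epsilon> (b 0 x) = \<zeta> x"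
    "\<And>i x. x \<in> carrier (Q (Suc i)) \<Longrightarrow> \<delta> i (b (Suc i) x) = b i (\<eta> i x)" using chain_map[OF q r] by metis
  let ?k = "\<lambda>i x. x \<ominus>\<^bsub>?P i\<^esub> b i (a i x)"
  have k: "?k i \<in> mod_hom R (?P i) (?P i)" for i by (rule hom_minus[OF mP hom_id hom_comp[OF a(1) b(1)]])
  have ba: "b i (a i x) \<in> carrier (?P i)" if "x \<in> carrier (?P i)" for i x using hom_closed[OF b(1) hom_closed[OF a(1) that]] .
  have "\<exists>s. (\<forall>i. s i \<in> mod_hom R (?P i) (?P (Suc i))) \<and> (\<forall>x\<in>carrier (?P 0). ?k 0 x = \<delta> 0 (s 0 x)) \<and>
    (\<forall>i. \<forall>x\<in>carrier (?P (Suc i)). ?k (Suc i) x = \<delta> (Suc i) (s (Suc i) x) \<oplus>\<^bsub>?P (Suc i)\<^esub> s i (\<delta> i x))"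
  proof (rule null_homotopy[OF r k])
    fix i x assume x: "x \<in> carrier (?P (Suc i))"
    show "\<delta> i (?k (Suc i) x) = ?k i (\<delta> i x)"
      using hom_diff[OF mP mP dl x ba[OF x]] b(3)[OF hom_closed[OF a(1) x]] a(3)[OF x] by simp
  next
    fix x assume x: "x \<in> carrier (?P 0)"
    interpret V: module R V by (rule proj_resolutionD(1)[OF r])
    show "\<epsilon> (?k 0 x) = \<zero>\<^bsub>V\<^esub>"
      using hom_diff[OF mP proj_resolutionD(1)[OF r] proj_resolutionD(4)[OF r] x ba[OF x]] b(2)[OF hom_closed[OF a(1) x]] a(2)[OF x]
        hom_closed[OF proj_resolutionD(4)[OF r] x] by (simp add: V.minus_eq_zero_iff)
  qed
  then obtain s where s1: "\<forall>i. s i \<in> mod_hom R (?P i) (?P (Suc i))"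
    and s2: "\<forall>i. \<forall>x\<in>carrier (?P (Suc i)). ?k (Suc i) x = \<delta> (Suc i) (s (Suc i) x) \<oplus>\<^bsub>?P (Suc i)\<^esub> s i (\<delta> i x)" by (elim exE conjE)
  note s = s1[rule_format] s2[rule_format]
  let ?x = "fin_unit R (0::nat)"
  have x: "?x \<in> carrier (?P (Suc p))" by (rule fin_unit_carrier) (use m in simp)
  interpret P: module R "?P (Suc p)" by (rule mP)
  have "a (Suc p) ?x = \<zero>\<^bsub>Q (Suc p)\<^esub>" using hom_closed[OF a(1) x] z by (simp add: zero_module_def)
  then have "b (Suc p) (a (Suc p) ?x) = \<zero>\<^bsub>?P (Suc p)\<^esub>" using hom_zero[OF mQ mP b(1)] by simp
  then have "?k (Suc p) ?x = ?x" using x by (simp add: P.minus_zero_right)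
  then have "?x = \<delta> (Suc p) (s (Suc p) ?x) \<oplus>\<^bsub>?P (Suc p)\<^esub> s p (\<delta> p ?x)" using s(2)[OF x] by simp
  from fun_cong[OF this, of 0] have "?x 0 = \<delta> (Suc p) (s (Suc p) ?x) 0 \<oplus> s p (\<delta> p ?x) 0" by (simp only: fin_mod_simps)
  moreover have "\<delta> (Suc p) (s (Suc p) ?x) 0 \<in> \<mm>" by (rule min[OF hom_closed[OF s(1) x]])
  moreover have "s p (\<delta> p ?x) 0 \<in> \<mm>" by (rule fin_mod_hom_max_coord[OF s(1) hom_closed[OF dl x] min[OF x]])
  ultimately have "?x 0 \<in> \<mm>" using additive_subgroup.a_closed[OF ideal.axioms(1)[OF ideal_max]] by simp
  then show False using one_notin_max by (simp add: fin_unit_def)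
qed

lemma resolution_exists:
  assumes "fgm R V"
  shows "\<exists>m \<delta> \<epsilon>. proj_resolution R V (\<lambda>i. fin_mod R {..<m i :: nat}) \<delta> \<epsilon> \<and> (\<forall>i x k. x \<in> carrier (fin_mod R {..<m (Suc i)}) \<longrightarrow> \<delta> i x k \<in> \<mm>)"
proof -
  obtain m \<delta> \<epsilon> where "left_resolution R V (\<lambda>i. fin_mod R {..<m i :: nat}) \<delta> \<epsilon>"
    "\<forall>i. \<forall>x\<in>carrier (fin_mod R {..<m (Suc i)}). \<forall>k. \<delta> i x k \<in> \<mm>" using minimal_resolution[OF assms] by metis
  moreover have "proj_mod R (fin_mod R {..<m i})" for i by (rule proj_fin_mod)
  moreover have "module R V" using assms by (simp add: fgm_def)
  ultimately have "proj_resolution R V (\<lambda>i. fin_mod R {..<m i :: nat}) \<delta> \<epsilon> \<and> (\<forall>i x k. x \<in> carrier (fin_mod R {..<m (Suc i)}) \<longrightarrow> \<delta> i x k \<in> \<mm>)"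
    by (simp add: proj_resolution_def)
  then show ?thesis by (intro exI)
qed

end

context cm_inj_res begin

text \<open>If the last term of the minimal resolution were in degree \<open>i + 1\<close>, every \<open>w\<close> in \<open>\<omega>\<close> would be the value of a map
  from it that extends to degree \<open>i\<close>, whence \<open>\<omega> = \<mm> \<omega>\<close>.\<close>

lemma finite_pd_imp_basis:
  assumes V: "fgm R V" and v: "\<And>j. Ext_vanish j V {\<zero>\<^bsub>V\<^esub>}" and q: "proj_resolution R V Q \<eta> \<zeta>" and z: "\<And>i. i > p \<Longrightarrow> zero_module (Q i)"
  shows "\<exists>B. is_basis R V B"
proof -
  have mV: "module R V" using V by (simp add: fgm_def)
  obtain m \<delta> \<epsilon> where r: "proj_resolution R V (\<lambda>i. fin_mod R {..<m i :: nat}) \<delta> \<epsilon>"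
    and min: "\<And>i x k. x \<in> carrier (fin_mod R {..<m (Suc i)}) \<Longrightarrow> \<delta> i x k \<in> \<mm>" using resolution_exists[OF V] by metis
  let ?P = "\<lambda>i. fin_mod R {..<m i}"
  note dl = proj_resolutionD(5)[OF r]
  have fP: "fgm R (?P i)" for i by (rule fgm_fin_mod) simp
  have step: "m (Suc i) = 0" if m0: "m (Suc (Suc i)) = 0" for i
  proof (rule ccontr)
    assume m: "m (Suc i) \<noteq> 0"
    interpret W: module R \<omega> by (rule modW)
    have x: "fin_unit R 0 \<in> carrier (?P (Suc i))" by (rule fin_unit_carrier) (use m in simp)
    have "w \<in> mspan R \<omega> {a \<odot>\<^bsub>\<omega>\<^esub> w | a w. a \<in> \<mm> \<and> w \<in> carrier \<omega>}" if w: "w \<in> carrier \<omega>" for w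
    proof -
      have f: "(\<lambda>x. x 0 \<odot>\<^bsub>\<omega>\<^esub> w) \<in> mod_hom R (?P (Suc i)) \<omega>"
        using w fin_mod_val[of _ "{..<m (Suc i)}"] by (intro mod_homI) (auto simp: fin_mod_simps W.smult_l_distr W.smult_assoc1)
      have fz: "\<delta> (Suc i) x 0 \<odot>\<^bsub>\<omega>\<^esub> w = \<zero>\<^bsub>\<omega>\<^esub>" if x: "x \<in> carrier (?P (Suc (Suc i)))" for x
      proof -
        have "x = \<zero>\<^bsub>?P (Suc (Suc i))\<^esub>" using x m0 by (auto simp: fin_mod_carrier fin_mod_simps)
        then have "\<delta> (Suc i) x = \<zero>\<^bsub>?P (Suc i)\<^esub>" using hom_zero[OF proj_resolutionD(2)[OF r] proj_resolutionD(2)[OF r] dl] by simp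
        then show ?thesis using w by (simp add: fin_mod_simps)
      qed
      obtain g where g: "g \<in> mod_hom R (?P i) \<omega>" "\<forall>x\<in>carrier (?P (Suc i)). g (\<delta> i x) = x 0 \<odot>\<^bsub>\<omega>\<^esub> w"
      proof -
        have "\<exists>g\<in>mod_hom R (?P i) \<omega>. \<forall>x\<in>carrier (?P (Suc i)). g (\<delta> i x) = x 0 \<odot>\<^bsub>\<omega>\<^esub> w"
          by (rule hom_cohomology_zero[OF r fP v f]) (rule fz)
        then show ?thesis using that by (elim bexE)
      qed
      have "g (\<delta> i (fin_unit R 0)) = w" using g(2) x w by (simp add: fin_unit_def)
      moreover have "g (\<delta> i (fin_unit R 0)) \<in> mspan R \<omega> {a \<odot>\<^bsub>\<omega>\<^esub> w | a w. a \<in> \<mm> \<and> w \<in> carrier \<omega>}"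
        by (rule fin_mod_hom_max[OF modW g(1) hom_closed[OF dl x] min[OF x]])
      ultimately show ?thesis by simp
    qed
    then have "zero_module \<omega>" by (intro nakayama_fgm[OF fg_omega]) auto
    moreover have "A\<omega> d \<subseteq> carrier \<omega>" "\<zero>\<^bsub>\<omega>\<^esub> \<in> A\<omega> d" using ys(1) submodD(1,2)[OF modW, of "A\<omega> d"] by (auto simp: regular_chain_def)
    ultimately show False using ys(3) by (auto simp: zero_module_def)
  qed
  have "m (Suc p) = 0" by (rule minimal_length[OF r min q z]) auto
  \<comment> \<open>The highest remaining positive degree is removed repeatedly. Only
    \<open>P 0\<close> is left, and \<epsilon> is an isomorphism.\<close>
  then have m1: "m (Suc 0) = 0"
  proof (induction p)
    case (Suc p) then show ?case using step by simp
  qed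
  have e: "\<epsilon> \<in> mod_hom R (?P 0) V" by (rule proj_resolutionD(4)[OF r])
  have "inj_on \<epsilon> (carrier (?P 0))"
  proof (subst hom_inj_iff[OF module_fin_mod mV e], intro ballI impI)
    fix x assume "x \<in> carrier (?P 0)" "\<epsilon> x = \<zero>\<^bsub>V\<^esub>"
    then obtain y where y: "x = \<delta> 0 y" "y \<in> carrier (?P (Suc 0))" using proj_resolutionD(7)[OF r] by auto
    have "y = \<zero>\<^bsub>?P (Suc 0)\<^esub>" using y(2) m1 by (auto simp: fin_mod_carrier fin_mod_simps)
    then show "x = \<zero>\<^bsub>?P 0\<^esub>" using y(1) hom_zero[OF proj_resolutionD(2)[OF r] proj_resolutionD(2)[OF r] dl] by simp
  qed
  then have "bij_betw \<epsilon> (carrier (?P 0)) (carrier V)" using proj_resolutionD(6)[OF r] by (simp add: bij_betw_def)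
  from iso_fin_basis[OF mV e this] show ?thesis by (intro exI)
qed

text \<open>Otherwise all \<open>Ext\<close> modules from \<open>V\<close> to \<open>\<omega>\<close> vanish, also in degree \<open>0\<close> and after division by a maximal
  regular sequence, but then a socle element gives a nonzero map from \<open>V\<close>.\<close>

lemma Hom_omega_nonzero:
  assumes V: "fgm R V" and v: "\<And>j. Ext_vanish j V {\<zero>\<^bsub>V\<^esub>}" and nz: "\<not> zero_module V"
  shows "\<not> zero_module (Hom_module R V \<omega>)"
proof
  assume zH: "zero_module (Hom_module R V \<omega>)"
  have mV: "module R V" using V by (simp add: fgm_def)
  interpret W: module R \<omega> by (rule modW)
  obtain m \<delta> \<epsilon> where r: "proj_resolution R V (\<lambda>i. fin_mod R {..<m i :: nat}) \<delta> \<epsilon>"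
    and min: "\<And>i x k. x \<in> carrier (fin_mod R {..<m (Suc i)}) \<Longrightarrow> \<delta> i x k \<in> \<mm>" using resolution_exists[OF V] by metis
  let ?P = "\<lambda>i. fin_mod R {..<m i}"
  have fP: "fgm R (?P i)" for i by (rule fgm_fin_mod) simp
  have all: "cohom_vanish R ?P \<delta> \<omega> (A\<omega> 0) i" for i
  proof (rule cohom_vanishI)
    fix f assume f: "f \<in> mod_hom R (?P i) \<omega>" and "\<And>x. x \<in> carrier (?P (Suc i)) \<Longrightarrow> f (\<delta> i x) \<in> A\<omega> 0"
    then have fz: "\<And>x. x \<in> carrier (?P (Suc i)) \<Longrightarrow> f (\<delta> i x) = \<zero>\<^bsub>\<omega>\<^esub>" using ys(2) by simp
    show "\<exists>b\<in>bdry R ?P \<delta> \<omega> i. \<forall>x\<in>carrier (?P i). f x \<ominus>\<^bsub>\<omega>\<^esub> b x \<in> A\<omega> 0"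
    proof (cases i)
      case 0
      have "\<exists>g\<in>mod_hom R V \<omega>. \<forall>x\<in>carrier (?P 0). g (\<epsilon> x) = f x"
      proof (rule hom_factor[OF proj_resolutionD(2)[OF r] mV modW proj_resolutionD(4,6)[OF r]])
        show "f \<in> mod_hom R (?P 0) \<omega>" using f 0 by simp
        show "f x = \<zero>\<^bsub>\<omega>\<^esub>" if "x \<in> carrier (?P 0)" "\<epsilon> x = \<zero>\<^bsub>V\<^esub>" for x
          using that proj_resolutionD(7)[OF r that(1)] fz 0 by auto
      qed
      then obtain g where g: "g \<in> mod_hom R V \<omega>" "\<forall>x\<in>carrier (?P 0). g (\<epsilon> x) = f x" by metis
      have g0: "restrict g (carrier V) = \<zero>\<^bsub>Hom_module R V \<omega>\<^esub>" using restrict_in_Hom[OF mV g(1)] zH by (simp add: zero_module_def)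
      have gu: "g u = \<zero>\<^bsub>\<omega>\<^esub>" if "u \<in> carrier V" for u using that fun_cong[OF g0, of u] by (simp add: Hom_apply)
      have "f x = \<zero>\<^bsub>\<omega>\<^esub>" if x: "x \<in> carrier (?P 0)" for x
        using g(2) x gu[OF hom_closed[OF proj_resolutionD(4)[OF r] x]] by simp
      then show ?thesis using 0 ys(2) by (simp add: W.minus_zero_right)
    next
      case (Suc k)
      obtain g where "g \<in> mod_hom R (?P k) \<omega>" "\<forall>x\<in>carrier (?P (Suc k)). g (\<delta> k x) = f x"
        using hom_cohomology_zero[OF r fP v] f fz unfolding Suc by metis
      then show ?thesis unfolding Suc using ys(2) hom_closed[OF f, unfolded Suc]
        by (intro bexI[of _ "\<lambda>x. g (\<delta> k x)"]) (auto simp: W.minus_eq_zero_iff)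
    qed
  qed
  have u: "cohom_vanish R ?P \<delta> \<omega> (A\<omega> d) 0" by (rule regular_chain_cohom_vanish_all[OF r modW ys(1) all order_refl])
  have sA: "submodule (A\<omega> d) R \<omega>" using ys(1) by (simp add: regular_chain_def)
  obtain z where z: "z \<in> carrier \<omega>" "z \<notin> A\<omega> d" "\<forall>a\<in>\<mm>. a \<odot>\<^bsub>\<omega>\<^esub> z \<in> A\<omega> d"
    using regular_chain_socle[OF fg_omega ys(1) dim ys(3)] by metis
  have "m 0 > 0"
  proof (rule ccontr)
    assume "\<not> 0 < m 0"
    then have "carrier (?P 0) = {\<zero>\<^bsub>?P 0\<^esub>}" by (auto simp: fin_mod_carrier fin_mod_simps)
    then have "carrier V = {\<zero>\<^bsub>V\<^esub>}" using proj_resolutionD(6)[OF r] hom_zero[OF proj_resolutionD(2)[OF r] mV proj_resolutionD(4)[OF r]] by auto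
    then show False using nz by (simp add: zero_module_def)
  qed
  then have "\<not> cohom_vanish R ?P \<delta> \<omega> (A\<omega> d) 0"
    by (intro socle_imp_not_cohom_vanish_minimal[OF modW sA z(1,2)]) (use z(3) min in auto)
  then show False using u by simp
qed

end

section \<open>Depth, Ext modules and dual modules\<close>

lemma krull_dim_le_of_surj_hom:
  assumes "ring_hom_ring A B h" "cring A" "h ` carrier A = carrier B"
  shows "krull_dim B \<le> krull_dim A"
  unfolding krull_dim_def
proof (rule Sup_subset_mono, rule subsetI)
  interpret h: ring_hom_ring A B h by fact
  fix m assume "m \<in> {enat n | n. \<exists>p. (\<forall>i\<le>n. primeideal (p i) B) \<and> (\<forall>i<n. p i \<subset> p (Suc i))}"
  then obtain n p where p: "m = enat n" "\<forall>i\<le>n. primeideal (p i) B" "\<forall>i<n. p i \<subset> p (Suc i)" by auto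
  let ?q = "\<lambda>i. {r \<in> carrier A. h r \<in> p i}"
  have "primeideal (?q i) A" if "i \<le> n" for i by (rule h.primeideal_vimage[OF assms(2)]) (use p(2) that in simp)
  moreover have "?q i \<subset> ?q (Suc i)" if i: "i < n" for i
  proof -
    obtain y where y: "y \<in> p (Suc i)" "y \<notin> p i" using p(3) i by blast
    have "primeideal (p (Suc i)) B" using p(2) i by simp
    then have "y \<in> carrier B" using y(1) by (meson ideal.Icarr primeideal.axioms(1))
    then obtain x where x: "y = h x" "x \<in> carrier A" unfolding assms(3)[symmetric] by (rule imageE)
    have sub: "p i \<subseteq> p (Suc i)" using p(3) i by blast
    have "?q i \<subseteq> ?q (Suc i)" using sub by (intro subsetI) (auto simp only: mem_Collect_eq)
    moreover have "x \<in> ?q (Suc i)" "x \<notin> ?q i" using x y by auto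
    ultimately show ?thesis by blast
  qed
  ultimately show "m \<in> {enat n | n. \<exists>p. (\<forall>i\<le>n. primeideal (p i) A) \<and> (\<forall>i<n. p i \<subset> p (Suc i))}"
    using p(1) by (intro CollectI exI[of _ n] conjI exI[of _ ?q]) auto
qed

lemma krull_dim_ring_iso:
  assumes "A \<simeq> B" "cring A" "cring B" shows "krull_dim A = krull_dim B"
proof -
  have le: "krull_dim B \<le> krull_dim A" if i: "A \<simeq> B" and c: "cring A" "cring B" for A :: "('x,'y) ring_scheme" and B :: "('z,'u) ring_scheme"
  proof -
    obtain h where h: "h \<in> ring_iso A B" using i unfolding is_ring_iso_def by auto
    have "ring_hom_ring A B h" using h c by (intro ring_hom_ringI2) (auto simp: cring_def ring_iso_def)
    then show ?thesis by (rule krull_dim_le_of_surj_hom) (use h c in \<open>auto simp: ring_iso_def bij_betw_def\<close>)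
  qed
  have "B \<simeq> A" using assms(1) assms(2) by (simp add: ring_iso_sym cring.axioms(1))
  then show ?thesis using le[OF assms] le[OF _ assms(3,2)] by (intro antisym)
qed

context noetherian_local_ring begin

text \<open>The definition of \<open>module_dim\<close> passes to the ring modulo the annihilator.
  The annihilator of R is zero, as 1 detects, but R modulo zero is another ring of another type, so
  an isomorphism is needed.\<close>

lemma depth_self:
  assumes "cm_module R (self_module R)" shows "depth R (self_module R) = krull_dim R"
proof -
  have "annihilator R (self_module R) = {\<zero>}"
  proof
    show "annihilator R (self_module R) \<subseteq> {\<zero>}"
    proof
      fix a assume "a \<in> annihilator R (self_module R)"
      then have "a \<in> carrier R" "\<forall>x\<in>carrier R. a \<otimes> x = \<zero>" by (auto simp: annihilator_def)
      then have "a \<in> carrier R" "a \<otimes> \<one> = \<zero>" by blast+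
      then show "a \<in> {\<zero>}" by simp
    qed
    show "{\<zero>} \<subseteq> annihilator R (self_module R)" by (auto simp: annihilator_def)
  qed
  moreover have "krull_dim R = krull_dim (R Quot {\<zero>})"
    by (rule krull_dim_ring_iso[OF FactRing_zeroideal(2) is_cring ideal.quotient_is_cring[OF zeroideal is_cring]])
  ultimately show ?thesis using assms by (simp add: cm_module_def module_dim_def)
qed

text \<open>All members of the chain lie in \<mm> W, which by Nakayama's lemma is not all of
  \<open>W\<close>.\<close>

lemma regular_chain_top_ne:
  assumes W: "fgm R W" and nz: "\<not> zero_module W" and c: "regular_chain R W ys A n" "A 0 = {\<zero>\<^bsub>W\<^esub>}"
  shows "A n \<noteq> carrier W"
proof
  assume eq: "A n = carrier W"
  have mW: "module R W" using W by (simp add: fgm_def)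
  interpret W: module R W by (rule mW)
  let ?G = "{a \<odot>\<^bsub>W\<^esub> w | a w. a \<in> \<mm> \<and> w \<in> carrier W}"
  have sub: "submodule (mspan R W ?G) R W" by (rule mspan_submod[OF mW]) (use max_carr in auto)
  have "A k \<subseteq> mspan R W ?G" if "k \<le> n" for k using that
  proof (induction k)
    case 0 then show ?case using c(2) submodD(2)[OF mW sub] by simp
  next
    case (Suc k)
    have y: "ys k \<in> \<mm>" "A (Suc k) = addmul W (A k) (ys k)" using c(1) Suc.prems by (auto simp: regular_chain_def)
    have "(\<lambda>w. ys k \<odot>\<^bsub>W\<^esub> w) ` carrier W \<subseteq> mspan R W ?G"
    proof (rule image_subsetI)
      fix w assume "w \<in> carrier W"
      then have "ys k \<odot>\<^bsub>W\<^esub> w \<in> ?G" using y(1) by blast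
      then show "ys k \<odot>\<^bsub>W\<^esub> w \<in> mspan R W ?G" by (rule subsetD[OF mspan_superset])
    qed
    then show ?case unfolding y(2) by (intro msum_least[OF mW sub] Suc.IH) (use Suc.prems in auto)
  qed
  then have "carrier W \<subseteq> mspan R W ?G" using eq by auto
  then show False using nakayama_fgm[OF W] nz by simp
qed

text \<open>A direct summand inherits regular sequences. The projection maps the submodules of the
  chain into themselves, hence intersecting with the summand commutes with adding the multiples of
  the next element.\<close>

lemma regular_chain_retract:
  assumes W: "module R W" and W': "module R W'" and i: "i \<in> mod_hom R W' W" and p: "p \<in> mod_hom R W W'"
    and pi: "\<And>w. w \<in> carrier W' \<Longrightarrow> p (i w) = w" and c: "regular_chain R W ys A n" "A 0 = {\<zero>\<^bsub>W\<^esub>}"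
  shows "regular_chain R W' ys (\<lambda>k. {w \<in> carrier W'. i w \<in> A k}) n" "{w \<in> carrier W'. i w \<in> A 0} = {\<zero>\<^bsub>W'\<^esub>}"
proof -
  interpret W: module R W by (rule W)
  interpret W': module R W' by (rule W')
  have sA: "submodule (A k) R W" if "k \<le> n" for k using c(1) that by (simp add: regular_chain_def)
  have c': "ys k \<in> \<mm>" "\<And>w. w \<in> carrier W \<Longrightarrow> ys k \<odot>\<^bsub>W\<^esub> w \<in> A k \<Longrightarrow> w \<in> A k" "A (Suc k) = addmul W (A k) (ys k)"
    if "k < n" for k using c(1) that by (auto simp: regular_chain_def)
  \<comment> \<open>The members of the chain are stable under the idempotent \<open>i\<close> after
    \<open>p\<close>; they are generated by multiples of ring elements, with which it
    commutes.\<close>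
  have inv: "i (p u) \<in> A k" if "k \<le> n" "u \<in> A k" for k u using that
  proof (induction k arbitrary: u)
    case 0 then show ?case using c(2) hom_zero[OF W W' p] hom_zero[OF W' W i] by simp
  next
    case (Suc k)
    have k: "k < n" "k \<le> n" using Suc.prems by auto
    have y: "ys k \<in> carrier R" by (rule max_carr[OF c'(1)[OF k(1)]])
    obtain a b where ab: "a \<in> A k" "b \<in> (\<lambda>w. ys k \<odot>\<^bsub>W\<^esub> w) ` carrier W" "u = a \<oplus>\<^bsub>W\<^esub> b"
      using Suc.prems(2) unfolding c'(3)[OF k(1)] by (rule msumE)
    from ab(2) obtain w where w: "b = ys k \<odot>\<^bsub>W\<^esub> w" "w \<in> carrier W" by (rule imageE)
    have aW: "a \<in> carrier W" by (rule submodD(3)[OF W sA[OF k(2)] ab(1)])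
    have pw: "p w \<in> carrier W'" "p a \<in> carrier W'" using hom_closed[OF p] w(2) aW by auto
    have "i (p u) = i (p a) \<oplus>\<^bsub>W\<^esub> ys k \<odot>\<^bsub>W\<^esub> i (p w)"
      using ab(3) w aW y pw by (simp add: hom_add[OF p] hom_smult[OF p] hom_add[OF i] hom_smult[OF i])
    moreover have "i (p a) \<in> A k" by (rule Suc.IH[OF k(2) ab(1)])
    ultimately show ?case unfolding c'(3)[OF k(1)] using hom_closed[OF i pw(1)] by (auto intro: msumI)
  qed
  show "{w \<in> carrier W'. i w \<in> A 0} = {\<zero>\<^bsub>W'\<^esub>}"
  proof
    show "{w \<in> carrier W'. i w \<in> A 0} \<subseteq> {\<zero>\<^bsub>W'\<^esub>}"
    proof
      fix w assume "w \<in> {w \<in> carrier W'. i w \<in> A 0}"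
      then have "w \<in> carrier W'" "i w = \<zero>\<^bsub>W\<^esub>" using c(2) by auto
      then show "w \<in> {\<zero>\<^bsub>W'\<^esub>}" using pi[of w] hom_zero[OF W W' p] by simp
    qed
    show "{\<zero>\<^bsub>W'\<^esub>} \<subseteq> {w \<in> carrier W'. i w \<in> A 0}" using c(2) hom_zero[OF W' W i] by simp
  qed
  show "regular_chain R W' ys (\<lambda>k. {w \<in> carrier W'. i w \<in> A k}) n" unfolding regular_chain_def
  proof (intro conjI allI impI ballI)
    show "submodule {w \<in> carrier W'. i w \<in> A k} R W'" if "k \<le> n" for k by (rule submod_vimage[OF W' W i sA[OF that]])
    fix k assume k: "k < n"
    show "ys k \<in> \<mm>" by (rule c'(1)[OF k])
    have y: "ys k \<in> carrier R" by (rule max_carr[OF c'(1)[OF k]])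
    show "w \<in> {w \<in> carrier W'. i w \<in> A k}" if "w \<in> carrier W'" "ys k \<odot>\<^bsub>W'\<^esub> w \<in> {w \<in> carrier W'. i w \<in> A k}" for w
      using that c'(2)[OF k hom_closed[OF i that(1)]] hom_smult[OF i y that(1)] by simp
    show "{w \<in> carrier W'. i w \<in> A (Suc k)} = addmul W' {w \<in> carrier W'. i w \<in> A k} (ys k)" (is "?L = ?R")
    proof
      show "?L \<subseteq> ?R"
      proof
        fix w assume "w \<in> ?L"
        then have w: "w \<in> carrier W'" "i w \<in> A (Suc k)" by auto
        obtain a b where ab: "a \<in> A k" "b \<in> (\<lambda>w. ys k \<odot>\<^bsub>W\<^esub> w) ` carrier W" "i w = a \<oplus>\<^bsub>W\<^esub> b"
          using w(2) unfolding c'(3)[OF k] by (rule msumE)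
        from ab(2) obtain u where u: "b = ys k \<odot>\<^bsub>W\<^esub> u" "u \<in> carrier W" by (rule imageE)
        have aW: "a \<in> carrier W" by (rule submodD(3)[OF W sA ab(1)]) (use k in simp)
        have "w = p (i w)" using pi w(1) by simp
        also have "\<dots> = p a \<oplus>\<^bsub>W'\<^esub> ys k \<odot>\<^bsub>W'\<^esub> p u" using ab(3) u aW y by (simp add: hom_add[OF p] hom_smult[OF p])
        also have "\<dots> \<in> ?R"
          using inv[of k a] ab(1) k hom_closed[OF p aW] hom_closed[OF p u(2)] by (intro msumI) auto
        finally show "w \<in> ?R" .
      qed
      show "?R \<subseteq> ?L"
      proof
        fix w assume "w \<in> ?R"
        then obtain a b where ab: "a \<in> {w \<in> carrier W'. i w \<in> A k}" "b \<in> (\<lambda>w. ys k \<odot>\<^bsub>W'\<^esub> w) ` carrier W'" "w = a \<oplus>\<^bsub>W'\<^esub> b"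
          by (rule msumE)
        from ab(2) obtain u where u: "b = ys k \<odot>\<^bsub>W'\<^esub> u" "u \<in> carrier W'" by (rule imageE)
        have "i w = i a \<oplus>\<^bsub>W\<^esub> ys k \<odot>\<^bsub>W\<^esub> i u" using ab u y by (simp add: hom_add[OF i] hom_smult[OF i])
        also have "\<dots> \<in> A (Suc k)" unfolding c'(3)[OF k] using ab(1) hom_closed[OF i u(2)] by (intro msumI) auto
        finally show "w \<in> ?L" using ab u y by simp
      qed
    qed
  qed
qed

section \<open>The cohomology modules behind \<open>Ext_module\<close>\<close>

lemma coboundaries_bdry:
  assumes r: "proj_resolution R V P \<delta> \<epsilon>" and W: "module R W" and f: "f \<in> carrier (Hom_module R (P i) W)"
  shows "f \<in> coboundaries R P \<delta> W i \<longleftrightarrow> (\<exists>b\<in>bdry R P \<delta> W i. \<forall>x\<in>carrier (P i). f x = b x)"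
proof (cases i)
  case 0
  have "f = (\<lambda>x\<in>carrier (P 0). \<zero>\<^bsub>W\<^esub>) \<longleftrightarrow> (\<forall>x\<in>carrier (P 0). f x = \<zero>\<^bsub>W\<^esub>)"
    using f 0 by (auto simp: Hom_carrier intro: restrict_eqI)
  then show ?thesis using 0 by (simp add: Hom_apply)
next
  case (Suc k)
  show ?thesis
  proof
    assume "f \<in> coboundaries R P \<delta> W i"
    then obtain g where g: "f = (\<lambda>x\<in>carrier (P (Suc k)). g (\<delta> k x))" "g \<in> carrier (Hom_module R (P k) W)" using Suc by auto
    then have "g \<in> mod_hom R (P k) W" by (simp add: Hom_carrier)
    then show "\<exists>b\<in>bdry R P \<delta> W i. \<forall>x\<in>carrier (P i). f x = b x" using g(1) Suc by (intro bexI[of _ "\<lambda>x. g (\<delta> k x)"]) auto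
  next
    assume "\<exists>b\<in>bdry R P \<delta> W i. \<forall>x\<in>carrier (P i). f x = b x"
    then obtain g where g: "g \<in> mod_hom R (P k) W" "\<forall>x\<in>carrier (P i). f x = g (\<delta> k x)" using Suc by auto
    have "f = (\<lambda>x\<in>carrier (P (Suc k)). restrict g (carrier (P k)) (\<delta> k x))"
      using f Suc g(2) hom_closed[OF proj_resolutionD(5)[OF r, of k]] by (intro restrict_eqI) (auto simp: Hom_carrier)
    then show "f \<in> coboundaries R P \<delta> W i" unfolding Suc coboundaries.simps
      using restrict_in_Hom[OF proj_resolutionD(2)[OF r] g(1)] by (rule image_eqI)
  qed
qed

lemma submod_cocycles:
  assumes r: "proj_resolution R V P \<delta> \<epsilon>" and W: "module R W"
  shows "submodule (cocycles R P \<delta> W i) R (Hom_module R (P i) W)"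
proof (rule submodI[OF module_Hom[OF proj_resolutionD(2)[OF r] W]])
  interpret W: module R W by (rule W)
  interpret H: module R "Hom_module R (P i) W" by (rule module_Hom[OF proj_resolutionD(2)[OF r] W])
  have dc: "\<delta> i x \<in> carrier (P i)" if "x \<in> carrier (P (Suc i))" for x by (rule hom_closed[OF proj_resolutionD(5)[OF r] that])
  show "cocycles R P \<delta> W i \<subseteq> carrier (Hom_module R (P i) W)" by (auto simp: cocycles_def)
  show "\<zero>\<^bsub>Hom_module R (P i) W\<^esub> \<in> cocycles R P \<delta> W i" unfolding cocycles_def using dc H.zero_closed by (simp add: Hom_apply)
  show "f \<oplus>\<^bsub>Hom_module R (P i) W\<^esub> g \<in> cocycles R P \<delta> W i" if "f \<in> cocycles R P \<delta> W i" "g \<in> cocycles R P \<delta> W i" for f g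
    using that dc H.add.m_closed[of f g] unfolding cocycles_def by (simp add: Hom_apply)
  show "a \<odot>\<^bsub>Hom_module R (P i) W\<^esub> f \<in> cocycles R P \<delta> W i" if "a \<in> carrier R" "f \<in> cocycles R P \<delta> W i" for a f
    using that dc H.smult_closed[of a f] unfolding cocycles_def by (simp add: Hom_apply)
qed

lemma coboundaries_le_cocycles:
  assumes r: "proj_resolution R V P \<delta> \<epsilon>" and W: "module R W"
  shows "coboundaries R P \<delta> W i \<subseteq> cocycles R P \<delta> W i"
proof (cases i)
  case 0 then show ?thesis using submodD(2)[OF module_Hom[OF proj_resolutionD(2)[OF r] W] submod_cocycles[OF r W]] by simp
next
  case (Suc k)
  show ?thesis
  proof
    fix f assume f: "f \<in> coboundaries R P \<delta> W i"
    then obtain g where g: "f = (\<lambda>x\<in>carrier (P (Suc k)). g (\<delta> k x))" "g \<in> mod_hom R (P k) W" using Suc by (auto simp: Hom_carrier)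
    have "f \<in> carrier (Hom_module R (P i) W)" unfolding g(1) Suc
      by (rule restrict_in_Hom[OF proj_resolutionD(2)[OF r] hom_comp[OF proj_resolutionD(5)[OF r] g(2)]])
    moreover have "f (\<delta> i x) = \<zero>\<^bsub>W\<^esub>" if x: "x \<in> carrier (P (Suc i))" for x
      using x proj_resolutionD(10)[OF r, of x k] hom_zero[OF proj_resolutionD(2)[OF r] W g(2)] hom_closed[OF proj_resolutionD(5)[OF r, of i] x] g(1) by (simp add: Suc)
    ultimately show "f \<in> cocycles R P \<delta> W i" by (simp add: cocycles_def)
  qed
qed

lemma submod_coboundaries:
  assumes r: "proj_resolution R V P \<delta> \<epsilon>" and W: "module R W"
  shows "submodule (coboundaries R P \<delta> W i) R (Hom_module R (P i) W \<restriction> cocycles R P \<delta> W i)"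
proof -
  have mH: "module R (Hom_module R (P i) W)" by (rule module_Hom[OF proj_resolutionD(2)[OF r] W])
  have "submodule (coboundaries R P \<delta> W i) R (Hom_module R (P i) W)"
  proof (cases i)
    case 0 then show ?thesis using submod_zero[OF mH] by simp
  next
    case (Suc k)
    have "(\<lambda>g. \<lambda>x\<in>carrier (P (Suc k)). g (\<delta> k x)) \<in> mod_hom R (Hom_module R (P k) W) (Hom_module R (P (Suc k)) W)"
      by (rule precomp_hom[OF proj_resolutionD(2)[OF r] proj_resolutionD(5)[OF r]])
    from submod_image[OF module_Hom[OF proj_resolutionD(2)[OF r] W] module_Hom[OF proj_resolutionD(2)[OF r] W] this
        submod_carrier[OF module_Hom[OF proj_resolutionD(2)[OF r] W]]]
    show ?thesis by (simp add: Suc)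
  qed
  then show ?thesis by (intro submod_sub[OF mH submod_cocycles[OF r W] _ coboundaries_le_cocycles[OF r W]])
qed

lemma zero_cohomology:
  assumes r: "proj_resolution R V P \<delta> \<epsilon>" and W: "module R W" and z: "zero_module (Hom_cohomology R P \<delta> W i)"
  shows "cocycles R P \<delta> W i = coboundaries R P \<delta> W i"
proof
  let ?C = "Hom_module R (P i) W \<restriction> cocycles R P \<delta> W i"
  have mC: "module R ?C" by (rule module_sub[OF module_Hom[OF proj_resolutionD(2)[OF r] W] submod_cocycles[OF r W]])
  note sB = submod_coboundaries[OF r W]
  show "coboundaries R P \<delta> W i \<subseteq> cocycles R P \<delta> W i" by (rule coboundaries_le_cocycles[OF r W])
  show "cocycles R P \<delta> W i \<subseteq> coboundaries R P \<delta> W i"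
  proof
    fix f assume f: "f \<in> cocycles R P \<delta> W i"
    then have "coboundaries R P \<delta> W i +>\<^bsub>?C\<^esub> f \<in> carrier (quot_module ?C (coboundaries R P \<delta> W i))"
      unfolding quot_carrier by simp
    then have "coboundaries R P \<delta> W i +>\<^bsub>?C\<^esub> f = \<zero>\<^bsub>quot_module ?C (coboundaries R P \<delta> W i)\<^esub>"
      using z by (simp add: zero_module_def Hom_cohomology_def)
    then show "f \<in> coboundaries R P \<delta> W i" using quot_coset_zero_iff[OF mC sB] f by simp
  qed
qed

text \<open>A class that is not zero spans a one-dimensional space over the residue field, so every
  other class is a multiple of it. The conclusion is stated for cocycles, with a coboundary as the
  error.\<close>

lemma one_dim_cohomology:
  assumes r: "proj_resolution R V P \<delta> \<epsilon>" and W: "module R W" and iso: "mod_iso R (Hom_cohomology R P \<delta> W i) (residue_module R)"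
    and f: "f \<in> mod_hom R (P i) W" "\<And>x. x \<in> carrier (P (Suc i)) \<Longrightarrow> f (\<delta> i x) = \<zero>\<^bsub>W\<^esub>"
    and g: "g \<in> mod_hom R (P i) W" "\<And>x. x \<in> carrier (P (Suc i)) \<Longrightarrow> g (\<delta> i x) = \<zero>\<^bsub>W\<^esub>"
    and nf: "\<And>b. b \<in> bdry R P \<delta> W i \<Longrightarrow> \<exists>x\<in>carrier (P i). f x \<noteq> b x"
  shows "\<exists>a\<in>carrier R. \<exists>b\<in>bdry R P \<delta> W i. \<forall>x\<in>carrier (P i). g x \<ominus>\<^bsub>W\<^esub> a \<odot>\<^bsub>W\<^esub> f x = b x"
proof -
  let ?H = "Hom_module R (P i) W" let ?C = "?H \<restriction> cocycles R P \<delta> W i" let ?B = "coboundaries R P \<delta> W i"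
  have mH: "module R ?H" by (rule module_Hom[OF proj_resolutionD(2)[OF r] W])
  have mC: "module R ?C" by (rule module_sub[OF mH submod_cocycles[OF r W]])
  have sB: "submodule ?B R ?C" by (rule submod_coboundaries[OF r W])
  interpret W: module R W by (rule W)
  interpret C: module R ?C by (rule mC)
  interpret K: module R "residue_module R" by (rule module_residue)
  obtain J where J: "J \<in> mod_hom R (quot_module ?C ?B) (residue_module R)"
    "bij_betw J (carrier (quot_module ?C ?B)) (carrier (residue_module R))"
    using iso unfolding mod_iso_def Hom_cohomology_def by auto
  let ?j = "\<lambda>u. J (?B +>\<^bsub>?C\<^esub> u)"
  have j: "?j \<in> mod_hom R ?C (residue_module R)" by (rule hom_comp[OF quot_coset_hom[OF mC sB] J(1)])
  have jz: "?j u = \<zero>\<^bsub>residue_module R\<^esub> \<longleftrightarrow> u \<in> ?B" if u: "u \<in> carrier ?C" for u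
  proof -
    have mQ: "module R (quot_module ?C ?B)" by (rule module_quot[OF mC sB])
    have "\<forall>x\<in>carrier (quot_module ?C ?B). J x = \<zero>\<^bsub>residue_module R\<^esub> \<longrightarrow> x = \<zero>\<^bsub>quot_module ?C ?B\<^esub>"
      using hom_inj_iff[OF mQ module_residue J(1)] bij_betw_imp_inj_on[OF J(2)] by simp
    moreover have "J \<zero>\<^bsub>quot_module ?C ?B\<^esub> = \<zero>\<^bsub>residue_module R\<^esub>" by (rule hom_zero[OF mQ module_residue J(1)])
    ultimately show ?thesis using quot_coset_zero_iff[OF mC sB u] hom_closed[OF quot_coset_hom[OF mC sB] u] by metis
  qed
  have dc: "\<delta> i x \<in> carrier (P i)" if "x \<in> carrier (P (Suc i))" for x by (rule hom_closed[OF proj_resolutionD(5)[OF r] that])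
  let ?f = "restrict f (carrier (P i))" and ?g = "restrict g (carrier (P i))"
  have fC: "?f \<in> carrier ?C" using restrict_in_Hom[OF proj_resolutionD(2)[OF r] f(1)] f(2) dc by (simp add: cocycles_def)
  have gC: "?g \<in> carrier ?C" using restrict_in_Hom[OF proj_resolutionD(2)[OF r] g(1)] g(2) dc by (simp add: cocycles_def)
  have CH: "u \<in> carrier ?H" if "u \<in> carrier ?C" for u using that by (simp add: cocycles_def)
  have "?f \<notin> ?B" using coboundaries_bdry[OF r W CH[OF fC]] nf by force
  then have jf: "?j ?f \<noteq> \<zero>\<^bsub>residue_module R\<^esub>" using jz[OF fC] by simp
  obtain a where a: "?j ?f = \<mm> +>\<^bsub>self_module R\<^esub> a" "a \<in> carrier R"
    using hom_closed[OF j fC] unfolding residue_carrier by (rule imageE)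
  obtain c where c: "?j ?g = \<mm> +>\<^bsub>self_module R\<^esub> c" "c \<in> carrier R"
    using hom_closed[OF j gC] unfolding residue_carrier by (rule imageE)
  have "a \<notin> \<mm>" using jf residue_zero_iff[OF a(2)] a(1) by simp
  then have un: "a \<in> Units R" by (rule notin_max_Unit[OF a(2)])
  \<comment> \<open>The elements \<open>a\<close> and \<open>c\<close> represent the classes of
    \<open>f\<close> and \<open>g\<close> in the residue field; \<open>a\<close> is a unit because
    the class of \<open>f\<close> is not zero, so \<open>t\<close> is the factor from
    \<open>f\<close> to \<open>g\<close>.\<close>
  define t where "t = c \<otimes> inv a"
  have t: "t \<in> carrier R" "t \<otimes> a = c" using un a(2) c(2) by (auto simp: t_def m_assoc)
  let ?u = "?g \<ominus>\<^bsub>?C\<^esub> t \<odot>\<^bsub>?C\<^esub> ?f"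
  have tf: "t \<odot>\<^bsub>?C\<^esub> ?f \<in> carrier ?C" by (rule C.smult_closed[OF t(1) fC])
  have uC: "?u \<in> carrier ?C" by (rule C.minus_closed[OF gC tf])
  have "t \<odot>\<^bsub>residue_module R\<^esub> ?j ?f = ?j ?g"
    unfolding a(1) c(1) using hom_smult[OF residue_coset_hom t(1), of a] a(2) t(2) by simp
  then have "?j ?u = \<zero>\<^bsub>residue_module R\<^esub>"
    using hom_diff[OF mC module_residue j gC tf] hom_smult[OF j t(1) fC] hom_closed[OF j gC] by (simp add: K.minus_eq_zero_iff)
  then have "?u \<in> ?B" using jz[OF uC] by simp
  then obtain b where b: "b \<in> bdry R P \<delta> W i" "\<forall>x\<in>carrier (P i). ?u x = b x" using coboundaries_bdry[OF r W CH[OF uC]] by auto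
  have "?u x = g x \<ominus>\<^bsub>W\<^esub> t \<odot>\<^bsub>W\<^esub> f x" if x: "x \<in> carrier (P i)" for x
  proof -
    have ev: "(\<lambda>u. u x) \<in> mod_hom R ?C W"
      by (rule hom_dom_sub[OF Hom_eval_hom[OF x]]) (auto simp: cocycles_def)
    show ?thesis using hom_diff[OF mC W ev gC tf] hom_smult[OF ev t(1) fC] x by simp
  qed
  then show ?thesis using b t(1) by (intro bexI[of _ t] bexI[of _ b]) auto
qed

section \<open>Duals of finite free modules\<close>

lemma hom_finsum:
  assumes "module R M" "module R N" "f \<in> mod_hom R M N" "finite S" "\<And>s. s \<in> S \<Longrightarrow> g s \<in> carrier M"
  shows "f (\<Oplus>\<^bsub>M\<^esub>s\<in>S. g s) = (\<Oplus>\<^bsub>N\<^esub>s\<in>S. f (g s))"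
  using assms(4,5)
proof (induction S rule: finite_induct)
  interpret M: module R M by fact
  interpret N: module R N by fact
  case empty show ?case using hom_zero[OF assms(1-3)] by simp
next
  interpret M: module R M by fact
  interpret N: module R N by fact
  case (insert a S)
  then have "f (\<Oplus>\<^bsub>M\<^esub>s\<in>insert a S. g s) = f (g a) \<oplus>\<^bsub>N\<^esub> f (\<Oplus>\<^bsub>M\<^esub>s\<in>S. g s)"
    using hom_add[OF assms(3), of "g a" "\<Oplus>\<^bsub>M\<^esub>s\<in>S. g s"] by simp
  then show ?case using insert hom_closed[OF assms(3)] by simp
qed

lemma dual_basis_iso:
  assumes P: "module R P" and B: "is_basis R P B" "finite B"
  shows "(\<lambda>u b. if b \<in> B then u b else \<zero>) \<in> mod_hom R (dual_module R P) (fin_mod R B)" (is "?F \<in> _")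
    "bij_betw (\<lambda>u b. if b \<in> B then u b else \<zero>) (carrier (dual_module R P)) (carrier (fin_mod R B))"
proof -
  note mS = module_self[OF is_cring]
  have BP: "B \<subseteq> carrier P" using B(1) by (simp add: is_basis_def)
  have uc: "u b \<in> carrier R" if "u \<in> carrier (dual_module R P)" "b \<in> B" for u b
    using that BP hom_closed[of u R P "self_module R" b] by (auto simp: dual_module_def Hom_carrier)
  have fc: "?F u \<in> carrier (fin_mod R B)" if u: "u \<in> carrier (dual_module R P)" for u
  proof -
    have "finite {x. ?F u x \<noteq> \<zero>}" by (rule rev_finite_subset[OF B(2)]) auto
    then show ?thesis using uc[OF u] by (simp add: fin_mod_carrier)
  qed
  have BPD: "b \<in> carrier P" if "b \<in> B" for b using BP that by auto
  show "?F \<in> mod_hom R (dual_module R P) (fin_mod R B)"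
    by (rule mod_homI) (use fc BPD in \<open>auto simp: dual_module_def Hom_apply fin_mod_simps fun_eq_iff\<close>)
  show "bij_betw ?F (carrier (dual_module R P)) (carrier (fin_mod R B))" unfolding bij_betw_def
  proof
    show "inj_on ?F (carrier (dual_module R P))"
    proof (rule inj_onI)
      fix u v assume uv: "u \<in> carrier (dual_module R P)" "v \<in> carrier (dual_module R P)" "?F u = ?F v"
      have eq: "u b = v b" if "b \<in> B" for b using fun_cong[OF uv(3), of b] that by simp
      have "u x = v x" if "x \<in> carrier P" for x
        using hom_eq_on_span[OF P mS _ _ BP, of u v x] eq uv(1,2) basis_span[OF P B(1)] that by (simp add: dual_module_def Hom_carrier)
      then show "u = v" using Hom_eqI uv(1,2) unfolding dual_module_def by metis
    qed
    show "?F ` carrier (dual_module R P) = carrier (fin_mod R B)"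
    proof
      show "?F ` carrier (dual_module R P) \<subseteq> carrier (fin_mod R B)" using fc by auto
      show "carrier (fin_mod R B) \<subseteq> ?F ` carrier (dual_module R P)"
      proof
        fix c assume c: "c \<in> carrier (fin_mod R B)"
        obtain u where u: "u \<in> mod_hom R P (self_module R)" "\<forall>b\<in>B. u b = c b"
          using basis_hom_ex[OF P B(1) mS, of c] fin_mod_val[OF c] by auto
        have "c = ?F (restrict u (carrier P))" using u(2) c BPD by (auto simp: fun_eq_iff fin_mod_carrier)
        then show "c \<in> ?F ` carrier (dual_module R P)" using restrict_in_Hom[OF P u(1)] unfolding dual_module_def by (rule image_eqI)
      qed
    qed
  qed
qed

lemma module_dual: "module R M \<Longrightarrow> module R (dual_module R M)"
  unfolding dual_module_def by (rule module_Hom[OF _ module_self[OF is_cring]])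

lemma dual_proj:
  assumes P: "module R P" and B: "is_basis R P B" "finite B"
  shows "proj_mod R (dual_module R P)"
proof -
  note F = dual_basis_iso[OF assms]
  show ?thesis
    by (rule proj_mod_iso_fin[OF module_dual[OF P] hom_inv[OF module_dual[OF P] module_fin_mod F] bij_betw_inv_into[OF F(2)]])
qed

text \<open>The \<open>w b\<close> are the values of \<open>k\<close> on the dual basis. For W = R
  this says that a functional on the dual is an evaluation.\<close>

lemma dual_hom_expand:
  assumes P: "module R P" and B: "is_basis R P B" "finite B" and W: "module R W" and k: "k \<in> mod_hom R (dual_module R P) W"
  shows "\<exists>w\<in>B \<rightarrow> carrier W. \<forall>u\<in>carrier (dual_module R P). k u = (\<Oplus>\<^bsub>W\<^esub>b\<in>B. u b \<odot>\<^bsub>W\<^esub> w b)"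
proof -
  interpret W: module R W by (rule W)
  note F = dual_basis_iso[OF P B]
  let ?F = "\<lambda>u b. if b \<in> B then u b else \<zero>"
  let ?G = "inv_into (carrier (dual_module R P)) ?F"
  have BP: "B \<subseteq> carrier P" using B(1) by (simp add: is_basis_def)
  have G: "?G \<in> mod_hom R (fin_mod R B) (dual_module R P)" by (rule hom_inv[OF module_dual[OF P] module_fin_mod F])
  let ?w = "\<lambda>b. k (?G (fin_unit R b))"
  have w: "?w \<in> B \<rightarrow> carrier W" using hom_closed[OF hom_comp[OF G k] fin_unit_carrier] by simp
  show ?thesis
  proof (rule bexI[OF _ w], rule ballI)
    fix u assume u: "u \<in> carrier (dual_module R P)"
    have Fu: "?F u \<in> carrier (fin_mod R B)" by (rule hom_closed[OF F(1) u])
    have GF: "?G (?F u) = u" by (rule inv_into_f_f[OF bij_betw_imp_inj_on[OF F(2)] u])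
    have "k (?G (?F u)) = lin_ext R W ?w (?F u)"
      by (rule fin_mod_hom_eqI[OF W hom_comp[OF G k] lin_ext_hom[OF W w] _ Fu]) (simp add: lin_ext_unit[OF W w])
    also have "\<dots> = (\<Oplus>\<^bsub>W\<^esub>b\<in>B. ?F u b \<odot>\<^bsub>W\<^esub> ?w b)"
      by (rule lin_ext_alt[OF W Fu w B(2) order_refl]) auto
    also have "\<dots> = (\<Oplus>\<^bsub>W\<^esub>b\<in>B. u b \<odot>\<^bsub>W\<^esub> ?w b)"
    proof (rule W.finsum_cong')
      have "u b \<in> carrier R" if "b \<in> B" for b using fin_mod_val[OF Fu, of b] that by simp
      then show "(\<lambda>b. u b \<odot>\<^bsub>W\<^esub> ?w b) \<in> B \<rightarrow> carrier W" using w by auto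
    qed simp_all
    finally show "k u = (\<Oplus>\<^bsub>W\<^esub>b\<in>B. u b \<odot>\<^bsub>W\<^esub> ?w b)" unfolding GF .
  qed
qed

text \<open>The choice in \<open>Ext_module\<close> mentions neither the degree nor the second
  argument, so one resolution serves for all of them at once. The minimal resolution shows only that
  the choice succeeds.\<close>

lemma Ext_resolution:
  fixes V :: "('a,'x,'y) module_scheme"
  assumes V: "fgm R V"
  shows "\<exists>P \<delta> \<epsilon>. proj_resolution R V P \<delta> \<epsilon> \<and> (\<forall>i. free_module R (P i) \<and> fgm R (P i)) \<and>
     (\<forall>j (W :: ('a,'c,'d) module_scheme). Ext_module R j V W = Hom_cohomology R P \<delta> W j)"
proof -
  define C where "C = (\<lambda>(P :: nat \<Rightarrow> ('a, nat \<Rightarrow> 'a) module, \<delta>).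
        (\<exists>\<epsilon>. left_resolution R V P \<delta> \<epsilon>) \<and> (\<forall>i. free_module R (P i) \<and> fg_module R (P i)))"
  obtain m \<delta>0 \<epsilon>0 where "left_resolution R V (\<lambda>i. fin_mod R {..<m i :: nat}) \<delta>0 \<epsilon>0" using minimal_resolution[OF V] by metis
  then have "C (\<lambda>i. fin_mod R {..<m i}, \<delta>0)" using free_fin_mod fg_fin_mod unfolding C_def by auto
  then have ex: "C (SOME x. C x)" by (rule someI)
  obtain P \<delta> where Pd: "(SOME x. C x) = (P, \<delta>)" by (cases "SOME x. C x")
  have mV: "module R V" using V by (simp add: fgm_def)
  obtain \<epsilon> where e: "left_resolution R V P \<delta> \<epsilon>" "\<forall>i. free_module R (P i) \<and> fg_module R (P i)"
  proof -
    have "C (P, \<delta>)" using ex Pd by simp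
    then show ?thesis using that unfolding C_def by auto
  qed
  have "proj_mod R (P i)" for i using e(2) basis_proj unfolding free_module_def by metis
  then have "proj_resolution R V P \<delta> \<epsilon>" using e(1) mV by (simp add: proj_resolution_def)
  moreover have "Ext_module R j V W = Hom_cohomology R P \<delta> W j" for j and W :: "('a,'c,'d) module_scheme"
    unfolding Ext_module_def using Pd unfolding C_def by simp
  ultimately show ?thesis using e(2) fg_module_imp_fgm by blast
qed

end

section \<open>A canonical module with a free quotient\<close>

lemma bdry_comp:
  assumes W: "module R W" "module R W'" and k: "k \<in> mod_hom R W W'" and b: "b \<in> bdry R P \<delta> W i"
  shows "(\<lambda>x. k (b x)) \<in> bdry R P \<delta> W' i"
proof (cases i)
  case 0 then show ?thesis using b hom_zero[OF W k] by auto
next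
  case (Suc j)
  then obtain g where g: "b = (\<lambda>x. g (\<delta> j x))" "g \<in> mod_hom R (P j) W" using b by auto
  show ?thesis unfolding Suc g(1) bdry.simps by (rule image_eqI[OF _ hom_comp[OF g(2) k]]) simp
qed

context noetherian_local_ring begin

lemma functionals_separate:
  assumes P: "module R P" and B: "is_basis R P B" and x: "x \<in> carrier P" "y \<in> carrier P"
    and eq: "\<And>u. u \<in> carrier (dual_module R P) \<Longrightarrow> u x = u y"
  shows "x = y"
proof -
  let ?F = "lin_ext R P (\<lambda>x. x)" let ?G = "inv_into (carrier (fin_mod R B)) ?F"
  have BP: "B \<subseteq> carrier P" using B by (simp add: is_basis_def)
  note bij = basis_iso[OF P B]
  have G: "?G \<in> mod_hom R P (fin_mod R B)" by (rule hom_inv[OF module_fin_mod P lin_ext_id_hom[OF P BP] bij])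
  have "?G x b = ?G y b" for b
  proof -
    have "(\<lambda>v. v b) \<in> mod_hom R (fin_mod R B) (self_module R)"
      using fin_mod_val[of _ B] by (intro mod_homI) (auto simp: fin_mod_simps)
    from restrict_in_Hom[OF P hom_comp[OF G this]] have "(\<lambda>x\<in>carrier P. ?G x b) \<in> carrier (dual_module R P)"
      unfolding dual_module_def .
    from eq[OF this] x show ?thesis by simp
  qed
  then have e: "?G x = ?G y" by auto
  have "carrier P = ?F ` carrier (fin_mod R B)" using bij by (simp add: bij_betw_def)
  then show ?thesis using inv_into_injective[OF e] x by auto
qed

lemma fgm_residue: "fgm R (residue_module R)"
  by (rule fgm_image[OF fgm_self module_residue residue_coset_hom]) (simp add: residue_carrier)

end

context cm_inj_res begin

text \<open>A nonzero retract of \<omega> inherits the regular sequence of length \<open>d\<close>.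
  Vanishing in degree \<open>d\<close> would descend to degree 0 on the quotient by it, where a
  socle element gives a nonzero map from the residue field.\<close>

lemma retract_not_cohom_vanish:
  assumes r: "proj_resolution R (residue_module R) P \<delta> \<epsilon>" and W': "fgm R W'" "\<not> zero_module W'"
    and i: "i \<in> mod_hom R W' \<omega>" and p: "p \<in> mod_hom R \<omega> W'" and pi: "\<And>w. w \<in> carrier W' \<Longrightarrow> p (i w) = w"
  shows "\<not> cohom_vanish R P \<delta> W' {\<zero>\<^bsub>W'\<^esub>} d"
proof
  assume u: "cohom_vanish R P \<delta> W' {\<zero>\<^bsub>W'\<^esub>} d"
  have mW': "module R W'" using W' by (simp add: fgm_def)
  let ?A = "\<lambda>k. {w \<in> carrier W'. i w \<in> A\<omega> k}"
  have c: "regular_chain R W' ys ?A d" "?A 0 = {\<zero>\<^bsub>W'\<^esub>}"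
    by (rule regular_chain_retract[OF modW mW' i p _ ys(1,2)], erule pi)+
  have sA: "submodule (?A d) R W'" using c(1) by (simp add: regular_chain_def)
  obtain z where z: "z \<in> carrier W'" "z \<notin> ?A d" "\<forall>a\<in>\<mm>. a \<odot>\<^bsub>W'\<^esub> z \<in> ?A d"
    using regular_chain_socle[OF W'(1) c(1) dim regular_chain_top_ne[OF W' c]] by (elim bexE conjE)
  have u0: "cohom_vanish R P \<delta> W' (?A 0) d" unfolding c(2) by (rule u)
  have "cohom_vanish R P \<delta> W' (?A d) (d - d)"
    by (rule regular_chain_cohom_vanish_top[OF r mW' c(1) residue_killed u0 order_refl])
  then show False using socle_imp_not_cohom_vanish[OF r mW' sA z(1,2)] z(3) by simp
qed

text \<open>If \<open>t\<close> were not injective, \<open>\<omega>\<close> would be the sum of a copy of \<open>R\<close> and the kernel of \<open>t\<close>. The \<open>d\<close>-th \<open>Ext\<close> module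
  from the residue field to either summand is nonzero, against type one.\<close>

lemma surjection_from_omega_bij:
  assumes t: "t \<in> mod_hom R \<omega> (self_module R)" and w0: "w0 \<in> carrier \<omega>" "t w0 = \<one>"
    and iso: "mod_iso R (Ext_module R d (residue_module R) \<omega>) (residue_module R)"
  shows "bij_betw t (carrier \<omega>) (carrier R)"
proof -
  note mS = module_self[OF is_cring]
  interpret W: module R \<omega> by (rule modW)
  have tc: "t u \<in> carrier R" if "u \<in> carrier \<omega>" for u using hom_closed[OF t that] by simp
  have i1: "(\<lambda>r. r \<odot>\<^bsub>\<omega>\<^esub> w0) \<in> mod_hom R (self_module R) \<omega>" by (rule hom_smult_elem[OF modW w0(1)])
  have ti: "t (r \<odot>\<^bsub>\<omega>\<^esub> w0) = r" if "r \<in> carrier R" for r using hom_smult[OF t that w0(1)] w0(2) that by simp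
  let ?L = "{u \<in> carrier \<omega>. t u = \<zero>\<^bsub>self_module R\<^esub>}"
  have L: "submodule ?L R \<omega>" by (rule submod_ker[OF modW mS t])
  have mL: "module R (\<omega> \<restriction> ?L)" by (rule module_sub[OF modW L])
  \<comment> \<open>The projection of \<omega> onto the kernel of \<open>t\<close> along the
    multiples of \<open>w0\<close>.\<close>
  let ?p = "\<lambda>u. u \<ominus>\<^bsub>\<omega>\<^esub> t u \<odot>\<^bsub>\<omega>\<^esub> w0"
  have p: "?p \<in> mod_hom R \<omega> \<omega>" by (rule hom_minus[OF modW hom_id hom_comp[OF t i1]])
  have "t (?p u) = \<zero>" if u: "u \<in> carrier \<omega>" for u
    using hom_diff[OF modW mS t u, of "t u \<odot>\<^bsub>\<omega>\<^esub> w0"] ti[OF tc[OF u]] tc[OF u] w0(1) by (simp add: a_minus_def a_inv_self r_neg)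
  then have pL: "?p \<in> mod_hom R \<omega> (\<omega> \<restriction> ?L)" by (intro hom_cod_sub[OF p]) (use hom_closed[OF p] in auto)
  have iL: "(\<lambda>u. u) \<in> mod_hom R (\<omega> \<restriction> ?L) \<omega>" by (rule hom_dom_sub[OF hom_id]) auto
  have pi: "?p u = u" if "u \<in> ?L" for u using that w0(1) by (simp add: W.minus_zero_right)
  have pw0: "?p (r \<odot>\<^bsub>\<omega>\<^esub> w0) = \<zero>\<^bsub>\<omega>\<^esub>" if "r \<in> carrier R" for r using ti[OF that] w0(1) that by (simp add: W.minus_eq_zero_iff)
  have "?L = {\<zero>\<^bsub>\<omega>\<^esub>}"
  proof (rule ccontr)
    assume nL: "?L \<noteq> {\<zero>\<^bsub>\<omega>\<^esub>}"
    obtain P \<delta> \<epsilon> where r: "proj_resolution R (residue_module R) P \<delta> \<epsilon>" and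
      ext: "Ext_module R d (residue_module R) \<omega> = Hom_cohomology R P \<delta> \<omega> d"
      using Ext_resolution[OF fgm_residue, where ?'c = 'c and ?'d = 'd] by blast
    have "\<not> zero_module (self_module R)" using one_neq_zero by (auto simp: zero_module_def)
    from retract_not_cohom_vanish[OF r fgm_self this i1 t] ti have n1: "\<not> cohom_vanish R P \<delta> (self_module R) {\<zero>} d" by simp
    have "\<not> zero_module (\<omega> \<restriction> ?L)" using nL by (simp add: zero_module_def)
    from retract_not_cohom_vanish[OF r fgm_sub[OF fg_omega L] this iL pL] pi have n2: "\<not> cohom_vanish R P \<delta> (\<omega> \<restriction> ?L) {\<zero>\<^bsub>\<omega>\<^esub>} d" by simp
    interpret S: module R "self_module R" by (rule mS)
    interpret L: module R "\<omega> \<restriction> ?L" by (rule mL)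
    obtain f1 where f1: "f1 \<in> mod_hom R (P d) (self_module R)" "\<And>x. x \<in> carrier (P (Suc d)) \<Longrightarrow> f1 (\<delta> d x) = \<zero>"
      "\<And>b. b \<in> bdry R P \<delta> (self_module R) d \<Longrightarrow> \<exists>x\<in>carrier (P d). f1 x \<ominus>\<^bsub>self_module R\<^esub> b x \<noteq> \<zero>"
      using n1 unfolding cohom_vanish_def by auto
    obtain f2 where f2: "f2 \<in> mod_hom R (P d) (\<omega> \<restriction> ?L)" "\<And>x. x \<in> carrier (P (Suc d)) \<Longrightarrow> f2 (\<delta> d x) = \<zero>\<^bsub>\<omega>\<^esub>"
      "\<And>b. b \<in> bdry R P \<delta> (\<omega> \<restriction> ?L) d \<Longrightarrow> \<exists>x\<in>carrier (P d). f2 x \<ominus>\<^bsub>\<omega> \<restriction> ?L\<^esub> b x \<noteq> \<zero>\<^bsub>\<omega>\<^esub>"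
      using n2 unfolding cohom_vanish_def by auto
    have f1c: "f1 x \<in> carrier R" if "x \<in> carrier (P d)" for x using hom_closed[OF f1(1) that] by simp
    have f2c: "f2 x \<in> ?L" if "x \<in> carrier (P d)" for x using hom_closed[OF f2(1) that] by simp
    have f2w: "f2 \<in> mod_hom R (P d) \<omega>" by (rule hom_cod_sup[OF f2(1)]) auto
    have F1: "(\<lambda>x. f1 x \<odot>\<^bsub>\<omega>\<^esub> w0) \<in> mod_hom R (P d) \<omega>" by (rule hom_comp[OF f1(1) i1])
    \<comment> \<open>The cocycle \<open>f1\<close>, carried from R into \<omega>, is no coboundary,
      since \<open>t\<close> would carry a bounding cochain back. So \<open>f2\<close> is a multiple
      of it modulo a coboundary. The projection \<open>?p\<close> removes this multiple and leaves
      \<open>f2\<close> as a coboundary in the kernel of \<open>t\<close>, a contradiction.\<close>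
    have "\<exists>a\<in>carrier R. \<exists>b\<in>bdry R P \<delta> \<omega> d. \<forall>x\<in>carrier (P d). f2 x \<ominus>\<^bsub>\<omega>\<^esub> a \<odot>\<^bsub>\<omega>\<^esub> (f1 x \<odot>\<^bsub>\<omega>\<^esub> w0) = b x"
    proof (rule one_dim_cohomology[OF r modW iso[unfolded ext] F1 _ f2w])
      show "f2 (\<delta> d x) = \<zero>\<^bsub>\<omega>\<^esub>" if "x \<in> carrier (P (Suc d))" for x by (rule f2(2)[OF that])
      show "f1 (\<delta> d x) \<odot>\<^bsub>\<omega>\<^esub> w0 = \<zero>\<^bsub>\<omega>\<^esub>" if "x \<in> carrier (P (Suc d))" for x using f1(2)[OF that] w0(1) by simp
      fix b assume b: "b \<in> bdry R P \<delta> \<omega> d"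
      show "\<exists>x\<in>carrier (P d). f1 x \<odot>\<^bsub>\<omega>\<^esub> w0 \<noteq> b x"
      proof (rule ccontr)
        assume "\<not> ?thesis"
        then have e: "f1 x \<odot>\<^bsub>\<omega>\<^esub> w0 = b x" if "x \<in> carrier (P d)" for x using that by auto
        have "t (b x) = f1 x" if "x \<in> carrier (P d)" for x using e[OF that] ti[OF f1c[OF that]] by simp
        then have "f1 x \<ominus>\<^bsub>self_module R\<^esub> t (b x) = \<zero>" if "x \<in> carrier (P d)" for x
          using that f1c[OF that] S.minus_eq_zero_iff[of "f1 x" "f1 x"] by simp
        then show False using f1(3)[OF bdry_comp[OF modW mS t b]] by auto
      qed
    qed
    then obtain a b where ab: "a \<in> carrier R" "b \<in> bdry R P \<delta> \<omega> d"
      "\<And>x. x \<in> carrier (P d) \<Longrightarrow> f2 x \<ominus>\<^bsub>\<omega>\<^esub> a \<odot>\<^bsub>\<omega>\<^esub> (f1 x \<odot>\<^bsub>\<omega>\<^esub> w0) = b x" by auto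
    have "f2 x \<ominus>\<^bsub>\<omega> \<restriction> ?L\<^esub> ?p (b x) = \<zero>\<^bsub>\<omega>\<^esub>" if x: "x \<in> carrier (P d)" for x
    proof -
      have f2x: "f2 x \<in> carrier \<omega>" using f2c[OF x] by simp
      have af: "a \<otimes> f1 x \<in> carrier R" using ab(1) f1c[OF x] by simp
      have e: "a \<odot>\<^bsub>\<omega>\<^esub> (f1 x \<odot>\<^bsub>\<omega>\<^esub> w0) = (a \<otimes> f1 x) \<odot>\<^bsub>\<omega>\<^esub> w0" using ab(1) f1c[OF x] w0(1) by (simp add: W.smult_assoc1)
      have "?p (b x) = ?p (f2 x) \<ominus>\<^bsub>\<omega>\<^esub> ?p ((a \<otimes> f1 x) \<odot>\<^bsub>\<omega>\<^esub> w0)"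
        unfolding ab(3)[OF x, symmetric] e by (rule hom_diff[OF modW modW p f2x]) (use af w0(1) in simp)
      also have "\<dots> = f2 x" unfolding pw0[OF af] pi[OF f2c[OF x]] using f2x by (simp add: W.minus_zero_right)
      finally show ?thesis using f2c[OF x] L.minus_eq_zero_iff[of "f2 x" "f2 x"] by simp
    qed
    then show False using f2(3)[OF bdry_comp[OF modW mL pL ab(2)]] by auto
  qed
  then have "inj_on t (carrier \<omega>)" using hom_inj_iff[OF modW mS t] by auto
  moreover have "t ` carrier \<omega> = carrier R"
  proof
    show "t ` carrier \<omega> \<subseteq> carrier R" using tc by auto
    show "carrier R \<subseteq> t ` carrier \<omega>"
    proof
      fix r assume r: "r \<in> carrier R"
      then show "r \<in> t ` carrier \<omega>" using ti[OF r] w0(1) by (intro image_eqI[of _ _ "r \<odot>\<^bsub>\<omega>\<^esub> w0"]) auto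
    qed
  qed
  ultimately show ?thesis by (simp add: bij_betw_def)
qed

end

section \<open>The dual of M\<close>

text \<open>The number \<open>q\<close> counts the spots 1, ..., \<open>q\<close> at which the dual
  complex is exact. The theorem takes q = 0 in its first part and q = d in its second, and d \<le> q
  + 1 is what both share.\<close>

locale dual_setup = cm_inj_res +
  fixes M :: "('a,'x,'y) module_scheme" and P :: "nat \<Rightarrow> ('a, nat \<Rightarrow> 'a) module" and \<delta> \<epsilon> and q :: nat
  assumes fgM: "fgm R M" and r: "proj_resolution R M P \<delta> \<epsilon>" and freeP: "\<And>i. free_module R (P i)" and fgP: "\<And>i. fgm R (P i)"
    and exact: "\<And>i. 1 \<le> i \<Longrightarrow> i \<le> q \<Longrightarrow> cocycles R P \<delta> (self_module R) i = coboundaries R P \<delta> (self_module R) i"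
    and dq: "d \<le> Suc q" and dualM: "\<not> zero_module (dual_module R M)"
    and type1: "mod_iso R (Ext_module R d (residue_module R) \<omega>) (residue_module R)"
begin

abbreviation "SR \<equiv> self_module R"
abbreviation "F i \<equiv> dual_module R (P i)"
abbreviation "ds i \<equiv> (\<lambda>u. \<lambda>x\<in>carrier (P (Suc i)). u (\<delta> i x))"
abbreviation "N \<equiv> dual_module R M"
abbreviation "K0 \<equiv> {u \<in> carrier (F 0). ds 0 u = \<zero>\<^bsub>F (Suc 0)\<^esub>}"
abbreviation "eN \<equiv> (\<lambda>u. \<lambda>x\<in>carrier (P 0). u (\<epsilon> x))"

lemmas mS = module_self[OF is_cring]
lemmas mP = proj_resolutionD(2)[OF r] and dl = proj_resolutionD(5)[OF r] and ep = proj_resolutionD(4)[OF r]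

lemma mM: "module R M" using fgM by (simp add: fgm_def)

lemma mF: "module R (F i)" by (rule module_dual[OF mP])
lemma mN: "module R N" by (rule module_dual[OF mM])
lemma fgF: "fgm R (F i)" unfolding dual_module_def by (rule fgm_Hom[OF fgP fgm_self])
lemma fgN: "fgm R N" unfolding dual_module_def by (rule fgm_Hom[OF fgM fgm_self])

lemma basisP: obtains B where "is_basis R (P i) B" "finite B" "B \<subseteq> carrier (P i)"
proof -
  obtain B where B: "is_basis R (P i) B" using freeP[of i] unfolding free_module_def by (elim conjE exE)
  show thesis by (rule that[OF B basis_finite[OF fgP B]]) (use B in \<open>simp add: is_basis_def\<close>)
qed

lemma projF: "proj_mod R (F i)"
proof -
  obtain B where "is_basis R (P i) B" "finite B" by (rule basisP)
  then show ?thesis by (rule dual_proj[OF mP])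
qed

lemma ds_hom: "ds i \<in> mod_hom R (F i) (F (Suc i))"
  unfolding dual_module_def by (rule precomp_hom[OF mP dl])

lemma sub_image: "submodule (ds i ` carrier (F i)) R (F (Suc i))"
  by (rule submod_image[OF mF mF ds_hom submod_carrier[OF mF]])

lemma ds_zero_iff: "ds i u = \<zero>\<^bsub>F (Suc i)\<^esub> \<longleftrightarrow> (\<forall>x\<in>carrier (P (Suc i)). u (\<delta> i x) = \<zero>)"
  unfolding dual_module_def Hom_apply by (auto simp: fun_eq_iff restrict_def)

text \<open>Each exact spot of the dual complex makes the image a syzygy of the next one, which lowers the degree
  from which on \<open>Ext\<close> into \<open>\<omega>\<close> vanishes by one.\<close>

lemma Ext_vanish_image: "k \<le> q \<Longrightarrow> j + k \<ge> d \<Longrightarrow> Ext_vanish j (F (Suc (q - k))) (ds (q - k) ` carrier (F (q - k)))"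
proof (induction k arbitrary: j)
  case 0
  then have "d \<le> j" by simp
  from Ext_vanish_fg[OF fgF sub_image this] show ?case by (simp only: diff_zero)
next
  case (Suc k)
  define i where "i = q - Suc k"
  have i: "q - k = Suc i" "Suc i \<le> q" using Suc.prems(1) by (auto simp: i_def)
  let ?B = "ds (Suc i) ` carrier (F (Suc i))"
  have "Ext_vanish (Suc j) (F (Suc (Suc i))) ?B"
    by (rule Suc.IH[of "Suc j", unfolded i(1)]) (use Suc.prems in simp_all)
  from Ext_vanish_submodule[OF fgF sub_image Ext_vanish_proj[OF projF] this]
  have v: "Ext_vanish j (F (Suc (Suc i)) \<restriction> ?B) {\<zero>\<^bsub>F (Suc (Suc i)) \<restriction> ?B\<^esub>}" by simp
  have k: "ds i ` carrier (F i) = {u \<in> carrier (F (Suc i)). ds (Suc i) u = \<zero>\<^bsub>F (Suc (Suc i)) \<restriction> ?B\<^esub>}"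
  proof -
    have "ds i ` carrier (F i) = cocycles R P \<delta> SR (Suc i)" using exact[of "Suc i"] i(2) by (simp add: dual_module_def)
    also have "\<dots> = {u \<in> carrier (F (Suc i)). ds (Suc i) u = \<zero>\<^bsub>F (Suc (Suc i))\<^esub>}"
      unfolding ds_zero_iff by (simp add: cocycles_def dual_module_def)
    finally show ?thesis by simp
  qed
  have "Ext_vanish j (F (Suc i)) (ds i ` carrier (F i))"
    by (rule Ext_vanish_of_surj[OF mF module_sub[OF mF sub_image] hom_cod_sub[OF ds_hom] _ k v]) auto
  then show ?case unfolding i_def .
qed

lemma sub_K0: "submodule K0 R (F 0)" by (rule submod_ker[OF mF mF ds_hom])

text \<open>The quotient of \<open>F 0\<close> by \<open>K0\<close> is the image in
  \<open>F 1\<close>, so its Ext is that of the cokernel one degree higher. This shift is the reason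
  for d \<le> q + 1 instead of d \<le> q.\<close>

lemma Ext_vanish_K0: "Ext_vanish j (F 0) K0"
proof -
  let ?B = "ds 0 ` carrier (F 0)"
  have "Ext_vanish (Suc j) (F (Suc 0)) ?B" using Ext_vanish_image[of q "Suc j"] dq by simp
  from Ext_vanish_submodule[OF fgF sub_image Ext_vanish_proj[OF projF] this]
  have v: "Ext_vanish j (F (Suc 0) \<restriction> ?B) {\<zero>\<^bsub>F (Suc 0) \<restriction> ?B\<^esub>}" by simp
  show ?thesis by (rule Ext_vanish_of_surj[OF mF module_sub[OF mF sub_image] hom_cod_sub[OF ds_hom] _ _ v]) auto
qed

lemma K0_eq: "K0 = {u \<in> carrier (F 0). \<forall>x\<in>carrier (P 0). \<epsilon> x = \<zero>\<^bsub>M\<^esub> \<longrightarrow> u x = \<zero>}"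
proof -
  have "(\<forall>x\<in>carrier (P (Suc 0)). u (\<delta> 0 x) = \<zero>) \<longleftrightarrow> (\<forall>x\<in>carrier (P 0). \<epsilon> x = \<zero>\<^bsub>M\<^esub> \<longrightarrow> u x = \<zero>)" for u :: "(nat \<Rightarrow> 'a) \<Rightarrow> 'a"
  proof
    assume u: "\<forall>x\<in>carrier (P (Suc 0)). u (\<delta> 0 x) = \<zero>"
    show "\<forall>x\<in>carrier (P 0). \<epsilon> x = \<zero>\<^bsub>M\<^esub> \<longrightarrow> u x = \<zero>"
    proof (intro ballI impI)
      fix x assume "x \<in> carrier (P 0)" "\<epsilon> x = \<zero>\<^bsub>M\<^esub>"
      then have "x \<in> \<delta> 0 ` carrier (P (Suc 0))" using proj_resolutionD(7)[OF r] by simp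
      then show "u x = \<zero>" by (rule imageE) (simp add: u)
    qed
  next
    assume u: "\<forall>x\<in>carrier (P 0). \<epsilon> x = \<zero>\<^bsub>M\<^esub> \<longrightarrow> u x = \<zero>"
    show "\<forall>x\<in>carrier (P (Suc 0)). u (\<delta> 0 x) = \<zero>" using u hom_closed[OF dl] proj_resolutionD(9)[OF r] by simp
  qed
  then show ?thesis unfolding ds_zero_iff by simp
qed

lemma eN_hom: "eN \<in> mod_hom R N (F 0)"
  unfolding dual_module_def by (rule precomp_hom[OF mP ep])

lemma eN_bij: "bij_betw eN (carrier N) K0"
  unfolding K0_eq using Hom_left_exact[OF mP mM mS ep proj_resolutionD(6)[OF r]] by (simp add: dual_module_def)

lemma eN_hom': "eN \<in> mod_hom R N (F 0 \<restriction> K0)"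
  by (rule hom_cod_sub[OF eN_hom]) (use eN_bij in \<open>simp add: bij_betw_def\<close>)

lemma Ext_vanish_N: "Ext_vanish j N {\<zero>\<^bsub>N\<^esub>}"
proof -
  have "Ext_vanish j (F 0 \<restriction> K0) {\<zero>\<^bsub>F 0 \<restriction> K0\<^esub>}" using Ext_vanish_submodule[OF fgF sub_K0 Ext_vanish_proj[OF projF] Ext_vanish_K0] by simp
  from Ext_vanish_iso[OF mN module_sub[OF mF sub_K0] eN_hom' _ this] show ?thesis by (simp add: eN_bij)
qed

lemma extend_N:
  assumes f: "f \<in> mod_hom R N \<omega>"
  shows "\<exists>g\<in>mod_hom R (F 0) \<omega>. \<forall>a\<in>carrier N. g (eN a) = f a"
proof -
  let ?i = "inv_into (carrier N) eN"
  have i: "?i \<in> mod_hom R (F 0 \<restriction> K0) N" by (rule hom_inv[OF mN module_sub[OF mF sub_K0] eN_hom']) (use eN_bij in simp)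
  obtain g where g: "g \<in> mod_hom R (F 0) \<omega>" "\<forall>a\<in>K0. g a = f (?i a)"
    using hom_ext_of_Ext_vanish[OF fgF sub_K0 Ext_vanish_K0 hom_comp[OF i f]] by (elim bexE)
  have "g (eN a) = f a" if a: "a \<in> carrier N" for a
  proof -
    have "eN a \<in> K0" using bij_betwE[OF eN_bij] a by blast
    moreover have "?i (eN a) = a" by (rule inv_into_f_f[OF bij_betw_imp_inj_on[OF eN_bij] a])
    ultimately show ?thesis using g(2) by simp
  qed
  then show ?thesis using g(1) by (intro bexI[of _ g]) simp_all
qed

text \<open>Maps from \<open>N\<close> to \<open>\<omega>\<close> extend to the dual of the free cover of \<open>M\<close>, so they are sums of maps of the form
  \<open>a \<mapsto> a (x) v\<close>. If all maps from \<open>\<omega>\<close> to \<open>R\<close> had values in the maximal ideal, a functional on the free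
  module \<open>Hom(N, \<omega>)\<close> could not be \<open>1\<close> on a basis element.\<close>

lemma surjection_exists:
  assumes Y: "is_basis R (Hom_module R N \<omega>) B" "B \<noteq> {}"
  shows "\<exists>t\<in>mod_hom R \<omega> SR. \<exists>w\<in>carrier \<omega>. t w = \<one>"
proof -
  let ?Y = "Hom_module R N \<omega>"
  have mY: "module R ?Y" by (rule module_Hom[OF mN modW])
  interpret W: module R \<omega> by (rule modW)
  have "\<exists>t\<in>mod_hom R \<omega> SR. \<exists>w\<in>carrier \<omega>. t w \<notin> \<mm>"
  proof (rule ccontr)
    assume "\<not> ?thesis"
    then have allm: "t w \<in> \<mm>" if "t \<in> mod_hom R \<omega> SR" "w \<in> carrier \<omega>" for t w using that by auto
    obtain b0 where b0: "b0 \<in> B" using Y(2) by auto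
    have b0Y: "b0 \<in> carrier ?Y" using Y(1) b0 by (auto simp: is_basis_def)
    obtain c where c: "c \<in> mod_hom R ?Y SR" "\<forall>b\<in>B. c b = \<one>"
      using basis_hom_ex[OF mY Y(1) mS, of "\<lambda>_. \<one>"] by auto
    have b0h: "b0 \<in> mod_hom R N \<omega>" using b0Y by (simp add: Hom_carrier)
    obtain g where g: "g \<in> mod_hom R (F 0) \<omega>" "\<forall>a\<in>carrier N. g (eN a) = b0 a" using extend_N[OF b0h] by (elim bexE)
    obtain BP where BP: "is_basis R (P 0) BP" "finite BP" "BP \<subseteq> carrier (P 0)" by (rule basisP)
    obtain w where w: "w \<in> BP \<rightarrow> carrier \<omega>" "\<forall>u\<in>carrier (F 0). g u = (\<Oplus>\<^bsub>\<omega>\<^esub>b\<in>BP. u b \<odot>\<^bsub>\<omega>\<^esub> w b)"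
      using dual_hom_expand[OF mP BP(1,2) modW g(1)] by (elim bexE)
    have Nh: "a x \<in> carrier R" if "a \<in> carrier N" "x \<in> carrier M" for a x
      using that hom_closed[of a R M SR x] by (simp add: dual_module_def Hom_carrier)
    have ec: "\<epsilon> b \<in> carrier M" if "b \<in> BP" for b using hom_closed[OF ep] BP(3) that by auto
    let ?i = "\<lambda>b v. \<lambda>a\<in>carrier N. a (\<epsilon> b) \<odot>\<^bsub>\<omega>\<^esub> v"
    have evN: "(\<lambda>a. a x) \<in> mod_hom R N SR" if "x \<in> carrier M" for x unfolding dual_module_def by (rule Hom_eval_hom[OF that])
    have iY: "?i b v \<in> carrier ?Y" if "b \<in> BP" "v \<in> carrier \<omega>" for b v
      by (rule restrict_in_Hom[OF mN hom_comp[OF evN[OF ec[OF that(1)]] hom_smult_elem[OF modW that(2)]]])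
    have ih: "?i b \<in> mod_hom R \<omega> ?Y" if b: "b \<in> BP" for b
    proof (rule mod_homI)
      fix v assume v: "v \<in> carrier \<omega>"
      show "?i b v \<in> carrier ?Y" by (rule iY[OF b v])
      show "?i b (v \<oplus>\<^bsub>\<omega>\<^esub> v') = ?i b v \<oplus>\<^bsub>?Y\<^esub> ?i b v'" if "v' \<in> carrier \<omega>" for v'
        using v that Nh[OF _ ec[OF b]] by (simp add: Hom_apply W.smult_r_distr cong: restrict_cong)
      show "?i b (s \<odot>\<^bsub>\<omega>\<^esub> v) = s \<odot>\<^bsub>?Y\<^esub> ?i b v" if "s \<in> carrier R" for s
        using v that Nh[OF _ ec[OF b]] by (simp add: Hom_apply W.smult_assoc1[symmetric] m_comm cong: restrict_cong)
    qed
    have wc: "w b \<in> carrier \<omega>" if "b \<in> BP" for b using w(1) that by auto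
    let ?s = "\<Oplus>\<^bsub>?Y\<^esub>b\<in>BP. ?i b (w b)"
    have sY: "?s \<in> carrier ?Y"
      by (rule submod_finsum[OF mY submod_carrier[OF mY] BP(2)]) (rule iY[OF _ wc])
    have "b0 = ?s"
    proof (rule Hom_eqI[OF b0Y sY])
      fix a assume a: "a \<in> carrier N"
      have eNa: "eN a \<in> carrier (F 0)" by (rule hom_closed[OF eN_hom a])
      have "?s a = (\<Oplus>\<^bsub>\<omega>\<^esub>b\<in>BP. ?i b (w b) a)"
        by (rule hom_finsum[OF mY modW Hom_eval_hom[OF a] BP(2)]) (rule iY[OF _ wc])
      also have "\<dots> = (\<Oplus>\<^bsub>\<omega>\<^esub>b\<in>BP. eN a b \<odot>\<^bsub>\<omega>\<^esub> w b)"
      proof (rule W.finsum_cong')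
        show "?i b (w b) a = eN a b \<odot>\<^bsub>\<omega>\<^esub> w b" if "b \<in> BP" for b using a BP(3) that by auto
        show "(\<lambda>b. eN a b \<odot>\<^bsub>\<omega>\<^esub> w b) \<in> BP \<rightarrow> carrier \<omega>" using Nh[OF a ec] wc BP(3) by (auto simp: subset_iff)
      qed simp
      also have "\<dots> = g (eN a)" by (rule w(2)[rule_format, OF eNa, symmetric])
      also have "\<dots> = b0 a" by (rule g(2)[rule_format, OF a])
      finally show "b0 a = ?s a" by simp
    qed
    \<comment> \<open>Each summand is the value at \<open>w b\<close> of a map from \<omega> to R,
      namely \<open>c\<close> after the inclusion \<open>?i b\<close>, and so lies in \<mm>.\<close>
    then have "c b0 = (\<Oplus>\<^bsub>SR\<^esub>b\<in>BP. c (?i b (w b)))"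
      using hom_finsum[OF mY mS c(1) BP(2), of "\<lambda>b. ?i b (w b)"] iY[OF _ wc] by simp
    also have "\<dots> \<in> \<mm>"
      by (rule submod_finsum[OF mS sub_max BP(2)]) (rule allm[OF hom_comp[OF ih c(1)] wc])
    finally show False using c(2) b0 one_notin_max by simp
  qed
  then obtain t w where t: "t \<in> mod_hom R \<omega> SR" "w \<in> carrier \<omega>" "t w \<notin> \<mm>" by (elim bexE)
  have tw: "t w \<in> carrier R" using hom_closed[OF t(1,2)] by simp
  have u: "t w \<in> Units R" by (rule notin_max_Unit[OF tw t(3)])
  have "t (inv (t w) \<odot>\<^bsub>\<omega>\<^esub> w) = \<one>" using hom_smult[OF t(1) Units_inv_closed[OF u] t(2)] u by simp
  then show ?thesis using t(1,2) u by (intro bexI[of _ t] bexI[of _ "inv (t w) \<odot>\<^bsub>\<omega>\<^esub> w"]) auto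
qed

text \<open>Finite projective dimension gives a basis of Hom(N, \<omega>), which is not empty
  because \<open>N\<close> is nonzero. A basis element produces a map from \<omega> onto R, which
  type one makes bijective. Composition with it identifies Hom(N, \<omega>) with the bidual of
  \<open>M\<close>.\<close>

lemma omega_iso_and_free:
  assumes Q: "proj_resolution R (Hom_module R N \<omega>) Q \<eta> \<zeta>" "\<And>i. i > p \<Longrightarrow> zero_module (Q i)"
  shows "\<exists>t\<in>mod_hom R \<omega> SR. bij_betw t (carrier \<omega>) (carrier R)" "free_module R (dual_module R N)"
proof -
  let ?Y = "Hom_module R N \<omega>"
  have mY: "module R ?Y" by (rule module_Hom[OF mN modW])
  have "\<exists>B. is_basis R ?Y B"
    by (rule finite_pd_imp_basis[OF fgm_Hom[OF fgN fg_omega] _ Q]) (rule Ext_vanish_dual[OF fgN Ext_vanish_N])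
  then obtain B where B: "is_basis R ?Y B" by (elim exE)
  have "B \<noteq> {}"
  proof
    assume "B = {}"
    then have "carrier ?Y = {\<zero>\<^bsub>?Y\<^esub>}" using basis_span[OF mY B] mspan_empty[OF mY] by simp
    then show False using Hom_omega_nonzero[OF fgN Ext_vanish_N dualM] by (simp add: zero_module_def)
  qed
  from surjection_exists[OF B this] obtain t w where t: "t \<in> mod_hom R \<omega> SR" "w \<in> carrier \<omega>" "t w = \<one>" by (elim bexE)
  have bij: "bij_betw t (carrier \<omega>) (carrier R)" by (rule surjection_from_omega_bij[OF t type1])
  then show "\<exists>t\<in>mod_hom R \<omega> SR. bij_betw t (carrier \<omega>) (carrier R)" using t(1) by (intro bexI)
  have ti: "inv_into (carrier \<omega>) t \<in> mod_hom R SR \<omega>" by (rule hom_inv[OF modW mS t(1)]) (simp add: bij)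
  let ?f = "\<lambda>u. \<lambda>x\<in>carrier N. t (u x)"
  have f: "?f \<in> mod_hom R ?Y (dual_module R N)" unfolding dual_module_def by (rule postcomp_hom[OF mN[unfolded dual_module_def] modW mS t(1)])
  have "bij_betw ?f (carrier ?Y) (carrier (dual_module R N))" unfolding bij_betw_def
  proof
    show "inj_on ?f (carrier ?Y)"
    proof (rule inj_onI)
      fix u v assume uv: "u \<in> carrier ?Y" "v \<in> carrier ?Y" "?f u = ?f v"
      show "u = v"
      proof (rule Hom_eqI[OF uv(1,2)])
        fix x assume x: "x \<in> carrier N"
        have "t (u x) = t (v x)" using fun_cong[OF uv(3), of x] x by simp
        moreover have "u x \<in> carrier \<omega>" "v x \<in> carrier \<omega>"
          using uv(1,2) x hom_closed[of u R N \<omega>] hom_closed[of v R N \<omega>] by (simp_all add: Hom_carrier)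
        ultimately show "u x = v x" using bij_betw_imp_inj_on[OF bij] by (auto dest: inj_onD)
      qed
    qed
    show "?f ` carrier ?Y = carrier (dual_module R N)"
    proof
      show "?f ` carrier ?Y \<subseteq> carrier (dual_module R N)" using hom_closed[OF f] by auto
      show "carrier (dual_module R N) \<subseteq> ?f ` carrier ?Y"
      proof
        fix v assume "v \<in> carrier (dual_module R N)"
        then have v: "v \<in> mod_hom R N SR" "v \<in> extensional (carrier N)" by (auto simp: dual_module_def Hom_carrier)
        let ?u = "\<lambda>x\<in>carrier N. inv_into (carrier \<omega>) t (v x)"
        have "v = ?f ?u"
          using v(2) hom_closed[OF v(1)] bij by (intro restrict_eqI) (simp_all add: bij_betw_def f_inv_into_f)
        then show "v \<in> ?f ` carrier ?Y" using restrict_in_Hom[OF mN hom_comp[OF v(1) ti]] by (rule image_eqI)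
      qed
    qed
  qed
  moreover have "free_module R ?Y" using B mY by (auto simp: free_module_def)
  ultimately show "free_module R (dual_module R N)" by (intro free_iso[OF _ module_dual[OF mN] f])
qed

text \<open>A functional on \<open>N\<close> extends to the dual of a free module, where it is an evaluation. This gives
  surjectivity; for injectivity the same is done one step further in the dual complex.\<close>

lemma reflexive:
  assumes t: "t \<in> mod_hom R \<omega> SR" "bij_betw t (carrier \<omega>) (carrier R)" and dq': "d \<le> q"
  shows "(\<lambda>x. \<lambda>a\<in>carrier N. a x) \<in> mod_hom R M (dual_module R N)" (is "?b \<in> _")
    "bij_betw (\<lambda>x. \<lambda>a\<in>carrier N. a x) (carrier M) (carrier (dual_module R N))"
proof -
  have mD: "module R (dual_module R N)" by (rule module_dual[OF mN])
  interpret M: module R M by (rule mM)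
  interpret P0: module R "P 0" by (rule mP)
  interpret S: module R SR by (rule mS)
  let ?ti = "inv_into (carrier \<omega>) t"
  have ti: "?ti \<in> mod_hom R SR \<omega>" by (rule hom_inv[OF modW mS t(1)]) (simp add: t(2))
  have tti: "t (?ti r) = r" if "r \<in> carrier R" for r using that t(2) by (simp add: bij_betw_def f_inv_into_f)
  have Na: "a \<in> mod_hom R M SR" if "a \<in> carrier N" for a using that by (simp add: dual_module_def Hom_carrier)
  have evN: "(\<lambda>a. a x) \<in> mod_hom R N SR" if "x \<in> carrier M" for x unfolding dual_module_def by (rule Hom_eval_hom[OF that])
  have bc: "?b x \<in> carrier (dual_module R N)" if "x \<in> carrier M" for x
    using restrict_in_Hom[OF mN evN[OF that]] by (simp add: dual_module_def)
  show b: "?b \<in> mod_hom R M (dual_module R N)"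
  proof (rule mod_homI)
    fix x assume x: "x \<in> carrier M"
    show "?b x \<in> carrier (dual_module R N)" by (rule bc[OF x])
    show "?b (x \<oplus>\<^bsub>M\<^esub> y) = ?b x \<oplus>\<^bsub>dual_module R N\<^esub> ?b y" if "y \<in> carrier M" for y
      using hom_add[OF Na x that] unfolding dual_module_def[of R N] Hom_apply by (auto cong: restrict_cong)
    show "?b (s \<odot>\<^bsub>M\<^esub> x) = s \<odot>\<^bsub>dual_module R N\<^esub> ?b x" if "s \<in> carrier R" for s
      using hom_smult[OF Na that x] unfolding dual_module_def[of R N] Hom_apply by (auto cong: restrict_cong)
  qed
  have Fu: "u \<in> mod_hom R (P i) SR" if "u \<in> carrier (F i)" for u i using that by (simp add: dual_module_def Hom_carrier)
  obtain BP where BP: "is_basis R (P 0) BP" "finite BP" "BP \<subseteq> carrier (P 0)" by (rule basisP)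
  obtain BQ where BQ: "is_basis R (P (Suc 0)) BQ" "finite BQ" "BQ \<subseteq> carrier (P (Suc 0))" by (rule basisP)
  \<comment> \<open>Finite free modules are reflexive. The point \<open>y\<close> has the values of
    the functional on the dual basis as its coordinates.\<close>
  have evaluation: "\<exists>y\<in>carrier (P i). \<forall>u\<in>carrier (F i). k u = u y"
    if k: "k \<in> mod_hom R (F i) SR" and B: "is_basis R (P i) B" "finite B" "B \<subseteq> carrier (P i)" for k i B
  proof -
    interpret Pi: module R "P i" by (rule mP)
    obtain w where w: "w \<in> B \<rightarrow> carrier SR" "\<forall>u\<in>carrier (F i). k u = (\<Oplus>\<^bsub>SR\<^esub>b\<in>B. u b \<odot>\<^bsub>SR\<^esub> w b)"
      using dual_hom_expand[OF mP B(1,2) mS k] by (elim bexE)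
    have wc: "w b \<in> carrier R" "b \<in> carrier (P i)" if "b \<in> B" for b using w(1) B(3) that by auto
    have wb: "w b \<odot>\<^bsub>P i\<^esub> b \<in> carrier (P i)" if "b \<in> B" for b using wc[OF that] by simp
    let ?y = "\<Oplus>\<^bsub>P i\<^esub>b\<in>B. w b \<odot>\<^bsub>P i\<^esub> b"
    have y: "?y \<in> carrier (P i)" by (rule submod_finsum[OF mP submod_carrier[OF mP] B(2) wb])
    have "k u = u ?y" if u: "u \<in> carrier (F i)" for u
    proof -
      have "u ?y = (\<Oplus>\<^bsub>SR\<^esub>b\<in>B. u (w b \<odot>\<^bsub>P i\<^esub> b))" by (rule hom_finsum[OF mP mS Fu[OF u] B(2) wb])
      also have "\<dots> = (\<Oplus>\<^bsub>SR\<^esub>b\<in>B. u b \<odot>\<^bsub>SR\<^esub> w b)"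
      proof (rule S.finsum_cong')
        have ub: "u b \<in> carrier R" if "b \<in> B" for b using hom_closed[OF Fu[OF u] wc(2)[OF that]] by simp
        show "u (w b \<odot>\<^bsub>P i\<^esub> b) = u b \<odot>\<^bsub>SR\<^esub> w b" if "b \<in> B" for b
          using hom_smult[OF Fu[OF u] wc[OF that]] m_comm[OF wc(1)[OF that] ub[OF that]] by simp
        show "(\<lambda>b. u b \<odot>\<^bsub>SR\<^esub> w b) \<in> B \<rightarrow> carrier SR" using ub wc(1) by auto
      qed simp
      finally show ?thesis using w(2) u by simp
    qed
    then show ?thesis using y by (intro bexI[of _ ?y]) auto
  qed
  show "bij_betw ?b (carrier M) (carrier (dual_module R N))" unfolding bij_betw_def
  proof
    show "?b ` carrier M = carrier (dual_module R N)"
    proof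
      show "?b ` carrier M \<subseteq> carrier (dual_module R N)" using bc by auto
      show "carrier (dual_module R N) \<subseteq> ?b ` carrier M"
      proof
        fix v assume "v \<in> carrier (dual_module R N)"
        then have v: "v \<in> mod_hom R N SR" "v \<in> extensional (carrier N)" by (auto simp: dual_module_def[of R N] Hom_carrier)
        obtain g where g: "g \<in> mod_hom R (F 0) \<omega>" "\<forall>a\<in>carrier N. g (eN a) = ?ti (v a)"
          using extend_N[OF hom_comp[OF v(1) ti]] by (elim bexE)
        obtain y where y: "y \<in> carrier (P 0)" "\<forall>u\<in>carrier (F 0). t (g u) = u y"
          using evaluation[OF hom_comp[OF g(1) t(1)] BP] by (elim bexE)
        have "v a = a (\<epsilon> y)" if a: "a \<in> carrier N" for a
        proof -
          have "v a = t (g (eN a))" using g(2) a tti hom_closed[OF v(1) a] by simp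
          also have "\<dots> = eN a y" using y(2) hom_closed[OF eN_hom a] by blast
          finally show ?thesis using y(1) by simp
        qed
        then have "v = ?b (\<epsilon> y)" using v(2) by (intro restrict_eqI) auto
        then show "v \<in> ?b ` carrier M" using hom_closed[OF ep y(1)] by (rule image_eqI)
      qed
    qed
    show "inj_on ?b (carrier M)"
    proof (subst hom_inj_iff[OF mM mD b], intro ballI impI)
      fix m assume m: "m \<in> carrier M" "?b m = \<zero>\<^bsub>dual_module R N\<^esub>"
      have am: "a m = \<zero>" if "a \<in> carrier N" for a
        using fun_cong[OF m(2), of a] that by (simp add: dual_module_def[of R N] Hom_apply)
      obtain u where u: "m = \<epsilon> u" "u \<in> carrier (P 0)" using m(1) unfolding proj_resolutionD(6)[OF r, symmetric] by (rule imageE)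
      let ?B = "ds 0 ` carrier (F 0)"
      have evu: "(\<lambda>f. f u) \<in> mod_hom R (F 0) SR" unfolding dual_module_def by (rule Hom_eval_hom[OF u(2)])
      \<comment> \<open>Evaluation at \<open>u\<close> vanishes on \<open>K0\<close>, so it is a
        functional on the image of \<open>F 0\<close> in \<open>F 1\<close>. Its extension to
        \<open>F 1\<close>, available since d \<le> q, is evaluation at some \<open>y\<close>. No
        functional separates \<open>u\<close> from the boundary of \<open>y\<close>, hence they are
        equal and \<open>m\<close> is zero.\<close>
      have "\<exists>g\<in>mod_hom R (F (Suc 0) \<restriction> ?B) SR. \<forall>f\<in>carrier (F 0). g (ds 0 f) = f u"
      proof (rule hom_factor[OF mF module_sub[OF mF sub_image] mS hom_cod_sub[OF ds_hom] _ evu])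
        fix f assume f: "f \<in> carrier (F 0)" "ds 0 f = \<zero>\<^bsub>F (Suc 0) \<restriction> ?B\<^esub>"
        then have "f \<in> K0" by simp
        then obtain a where a: "f = eN a" "a \<in> carrier N" using eN_bij unfolding bij_betw_def by blast
        then show "f u = \<zero>\<^bsub>SR\<^esub>" using am[OF a(2)] u by simp
      qed auto
      then obtain g where g: "g \<in> mod_hom R (F (Suc 0) \<restriction> ?B) SR" "\<forall>f\<in>carrier (F 0). g (ds 0 f) = f u" by (elim bexE)
      have "Ext_vanish 0 (F (Suc 0)) ?B" using Ext_vanish_image[of q 0] dq' by simp
      from hom_ext_of_Ext_vanish[OF fgF sub_image this hom_comp[OF g(1) ti]] obtain l where
        l: "l \<in> mod_hom R (F (Suc 0)) \<omega>" "\<forall>a\<in>?B. l a = ?ti (g a)" by (elim bexE)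
      obtain y where y: "y \<in> carrier (P (Suc 0))" "\<forall>f\<in>carrier (F (Suc 0)). t (l f) = f y"
        using evaluation[OF hom_comp[OF l(1) t(1)] BQ] by (elim bexE)
      have "u = \<delta> 0 y"
      proof (rule functionals_separate[OF mP BP(1) u(2) hom_closed[OF dl y(1)]])
        fix f assume f: "f \<in> carrier (F 0)"
        have "f u \<in> carrier R" using hom_closed[OF evu f] by simp
        then have "t (l (ds 0 f)) = f u" using l(2) g(2) f tti by simp
        moreover have "t (l (ds 0 f)) = ds 0 f y" using y(2) hom_closed[OF ds_hom f] by blast
        ultimately show "f u = f (\<delta> 0 y)" using y(1) by simp
      qed
      then show "m = \<zero>\<^bsub>M\<^esub>" using u(1) proj_resolutionD(9)[OF r y(1)] by simp
    qed
  qed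
qed

end

section \<open>Transport of the injective resolution and proof of the theorem\<close>

lemma Inf_enat_finite: "Inf {enat n | n. P n} < \<infinity> \<longleftrightarrow> (\<exists>n. P n)"
proof
  show "\<exists>n. P n" if "Inf {enat n | n. P n} < \<infinity>"
  proof (rule ccontr)
    assume "\<nexists>n. P n"
    then have "{enat n | n. P n} = {}" by simp
    then show False using that by (simp add: top_enat_def)
  qed
  assume "\<exists>n. P n"
  then obtain n where "P n" by auto
  then have "Inf {enat n | n. P n} \<le> enat n" by (intro Inf_lower) auto
  then show "Inf {enat n | n. P n} < \<infinity>" by (rule le_less_trans) simp
qed

text \<open>Only the augmentation changes, while the modules and their differentials are kept. Thus
  R obtains an injective resolution in the same type and of the same length as that of
  \<omega>.\<close>

lemma right_resolution_iso:
  assumes W: "module R W" "module R V" and t: "t \<in> mod_hom R W V" "bij_betw t (carrier W) (carrier V)"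
    and res: "right_resolution R W E D h"
  shows "right_resolution R V E D (\<lambda>x. h (inv_into (carrier W) t x))"
proof -
  interpret V: module R V by (rule W(2))
  let ?i = "inv_into (carrier W) t"
  have i: "?i \<in> mod_hom R V W" by (rule hom_inv[OF W t])
  have b: "bij_betw ?i (carrier V) (carrier W)" by (rule bij_betw_inv_into[OF t(2)])
  have h: "h \<in> mod_hom R W (E 0)" "mod_ker W (E 0) h = {\<zero>\<^bsub>W\<^esub>}" "mod_ker (E 0) (E 1) (D 0) = h ` carrier W"
    using res by (simp_all add: right_resolution_def)
  have "mod_ker V (E 0) (\<lambda>x. h (?i x)) = {\<zero>\<^bsub>V\<^esub>}"
  proof
    show "mod_ker V (E 0) (\<lambda>x. h (?i x)) \<subseteq> {\<zero>\<^bsub>V\<^esub>}"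
    proof
      fix x assume "x \<in> mod_ker V (E 0) (\<lambda>x. h (?i x))"
      then have x: "x \<in> carrier V" "h (?i x) = \<zero>\<^bsub>E 0\<^esub>" by (simp_all add: mod_ker_def)
      have "?i x \<in> mod_ker W (E 0) h" using hom_closed[OF i x(1)] x(2) by (simp add: mod_ker_def)
      then have "?i x = ?i \<zero>\<^bsub>V\<^esub>" using h(2) hom_zero[OF W(2,1) i] by simp
      then show "x \<in> {\<zero>\<^bsub>V\<^esub>}" using inj_onD[OF bij_betw_imp_inj_on[OF b] _ x(1) V.zero_closed] by simp
    qed
    have "\<zero>\<^bsub>W\<^esub> \<in> mod_ker W (E 0) h" using h(2) by simp
    then show "{\<zero>\<^bsub>V\<^esub>} \<subseteq> mod_ker V (E 0) (\<lambda>x. h (?i x))"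
      using hom_zero[OF W(2,1) i] V.zero_closed by (simp add: mod_ker_def)
  qed
  moreover have "(\<lambda>x. h (?i x)) ` carrier V = h ` carrier W"
    using b by (simp add: bij_betw_def image_image[symmetric])
  ultimately show ?thesis using res h hom_comp[OF i h(1)] by (simp add: right_resolution_def)
qed

theorem proposition34:
  fixes R :: "('a, 'r) ring_scheme"
    and \<omega> :: "('a, 'w, 'z) module_scheme"
    and M :: "('a, 'b, 'm) module_scheme"
    and d :: nat
  assumes "cm_local_ring R"
    and "krull_dim R = enat d"
    and "canonical_module TYPE('v) R \<omega>"
    and "fg_module R M"
    and "\<not> zero_module (dual_module R M)"
    and "projective_dim TYPE('u) R (Hom_module R (dual_module R M) \<omega>) < \<infinity>"
  shows "(d \<le> 1 \<longrightarrow>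
           free_module R (dual_module R (dual_module R M)) \<and> gorenstein_local_ring TYPE('v) R) \<and>
         ((d \<ge> 1 \<longrightarrow> (\<forall>j\<in>{1..d}. zero_module (Ext_module R j M (self_module R)))) \<and>
          (d = 0 \<longrightarrow> (\<forall>j>0. zero_module (Ext_module R j M (self_module R)))) \<longrightarrow>
           free_module R M \<and> gorenstein_local_ring TYPE('v) R)"
proof -
  interpret noetherian_local_ring R using assms(1) by (simp add: cm_local_ring_def)
  let ?S = "self_module R" and ?N = "dual_module R M"
  have cmR: "cm_module R ?S" using assms(1) by (simp add: cm_local_ring_def)
  have mS: "module R ?S" by (rule module_self[OF is_cring])
  have can: "cm_module R \<omega>" "module_dim R \<omega> = krull_dim R" "type_one R \<omega>" "injective_dim TYPE('v) R \<omega> < \<infinity>"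
    using assms(3) by (simp_all add: canonical_module_def mcm_module_def)
  have fgW: "fgm R \<omega>" using can(1) by (intro fg_module_imp_fgm) (simp add: cm_module_def)
  then have mW: "module R \<omega>" by (simp add: fgm_def)
  have fgM: "fgm R M" by (rule fg_module_imp_fgm[OF assms(4)])
  then have mM: "module R M" by (simp add: fgm_def)
  have mN: "module R ?N" by (rule module_dual[OF mM])
  have dW: "depth R \<omega> = enat d" using can(1,2) assms(2) by (simp add: cm_module_def)
  obtain xs I where xs: "regular_chain R ?S xs I d" "I 0 = {\<zero>\<^bsub>R\<^esub>}" "I d \<noteq> carrier R"
    using depth_imp_regular_chain[OF mS, of d] cmR depth_self[OF cmR] assms(2) by (auto simp: cm_module_def)
  obtain ys A where ys: "regular_chain R \<omega> ys A d" "A 0 = {\<zero>\<^bsub>\<omega>\<^esub>}" "A d \<noteq> carrier \<omega>"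
    using depth_imp_regular_chain[OF mW _ dW] can(1) by (auto simp: cm_module_def)
  have type1: "mod_iso R (Ext_module R d (residue_module R) \<omega>) (residue_module R)"
    using can(3) dW by (auto simp: type_one_def)
  obtain n and E :: "nat \<Rightarrow> ('a, 'v) module" and D h where E: "right_resolution R \<omega> E D h"
    "\<And>i. injective_module R (E i)" "\<And>i. i > n \<Longrightarrow> zero_module (E i)"
    using can(4) unfolding injective_dim_def Inf_enat_finite by blast
  obtain p and Q :: "nat \<Rightarrow> ('a, 'u) module" and \<eta> \<zeta> where "left_resolution R (Hom_module R ?N \<omega>) Q \<eta> \<zeta>"
    "\<And>i. projective_module R (Q i)" and Qz: "\<And>i. i > p \<Longrightarrow> zero_module (Q i)"
    using assms(6) unfolding projective_dim_def Inf_enat_finite by blast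
  then have Q: "proj_resolution R (Hom_module R ?N \<omega>) Q \<eta> \<zeta>"
    using module_Hom[OF mN mW] projective_imp_proj_mod by (auto simp: proj_resolution_def)
  interpret cm_inj_res R \<omega> E D h d n xs I ys A
    by unfold_locales (fact fgW E assms(2) xs ys)+
  obtain P \<delta> \<epsilon> where P: "proj_resolution R M P \<delta> \<epsilon>" "\<And>i. free_module R (P i)" "\<And>i. fgm R (P i)"
    and Ext: "\<And>j. Ext_module R j M ?S = Hom_cohomology R P \<delta> ?S j"
    using Ext_resolution[OF fgM, where ?'c = 'a and ?'d = unit] by blast
  have dual_setup: "dual_setup R \<omega> E D h d n xs I ys A M P \<delta> \<epsilon> q"
    if "d \<le> Suc q" "\<And>i. 1 \<le> i \<Longrightarrow> i \<le> q \<Longrightarrow> cocycles R P \<delta> ?S i = coboundaries R P \<delta> ?S i" for q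
    by unfold_locales (fact fgM P that assms(5) type1)+
  have gorenstein: "gorenstein_local_ring TYPE('v) R"
    if t: "t \<in> mod_hom R \<omega> ?S" "bij_betw t (carrier \<omega>) (carrier R)" for t
  proof -
    have "right_resolution R ?S E D (\<lambda>x. h (inv_into (carrier \<omega>) t x))"
      by (rule right_resolution_iso[OF mW mS t(1) _ E(1)]) (simp add: t(2))
    then have "injective_dim TYPE('v) R ?S < \<infinity>"
      unfolding injective_dim_def Inf_enat_finite using E(2,3) by blast
    then show ?thesis using noetherian_local_ring_axioms by (simp add: gorenstein_local_ring_def)
  qed
  show ?thesis
  proof (intro conjI impI)
    assume "d \<le> 1"
    \<comment> \<open>With q = 0 no exact spot is claimed, and d \<le> 1 is the remaining
      bound.\<close>
    then have *: "dual_setup R \<omega> E D h d n xs I ys A M P \<delta> \<epsilon> 0" by (intro dual_setup) simp_all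
    show "free_module R (dual_module R ?N)" by (rule dual_setup.omega_iso_and_free(2)[OF * Q Qz])
    show "gorenstein_local_ring TYPE('v) R"
      using dual_setup.omega_iso_and_free(1)[OF * Q Qz] gorenstein by blast
  next
    assume Ext0: "(d \<ge> 1 \<longrightarrow> (\<forall>j\<in>{1..d}. zero_module (Ext_module R j M ?S))) \<and>
          (d = 0 \<longrightarrow> (\<forall>j>0. zero_module (Ext_module R j M ?S)))"
    \<comment> \<open>The value q = d leaves one spot more than freeness of the bidual takes; it is
      spent on reflexivity.\<close>
    have *: "dual_setup R \<omega> E D h d n xs I ys A M P \<delta> \<epsilon> d"
      by (rule dual_setup, simp, rule zero_cohomology[OF P(1) mS]) (use Ext0 in \<open>simp add: Ext[symmetric]\<close>)
    obtain t where t: "t \<in> mod_hom R \<omega> ?S" "bij_betw t (carrier \<omega>) (carrier R)"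
      using dual_setup.omega_iso_and_free(1)[OF * Q Qz] by blast
    show "gorenstein_local_ring TYPE('v) R" by (rule gorenstein[OF t])
    have mD: "module R (dual_module R ?N)" by (rule module_dual[OF mN])
    note b = dual_setup.reflexive[OF * t order_refl]
    show "free_module R M"
      by (rule free_iso[OF dual_setup.omega_iso_and_free(2)[OF * Q Qz] mM hom_inv[OF mM mD b] bij_betw_inv_into[OF b(2)]])
  qed
qed

end
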